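(* Let $N\in\mathbb{N}$ and put $N_4:=\gcd(N,4)$. Let $\theta_N(\tau;\nu)$, $\nu\in\{0,1\}$, be the unary theta functions described in the context. (1) There exists a mock modular form $\widetilde{\theta}^+_{N}(\tau;1)$ of weight $\tfrac12$ for $\overline{\rho}_N$ with shadow $\tfrac{1}{\sqrt{N}}\theta_N(\tau;1)$ such that $24N_4\,\widetilde{\theta}^+_{N}(\tau;1)$ has integral Fourier coefficients. (2) There exists a mock modular form $\widetilde{\theta}^+_{N}(\tau;0)$ of weight $\tfrac32$ for $\overline{\rho}_N$ with shadow $\tfrac{\sqrt{N}}{2\pi}\theta_N(\tau;0)$ such that $144N_4\,\widetilde{\theta}^+_{N}(\tau;0)$ has integral Fourier coefficients.
   Context: Notation: $q=e^{2\pi i\tau}$, $\tau=u+iv\in\mathbb{H}$, $\mathbf{e}(x)=e^{2\pi i x}$. $\mathrm{Mp}_2(\mathbb{Z})$ is the metaplectic double cover of $\mathrm{SL}_2(\mathbb{Z})$, consisting of pairs $(A,\phi)$ with $A=\begin{pmatrix}a&b\\c&d\end{pmatrix}\in\mathrm{SL}_2(\mathbb{Z})$ and $\phi$ holomorphic on $\mathbb{H}$ with $\phi(\tau)^2=c\tau+d$; it is generated by $T=(\begin{pmatrix}1&1\\0&1\end{pmatrix},1)$ and $S=(\begin{pmatrix}0&-1\\1&0\end{pmatrix},\sqrt{\tau})$. For an even lattice $L$ with quadratic form $Q$, bilinear form $(x,y)=Q(x+y)-Q(x)-Q(y)$, signature $(b^+,b^-)$, dual $L'$ and $A_L=L'/L$,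 the Weil representation $\rho_L$ on $\mathbb{C}[A_L]=\bigoplus_{h\in A_L}\mathbb{C}\mathfrak{e}_h$ is given by $\rho_L(T)\mathfrak{e}_h=\mathbf{e}(Q(h))\mathfrak{e}_h$ and $\rho_L(S)\mathfrak{e}_h=\frac{\mathbf{e}((b^--b^+)/8)}{\sqrt{|A_L|}}\sum_{\mu\in A_L}\mathbf{e}(-(h,\mu))\mathfrak{e}_\mu$. For $N\in\mathbb{N}$ let $\mathbb{Z}[N]$ be the lattice $\mathbb{Z}$ with $Q(x)=Nx^2$; its discriminant group is identified with $\mathbb{Z}/2N\mathbb{Z}$ ($Q(h)=h^2/4N$ mod 1, $(h,\mu)=h\mu/2N$ mod 1), $\rho_N$ denotes its Weil representation and $\overline{\rho}_N$ the complex conjugate representation (= Weil representation of $\mathbb{Z}$ with $Q(x)=-Nx^2$). A smooth $f:\mathbb{H}\to\mathbb{C}[\mathbb{Z}/2N\mathbb{Z}]$ is modular of weight $k$ for a representation $\rho$ if $f(A\tau)=\phi(\tau)^{2k}\rho((A,\phi))f(\tau)$ for all $(A,\phi)\in\mathrm{Mp}_2(\mathbb{Z})$. A harmonic Maass form of weight $k$ for $\rho$ is such an $f$ annihilated by the weight $k$ hyperbolic Laplacian $\Delta_k=-v^2(\partial_u^2+\partial_v^2)+ikv(\partial_u+i\partial_v)$ and of at most linear exponential growth as $v\to\infty$; it decomposes uniquely as $f=f^++f^-$ where the holomorphic part $f^+$ has an expansion $\sum_h\sum_{m\gg-\infty}a(h,m)q^m\mathfrak{e}_h$ and $f^-$ is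 the non-holomorphic part. Let $\xi_k f:=2iv^k\overline{\partial f/\partial\overline{\tau}}$. A mock modular form of weight $k$ for $\rho$ with shadow $g$ is the holomorphic part $f^+$ of a harmonic Maass form $f$ of weight $k$ for $\rho$ with $\xi_k f=g$. "Integral Fourier coefficients" means all $a(h,m)\in\mathbb{Z}$. For $\nu\in\{0,1\}$, $\theta_N(\tau;\nu):=\sum_{h\bmod 2N}\sum_{n\in 2N\mathbb{Z}+h}n^\nu q^{n^2/4N}\mathfrak{e}_h$, a holomorphic modular form of weight $\nu+\frac12$ for $\rho_N$. *)

theory Defs
  imports
    "HOL-Complex_Analysis.Complex_Analysis"
    "HOL-Library.Landau_Symbols"
    "HOL-Number_Theory.Cong"
    "HOL-Algebra.Generated_Groups"
    "Jordan_Normal_Form.Determinant"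
begin

definition uhp :: "complex set" where
  "uhp = {\<tau>. Im \<tau> > 0}"

text \<open>The normalised exponential \<open>x \<mapsto> exp (2 \<pi> i x)\<close>; thus \<open>q\<^sup>m = ee (m * \<tau>)\<close>.\<close>

definition ee :: "complex \<Rightarrow> complex" where
  "ee z = exp (2 * of_real pi * \<i> * z)"


section \<open>The metaplectic group\<close>

definition mat2 :: "int \<Rightarrow> int \<Rightarrow> int \<Rightarrow> int \<Rightarrow> int mat" where
  "mat2 a b c d = mat_of_rows_list 2 [[a, b], [c, d]]"

definition mob :: "int mat \<Rightarrow> complex \<Rightarrow> complex" where
  "mob A = moebius (of_int (A $$ (0,0))) (of_int (A $$ (0,1)))
                   (of_int (A $$ (1,0))) (of_int (A $$ (1,1)))"

text \<open>The function \<open>\<phi>\<close> lives on the upper half plane; it is made \<^const>\<open>extensional\<close> so that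
  equality of pairs is equality of functions on the upper half plane.\<close>

definition Mp2 :: "(int mat \<times> (complex \<Rightarrow> complex)) monoid" where
  "Mp2 = \<lparr>carrier = {(A, \<phi>). A \<in> carrier_mat 2 2 \<and> Determinant.det A = 1 \<and>
              \<phi> \<in> extensional uhp \<and> \<phi> holomorphic_on uhp \<and>
              (\<forall>\<tau>\<in>uhp. (\<phi> \<tau>)\<^sup>2 = of_int (A $$ (1,0)) * \<tau> + of_int (A $$ (1,1)))},
          monoid.mult = (\<lambda>(A, \<phi>) (B, \<psi>). (A * B, \<lambda>\<tau>\<in>uhp. \<phi> (mob B \<tau>) * \<psi> \<tau>)),
          one = (1\<^sub>m 2, \<lambda>\<tau>\<in>uhp. 1)\<rparr>"

definition mpT :: "int mat \<times> (complex \<Rightarrow> complex)" where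
  "mpT = (mat2 1 1 0 1, \<lambda>\<tau>\<in>uhp. 1)"

definition mpS :: "int mat \<times> (complex \<Rightarrow> complex)" where
  "mpS = (mat2 0 (-1) 1 0, \<lambda>\<tau>\<in>uhp. csqrt \<tau>)"


section \<open>The Weil representation of the lattice \<open>\<int>\<close> with \<open>Q(x) = N x\<^sup>2\<close>\<close>

text \<open>The discriminant group \<open>\<int>/2N\<int>\<close> is represented by the residues \<open>0, \<dots>, 2N - 1\<close>, so that
  endomorphisms of its group ring are \<open>2N \<times> 2N\<close> matrices; column \<open>h\<close> is the image of the basis
  vector with index \<open>h\<close>. The signature is \<open>(1, 0)\<close>.\<close>

definition weil_T :: "nat \<Rightarrow> complex mat" where
  "weil_T N = Matrix.mat (2 * N) (2 * N)
     (\<lambda>(\<mu>, h). if \<mu> = h then ee (of_nat (h\<^sup>2) / of_nat (4 * N)) else 0)"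

definition weil_S :: "nat \<Rightarrow> complex mat" where
  "weil_S N = Matrix.mat (2 * N) (2 * N)
     (\<lambda>(\<mu>, h). ee (- 1 / 8) / of_real (sqrt (real (2 * N))) *
        ee (- (of_nat (h * \<mu>) / of_nat (2 * N))))"

definition GL :: "nat \<Rightarrow> complex mat monoid" where
  "GL n = units_of (ring_mat TYPE(complex) n ())"

text \<open>As \<open>S\<close> and \<open>T\<close> generate the metaplectic group, the graph of the Weil representation is the
  subgroup of \<open>Mp2 \<times> GL(2N)\<close> generated by the two pairs \<open>(T, \<rho>(T))\<close> and \<open>(S, \<rho>(S))\<close>.
  The graph is single-valued, so the choice below picks the unique value.\<close>

definition weil_graph :: "nat \<Rightarrow> ((int mat \<times> (complex \<Rightarrow> complex)) \<times> complex mat) set" where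
  "weil_graph N = generate (Mp2 \<times>\<times> GL (2 * N)) {(mpT, weil_T N), (mpS, weil_S N)}"

definition weil_rep :: "nat \<Rightarrow> int mat \<times> (complex \<Rightarrow> complex) \<Rightarrow> complex mat" where
  "weil_rep N g = (SOME M. (g, M) \<in> weil_graph N)"

definition conj_weil_rep :: "nat \<Rightarrow> int mat \<times> (complex \<Rightarrow> complex) \<Rightarrow> complex mat" where
  "conj_weil_rep N g = map_mat cnj (weil_rep N g)"


section \<open>Differential operators\<close>

definition d_u :: "(complex \<Rightarrow> complex) \<Rightarrow> complex \<Rightarrow> complex" where
  "d_u f \<tau> = frechet_derivative f (at \<tau>) 1"

definition d_v :: "(complex \<Rightarrow> complex) \<Rightarrow> complex \<Rightarrow> complex" where
  "d_v f \<tau> = frechet_derivative f (at \<tau>) \<i>"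

text \<open>Here \<^const>\<open>differentiable_on\<close> is real differentiability, so this is \<open>C\<^sup>n\<close> in the
  two real variables \<open>u, v\<close>.\<close>

primrec Cn_uhp :: "nat \<Rightarrow> (complex \<Rightarrow> complex) \<Rightarrow> bool" where
  "Cn_uhp 0 f \<longleftrightarrow> continuous_on uhp f"
| "Cn_uhp (Suc n) f \<longleftrightarrow> f differentiable_on uhp \<and> Cn_uhp n (d_u f) \<and> Cn_uhp n (d_v f)"

definition smooth_uhp :: "(complex \<Rightarrow> complex) \<Rightarrow> bool" where
  "smooth_uhp f \<longleftrightarrow> (\<forall>n. Cn_uhp n f)"

definition d_taubar :: "(complex \<Rightarrow> complex) \<Rightarrow> complex \<Rightarrow> complex" where
  "d_taubar f \<tau> = (d_u f \<tau> + \<i> * d_v f \<tau>) / 2"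

definition laplacian :: "real \<Rightarrow> (complex \<Rightarrow> complex) \<Rightarrow> complex \<Rightarrow> complex" where
  "laplacian k f \<tau> =
     - of_real ((Im \<tau>)\<^sup>2) * (d_u (d_u f) \<tau> + d_v (d_v f) \<tau>)
     + \<i> * of_real (k * Im \<tau>) * (d_u f \<tau> + \<i> * d_v f \<tau>)"

definition xi :: "real \<Rightarrow> (complex \<Rightarrow> complex) \<Rightarrow> complex \<Rightarrow> complex" where
  "xi k f \<tau> = 2 * \<i> * of_real (Im \<tau> powr k) * cnj (d_taubar f \<tau>)"


section \<open>Vector-valued harmonic Maass forms and mock modular forms\<close>

text \<open>A function with values in the group ring of \<open>\<int>/2N\<int>\<close> is given by its components
  \<open>f h\<close> with \<open>h < 2N\<close>; all other values of \<open>f\<close> are ignored. The weight \<open>k\<close> is a half-integer.\<close>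

definition modular ::
  "nat \<Rightarrow> real \<Rightarrow> (int mat \<times> (complex \<Rightarrow> complex) \<Rightarrow> complex mat) \<Rightarrow>
   (nat \<Rightarrow> complex \<Rightarrow> complex) \<Rightarrow> bool" where
  "modular N k \<rho> f \<longleftrightarrow>
     (\<forall>(A, \<phi>)\<in>carrier Mp2. \<forall>\<tau>\<in>uhp. \<forall>h<2*N.
        f h (mob A \<tau>) = \<phi> \<tau> powi \<lfloor>2 * k\<rfloor> * (\<Sum>\<mu><2*N. \<rho> (A, \<phi>) $$ (h, \<mu>) * f \<mu> \<tau>))"

definition linear_exp_growth :: "(complex \<Rightarrow> complex) \<Rightarrow> bool" where
  "linear_exp_growth f \<longleftrightarrow>
     (\<exists>C. (\<lambda>\<tau>. norm (f \<tau>)) \<in> O[filtercomap Im at_top](\<lambda>\<tau>. exp (C * Im \<tau>)))"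

definition harmonic_maass_form ::
  "nat \<Rightarrow> real \<Rightarrow> (int mat \<times> (complex \<Rightarrow> complex) \<Rightarrow> complex mat) \<Rightarrow>
   (nat \<Rightarrow> complex \<Rightarrow> complex) \<Rightarrow> bool" where
  "harmonic_maass_form N k \<rho> f \<longleftrightarrow>
     (\<forall>h<2*N. smooth_uhp (f h)) \<and>
     modular N k \<rho> f \<and>
     (\<forall>h<2*N. \<forall>\<tau>\<in>uhp. laplacian k (f h) \<tau> = 0) \<and>
     (\<forall>h<2*N. linear_exp_growth (f h))"

text \<open>Since \<open>T\<close> acts diagonally by \<open>4N\<close>-th roots of unity, all exponents are of the form
  \<open>m = n/4N\<close> with an integer \<open>n\<close>; the coefficient \<open>a(h, n/4N)\<close> is written \<open>a h n\<close>.\<close>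

definition q_expansion ::
  "nat \<Rightarrow> (nat \<Rightarrow> complex \<Rightarrow> complex) \<Rightarrow> (nat \<Rightarrow> int \<Rightarrow> complex) \<Rightarrow> bool" where
  "q_expansion N F a \<longleftrightarrow>
     (\<exists>n\<^sub>0. \<forall>h<2*N. \<forall>n<n\<^sub>0. a h n = 0) \<and>
     (\<forall>h<2*N. \<forall>\<tau>\<in>uhp.
        ((\<lambda>n. a h n * ee (of_int n / of_nat (4 * N) * \<tau>)) has_sum F h \<tau>) UNIV)"

text \<open>The upper incomplete Gamma function \<open>\<Gamma>(s, x)\<close> for real \<open>x \<noteq> 0\<close> and real \<open>s\<close> that is not a
  non-positive integer: the integral for \<open>x > 0\<close>, and for \<open>x < 0\<close> its continuation
  \<open>\<Gamma>(s, x) = \<Gamma>(s) - (\<Sum>j. (-1)\<^sup>j x\<^bsup>s+j\<^esup> / (j! (s+j)))\<close> with the principal branch.\<close>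

definition inc_Gamma :: "real \<Rightarrow> real \<Rightarrow> complex" where
  "inc_Gamma s x =
     (if x > 0 then of_real (integral {x..} (\<lambda>t. t powr (s - 1) * exp (- t)))
      else of_real (Gamma s) -
        (\<Sum>j. (-1) ^ j * (of_real x :: complex) powr (of_real s + of_nat j) /
              (fact j * (of_real s + of_nat j))))"

text \<open>The expansion of a non-holomorphic part: with \<open>m = n/4N\<close>, the terms are
  \<open>v\<^bsup>1-k\<^esup>\<close> for \<open>m = 0\<close> and \<open>\<Gamma>(1 - k, -4\<pi>mv) q\<^sup>m\<close> for \<open>m \<noteq> 0\<close>, with \<open>m\<close> bounded above.
  These are the solutions of the weight \<open>k\<close> Laplace equation with \<open>u\<close>-dependence
  \<open>exp (2 \<pi> i m u)\<close> complementary to \<open>q\<^sup>m\<close>.\<close>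

definition nonhol_term :: "nat \<Rightarrow> real \<Rightarrow> int \<Rightarrow> complex \<Rightarrow> complex" where
  "nonhol_term N k n \<tau> =
     (if n = 0 then of_real (Im \<tau> powr (1 - k))
      else inc_Gamma (1 - k) (- 4 * pi * (of_int n / of_nat (4 * N)) * Im \<tau>) *
           ee (of_int n / of_nat (4 * N) * \<tau>))"

definition nonhol_expansion ::
  "nat \<Rightarrow> real \<Rightarrow> (nat \<Rightarrow> complex \<Rightarrow> complex) \<Rightarrow> (nat \<Rightarrow> int \<Rightarrow> complex) \<Rightarrow> bool" where
  "nonhol_expansion N k F b \<longleftrightarrow>
     (\<exists>n\<^sub>0. \<forall>h<2*N. \<forall>n>n\<^sub>0. b h n = 0) \<and>
     (\<forall>h<2*N. \<forall>\<tau>\<in>uhp. ((\<lambda>n. b h n * nonhol_term N k n \<tau>) has_sum F h \<tau>) UNIV)"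

definition is_holomorphic_part ::
  "nat \<Rightarrow> real \<Rightarrow> (nat \<Rightarrow> complex \<Rightarrow> complex) \<Rightarrow> (nat \<Rightarrow> complex \<Rightarrow> complex) \<Rightarrow> bool" where
  "is_holomorphic_part N k f F \<longleftrightarrow>
     (\<exists>a. q_expansion N F a) \<and>
     (\<exists>b. nonhol_expansion N k (\<lambda>h \<tau>. f h \<tau> - F h \<tau>) b)"

definition mock_modular_form ::
  "nat \<Rightarrow> real \<Rightarrow> (int mat \<times> (complex \<Rightarrow> complex) \<Rightarrow> complex mat) \<Rightarrow>
   (nat \<Rightarrow> complex \<Rightarrow> complex) \<Rightarrow> (nat \<Rightarrow> complex \<Rightarrow> complex) \<Rightarrow> bool" where
  "mock_modular_form N k \<rho> g F \<longleftrightarrow>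
     (\<exists>f. harmonic_maass_form N k \<rho> f \<and> is_holomorphic_part N k f F \<and>
          (\<forall>h<2*N. \<forall>\<tau>\<in>uhp. xi k (f h) \<tau> = g h \<tau>))"

definition integral_coefficients :: "nat \<Rightarrow> (nat \<Rightarrow> complex \<Rightarrow> complex) \<Rightarrow> bool" where
  "integral_coefficients N F \<longleftrightarrow> (\<exists>a. q_expansion N F a \<and> (\<forall>h<2*N. \<forall>n. a h n \<in> \<int>))"


section \<open>Unary theta functions\<close>

definition unary_theta :: "nat \<Rightarrow> nat \<Rightarrow> nat \<Rightarrow> complex \<Rightarrow> complex" where
  "unary_theta N \<nu> h \<tau> =
     (\<Sum>\<^sub>\<infinity>n\<in>{n::int. [n = int h] (mod int (2 * N))}.
        of_int n ^ \<nu> * ee (of_int (n\<^sup>2) / of_nat (4 * N) * \<tau>))"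

end

theory Submission
  imports Defs "HOL-Probability.Probability" "HOL-Real_Asymp.Real_Asymp"
begin

text \<open>
  Both forms are theta coefficients of a meromorphic Jacobi form. Let \<open>K = \<theta>\<^sub>1 / \<eta>\<^sup>3\<close>, so that
  \<open>\<phi> = K\<^sup>2\<close> has weight \<open>-2\<close>, index 1 and a double zero at the lattice points, and let \<open>G\<close> be an elliptic
  function of weight \<open>2N + k\<close>, \<open>k \<in> {1, 2}\<close>, with a pole of that order at the lattice points only.
  Then \<open>\<phi>\<^sup>N G\<close> has index \<open>N\<close>, weight \<open>k\<close> and a pole of order \<open>k\<close>; subtracting the multiple of the
  non-holomorphic Poincare series with the same pole leaves a function that is entire in \<open>z\<close> and transforms
  like a Jacobi form. Its theta coefficients are therefore modular for the conjugate Weil representation.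
  The coefficients of the Poincare series are Mordell integrals, which evaluate to the non-holomorphic
  Eichler integral of the unary theta function up to an explicit monomial in \<open>q\<close>. Those of \<open>\<phi>\<^sup>N G\<close> are
  integral as soon as \<open>G\<close> has an integral expansion, and polynomials in \<open>12 \<wp>\<close>, \<open>\<wp>'\<close>, \<open>\<wp>''\<close> and
  \<open>K(3z) / K(z)\<^sup>9\<close> provide integral \<open>G\<close> with leading coefficient \<open>12\<close> (\<open>-24\<close> for odd weight); dividing by
  half of that leading coefficient normalises the shadow.
\<close>

abbreviation tpi :: complex where "tpi \<equiv> 2 * of_real pi * \<i>"

lemma ee_add: "ee (x + y) = ee x * ee y"
  by (simp add: ee_def exp_add ring_distribs)

lemma ee_0 [simp]: "ee 0 = 1"
  by (simp add: ee_def)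

lemma ee_minus: "ee (- x) = inverse (ee x)"
  by (simp add: ee_def exp_minus)

lemma ee_diff: "ee (x - y) = ee x / ee y"
  by (simp add: ee_def exp_diff ring_distribs)

lemma ee_nonzero [simp]: "ee x \<noteq> 0"
  by (simp add: ee_def)

lemma ee_of_int [simp]: "ee (of_int n) = 1"
  unfolding ee_def using exp_integer_2pi[of "of_int n"] by (simp add: mult_ac)

lemma ee_of_nat [simp]: "ee (of_nat n) = 1"
  using ee_of_int[of "int n"] by simp

lemma ee_1 [simp]: "ee 1 = 1"
  using ee_of_nat[of 1] by simp

lemma ee_eq_1_iff: "ee z = 1 \<longleftrightarrow> z \<in> \<int>"
proof
  assume "ee z = 1"
  then obtain n :: int where "- (2 * pi * Im z) = 0" "2 * pi * Re z = of_int (2 * n) * pi"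
    unfolding ee_def exp_eq_1 by auto
  hence "z = of_int n" by (auto simp: complex_eq_iff)
  then show "z \<in> \<int>" by simp
qed (auto elim!: Ints_cases)

lemma ee_power: "ee z ^ n = ee (of_nat n * z)"
  by (simp add: ee_def exp_of_nat_mult [symmetric] mult_ac)

lemma norm_ee: "norm (ee z) = exp (- 2 * pi * Im z)"
  by (simp add: ee_def norm_exp_eq_Re)

lemma cnj_ee: "cnj (ee z) = ee (- cnj z)"
  by (simp add: ee_def exp_cnj)

lemma ee_has_field_derivative:
  "((\<lambda>z. ee (k * z)) has_field_derivative tpi * k * ee (k * z)) (at z within S)"
  unfolding ee_def by (auto intro!: derivative_eq_intros simp: mult_ac)

lemma ee_holomorphic: "f holomorphic_on S \<Longrightarrow> (\<lambda>z. ee (f z)) holomorphic_on S"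
  unfolding ee_def by (intro holomorphic_intros)

lemma ee_continuous: "continuous_on S f \<Longrightarrow> continuous_on S (\<lambda>x. ee (f x))"
  unfolding ee_def by (intro continuous_intros)

lemma uhpD: "t \<in> uhp \<Longrightarrow> Im t > 0"
  by (simp add: uhp_def)

lemma uhp_nonzero: "t \<in> uhp \<Longrightarrow> t \<noteq> 0"
  by (auto simp: uhp_def)

lemma minus_inverse_in_uhp: "t \<in> uhp \<Longrightarrow> - 1 / t \<in> uhp"
  by (auto simp: uhp_def Im_divide field_simps complex_eq_iff sum_power2_gt_zero_iff)

lemma add_1_in_uhp: "t \<in> uhp \<Longrightarrow> t + 1 \<in> uhp"
  by (simp add: uhp_def)

lemma open_uhp: "open uhp"
  unfolding uhp_def by (simp add: open_halfspace_Im_gt)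

lemma convex_uhp: "convex uhp"
  unfolding uhp_def by (simp add: convex_halfspace_Im_gt)

section \<open>The metaplectic group\<close>

lemma mat2_index [simp]:
  "mat2 a b c d $$ (0, 0) = a" "mat2 a b c d $$ (0, Suc 0) = b"
  "mat2 a b c d $$ (Suc 0, 0) = c" "mat2 a b c d $$ (Suc 0, Suc 0) = d"
  by (auto simp: mat2_def mat_of_rows_list_def)

lemma mat2_dim [simp]: "dim_row (mat2 a b c d) = 2" "dim_col (mat2 a b c d) = 2"
  by (auto simp: mat2_def mat_of_rows_list_def)

lemma mat2_carrier [simp]: "mat2 a b c d \<in> carrier_mat 2 2"
  by (auto simp: mat2_def mat_of_rows_list_def)

lemma eq_mat2:
  assumes "A \<in> carrier_mat 2 2"
  shows "A = mat2 (A $$ (0, 0)) (A $$ (0, Suc 0)) (A $$ (Suc 0, 0)) (A $$ (Suc 0, Suc 0))"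
  using assms by (intro eq_matI) (auto simp: mat2_def mat_of_rows_list_def numeral_2_eq_2 less_Suc_eq)

lemma mat2_mult:
  "mat2 a b c d * mat2 a' b' c' d' =
     mat2 (a * a' + b * c') (a * b' + b * d') (c * a' + d * c') (c * b' + d * d')"
  by (intro eq_matI)
     (auto simp: less_Suc_eq mat2_def mat_of_rows_list_def scalar_prod_def numeral_2_eq_2)

lemma one_mat2: "1\<^sub>m 2 = mat2 1 0 0 1"
  by (intro eq_matI) (auto simp: less_Suc_eq mat2_def mat_of_rows_list_def numeral_2_eq_2)

lemma det_mat2: "Determinant.det (mat2 a b c d) = a * d - b * c"
  using laplace_expansion_row[OF mat2_carrier, of 0 a b c d]
  by (simp add: cofactor_def numeral_2_eq_2 mat_delete_def det_single)

definition SL2Z :: "int mat set" where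
  "SL2Z = {A \<in> carrier_mat 2 2. Determinant.det A = 1}"

definition automorphy :: "int mat \<Rightarrow> complex \<Rightarrow> complex" where
  "automorphy A t = of_int (A $$ (1, 0)) * t + of_int (A $$ (1, 1))"

lemma mat2_in_SL2Z_iff [simp]: "mat2 a b c d \<in> SL2Z \<longleftrightarrow> a * d - b * c = 1"
  by (simp add: SL2Z_def det_mat2)

lemma SL2Z_cases:
  assumes "A \<in> SL2Z"
  obtains a b c d where "A = mat2 a b c d" "a * d - b * c = 1"
  using eq_mat2[of A] det_mat2 assms unfolding SL2Z_def by auto metis

lemma SL2Z_carrier: "A \<in> SL2Z \<Longrightarrow> A \<in> carrier_mat 2 2"
  by (simp add: SL2Z_def)

lemma SL2Z_mult: "A \<in> SL2Z \<Longrightarrow> B \<in> SL2Z \<Longrightarrow> A * B \<in> SL2Z"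
  by (auto simp: SL2Z_def det_mult[of _ 2])

lemma SL2Z_inverse:
  assumes "A \<in> SL2Z"
  obtains B where "B \<in> SL2Z" "A * B = 1\<^sub>m 2" "B * A = 1\<^sub>m 2"
proof -
  obtain a b c d where "A = mat2 a b c d" "a * d - b * c = 1"
    using assms by (rule SL2Z_cases)
  thus ?thesis
    by (intro that[of "mat2 d (- b) (- c) a"]) (auto simp: mat2_mult one_mat2 algebra_simps)
qed

lemma automorphy_mat2: "automorphy (mat2 a b c d) t = of_int c * t + of_int d"
  by (simp add: automorphy_def)

lemma mob_mat2: "mob (mat2 a b c d) t = (of_int a * t + of_int b) / (of_int c * t + of_int d)"
  by (simp add: mob_def moebius_def)

lemma mob_one [simp]: "mob (1\<^sub>m 2) t = t"
  by (simp add: one_mat2 mob_mat2)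

lemma automorphy_nonzero:
  assumes "A \<in> SL2Z" "t \<in> uhp"
  shows "automorphy A t \<noteq> 0"
proof
  obtain a b c d where A: "A = mat2 a b c d" "a * d - b * c = 1"
    using assms(1) by (rule SL2Z_cases)
  assume vanish: "automorphy A t = 0"
  hence "Im (of_int c * t + of_int d) = 0" by (simp add: A automorphy_mat2)
  hence "c = 0" using uhpD[OF assms(2)] by auto
  with vanish have "d = 0" by (simp add: A automorphy_mat2)
  with \<open>c = 0\<close> A(2) show False by simp
qed

lemma mob_in_uhp:
  assumes "A \<in> SL2Z" "t \<in> uhp"
  shows "mob A t \<in> uhp"
proof -
  obtain a b c d where A: "A = mat2 a b c d" "a * d - b * c = 1"
    using assms(1) by (rule SL2Z_cases)
  define D where "D = automorphy A t"
  have "Im (mob A t) = Im ((of_int a * t + of_int b) * cnj D) / (norm D)^2"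
    by (simp add: A D_def automorphy_mat2 mob_mat2 complex_div_cnj[of _ "_ + _"])
  also have "Im ((of_int a * t + of_int b) * cnj D) = of_int (a * d - b * c) * Im t"
    by (simp add: A(1) D_def automorphy_mat2 algebra_simps)
  also have "\<dots> = Im t" by (simp only: A(2))
  finally show ?thesis
    using automorphy_nonzero[OF assms] assms(2) by (simp add: D_def uhp_def)
qed

lemma automorphy_mult:
  assumes "A \<in> SL2Z" "B \<in> SL2Z" "t \<in> uhp"
  shows "automorphy (A * B) t = automorphy A (mob B t) * automorphy B t"
proof -
  obtain a b c d where B: "B = mat2 a b c d" using assms(2) by (rule SL2Z_cases)
  obtain a' b' c' d' where A: "A = mat2 a' b' c' d'" using assms(1) by (rule SL2Z_cases)
  show ?thesis using automorphy_nonzero[OF assms(2,3)]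
    by (simp add: A B mat2_mult automorphy_mat2 mob_mat2 field_simps)
qed

lemma mob_mult:
  assumes "A \<in> SL2Z" "B \<in> SL2Z" "t \<in> uhp"
  shows "mob (A * B) t = mob A (mob B t)"
proof -
  obtain a b c d where B: "B = mat2 a b c d" using assms(2) by (rule SL2Z_cases)
  obtain a' b' c' d' where A: "A = mat2 a' b' c' d'" using assms(1) by (rule SL2Z_cases)
  have "(of_int (a' * a + b' * c) * t + of_int (a' * b + b' * d)) =
      (of_int a' * mob B t + of_int b') * automorphy B t"
    using automorphy_nonzero[OF assms(2,3)] by (simp add: B automorphy_mat2 mob_mat2 field_simps)
  moreover have "of_int (c' * a + d' * c) * t + of_int (c' * b + d' * d) =
      automorphy A (mob B t) * automorphy B t"
    using automorphy_mult[OF assms] by (simp only: A B mat2_mult automorphy_mat2)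
  ultimately have "mob (A * B) t = (of_int a' * mob B t + of_int b') / automorphy A (mob B t)"
    unfolding A B mat2_mult mob_mat2[of "a' * a + b' * c"] using automorphy_nonzero[OF assms(2,3)]
    by (simp only: B) simp
  also have "\<dots> = mob A (mob B t)"
    by (simp add: A automorphy_mat2 mob_mat2[of a'])
  finally show ?thesis .
qed

lemma holomorphic_on_compose_mob:
  assumes "A \<in> SL2Z" "f holomorphic_on uhp"
  shows "(\<lambda>t. f (mob A t)) holomorphic_on uhp"
proof -
  obtain a b c d where A: "A = mat2 a b c d" using assms(1) by (rule SL2Z_cases)
  have "mob A holomorphic_on uhp"
    using automorphy_nonzero[OF assms(1)] unfolding A mob_mat2[abs_def]
    by (intro holomorphic_intros) (auto simp: automorphy_mat2)
  from holomorphic_on_compose_gen[OF this assms(2)] mob_in_uhp[OF assms(1)]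
  show ?thesis by (auto simp: o_def)
qed

lemma Mp2_carrier_iff:
  "(A, \<phi>) \<in> carrier Mp2 \<longleftrightarrow> A \<in> SL2Z \<and> \<phi> \<in> extensional uhp \<and> \<phi> holomorphic_on uhp \<and>
     (\<forall>t\<in>uhp. (\<phi> t)^2 = automorphy A t)"
  by (auto simp: Mp2_def SL2Z_def automorphy_def)

lemma Mp2_mult: "(A, \<phi>) \<otimes>\<^bsub>Mp2\<^esub> (B, \<psi>) = (A * B, \<lambda>t\<in>uhp. \<phi> (mob B t) * \<psi> t)"
  by (simp add: Mp2_def)

lemma Mp2_one: "\<one>\<^bsub>Mp2\<^esub> = (1\<^sub>m 2, \<lambda>t\<in>uhp. 1)"
  by (simp add: Mp2_def)

lemma Mp2_nonzero:
  assumes "(A, \<phi>) \<in> carrier Mp2" "t \<in> uhp"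
  shows "\<phi> t \<noteq> 0"
proof -
  have "(\<phi> t)^2 \<noteq> 0" using assms automorphy_nonzero by (simp add: Mp2_carrier_iff)
  thus ?thesis by auto
qed

lemma restrict_uhp_holomorphic: "f holomorphic_on uhp \<Longrightarrow> (\<lambda>t\<in>uhp. f t) holomorphic_on uhp"
  by (erule holomorphic_transform) simp

lemma Mp2_mult_closed:
  assumes "(A, \<phi>) \<in> carrier Mp2" "(B, \<psi>) \<in> carrier Mp2"
  shows "(A, \<phi>) \<otimes>\<^bsub>Mp2\<^esub> (B, \<psi>) \<in> carrier Mp2"
  using assms SL2Z_mult[of A B] automorphy_mult[of A B] mob_in_uhp[of B]
  by (auto simp: Mp2_mult Mp2_carrier_iff power_mult_distrib
           intro!: restrict_uhp_holomorphic holomorphic_on_mult holomorphic_on_compose_mob)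

lemma Mp2_left_inverse:
  assumes \<phi>: "(A, \<phi>) \<in> carrier Mp2"
  shows "\<exists>y\<in>carrier Mp2. y \<otimes>\<^bsub>Mp2\<^esub> (A, \<phi>) = \<one>\<^bsub>Mp2\<^esub>"
proof -
  have A: "A \<in> SL2Z" and hol: "\<phi> holomorphic_on uhp" using \<phi> by (auto simp: Mp2_carrier_iff)
  obtain B where B: "B \<in> SL2Z" "A * B = 1\<^sub>m 2" "B * A = 1\<^sub>m 2" using A by (rule SL2Z_inverse)
  define \<psi> where "\<psi> = (\<lambda>t\<in>uhp. inverse (\<phi> (mob B t)))"
  have "\<psi> holomorphic_on uhp" unfolding \<psi>_def
    using Mp2_nonzero[OF \<phi>] mob_in_uhp[OF B(1)]
    by (intro restrict_uhp_holomorphic holomorphic_on_inverse holomorphic_on_compose_mob[OF B(1) hol]) auto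
  moreover have "(\<psi> t)^2 = automorphy B t" if "t \<in> uhp" for t
  proof -
    have "automorphy A (mob B t) * automorphy B t = 1"
      using automorphy_mult[OF A B(1) that] by (simp add: B(2) automorphy_def)
    moreover have "(\<phi> (mob B t))^2 = automorphy A (mob B t)"
      using \<phi> mob_in_uhp[OF B(1) that] by (simp add: Mp2_carrier_iff)
    ultimately have "inverse ((\<phi> (mob B t))^2) = automorphy B t" using inverse_unique by simp
    thus ?thesis using that by (simp add: \<psi>_def power_inverse)
  qed
  ultimately have "(B, \<psi>) \<in> carrier Mp2" using B(1) by (simp add: Mp2_carrier_iff \<psi>_def)
  moreover have "mob B (mob A t) = t" if "t \<in> uhp" for t
    using mob_mult[OF B(1) A that] B(3) by simp
  hence "(B, \<psi>) \<otimes>\<^bsub>Mp2\<^esub> (A, \<phi>) = \<one>\<^bsub>Mp2\<^esub>"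
    using Mp2_nonzero[OF \<phi>] mob_in_uhp[OF A]
    by (auto simp: Mp2_mult Mp2_one B(3) \<psi>_def intro!: restrict_ext)
  ultimately show ?thesis by blast
qed

lemma group_Mp2: "group Mp2"
proof (rule groupI)
  fix x y assume "x \<in> carrier Mp2" "y \<in> carrier Mp2"
  thus "x \<otimes>\<^bsub>Mp2\<^esub> y \<in> carrier Mp2" using Mp2_mult_closed by (cases x, cases y) auto
next
  show "\<one>\<^bsub>Mp2\<^esub> \<in> carrier Mp2"
    by (auto simp: Mp2_one Mp2_carrier_iff one_mat2 automorphy_mat2 intro!: restrict_uhp_holomorphic)
next
  fix x y z assume carriers: "x \<in> carrier Mp2" "y \<in> carrier Mp2" "z \<in> carrier Mp2"
  obtain A \<phi> B \<psi> C \<eta> where xyz: "x = (A, \<phi>)" "y = (B, \<psi>)" "z = (C, \<eta>)"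
    by (cases x, cases y, cases z)
  have SL: "A \<in> SL2Z" "B \<in> SL2Z" "C \<in> SL2Z" using carriers by (auto simp: xyz Mp2_carrier_iff)
  have "A * B * C = A * (B * C)"
    using SL[THEN SL2Z_carrier] by (rule assoc_mult_mat)
  moreover have "(\<lambda>t\<in>uhp. (\<lambda>t\<in>uhp. \<phi> (mob B t) * \<psi> t) (mob C t) * \<eta> t) =
      (\<lambda>t\<in>uhp. \<phi> (mob (B * C) t) * (\<lambda>t\<in>uhp. \<psi> (mob C t) * \<eta> t) t)"
    using mob_in_uhp[OF SL(3)] mob_mult[OF SL(2,3)] by (auto intro!: restrict_ext)
  ultimately show "x \<otimes>\<^bsub>Mp2\<^esub> y \<otimes>\<^bsub>Mp2\<^esub> z = x \<otimes>\<^bsub>Mp2\<^esub> (y \<otimes>\<^bsub>Mp2\<^esub> z)"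
    unfolding xyz Mp2_mult by simp
next
  fix x assume carrier: "x \<in> carrier Mp2"
  obtain A \<phi> where x: "x = (A, \<phi>)" by (cases x)
  have A: "A \<in> SL2Z" "\<phi> \<in> extensional uhp" using carrier by (auto simp: x Mp2_carrier_iff)
  have "(\<lambda>t\<in>uhp. (\<lambda>t\<in>uhp. 1) (mob A t) * \<phi> t) = \<phi>"
    using mob_in_uhp[OF A(1)] by (intro extensionalityI[OF _ A(2)]) auto
  thus "\<one>\<^bsub>Mp2\<^esub> \<otimes>\<^bsub>Mp2\<^esub> x = x"
    using SL2Z_carrier[OF A(1)] by (simp add: x Mp2_one Mp2_mult)
  show "\<exists>y\<in>carrier Mp2. y \<otimes>\<^bsub>Mp2\<^esub> x = \<one>\<^bsub>Mp2\<^esub>"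
    unfolding x by (rule Mp2_left_inverse) (use carrier x in simp)
qed

lemma mpT_carrier: "mpT \<in> carrier Mp2"
  by (auto simp: mpT_def Mp2_carrier_iff automorphy_mat2 intro!: restrict_uhp_holomorphic)

lemma mpS_carrier: "mpS \<in> carrier Mp2"
proof -
  have "csqrt holomorphic_on uhp"
    by (rule holomorphic_on_subset[OF holomorphic_on_csqrt]) (auto simp: uhp_def complex_nonpos_Reals_iff)
  thus ?thesis
    by (auto simp: mpS_def Mp2_carrier_iff automorphy_mat2 intro!: restrict_uhp_holomorphic)
qed

lemma Mp2_eq_up_to_sign:
  assumes \<phi>: "(A, \<phi>) \<in> carrier Mp2" and \<psi>: "(A, \<psi>) \<in> carrier Mp2"
  shows "\<psi> = \<phi> \<or> \<psi> = (\<lambda>t\<in>uhp. - \<phi> t)"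
proof -
  have ext: "\<phi> \<in> extensional uhp" "\<psi> \<in> extensional uhp" using \<phi> \<psi> by (auto simp: Mp2_carrier_iff)
  have sign: "\<psi> t / \<phi> t \<in> {1, -1}" if "t \<in> uhp" for t
  proof -
    have "(\<psi> t)^2 = (\<phi> t)^2" using that \<phi> \<psi> by (simp add: Mp2_carrier_iff)
    thus ?thesis using Mp2_nonzero[OF \<phi> that] by (auto simp: power2_eq_iff)
  qed
  have "continuous_on uhp (\<lambda>t. \<psi> t / \<phi> t)"
    using Mp2_nonzero[OF \<phi>] \<phi> \<psi>
    by (intro holomorphic_on_imp_continuous_on holomorphic_on_divide) (auto simp: Mp2_carrier_iff)
  moreover have "finite ((\<lambda>t. \<psi> t / \<phi> t) ` uhp)"
    by (rule finite_subset[of _ "{1,-1}"]) (use sign in blast, simp)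
  ultimately have "(\<lambda>t. \<psi> t / \<phi> t) constant_on uhp"
    by (intro continuous_finite_range_constant convex_connected convex_uhp)
  then obtain k where k: "\<And>t. t \<in> uhp \<Longrightarrow> \<psi> t / \<phi> t = k" by (auto simp: constant_on_def)
  have "\<i> \<in> uhp" by (simp add: uhp_def)
  with k sign have "k = 1 \<or> k = -1" by blast
  moreover have "\<psi> t = k * \<phi> t" if "t \<in> uhp" for t
    using k[OF that] Mp2_nonzero[OF \<phi> that] by (simp add: field_simps)
  ultimately show ?thesis
    using ext by (auto intro!: extensionalityI[where A=uhp])
qed

lemma SL2Z_subset_if_generators:
  assumes S: "mat2 0 (- 1) 1 0 \<in> H" and T: "mat2 1 1 0 1 \<in> H"
    and mult: "\<And>A B. A \<in> H \<Longrightarrow> B \<in> H \<Longrightarrow> A * B \<in> H"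
  shows "SL2Z \<subseteq> H"
proof -
  have neg_one: "mat2 (- 1) 0 0 (- 1) \<in> H" using mult[OF S S] by (simp add: mat2_mult)
  have S_inv: "mat2 0 1 (- 1) 0 \<in> H" using mult[OF neg_one S] by (simp add: mat2_mult)
  have T_inv: "mat2 1 (- 1) 0 1 \<in> H"
    using mult[OF mult[OF mult[OF mult[OF S T] S] T] S_inv] by (simp add: mat2_mult)
  have T_power: "mat2 1 n 0 1 \<in> H" for n
  proof (induction n rule: int_induct[of _ 1])
    case (step1 i) from mult[OF step1(2) T] show ?case by (simp add: mat2_mult add_ac)
  next
    case (step2 i) from mult[OF step2(2) T_inv] show ?case by (simp add: mat2_mult add_ac)
  qed (rule T)
  have "mat2 a b c d \<in> H" if "a * d - b * c = 1" for a b c d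
    using that
  proof (induction "nat \<bar>c\<bar>" arbitrary: a b c d rule: less_induct)
    case less
    show ?case
    proof (cases "c = 0")
      case True
      with less.prems have "a * d = 1" by simp
      hence "(a = 1 \<and> d = 1) \<or> (a = -1 \<and> d = -1)" by (simp add: zmult_eq_1_iff)
      with T_power[of b] mult[OF neg_one T_power[of "-b"]] True show ?thesis by (auto simp: mat2_mult)
    next
      case False
      define n where "n = a div c"
      define a' b' where "a' = a - n * c" and "b' = b - n * d"
      have "a' = a mod c" by (simp add: a'_def n_def minus_div_mult_eq_mod)
      hence "\<bar>a'\<bar> < \<bar>c\<bar>" using False by (simp add: abs_mod_less)
      moreover have "(- c) * b' - (- d) * a' = 1"
        using less.prems by (simp add: a'_def b'_def algebra_simps)
      ultimately have "mat2 (-c) (-d) a' b' \<in> H" by (intro less.hyps) auto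
      from mult[OF T_power[of n] mult[OF S_inv this]] show ?thesis
        by (simp add: mat2_mult a'_def b'_def algebra_simps)
    qed
  qed
  thus ?thesis by (auto elim!: SL2Z_cases)
qed

lemma mpS_power_4:
  "(mpS \<otimes>\<^bsub>Mp2\<^esub> mpS) \<otimes>\<^bsub>Mp2\<^esub> (mpS \<otimes>\<^bsub>Mp2\<^esub> mpS) = (1\<^sub>m 2, \<lambda>t\<in>uhp. - 1)"
proof -
  define \<psi> where "\<psi> = (\<lambda>t. csqrt (- 1 / t) * csqrt t)"
  have square: "\<psi> t * \<psi> t = - 1" if "t \<in> uhp" for t
  proof -
    have "\<psi> t * \<psi> t = (csqrt (- 1 / t))^2 * (csqrt t)^2"
      by (simp add: \<psi>_def power2_eq_square mult_ac)
    thus ?thesis using uhp_nonzero[OF that] by simp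
  qed
  have "mpS \<otimes>\<^bsub>Mp2\<^esub> mpS = (mat2 (-1) 0 0 (-1), \<lambda>t\<in>uhp. \<psi> t)"
    using minus_inverse_in_uhp
    by (auto simp: mpS_def Mp2_mult mat2_mult \<psi>_def mob_mat2 intro!: restrict_ext)
  thus ?thesis
    using square by (auto simp: Mp2_mult mat2_mult mob_mat2 one_mat2 intro!: restrict_ext)
qed

lemma Mp2_generated: "generate Mp2 {mpT, mpS} = carrier Mp2"
proof
  interpret group Mp2 by (rule group_Mp2)
  define H where "H = generate Mp2 {mpT, mpS}"
  show "generate Mp2 {mpT, mpS} \<subseteq> carrier Mp2"
    using mpT_carrier mpS_carrier by (intro generate_incl) auto
  hence H_carrier: "H \<subseteq> carrier Mp2" by (simp add: H_def)
  have mult: "x \<otimes>\<^bsub>Mp2\<^esub> y \<in> H" if "x \<in> H" "y \<in> H" for x y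
    using that by (simp add: H_def generate.eng)
  have gens: "mpT \<in> H" "mpS \<in> H" by (auto simp: H_def intro: generate.incl)
  have SL: "SL2Z \<subseteq> fst ` H"
  proof (rule SL2Z_subset_if_generators)
    show "mat2 0 (- 1) 1 0 \<in> fst ` H" "mat2 1 1 0 1 \<in> fst ` H"
      using gens by (force simp: mpS_def mpT_def image_iff)+
    fix A B assume "A \<in> fst ` H" "B \<in> fst ` H"
    then obtain \<phi> \<psi> where "(A, \<phi>) \<in> H" "(B, \<psi>) \<in> H" by auto
    from imageI[OF mult[OF this], of fst] show "A * B \<in> fst ` H" by (simp add: Mp2_mult)
  qed
  have neg: "(A, \<lambda>t\<in>uhp. - \<phi> t) \<in> H" if "(A, \<phi>) \<in> H" for A \<phi>
  proof -
    have A: "A \<in> SL2Z" using that H_carrier by (auto simp: Mp2_carrier_iff)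
    have "(1\<^sub>m 2, \<lambda>t\<in>uhp. - 1) \<otimes>\<^bsub>Mp2\<^esub> (A, \<phi>) \<in> H"
      using that gens(2) by (intro mult) (auto simp: mpS_power_4[symmetric] intro: mult)
    moreover have "(1\<^sub>m 2, \<lambda>t\<in>uhp. - 1) \<otimes>\<^bsub>Mp2\<^esub> (A, \<phi>) = (A, \<lambda>t\<in>uhp. - \<phi> t)"
      using mob_in_uhp[OF A] SL2Z_carrier[OF A] by (auto simp: Mp2_mult intro!: restrict_ext)
    ultimately show ?thesis by simp
  qed
  show "carrier Mp2 \<subseteq> generate Mp2 {mpT, mpS}"
    unfolding H_def[symmetric]
  proof
    fix g assume g: "g \<in> carrier Mp2"
    obtain A \<phi> where A: "g = (A, \<phi>)" by (cases g)
    hence "A \<in> fst ` H" using g SL by (auto simp: Mp2_carrier_iff)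
    then obtain \<psi> where \<psi>: "(A, \<psi>) \<in> H" by auto
    hence "\<phi> = \<psi> \<or> \<phi> = (\<lambda>t\<in>uhp. - \<psi> t)"
      using g A H_carrier by (intro Mp2_eq_up_to_sign) auto
    with \<psi> neg[OF \<psi>] A show "g \<in> H" by auto
  qed
qed

section \<open>The Weil representation\<close>

lemma group_GL: "group (GL n)"
  unfolding GL_def by (rule monoid.units_group[OF ring.is_monoid[OF ring_mat]])

lemma GL_mult [simp]: "A \<otimes>\<^bsub>GL n\<^esub> B = A * B"
  by (simp add: GL_def units_of_def ring_mat_def)

lemma GL_one [simp]: "\<one>\<^bsub>GL n\<^esub> = 1\<^sub>m n"
  by (simp add: GL_def units_of_def ring_mat_def)

lemma GL_carrierD: "A \<in> carrier (GL n) \<Longrightarrow> A \<in> carrier_mat n n"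
  by (auto simp: GL_def units_of_def ring_mat_def Units_def)

lemma GL_carrierI:
  assumes "A \<in> carrier_mat n n" "B \<in> carrier_mat n n" "A * B = 1\<^sub>m n"
  shows "A \<in> carrier (GL n)"
  using assms mat_mult_left_right_inverse[OF assms]
  by (auto simp: GL_def units_of_def ring_mat_def Units_def)

lemma sum_roots_of_unity:
  assumes "n > 0" "i < n" "j < n"
  shows "(\<Sum>k<n. ee ((of_nat i - of_nat j) * of_nat k / of_nat n)) = (if i = j then of_nat n else 0)"
proof (cases "i = j")
  case False
  define x where "x = ee ((of_nat i - of_nat j) / of_nat n)"
  have powers: "ee ((of_nat i - of_nat j) * of_nat k / of_nat n) = x ^ k" for k
    by (simp add: x_def ee_power mult_ac)
  have "x \<noteq> 1"
  proof
    assume "x = 1"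
    then obtain m :: int where "(of_nat i - of_nat j) / of_nat n = (of_int m :: complex)"
      unfolding x_def ee_eq_1_iff by (auto elim: Ints_cases)
    hence "(of_nat i - of_nat j :: complex) = of_int m * of_nat n" using assms by (simp add: field_simps)
    hence "(of_int (int i - int j) :: complex) = of_int (m * int n)" by simp
    hence diff: "int i - int j = m * int n" by (simp only: of_int_eq_iff)
    with False have "m \<noteq> 0" by auto
    hence "\<bar>m * int n\<bar> \<ge> int n" using assms by (simp add: abs_mult mult_le_cancel_right1)
    with diff assms show False by linarith
  qed
  moreover have "x ^ n = 1"
    unfolding powers[symmetric] using assms ee_of_int[of "int i - int j"] by simp
  ultimately show ?thesis using False by (simp only: powers) (simp add: geometric_sum)
qed auto

lemma weil_T_GL: "weil_T N \<in> carrier (GL (2 * N))"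
proof -
  define B where "B = Matrix.mat (2 * N) (2 * N)
     (\<lambda>(\<mu>, h). if \<mu> = h then ee (- (of_nat (h^2) / of_nat (4 * N))) else 0)"
  have "(\<Sum>i = 0..<2 * N. (if k = i then ee (of_nat (i^2) / of_nat (4 * N)) else 0) *
      (if i = j then ee (- (of_nat (j^2) / of_nat (4 * N))) else 0)) = (if k = j then 1 else 0)"
    if "k < 2 * N" "j < 2 * N" for j k
    using that by (subst sum.remove[of _ k]) (auto simp: ee_minus)
  thus ?thesis
    by (intro GL_carrierI[of _ _ B]; (intro eq_matI)?) (auto simp: weil_T_def B_def scalar_prod_def)
qed

lemma weil_S_GL:
  assumes "N > 0"
  shows "weil_S N \<in> carrier (GL (2 * N))"
proof (rule GL_carrierI)
  define r where "r = complex_of_real (sqrt (real (2 * N)))"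
  have r: "r * r = of_nat (2 * N)"
    unfolding r_def by (simp flip: of_real_mult del: of_nat_mult)
  define B where "B = Matrix.mat (2 * N) (2 * N)
     (\<lambda>(\<mu>, h). ee (1 / 8) / r * ee (of_nat (h * \<mu>) / of_nat (2 * N)))"
  have entry: "ee (- 1 / 8) / r * ee (- (of_nat (i * k) / of_nat (2 * N))) *
      (ee (1 / 8) / r * ee (of_nat (j * i) / of_nat (2 * N))) =
      ee ((of_nat j - of_nat k) * of_nat i / of_nat (2 * N)) / of_nat (2 * N)" for i j k
  proof -
    have "ee (- (of_nat (i * k) / of_nat (2 * N))) * ee (of_nat (j * i) / of_nat (2 * N))
        = ee ((of_nat j - of_nat k) * of_nat i / of_nat (2 * N))"
      by (simp flip: ee_add add: right_diff_distrib diff_divide_distrib mult_ac)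
    moreover have "a / r * b * (c / r * d) = (a * c) * (b * d) / (r * r)" for a b c d :: complex
      by simp
    moreover have "ee (- 1 / 8) * ee (1 / 8) = 1" by (simp flip: ee_add)
    ultimately show ?thesis unfolding r by (simp only: mult_1)
  qed
  show "weil_S N * B = 1\<^sub>m (2 * N)"
  proof (rule eq_matI, goal_cases)
    case (1 k j)
    hence kj: "k < 2 * N" "j < 2 * N" by auto
    have "(weil_S N * B) $$ (k, j) =
        (\<Sum>i<2 * N. ee ((of_nat j - of_nat k) * of_nat i / of_nat (2 * N)) / of_nat (2 * N))"
      unfolding entry[symmetric]
      using kj by (simp add: weil_S_def B_def scalar_prod_def r_def atLeast0LessThan)
    also have "\<dots> = (if k = j then 1 else 0)"
      unfolding sum_divide_distrib[symmetric] by (subst sum_roots_of_unity) (use kj assms in auto)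
    finally show ?case using kj by simp
  qed (auto simp: weil_S_def B_def)
qed (auto simp: weil_S_def)

lemma weil_generators_carrier:
  assumes "N > 0"
  shows "{(mpT, weil_T N), (mpS, weil_S N)} \<subseteq> carrier (Mp2 \<times>\<times> GL (2 * N))"
  using mpT_carrier mpS_carrier weil_T_GL weil_S_GL[OF assms] by auto

lemma weil_graph_carrier:
  assumes "N > 0"
  shows "weil_graph N \<subseteq> carrier (Mp2 \<times>\<times> GL (2 * N))"
  unfolding weil_graph_def
  by (rule group.generate_incl[OF DirProd_group[OF group_Mp2 group_GL] weil_generators_carrier[OF assms]])

lemma fst_weil_graph:
  assumes "N > 0"
  shows "fst ` weil_graph N = carrier Mp2"
proof -
  interpret proj: group_hom "Mp2 \<times>\<times> GL (2 * N)" Mp2 fst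
    by (intro group_hom.intro DirProd_group group_Mp2 group_GL group_hom_axioms.intro)
       (auto simp: hom_def DirProd_def)
  show ?thesis
    using proj.generate_img[OF weil_generators_carrier[OF assms]] Mp2_generated
    by (simp add: weil_graph_def)
qed

definition cnj_equivariant ::
  "nat \<Rightarrow> int \<Rightarrow> (nat \<Rightarrow> complex \<Rightarrow> complex) \<Rightarrow> (int mat \<times> (complex \<Rightarrow> complex)) \<times> complex mat \<Rightarrow> bool"
where
  "cnj_equivariant n k f = (\<lambda>((A, \<phi>), M). \<forall>t\<in>uhp. Matrix.vec n (\<lambda>h. f h (mob A t)) =
     \<phi> t powi k \<cdot>\<^sub>v (map_mat cnj M *\<^sub>v Matrix.vec n (\<lambda>h. f h t)))"

interpretation cnj: semiring_hom cnj
  by unfold_locales auto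

lemma cnj_equivariant_iff:
  assumes "M \<in> carrier_mat n n"
  shows "cnj_equivariant n k f ((A, \<phi>), M) \<longleftrightarrow>
    (\<forall>t\<in>uhp. \<forall>h<n. f h (mob A t) = \<phi> t powi k * (\<Sum>\<mu><n. cnj (M $$ (h, \<mu>)) * f \<mu> t))"
  using assms by (auto simp: cnj_equivariant_def vec_eq_iff scalar_prod_def atLeast0LessThan)

lemma cnj_equivariant_one: "cnj_equivariant n k f (\<one>\<^bsub>Mp2 \<times>\<times> GL n\<^esub>)"
  by (auto simp: cnj_equivariant_def Mp2_one cnj.mat_hom_one)

lemma cnj_equivariant_mult:
  assumes x: "x \<in> carrier (Mp2 \<times>\<times> GL n)" "cnj_equivariant n k f x"
    and y: "y \<in> carrier (Mp2 \<times>\<times> GL n)" "cnj_equivariant n k f y"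
  shows "cnj_equivariant n k f (x \<otimes>\<^bsub>Mp2 \<times>\<times> GL n\<^esub> y)"
proof -
  obtain A \<phi> M B \<psi> L where xy: "x = ((A, \<phi>), M)" "y = ((B, \<psi>), L)" by (metis surj_pair)
  have SL: "A \<in> SL2Z" "B \<in> SL2Z" using x(1) y(1) by (auto simp: xy Mp2_carrier_iff)
  have mats: "M \<in> carrier_mat n n" "L \<in> carrier_mat n n"
    using x(1) y(1) GL_carrierD by (auto simp: xy)
  define F where "F = (\<lambda>t. Matrix.vec n (\<lambda>h. f h t))"
  have F: "F t \<in> carrier_vec n" for t by (simp add: F_def)
  have "F (mob (A * B) t) = (\<phi> (mob B t) * \<psi> t) powi k \<cdot>\<^sub>v (map_mat cnj (M * L) *\<^sub>v F t)"
    if t: "t \<in> uhp" for t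
  proof -
    have "F (mob (A * B) t) = F (mob A (mob B t))" by (simp add: mob_mult[OF SL t])
    also have "\<dots> = \<phi> (mob B t) powi k \<cdot>\<^sub>v (map_mat cnj M *\<^sub>v F (mob B t))"
      using x(2) mob_in_uhp[OF SL(2) t] by (simp add: xy F_def cnj_equivariant_def)
    also have "F (mob B t) = \<psi> t powi k \<cdot>\<^sub>v (map_mat cnj L *\<^sub>v F t)"
      using y(2) t by (simp add: xy F_def cnj_equivariant_def)
    also have "map_mat cnj M *\<^sub>v (\<psi> t powi k \<cdot>\<^sub>v (map_mat cnj L *\<^sub>v F t)) =
        \<psi> t powi k \<cdot>\<^sub>v (map_mat cnj M *\<^sub>v (map_mat cnj L *\<^sub>v F t))"
      by (rule mult_mat_vec[of _ n n]) (use mats F in auto)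
    also have "map_mat cnj M *\<^sub>v (map_mat cnj L *\<^sub>v F t) = map_mat cnj (M * L) *\<^sub>v F t"
      unfolding cnj.mat_hom_mult[OF mats] using mats F[of t] by (subst assoc_mult_mat_vec) auto
    finally show ?thesis by (simp add: smult_smult_assoc power_int_mult_distrib)
  qed
  thus ?thesis by (simp add: xy Mp2_mult cnj_equivariant_def F_def)
qed

lemma cnj_equivariant_inv:
  assumes x: "x \<in> carrier (Mp2 \<times>\<times> GL n)" "cnj_equivariant n k f x"
  shows "cnj_equivariant n k f (inv\<^bsub>Mp2 \<times>\<times> GL n\<^esub> x)"
proof -
  interpret G: group "Mp2 \<times>\<times> GL n" by (intro DirProd_group group_Mp2 group_GL)
  obtain A \<phi> M B \<psi> L where xy: "x = ((A, \<phi>), M)" "inv\<^bsub>Mp2 \<times>\<times> GL n\<^esub> x = ((B, \<psi>), L)"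
    by (metis surj_pair)
  note carriers = x(1)[unfolded xy(1)] G.inv_closed[OF x(1), unfolded xy(2)]
  have SL: "A \<in> SL2Z" "B \<in> SL2Z" using carriers by (auto simp: Mp2_carrier_iff)
  have mats: "M \<in> carrier_mat n n" "L \<in> carrier_mat n n" using carriers GL_carrierD by auto
  have "(A * B, \<lambda>t\<in>uhp. \<phi> (mob B t) * \<psi> t) = (1\<^sub>m 2, \<lambda>t\<in>uhp. 1)"
    using G.r_inv[OF x(1), unfolded xy(2)] by (simp add: xy(1) Mp2_mult Mp2_one)
  hence AB: "A * B = 1\<^sub>m 2" and \<phi>\<psi>: "\<And>t. t \<in> uhp \<Longrightarrow> \<psi> t * \<phi> (mob B t) = 1"
    by (auto dest!: fun_cong simp: mult.commute split: if_splits)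
  have LM: "L * M = 1\<^sub>m n" using G.l_inv[OF x(1), unfolded xy(2)] by (simp add: xy(1))
  define F where "F = (\<lambda>t. Matrix.vec n (\<lambda>h. f h t))"
  have F: "F t \<in> carrier_vec n" for t by (simp add: F_def)
  have "F (mob B t) = \<psi> t powi k \<cdot>\<^sub>v (map_mat cnj L *\<^sub>v F t)" if t: "t \<in> uhp" for t
  proof -
    define s where "s = mob B t"
    have "F t = F (mob A s)" using mob_mult[OF SL t] by (simp add: s_def AB)
    also have "\<dots> = \<phi> s powi k \<cdot>\<^sub>v (map_mat cnj M *\<^sub>v F s)"
      using x(2) mob_in_uhp[OF SL(2) t] by (simp add: xy(1) F_def s_def cnj_equivariant_def)
    finally have "map_mat cnj L *\<^sub>v F t =
        \<phi> s powi k \<cdot>\<^sub>v (map_mat cnj L *\<^sub>v (map_mat cnj M *\<^sub>v F s))"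
      using mats F by (simp add: mult_mat_vec[of _ n n])
    also have "map_mat cnj L *\<^sub>v (map_mat cnj M *\<^sub>v F s) = map_mat cnj (L * M) *\<^sub>v F s"
      unfolding cnj.mat_hom_mult[OF mats(2,1)] using mats F[of s] by (subst assoc_mult_mat_vec) auto
    also have "\<dots> = F s" using F[of s] by (simp add: LM cnj.mat_hom_one)
    finally have "\<psi> t powi k \<cdot>\<^sub>v (map_mat cnj L *\<^sub>v F t) = (\<psi> t * \<phi> s) powi k \<cdot>\<^sub>v F s"
      by (simp add: smult_smult_assoc power_int_mult_distrib)
    thus ?thesis using \<phi>\<psi>[OF t] by (simp add: s_def)
  qed
  thus ?thesis unfolding xy(2) by (simp add: cnj_equivariant_def F_def)
qed

lemma cnj_equivariant_weil_graph:
  assumes N: "N > 0" and gens: "cnj_equivariant (2 * N) k f (mpT, weil_T N)"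
      "cnj_equivariant (2 * N) k f (mpS, weil_S N)"
    and x: "x \<in> weil_graph N"
  shows "cnj_equivariant (2 * N) k f x"
  using x weil_graph_carrier[OF N] unfolding weil_graph_def
proof (induction rule: generate.induct)
  case (inv h)
  thus ?case using gens weil_generators_carrier[OF N] by (intro cnj_equivariant_inv) auto
next
  case (eng h1 h2)
  thus ?case by (intro cnj_equivariant_mult) auto
qed (use gens cnj_equivariant_one in auto)

lemma modularI:
  assumes N: "N > 0"
    and fT: "\<And>t h. t \<in> uhp \<Longrightarrow> h < 2 * N \<Longrightarrow>
      f h (t + 1) = ee (- (of_nat (h^2) / of_nat (4 * N))) * f h t"
    and fS: "\<And>t h. t \<in> uhp \<Longrightarrow> h < 2 * N \<Longrightarrow> f h (- 1 / t) = csqrt t powi \<lfloor>2 * k\<rfloor> *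
      (\<Sum>\<mu><2*N. ee (1 / 8) / of_real (sqrt (real (2 * N))) * ee (of_nat (h * \<mu>) / of_nat (2 * N)) * f \<mu> t)"
  shows "modular N k (conj_weil_rep N) f"
proof -
  have "(\<Sum>\<mu><2*N. cnj (weil_T N $$ (h, \<mu>)) * f \<mu> t) = f h (t + 1)" if "t \<in> uhp" "h < 2 * N" for t h
    using that by (subst sum.remove[of _ h]) (auto simp: weil_T_def cnj_ee fT intro!: sum.neutral)
  hence equi_T: "cnj_equivariant (2 * N) \<lfloor>2 * k\<rfloor> f (mpT, weil_T N)"
    unfolding mpT_def by (subst cnj_equivariant_iff) (auto simp: weil_T_def mob_mat2)
  have "(\<Sum>\<mu><2*N. cnj (weil_S N $$ (h, \<mu>)) * f \<mu> t) = (\<Sum>\<mu><2*N. ee (1 / 8) /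
      of_real (sqrt (real (2 * N))) * ee (of_nat (h * \<mu>) / of_nat (2 * N)) * f \<mu> t)"
    if "h < 2 * N" for h t
    using that by (intro sum.cong refl) (simp add: weil_S_def cnj_ee mult_ac)
  hence equi_S: "cnj_equivariant (2 * N) \<lfloor>2 * k\<rfloor> f (mpS, weil_S N)"
    unfolding mpS_def using fS by (subst cnj_equivariant_iff) (auto simp: weil_S_def mob_mat2)
  show ?thesis
    unfolding modular_def
  proof (clarify, goal_cases)
    case (1 A \<phi> t h)
    define M where "M = weil_rep N (A, \<phi>)"
    have "(A, \<phi>) \<in> fst ` weil_graph N" using 1(1) by (simp add: fst_weil_graph[OF N])
    hence "\<exists>M. ((A, \<phi>), M) \<in> weil_graph N" by force
    hence graph: "((A, \<phi>), M) \<in> weil_graph N" unfolding M_def weil_rep_def by (rule someI_ex)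
    have M: "M \<in> carrier_mat (2 * N) (2 * N)"
      using graph weil_graph_carrier[OF N] by (auto dest: GL_carrierD)
    have "f h (mob A t) = \<phi> t powi \<lfloor>2 * k\<rfloor> * (\<Sum>\<mu><2*N. cnj (M $$ (h, \<mu>)) * f \<mu> t)"
      using cnj_equivariant_weil_graph[OF N equi_T equi_S graph] 1
      by (simp add: cnj_equivariant_iff[OF M])
    also have "(\<Sum>\<mu><2*N. cnj (M $$ (h, \<mu>)) * f \<mu> t) = (\<Sum>\<mu><2*N. conj_weil_rep N (A, \<phi>) $$ (h, \<mu>) * f \<mu> t)"
      using M 1 by (intro sum.cong refl) (simp add: conj_weil_rep_def M_def)
    finally show ?case .
  qed
qed

section \<open>The complementary error function\<close>

definition erfc :: "real \<Rightarrow> real" where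
  "erfc x = 2 / sqrt pi * (LINT t|lborel. indicator {x..} t *\<^sub>R exp (- t\<^sup>2))"

lemma integrable_gauss: "integrable lborel (\<lambda>t::real. exp (- t\<^sup>2))"
  and integral_gauss: "(LINT t|lborel. exp (- (t::real)\<^sup>2)) = sqrt pi"
  using has_bochner_integral_even_function[OF gaussian_moment_0]
  by (auto simp: has_bochner_integral_iff)

lemma integrable_gauss_indicator:
  "A \<in> sets borel \<Longrightarrow> integrable lborel (\<lambda>t::real. indicator A t *\<^sub>R exp (- t\<^sup>2))"
  using integrable_mult_indicator[OF _ integrable_gauss, of A] by simp

lemma erfc_0: "erfc 0 = 1"
  using gaussian_moment_0 by (simp add: erfc_def has_bochner_integral_iff)

lemma erfc_shift: "erfc x = 2 / sqrt pi * (LINT s|lborel. indicator {0..} s *\<^sub>R exp (- (x + s)\<^sup>2))"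
  unfolding erfc_def by (subst lborel_integral_real_affine[where c=1 and t=x])
    (auto intro!: Bochner_Integration.integral_cong split: split_indicator)

lemma erfc_nonneg: "erfc x \<ge> 0"
  unfolding erfc_def by (intro mult_nonneg_nonneg Bochner_Integration.integral_nonneg) auto

lemma erfc_le:
  assumes "x \<ge> 0"
  shows "erfc x \<le> exp (- x\<^sup>2)"
proof -
  have "(LINT s|lborel. indicator {0..} s *\<^sub>R exp (- (x + s)\<^sup>2)) \<le>
        (LINT s|lborel. exp (- x\<^sup>2) * (indicator {0..} s *\<^sub>R exp (- s\<^sup>2)))"
  proof (rule integral_mono)
    show "integrable lborel (\<lambda>s. exp (- x\<^sup>2) * (indicator {0..} s *\<^sub>R exp (- s\<^sup>2)))"
      by (intro integrable_mult_right integrable_gauss_indicator) auto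
    have "integrable lborel (\<lambda>s. indicator {x..} (x + 1 * s) *\<^sub>R exp (- (x + 1 * s)\<^sup>2))"
      using lborel_integrable_real_affine[OF integrable_gauss_indicator[of "{x..}"], of 1 x] by simp
    thus "integrable lborel (\<lambda>s. indicator {0..} s *\<^sub>R exp (- (x + s)\<^sup>2))"
      by (rule Bochner_Integration.integrable_cong[THEN iffD1, rotated 2]) (auto split: split_indicator)
  next
    fix s :: real
    have "exp (- (x + s)\<^sup>2) \<le> exp (- x\<^sup>2) * exp (- s\<^sup>2)" if "s \<ge> 0"
      using that assms unfolding exp_add[symmetric] by (simp add: power2_eq_square algebra_simps)
    thus "indicator {0..} s *\<^sub>R exp (- (x + s)\<^sup>2) \<le> exp (- x\<^sup>2) * (indicator {0..} s *\<^sub>R exp (- s\<^sup>2))"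
      by (auto split: split_indicator)
  qed
  also have "\<dots> = exp (- x\<^sup>2) * (sqrt pi / 2)"
    using gaussian_moment_0 by (simp add: has_bochner_integral_iff)
  finally show ?thesis unfolding erfc_shift by (simp add: field_simps)
qed

lemma integral_gauss_split:
  fixes x y :: real
  assumes "A \<union> {y..} = B" "A \<inter> {y..} \<subseteq> {y}" "A \<in> sets borel" "B \<in> sets borel"
  shows "(LINT t|lborel. indicator B t *\<^sub>R exp (- t\<^sup>2)) =
    (LINT t|lborel. indicator A t *\<^sub>R exp (- t\<^sup>2)) + (LINT t|lborel. indicator {y..} t *\<^sub>R exp (- t\<^sup>2))"
proof -
  have "(LINT t|lborel. indicator B t *\<^sub>R exp (- t\<^sup>2)) =
      (LINT t|lborel. indicator A t *\<^sub>R exp (- t\<^sup>2) + indicator {y..} t *\<^sub>R exp (- t\<^sup>2))"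
  proof (rule integral_cong_AE)
    show "AE t in lborel. indicator B t *\<^sub>R exp (- t\<^sup>2) =
        indicator A t *\<^sub>R exp (- t\<^sup>2) + indicator {y..} t *\<^sub>R exp (- t\<^sup>2)"
      using AE_lborel_singleton[of y] by eventually_elim (use assms(1,2) in \<open>auto split: split_indicator\<close>)
  qed (use assms(3,4) in measurable)
  also have "\<dots> = (LINT t|lborel. indicator A t *\<^sub>R exp (- t\<^sup>2)) + (LINT t|lborel. indicator {y..} t *\<^sub>R exp (- t\<^sup>2))"
    using assms(3) by (intro Bochner_Integration.integral_add integrable_gauss_indicator) auto
  finally show ?thesis .
qed

lemma erfc_minus: "erfc (- x) = 2 - erfc x"
proof -
  have "(LINT t|lborel. indicator {-x..} t *\<^sub>R exp (- t\<^sup>2)) = (LINT t|lborel. indicator {..x} t *\<^sub>R exp (- (t::real)\<^sup>2))"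
    by (subst lborel_integral_real_affine[where c="-1" and t=0])
      (auto intro!: Bochner_Integration.integral_cong split: split_indicator)
  moreover have "(LINT t|lborel. indicator UNIV t *\<^sub>R exp (- (t::real)\<^sup>2)) =
      (LINT t|lborel. indicator {..x} t *\<^sub>R exp (- t\<^sup>2)) + (LINT t|lborel. indicator {x..} t *\<^sub>R exp (- t\<^sup>2))"
    by (rule integral_gauss_split) auto
  ultimately have "(LINT t|lborel. indicator {-x..} t *\<^sub>R exp (- t\<^sup>2)) =
      sqrt pi - (LINT t|lborel. indicator {x..} t *\<^sub>R exp (- t\<^sup>2))"
    by (simp add: integral_gauss)
  thus ?thesis unfolding erfc_def by (simp only: right_diff_distrib) simp
qed

lemma erfc_eq_diff_integral:
  assumes "x \<le> y"
  shows "erfc y = erfc x - 2 / sqrt pi * integral {x..y} (\<lambda>t. exp (- t\<^sup>2))"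
proof -
  have "(LINT t|lborel. indicator {x..y} t *\<^sub>R exp (- t\<^sup>2)) = integral {x..y} (\<lambda>t. exp (- t\<^sup>2))"
    using set_borel_integral_eq_integral(2)[of "{x..y}" "\<lambda>t. exp (- t\<^sup>2)"] integrable_gauss_indicator[of "{x..y}"]
    by (simp add: set_lebesgue_integral_def set_integrable_def)
  moreover have "(LINT t|lborel. indicator {x..} t *\<^sub>R exp (- t\<^sup>2)) =
      (LINT t|lborel. indicator {x..y} t *\<^sub>R exp (- t\<^sup>2)) + (LINT t|lborel. indicator {y..} t *\<^sub>R exp (- t\<^sup>2))"
    by (rule integral_gauss_split) (use assms in auto)
  ultimately show ?thesis unfolding erfc_def by (simp add: field_simps)
qed

lemma DERIV_erfc: "(erfc has_real_derivative - (2 / sqrt pi * exp (- x\<^sup>2))) (at x)"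
proof -
  have "((\<lambda>y. integral {x - 1..y} (\<lambda>t. exp (- t\<^sup>2))) has_real_derivative exp (- x\<^sup>2)) (at x within {x - 1..x + 1})"
    by (rule integral_has_real_derivative) (auto intro!: continuous_intros)
  hence "((\<lambda>y. erfc (x - 1) - 2 / sqrt pi * integral {x - 1..y} (\<lambda>t. exp (- t\<^sup>2)))
      has_real_derivative - (2 / sqrt pi * exp (- x\<^sup>2))) (at x within {x - 1..x + 1})"
    by (rule DERIV_cmult[THEN DERIV_diff[OF DERIV_const], THEN DERIV_cong]) simp
  hence "(erfc has_real_derivative - (2 / sqrt pi * exp (- x\<^sup>2))) (at x within {x - 1..x + 1})"
    by (rule has_field_derivative_transform_within[of _ _ _ _ 1])
       (simp_all only: erfc_eq_diff_integral[symmetric] atLeastAtMost_iff zero_less_one, auto)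
  thus ?thesis by (simp add: at_within_Icc_at)
qed

lemma DERIV_erfc_chain [derivative_intros]:
  "(f has_real_derivative f') (at x within S) \<Longrightarrow>
   ((\<lambda>x. erfc (f x)) has_real_derivative - (2 / sqrt pi * exp (- (f x)\<^sup>2)) * f') (at x within S)"
  by (rule DERIV_chain2[OF DERIV_erfc])

lemma erfc_tendsto_0: "(erfc \<longlongrightarrow> 0) at_top"
proof (rule tendsto_sandwich[where f="\<lambda>_. 0"])
  show "eventually (\<lambda>x. erfc x \<le> exp (- x\<^sup>2)) at_top"
    using eventually_ge_at_top[of 0] by eventually_elim (rule erfc_le)
  show "((\<lambda>x::real. exp (- x\<^sup>2)) \<longlongrightarrow> 0) at_top" by real_asymp
qed (auto simp: erfc_nonneg)

lemma has_integral_atLeast_FTC: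
  fixes f :: "real \<Rightarrow> real"
  assumes D: "\<And>x. a \<le> x \<Longrightarrow> (F has_real_derivative f x) (at x)"
    and nonneg: "\<And>x. a \<le> x \<Longrightarrow> 0 \<le> f x" and lim: "(F \<longlongrightarrow> T) at_top"
  shows "(f has_integral (T - F a)) {a..}"
proof (rule has_integral_to_inf[OF _ _ nonneg])
  have ftc: "(f has_integral F y - F a) {a..y}" if "a \<le> y" for y
    by (rule fundamental_theorem_of_calculus[OF that])
       (auto intro: D has_field_derivative_at_within simp flip: has_real_derivative_iff_has_vector_derivative)
  show "f integrable_on {a..y}" for y
    using ftc[of y] by (cases "a \<le> y") (auto simp: integrable_on_def)
  have "\<forall>\<^sub>F y in at_top. F y - F a = integral {a..y} f"
    using eventually_ge_at_top[of a] by eventually_elim (rule integral_unique[OF ftc, symmetric])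
  from Lim_transform_eventually[OF tendsto_diff[OF lim tendsto_const] this]
  show "((\<lambda>y. integral {a..y} f) \<longlongrightarrow> T - F a) at_top" .
qed

lemma inc_Gamma_half:
  assumes "x > 0"
  shows "inc_Gamma (1/2) x = of_real (sqrt pi * erfc (sqrt x))"
proof -
  have "((\<lambda>t. t powr (1/2 - 1) * exp (- t)) has_integral (0 - (- sqrt pi * erfc (sqrt x)))) {x..}"
  proof (rule has_integral_atLeast_FTC)
    fix t :: real assume "x \<le> t"
    hence t: "t > 0" using assms by simp
    show "((\<lambda>t. - sqrt pi * erfc (sqrt t)) has_real_derivative t powr (1 / 2 - 1) * exp (- t)) (at t)"
      using t by (auto intro!: derivative_eq_intros simp: powr_minus powr_half_sqrt field_simps)
  next
    have "((\<lambda>t. - sqrt pi * erfc (sqrt t)) \<longlongrightarrow> - sqrt pi * 0) at_top"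
      by (intro tendsto_intros filterlim_compose[OF erfc_tendsto_0] sqrt_at_top)
    thus "((\<lambda>t. - sqrt pi * erfc (sqrt t)) \<longlongrightarrow> 0) at_top" by simp
  qed auto
  thus ?thesis using assms by (simp add: inc_Gamma_def integral_unique)
qed

lemma inc_Gamma_minus_half:
  assumes "x > 0"
  shows "inc_Gamma (-1/2) x = of_real (2 / sqrt x * exp (- x) - 2 * sqrt pi * erfc (sqrt x))"
proof -
  let ?F = "\<lambda>t. 2 * sqrt pi * erfc (sqrt t) - 2 / sqrt t * exp (- t)"
  have "((\<lambda>t. t powr (-1/2 - 1) * exp (- t)) has_integral (0 - ?F x)) {x..}"
  proof (rule has_integral_atLeast_FTC)
    fix t :: real assume "x \<le> t"
    hence t: "t > 0" using assms by simp
    have "t powr (-1/2 - 1) = 1 / (t * sqrt t)"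
      using t powr_mult_base[of t "1/2"] by (simp add: powr_minus_divide powr_half_sqrt)
    thus "(?F has_real_derivative t powr (-1 / 2 - 1) * exp (- t)) (at t)"
      using t by (auto intro!: derivative_eq_intros simp: field_simps)
  next
    have "((\<lambda>t. 2 * sqrt pi * erfc (sqrt t)) \<longlongrightarrow> 2 * sqrt pi * 0) at_top"
      by (intro tendsto_intros filterlim_compose[OF erfc_tendsto_0] sqrt_at_top)
    moreover have "((\<lambda>t::real. 2 / sqrt t * exp (- t)) \<longlongrightarrow> 0) at_top" by real_asymp
    ultimately show "(?F \<longlongrightarrow> 0) at_top" using tendsto_diff by fastforce
  qed auto
  thus ?thesis using assms by (simp add: inc_Gamma_def integral_unique)
qed

section \<open>Wirtinger derivatives\<close>

text \<open>Here \<open>a\<close> is \<open>\<partial>\<^sub>u f\<close> and \<open>P\<close> is \<open>\<partial>\<^sub>v f - \<i> \<partial>\<^sub>u f\<close>, so that \<open>P\<close> is a derivation that vanishes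
  exactly on holomorphic functions.\<close>

definition has_wirtinger :: "(complex \<Rightarrow> complex) \<Rightarrow> complex \<Rightarrow> complex \<Rightarrow> complex \<Rightarrow> bool" where
  "has_wirtinger f a P t \<longleftrightarrow> (f has_derivative (\<lambda>x. a * x + of_real (Im x) * P)) (at t)"

lemma has_wirtinger_d_u: "has_wirtinger f a P t \<Longrightarrow> d_u f t = a"
  unfolding has_wirtinger_def d_u_def by (drule frechet_derivative_at[symmetric]) simp

lemma has_wirtinger_d_v: "has_wirtinger f a P t \<Longrightarrow> d_v f t = \<i> * a + P"
  unfolding has_wirtinger_def d_v_def by (drule frechet_derivative_at[symmetric]) simp

lemma has_wirtinger_cong:
  "has_wirtinger f a P t \<Longrightarrow> a = a' \<Longrightarrow> P = P' \<Longrightarrow> has_wirtinger f a' P' t"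
  by simp

lemma has_wirtinger_add:
  "has_wirtinger f a P t \<Longrightarrow> has_wirtinger g b Q t \<Longrightarrow> has_wirtinger (\<lambda>x. f x + g x) (a + b) (P + Q) t"
  unfolding has_wirtinger_def by (drule (1) has_derivative_add) (simp add: algebra_simps)

lemma has_wirtinger_mult:
  "has_wirtinger f a P t \<Longrightarrow> has_wirtinger g b Q t \<Longrightarrow>
   has_wirtinger (\<lambda>x. f x * g x) (a * g t + f t * b) (P * g t + f t * Q) t"
  unfolding has_wirtinger_def by (drule (1) has_derivative_mult) (simp add: algebra_simps)

lemma has_wirtinger_cmult:
  "has_wirtinger f a P t \<Longrightarrow> has_wirtinger (\<lambda>x. c * f x) (c * a) (c * P) t"
  using has_wirtinger_mult[of "\<lambda>_. c" 0 0 t f a P] by (simp add: has_wirtinger_def)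

lemma has_wirtinger_hol:
  "(f has_field_derivative d) (at t) \<Longrightarrow> has_wirtinger f d 0 t"
  by (simp add: has_wirtinger_def has_field_derivative_def)

lemma has_wirtinger_cnj:
  assumes "(f has_field_derivative d) (at t)"
  shows "has_wirtinger (\<lambda>x. cnj (f x)) (cnj d) (- 2 * \<i> * cnj d) t"
proof -
  have "((\<lambda>x. cnj (f x)) has_derivative (\<lambda>x. cnj (d * x))) (at t)"
    using assms unfolding has_field_derivative_def by (rule has_derivative_cnj)
  moreover have "cnj (d * x) = cnj d * x + of_real (Im x) * (- 2 * \<i> * cnj d)" for x
    by (simp add: complex_eq_iff algebra_simps)
  ultimately show ?thesis by (simp only: has_wirtinger_def)
qed

lemma has_wirtinger_Im:
  assumes "(g has_real_derivative d) (at (Im t))"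
  shows "has_wirtinger (\<lambda>x. of_real (g (Im x))) 0 (of_real d) t"
proof -
  have "(g has_derivative (\<lambda>x. x * d)) (at (Im t))"
    using assms by (simp add: has_field_derivative_def mult_commute_abs)
  from has_derivative_compose[OF bounded_linear.has_derivative[OF bounded_linear_Im has_derivative_ident] this]
  have "((\<lambda>x. g (Im x)) has_derivative (\<lambda>x. Im x * d)) (at t)" by simp
  from has_derivative_of_real[OF this] show ?thesis unfolding has_wirtinger_def by simp
qed

lemma has_wirtinger_transform:
  assumes "has_wirtinger f a P t" "t \<in> uhp" "\<And>x. x \<in> uhp \<Longrightarrow> f x = g x"
  shows "has_wirtinger g a P t"
  using assms open_uhp unfolding has_wirtinger_def by (auto intro: has_derivative_transform_within_open)

lemma Cn_uhp_cong: "(\<And>x. x \<in> uhp \<Longrightarrow> f x = g x) \<Longrightarrow> Cn_uhp n f \<Longrightarrow> Cn_uhp n g"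
proof (induction n arbitrary: f g)
  case 0 thus ?case using continuous_on_cong[of uhp uhp f g] by auto
next
  case (Suc n)
  have f: "f differentiable_on uhp" "Cn_uhp n (d_u f)" "Cn_uhp n (d_v f)" using Suc.prems by auto
  have D: "(f has_derivative f') (at t) \<longleftrightarrow> (g has_derivative f') (at t)" if "t \<in> uhp" for t f'
    using has_derivative_transform_within_open[OF _ open_uhp that, of f f' UNIV g]
      has_derivative_transform_within_open[OF _ open_uhp that, of g f' UNIV f] Suc.prems(1) by auto
  have "d_u f t = d_u g t" "d_v f t = d_v g t" if "t \<in> uhp" for t
    using D[OF that] by (auto simp: d_u_def d_v_def frechet_derivative_def)
  hence "Cn_uhp n (d_u g)" "Cn_uhp n (d_v g)"
    using Suc.IH[of "d_u f" "d_u g"] Suc.IH[of "d_v f" "d_v g"] f by blast+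
  moreover have "g differentiable_on uhp"
    using f(1) D at_within_open[OF _ open_uhp]
    unfolding differentiable_on_def differentiable_def by metis
  ultimately show ?case by simp
qed

lemma smooth_uhpI:
  assumes closed: "\<And>f. f \<in> X \<Longrightarrow>
      \<exists>a P. a \<in> X \<and> (\<lambda>t. \<i> * a t + P t) \<in> X \<and> (\<forall>t\<in>uhp. has_wirtinger f (a t) (P t) t)"
    and "f \<in> X"
  shows "smooth_uhp f"
proof -
  have diff: "f differentiable_on uhp" if "f \<in> X" for f
    using closed[OF that] unfolding differentiable_on_def differentiable_def has_wirtinger_def
    by (meson has_derivative_at_withinI)
  have "Cn_uhp n f" if "f \<in> X" for n f
    using that
  proof (induction n arbitrary: f)
    case 0 thus ?case using diff differentiable_imp_continuous_on by auto
  next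
    case (Suc n)
    then obtain a P where aP: "a \<in> X" "(\<lambda>t. \<i> * a t + P t) \<in> X"
      "\<And>t. t \<in> uhp \<Longrightarrow> has_wirtinger f (a t) (P t) t" using closed by blast
    have "Cn_uhp n (d_u f)"
      by (rule Cn_uhp_cong[OF _ Suc.IH[OF aP(1)]]) (simp add: has_wirtinger_d_u[OF aP(3)])
    moreover have "Cn_uhp n (d_v f)"
      by (rule Cn_uhp_cong[OF _ Suc.IH[OF aP(2)]]) (simp add: has_wirtinger_d_v[OF aP(3)])
    ultimately show ?case using diff[OF Suc.prems] by simp
  qed
  thus ?thesis using assms(2) by (simp add: smooth_uhp_def)
qed

lemma
  assumes f: "\<And>t. t \<in> uhp \<Longrightarrow> has_wirtinger f (a t) (P t) t" and t: "t \<in> uhp"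
  shows xi_wirtinger: "xi k f t = of_real (Im t powr k) * cnj (P t)"
    and laplacian_wirtinger: "has_wirtinger a b Q t \<Longrightarrow> has_wirtinger P c R t \<Longrightarrow>
      laplacian k f t = - of_real ((Im t)\<^sup>2) * (\<i> * Q + \<i> * c + R) - of_real (k * Im t) * P t"
proof -
  have dbar: "d_u f t + \<i> * d_v f t = \<i> * P t"
    by (simp add: has_wirtinger_d_u[OF f[OF t]] has_wirtinger_d_v[OF f[OF t]] algebra_simps)
  show "xi k f t = of_real (Im t powr k) * cnj (P t)"
    by (simp add: xi_def d_taubar_def dbar complex_eq_iff)
  assume a: "has_wirtinger a b Q t" and P: "has_wirtinger P c R t"
  have "has_wirtinger (d_u f) b Q t"
    by (rule has_wirtinger_transform[OF a t]) (simp add: has_wirtinger_d_u[OF f])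
  moreover have "has_wirtinger (d_v f) (\<i> * b + c) (\<i> * Q + R) t"
    by (rule has_wirtinger_transform[OF has_wirtinger_add[OF has_wirtinger_cmult[OF a] P] t])
       (simp add: has_wirtinger_d_v[OF f])
  ultimately have "d_u (d_u f) t + d_v (d_v f) t = \<i> * Q + \<i> * c + R"
    using has_wirtinger_d_u has_wirtinger_d_v by (fastforce simp: algebra_simps)
  thus "laplacian k f t = - of_real ((Im t)\<^sup>2) * (\<i> * Q + \<i> * c + R) - of_real (k * Im t) * P t"
    unfolding laplacian_def dbar by (simp add: algebra_simps)
qed

definition uhp_majorized :: "(nat \<Rightarrow> complex \<Rightarrow> complex) \<Rightarrow> bool" where
  "uhp_majorized f \<longleftrightarrow> (\<forall>y>0. \<exists>M. summable M \<and> (\<forall>n t. Im t > y \<longrightarrow> norm (f n t) \<le> M n))"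

lemma uhp_majorizedE:
  assumes "uhp_majorized f" "y > 0"
  obtains M where "summable M" "\<And>n t. Im t > y \<Longrightarrow> norm (f n t) \<le> M n"
  using assms unfolding uhp_majorized_def by blast

lemma uhp_majorized_summable:
  assumes "uhp_majorized f" "t \<in> uhp"
  shows "summable (\<lambda>n. norm (f n t))"
proof -
  obtain M where M: "summable M" "\<And>n t'. Im t' > Im t / 2 \<Longrightarrow> norm (f n t') \<le> M n"
    by (rule uhp_majorizedE[OF assms(1) half_gt_zero[OF uhpD[OF assms(2)]]]) (rule that)
  show ?thesis
    by (rule summable_comparison_test[OF _ M(1)]) (use M(2) uhpD[OF assms(2)] in auto)
qed

lemma uhp_majorized_sums: "uhp_majorized f \<Longrightarrow> t \<in> uhp \<Longrightarrow> (\<lambda>n. f n t) sums (\<Sum>n. f n t)"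
  by (rule summable_sums[OF summable_norm_cancel[OF uhp_majorized_summable]])

lemma uhp_majorized_has_sum: "uhp_majorized f \<Longrightarrow> t \<in> uhp \<Longrightarrow> ((\<lambda>n. f n t) has_sum (\<Sum>n. f n t)) UNIV"
  by (rule norm_summable_imp_has_sum[OF uhp_majorized_summable uhp_majorized_sums])

lemma uhp_majorized_bounded:
  assumes "uhp_majorized f"
  shows "\<exists>C. \<forall>t. Im t > 1 \<longrightarrow> norm (\<Sum>n. f n t) \<le> C"
proof -
  obtain M where "summable M" "\<And>n t. Im t > 1 \<Longrightarrow> norm (f n t) \<le> M n"
    by (rule uhp_majorizedE[OF assms, of 1]) (simp, rule that)
  hence "norm (\<Sum>n. f n t) \<le> suminf M" if "Im t > 1" for t
    using that by (intro norm_suminf_le) auto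
  thus ?thesis by blast
qed

lemma uhp_majorized_mult_left:
  assumes "uhp_majorized f" "\<And>y. y > 0 \<Longrightarrow> \<exists>K. \<forall>n t. Im t > y \<longrightarrow> norm (k n t) \<le> K"
  shows "uhp_majorized (\<lambda>n t. k n t * f n t)"
  unfolding uhp_majorized_def
proof (intro allI impI)
  fix y :: real assume "y > 0"
  obtain M where M: "summable M" "\<And>n t. Im t > y \<Longrightarrow> norm (f n t) \<le> M n"
    by (rule uhp_majorizedE[OF assms(1) \<open>y > 0\<close>]) (rule that)
  obtain K where K: "\<And>n t. Im t > y \<Longrightarrow> norm (k n t) \<le> K" using assms(2)[OF \<open>y > 0\<close>] by blast
  have "norm (k n t * f n t) \<le> K * M n" if "Im t > y" for n t
    unfolding norm_mult using M(2)[OF that] K[OF that] norm_ge_zero order_trans by (intro mult_mono) blast+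
  thus "\<exists>M. summable M \<and> (\<forall>n t. Im t > y \<longrightarrow> norm (k n t * f n t) \<le> M n)"
    using summable_mult[OF M(1), of K] by blast
qed

lemma uhp_majorized_cmult: "uhp_majorized f \<Longrightarrow> uhp_majorized (\<lambda>n t. c * f n t)"
  by (rule uhp_majorized_mult_left) auto

lemma uhp_majorized_uniform_limit:
  assumes "uhp_majorized f" "y > 0"
  shows "uniform_limit {t. Im t > y} (\<lambda>n t. \<Sum>i<n. f i t) (\<lambda>t. \<Sum>i. f i t) sequentially"
proof -
  obtain M where "summable M" "\<And>n t. Im t > y \<Longrightarrow> norm (f n t) \<le> M n"
    by (rule uhp_majorizedE[OF assms]) (rule that)
  thus ?thesis by (intro Weierstrass_m_test) auto
qed

lemma norm_wirtinger_form_le: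
  assumes "norm x \<le> A" "norm y \<le> B"
  shows "norm (h * x + of_real (Im h) * y) \<le> norm h * (A + B)"
  unfolding distrib_left
proof (rule norm_triangle_mono)
  show "norm (h * x) \<le> norm h * A" unfolding norm_mult by (intro mult_left_mono assms) simp
  show "norm (of_real (Im h) * y) \<le> norm h * B"
    unfolding norm_mult norm_of_real using assms abs_Im_le_cmod[of h] by (intro mult_mono) auto
qed

lemma has_wirtinger_suminf:
  assumes D: "\<And>n t. t \<in> uhp \<Longrightarrow> has_wirtinger (f n) (a n t) (P n t) t"
    and maj: "uhp_majorized f" "uhp_majorized a" "uhp_majorized P" and t: "t \<in> uhp"
  shows "has_wirtinger (\<lambda>t. \<Sum>n. f n t) (\<Sum>n. a n t) (\<Sum>n. P n t) t"
proof -
  define S where "S = {z. Im z > Im t / 2}"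
  have y: "Im t / 2 > 0" using uhpD[OF t] by simp
  have S: "convex S" "open S" unfolding S_def by (rule convex_halfspace_Im_gt open_halfspace_Im_gt)+
  have t_S: "t \<in> S" and S_uhp: "S \<subseteq> uhp" using y by (auto simp: S_def uhp_def)
  let ?D = "\<lambda>x h. (\<Sum>n. a n x) * h + of_real (Im h) * (\<Sum>n. P n x)"
  have "\<exists>g. \<forall>x\<in>S. (\<lambda>n. f n x) sums g x \<and> (g has_derivative ?D x) (at x within S)"
  proof (rule has_derivative_series[OF S(1)])
    show "((f n) has_derivative (\<lambda>h. a n x * h + of_real (Im h) * P n x)) (at x within S)"
      if "x \<in> S" for n x
      using D[of x n] that S_uhp by (auto simp: has_wirtinger_def intro: has_derivative_at_withinI)
    show "t \<in> S" "(\<lambda>n. f n t) sums (\<Sum>n. f n t)" by (rule t_S uhp_majorized_sums[OF maj(1) t])+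
    fix e :: real assume e: "e > 0"
    have "\<forall>\<^sub>F n in sequentially. \<forall>x\<in>S. norm ((\<Sum>i<n. a i x) - (\<Sum>i. a i x)) < e / 2"
      "\<forall>\<^sub>F n in sequentially. \<forall>x\<in>S. norm ((\<Sum>i<n. P i x) - (\<Sum>i. P i x)) < e / 2"
      using maj(2,3)[THEN uhp_majorized_uniform_limit[OF _ y], unfolded uniform_limit_iff dist_norm,
          rule_format, of "e / 2"] e
      by (simp_all add: S_def)
    thus "\<forall>\<^sub>F n in sequentially. \<forall>x\<in>S. \<forall>h.
        norm ((\<Sum>i<n. a i x * h + of_real (Im h) * P i x) - ?D x h) \<le> e * norm h"
    proof eventually_elim
      case (elim n)
      show ?case
      proof (intro ballI allI)
        fix x h assume "x \<in> S"
        have "(\<Sum>i<n. a i x * h + of_real (Im h) * P i x) - ?D x h =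
            h * ((\<Sum>i<n. a i x) - (\<Sum>i. a i x)) + of_real (Im h) * ((\<Sum>i<n. P i x) - (\<Sum>i. P i x))"
          by (simp add: sum.distrib sum_distrib_left[symmetric] sum_distrib_right[symmetric] algebra_simps)
        also have "norm \<dots> \<le> norm h * (e / 2 + e / 2)"
          using elim \<open>x \<in> S\<close> by (intro norm_wirtinger_form_le) (auto intro: less_imp_le)
        finally show "norm ((\<Sum>i<n. a i x * h + of_real (Im h) * P i x) - ?D x h) \<le> e * norm h"
          by (simp add: mult.commute)
      qed
    qed
  qed
  then obtain g where g: "\<And>x. x \<in> S \<Longrightarrow> (\<lambda>n. f n x) sums g x" "(g has_derivative ?D t) (at t within S)"
    using t_S by blast
  have "(g has_derivative ?D t) (at t)" using g(2) unfolding at_within_open[OF t_S S(2)] .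
  thus ?thesis unfolding has_wirtinger_def
    by (rule has_derivative_transform_within_open[OF _ S(2) t_S]) (rule sums_unique[OF g(1)])
qed

section \<open>The non-holomorphic series\<close>

definition theta_q :: "nat \<Rightarrow> int \<Rightarrow> complex \<Rightarrow> complex" where
  "theta_q N n t = ee (of_int (n\<^sup>2) / of_nat (4 * N) * t)"

definition inv_sqrt_height :: "nat \<Rightarrow> complex \<Rightarrow> complex" where
  "inv_sqrt_height N t = of_real (1 / sqrt (real N * Im t))"

definition conj_theta_term :: "nat \<Rightarrow> nat \<Rightarrow> nat \<Rightarrow> complex \<Rightarrow> complex" where
  "conj_theta_term N p n t = of_nat n ^ p * cnj (theta_q N (int n) t)"

definition erfc_theta_term :: "nat \<Rightarrow> nat \<Rightarrow> nat \<Rightarrow> complex \<Rightarrow> complex" where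
  "erfc_theta_term N p n t = of_nat n ^ p *
     (of_real (erfc (real n * sqrt (pi * Im t / real N))) * inverse (theta_q N (int n) t))"

definition conj_theta :: "nat \<Rightarrow> (nat \<Rightarrow> real) \<Rightarrow> nat \<Rightarrow> complex \<Rightarrow> complex" where
  "conj_theta N c p t = (\<Sum>n. of_real (c n) * conj_theta_term N p n t)"

definition erfc_theta :: "nat \<Rightarrow> (nat \<Rightarrow> real) \<Rightarrow> nat \<Rightarrow> complex \<Rightarrow> complex" where
  "erfc_theta N c p t = (\<Sum>n. of_real (c n) * erfc_theta_term N p n t)"

definition eichler_three_half_term :: "nat \<Rightarrow> nat \<Rightarrow> complex \<Rightarrow> complex" where
  "eichler_three_half_term N n t =
     erfc_theta_term N 1 n t - of_real (real N / pi) * (inv_sqrt_height N t * conj_theta_term N 0 n t)"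

lemma theta_q_0 [simp]: "theta_q N 0 t = 1"
  by (simp add: theta_q_def)

lemma theta_q_nonzero [simp]: "theta_q N n t \<noteq> 0"
  by (simp add: theta_q_def)

lemma theta_q_minus [simp]: "theta_q N (- n) t = theta_q N n t"
  by (simp add: theta_q_def)

lemma inverse_theta_q: "inverse (theta_q N n t) = ee (- (of_int (n\<^sup>2) / of_nat (4 * N) * t))"
  by (simp add: theta_q_def ee_minus)

lemma norm_theta_q: "norm (theta_q N n t) = exp (- (pi / (2 * real N) * Im t * (of_int n)\<^sup>2))"
  unfolding theta_q_def norm_ee by (cases "N = 0") (simp_all add: field_simps)

lemma theta_q_has_field_derivative:
  "(theta_q N n has_field_derivative \<i> * of_real (pi / (2 * real N)) * (of_int n)\<^sup>2 * theta_q N n t) (at t)"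
  unfolding theta_q_def[abs_def] by (rule DERIV_cong[OF ee_has_field_derivative]) simp

lemma theta_q_holomorphic: "theta_q N n holomorphic_on S"
  unfolding theta_q_def[abs_def] by (intro ee_holomorphic holomorphic_intros)

lemma cnj_theta_q:
  assumes "N > 0"
  shows "cnj (theta_q N n t) = of_real (exp (- (pi * (of_int n)\<^sup>2 * Im t / real N))) * inverse (theta_q N n t)"
proof -
  have "cnj (tpi * (of_int (n\<^sup>2) / of_nat (4 * N) * t)) =
      of_real (- (pi * (of_int n)\<^sup>2 * Im t / real N)) + tpi * (- (of_int (n\<^sup>2) / of_nat (4 * N) * t))"
    using assms by (auto simp: complex_eq_iff field_simps)
  hence "cnj (exp (tpi * (of_int (n\<^sup>2) / of_nat (4 * N) * t))) =
      exp (of_real (- (pi * (of_int n)\<^sup>2 * Im t / real N)) + tpi * (- (of_int (n\<^sup>2) / of_nat (4 * N) * t)))"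
    by (simp only: exp_cnj)
  thus ?thesis unfolding inverse_theta_q unfolding theta_q_def ee_def exp_add exp_of_real .
qed

lemma summable_power_exp:
  assumes "a > 0"
  shows "summable (\<lambda>n. real n ^ p * exp (- a * real n))"
proof (rule summable_comparison_test_bigo)
  show "summable (\<lambda>n. norm (1 / real n ^ 2))"
    using inverse_power_summable[of 2] by (simp add: field_simps)
  show "(\<lambda>n. real n ^ p * exp (- a * real n)) \<in> O(\<lambda>n. 1 / real n ^ 2)"
    using assms by real_asymp
qed

lemma uhp_majorized_if_gauss_bound:
  assumes "b > 0" and le: "\<And>n t. Im t > 0 \<Longrightarrow> norm (f n t) \<le> real n ^ p * exp (- (b * Im t * (real n)\<^sup>2))"
  shows "uhp_majorized f"
  unfolding uhp_majorized_def
proof (intro allI impI exI conjI)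
  fix y :: real assume y: "y > 0"
  show "summable (\<lambda>n. real n ^ p * exp (- (b * y) * real n))"
    using assms(1) y by (intro summable_power_exp) auto
  fix n t assume t: "Im t > y"
  have "real n \<le> (real n)\<^sup>2" by (simp add: power2_eq_square) (metis le_square of_nat_le_iff of_nat_mult)
  hence "y * real n \<le> Im t * (real n)\<^sup>2" using t y by (intro mult_mono) auto
  hence "b * (y * real n) \<le> b * (Im t * (real n)\<^sup>2)" using assms(1) by (intro mult_left_mono) auto
  hence "real n ^ p * exp (- (b * Im t * (real n)\<^sup>2)) \<le> real n ^ p * exp (- (b * y) * real n)"
    by (intro mult_left_mono) (auto simp: mult.assoc)
  thus "norm (f n t) \<le> real n ^ p * exp (- (b * y) * real n)" using le[of t n] t y by simp
qed

lemma DERIV_erfc_sqrt: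
  assumes "v > 0" "N > 0"
  shows "((\<lambda>v. erfc (x * sqrt (pi * v / real N))) has_real_derivative
     - (x * exp (- (pi * x^2 * v / real N)) / sqrt (real N * v))) (at v)"
proof -
  have pos: "pi * v / real N > 0" using assms by simp
  have square: "(x * sqrt (pi * v / real N))^2 = pi * x^2 * v / real N"
    using pos assms by (simp add: power_mult_distrib mult_ac)
  have "2 / sqrt pi * (pi / real N * (inverse (sqrt (pi * v / real N)) / 2)) = 1 / sqrt (real N * v)"
  proof -
    have "2 / sqrt pi * (pi / real N * (inverse (sqrt (pi * v / real N)) / 2)) =
        (pi / (sqrt pi * sqrt pi)) * ((sqrt (real N) * sqrt (real N)) / real N) / (sqrt (real N) * sqrt v)"
      using assms by (simp add: real_sqrt_mult real_sqrt_divide del: real_sqrt_mult_self)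
    thus ?thesis using assms by (simp add: real_sqrt_mult)
  qed
  moreover have "((\<lambda>v. erfc (x * sqrt (pi * v / real N))) has_real_derivative
     - (2 / sqrt pi * exp (- (x * sqrt (pi * v / real N))\<^sup>2)) *
       (x * (pi / real N * (inverse (sqrt (pi * v / real N)) / 2)))) (at v)"
    using pos by (auto intro!: derivative_eq_intros simp: mult_ac)
  moreover have "- (a * e) * (x * d) = - (x * e) * (a * d)" for a d e :: real by simp
  ultimately show ?thesis by (simp only: square) simp
qed

context
  fixes N :: nat
  assumes N: "N > 0"
begin

abbreviation half_pi_N :: complex where "half_pi_N \<equiv> of_real (pi / (2 * real N))"

lemma uhp_majorized_conj_theta_term: "uhp_majorized (conj_theta_term N p)"
  by (rule uhp_majorized_if_gauss_bound[where b="pi / (2 * real N)"])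
     (use N in \<open>auto simp: conj_theta_term_def norm_mult norm_power norm_theta_q\<close>)

lemma uhp_majorized_erfc_theta_term: "uhp_majorized (erfc_theta_term N p)"
proof (rule uhp_majorized_if_gauss_bound[where b="pi / (2 * real N)"])
  fix n t assume v: "Im t > 0"
  define e where "e = erfc (real n * sqrt (pi * Im t / real N))"
  have "\<bar>e\<bar> \<le> exp (- (pi / real N * Im t * (real n)^2))"
    using erfc_le[of "real n * sqrt (pi * Im t / real N)"] erfc_nonneg v
    by (simp add: e_def power_mult_distrib mult_ac)
  hence "\<bar>e\<bar> * exp (pi / (2 * real N) * Im t * (real n)\<^sup>2) \<le>
      exp (- (pi / real N * Im t * (real n)^2)) * exp (pi / (2 * real N) * Im t * (real n)\<^sup>2)"
    by (rule mult_right_mono) simp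
  also have "\<dots> = exp (- (pi / (2 * real N) * Im t * (real n)\<^sup>2))"
    using N unfolding exp_add[symmetric] by (simp add: field_simps)
  finally show "norm (erfc_theta_term N p n t) \<le> real n ^ p * exp (- (pi / (2 * real N) * Im t * (real n)\<^sup>2))"
    unfolding erfc_theta_term_def norm_mult norm_power norm_inverse norm_theta_q
    by (simp add: e_def mult_left_mono flip: exp_minus)
qed (use N in simp)

lemma conj_theta_term_wirtinger:
  "has_wirtinger (conj_theta_term N p n)
     (- \<i> * half_pi_N * conj_theta_term N (p + 2) n t) (- 2 * half_pi_N * conj_theta_term N (p + 2) n t) t"
  unfolding conj_theta_term_def[abs_def]
  by (rule has_wirtinger_cong[OF has_wirtinger_cmult[OF has_wirtinger_cnj[OF theta_q_has_field_derivative]]])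
     (simp_all add: power_add power2_eq_square algebra_simps)

lemma erfc_theta_term_wirtinger:
  assumes t: "t \<in> uhp"
  shows "has_wirtinger (erfc_theta_term N p n)
     (- \<i> * half_pi_N * erfc_theta_term N (p + 2) n t) (- inv_sqrt_height N t * conj_theta_term N (p + 1) n t) t"
proof -
  have "((\<lambda>t. inverse (theta_q N (int n) t)) has_field_derivative
      - \<i> * half_pi_N * (of_nat n)\<^sup>2 * inverse (theta_q N (int n) t)) (at t)"
    by (rule DERIV_cong[OF DERIV_inverse'[OF theta_q_has_field_derivative theta_q_nonzero]]) simp
  note D = has_wirtinger_cmult[OF has_wirtinger_mult[OF
    has_wirtinger_Im[OF DERIV_erfc_sqrt[OF uhpD[OF t] N]] has_wirtinger_hol[OF this]]]
  show ?thesis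
    unfolding erfc_theta_term_def[abs_def] conj_theta_term_def cnj_theta_q[OF N] inv_sqrt_height_def
    by (rule has_wirtinger_cong[OF D]) (simp_all add: power_add power2_eq_square)
qed

lemma inv_sqrt_height_wirtinger:
  assumes "t \<in> uhp"
  shows "has_wirtinger (inv_sqrt_height N) 0 (- of_nat N / 2 * inv_sqrt_height N t ^ 3) t"
proof -
  define s where "s = sqrt (real N * Im t)"
  have s: "s > 0" using N uhpD[OF assms] by (simp add: s_def)
  have "((\<lambda>v. 1 / sqrt (real N * v)) has_real_derivative - (real N * (inverse s / 2)) / (s * s)) (at (Im t))"
    unfolding s_def using uhpD[OF assms] N by (auto intro!: derivative_eq_intros simp: mult_less_0_iff)
  from has_wirtinger_Im[OF this] show ?thesis
    unfolding inv_sqrt_height_def[abs_def]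
    by (rule has_wirtinger_cong)
       (simp_all only: s_def[symmetric], use s in \<open>simp_all add: field_simps power3_eq_cube\<close>)
qed

lemma inv_sqrt_height_square:
  assumes "t \<in> uhp"
  shows "of_nat N * of_real (Im t) * inv_sqrt_height N t ^ 2 = 1"
proof -
  have "real N * Im t * (1 / sqrt (real N * Im t))\<^sup>2 = 1"
    using N uhpD[OF assms] by (simp add: power_divide)
  from arg_cong[OF this, of complex_of_real] show ?thesis by (simp add: inv_sqrt_height_def)
qed

lemma inv_sqrt_height_bounded:
  "y > 0 \<Longrightarrow> \<exists>K. \<forall>n t. Im t > y \<longrightarrow> norm (- inv_sqrt_height N t) \<le> K"
proof (intro exI allI impI)
  fix t assume "y > 0" "Im t > y"
  thus "norm (- inv_sqrt_height N t) \<le> 1 / sqrt (real N * y)"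
    using N unfolding inv_sqrt_height_def norm_minus_cancel norm_of_real by (simp add: frac_le)
qed

lemma inv_sqrt_height_cube_wirtinger:
  assumes "t \<in> uhp"
  shows "has_wirtinger (\<lambda>t. inv_sqrt_height N t ^ 3) 0 (- 3 * of_nat N / 2 * inv_sqrt_height N t ^ 5) t"
  unfolding power3_eq_cube
  by (rule has_wirtinger_cong[OF has_wirtinger_mult[OF has_wirtinger_mult]])
     (rule inv_sqrt_height_wirtinger[OF assms] | simp add: power3_eq_cube eval_nat_numeral)+

context
  fixes c :: "nat \<Rightarrow> real" and B :: real
  assumes c_bound: "\<And>n. \<bar>c n\<bar> \<le> B"
begin

lemma uhp_majorized_coeff: "uhp_majorized f \<Longrightarrow> uhp_majorized (\<lambda>n t. of_real (c n) * f n t)"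
  by (rule uhp_majorized_mult_left) (use c_bound in auto)

lemmas conj_theta_majorized = uhp_majorized_coeff[OF uhp_majorized_conj_theta_term]
  and erfc_theta_majorized = uhp_majorized_coeff[OF uhp_majorized_erfc_theta_term]

lemma conj_theta_sums:
  "t \<in> uhp \<Longrightarrow> (\<lambda>n. of_real (c n) * conj_theta_term N p n t) sums conj_theta N c p t"
  unfolding conj_theta_def by (rule uhp_majorized_sums[OF conj_theta_majorized])

lemma erfc_theta_sums:
  "t \<in> uhp \<Longrightarrow> (\<lambda>n. of_real (c n) * erfc_theta_term N p n t) sums erfc_theta N c p t"
  unfolding erfc_theta_def by (rule uhp_majorized_sums[OF erfc_theta_majorized])

lemma conj_theta_has_sum:
  "t \<in> uhp \<Longrightarrow> ((\<lambda>n. of_real (c n) * conj_theta_term N p n t) has_sum conj_theta N c p t) UNIV"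
  unfolding conj_theta_def by (rule uhp_majorized_has_sum[OF conj_theta_majorized])

lemma erfc_theta_has_sum:
  "t \<in> uhp \<Longrightarrow> ((\<lambda>n. of_real (c n) * erfc_theta_term N p n t) has_sum erfc_theta N c p t) UNIV"
  unfolding erfc_theta_def by (rule uhp_majorized_has_sum[OF erfc_theta_majorized])

lemma conj_theta_bounded: "\<exists>C. \<forall>t. Im t > 1 \<longrightarrow> norm (conj_theta N c p t) \<le> C"
  unfolding conj_theta_def by (rule uhp_majorized_bounded[OF conj_theta_majorized])

lemma erfc_theta_bounded: "\<exists>C. \<forall>t. Im t > 1 \<longrightarrow> norm (erfc_theta N c p t) \<le> C"
  unfolding erfc_theta_def by (rule uhp_majorized_bounded[OF erfc_theta_majorized])

lemma conj_theta_wirtinger: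
  assumes t: "t \<in> uhp"
  shows "has_wirtinger (conj_theta N c p)
    (- \<i> * half_pi_N * conj_theta N c (p + 2) t) (- 2 * half_pi_N * conj_theta N c (p + 2) t) t"
proof -
  have "has_wirtinger (conj_theta N c p) (\<Sum>n. - \<i> * half_pi_N * (of_real (c n) * conj_theta_term N (p + 2) n t))
      (\<Sum>n. - 2 * half_pi_N * (of_real (c n) * conj_theta_term N (p + 2) n t)) t"
    unfolding conj_theta_def[abs_def]
  proof (rule has_wirtinger_suminf[OF _ _ _ _ t])
    show "has_wirtinger (\<lambda>t. of_real (c n) * conj_theta_term N p n t)
        (- \<i> * half_pi_N * (of_real (c n) * conj_theta_term N (p + 2) n t))
        (- 2 * half_pi_N * (of_real (c n) * conj_theta_term N (p + 2) n t)) t" for n t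
      by (rule has_wirtinger_cong[OF has_wirtinger_cmult[OF conj_theta_term_wirtinger]]) simp_all
  qed (intro uhp_majorized_cmult conj_theta_majorized)+
  thus ?thesis by (simp only: suminf_mult[OF sums_summable[OF conj_theta_sums[OF t]]] conj_theta_def)
qed

lemma erfc_theta_wirtinger:
  assumes t: "t \<in> uhp"
  shows "has_wirtinger (erfc_theta N c p)
    (- \<i> * half_pi_N * erfc_theta N c (p + 2) t) (- inv_sqrt_height N t * conj_theta N c (p + 1) t) t"
proof -
  have "has_wirtinger (erfc_theta N c p) (\<Sum>n. - \<i> * half_pi_N * (of_real (c n) * erfc_theta_term N (p + 2) n t))
      (\<Sum>n. - inv_sqrt_height N t * (of_real (c n) * conj_theta_term N (p + 1) n t)) t"
    unfolding erfc_theta_def[abs_def]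
  proof (rule has_wirtinger_suminf[OF _ _ _ _ t])
    show "has_wirtinger (\<lambda>t. of_real (c n) * erfc_theta_term N p n t)
        (- \<i> * half_pi_N * (of_real (c n) * erfc_theta_term N (p + 2) n t))
        (- inv_sqrt_height N t * (of_real (c n) * conj_theta_term N (p + 1) n t)) t" if "t \<in> uhp" for n t
      by (rule has_wirtinger_cong[OF has_wirtinger_cmult[OF erfc_theta_term_wirtinger[OF that]]]) simp_all
    show "uhp_majorized (\<lambda>n t. - inv_sqrt_height N t * (of_real (c n) * conj_theta_term N (p + 1) n t))"
      by (rule uhp_majorized_mult_left[OF conj_theta_majorized inv_sqrt_height_bounded])
  qed (intro uhp_majorized_cmult erfc_theta_majorized)+
  thus ?thesis
    by (simp only: suminf_mult[OF sums_summable[OF conj_theta_sums[OF t]]]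
        suminf_mult[OF sums_summable[OF erfc_theta_sums[OF t]]] conj_theta_def erfc_theta_def)
qed

inductive_set theta_algebra :: "(complex \<Rightarrow> complex) set" where
  hol: "f holomorphic_on uhp \<Longrightarrow> f \<in> theta_algebra"
| erfc: "erfc_theta N c p \<in> theta_algebra"
| conj: "conj_theta N c p \<in> theta_algebra"
| height: "inv_sqrt_height N \<in> theta_algebra"
| add: "f \<in> theta_algebra \<Longrightarrow> g \<in> theta_algebra \<Longrightarrow> (\<lambda>t. f t + g t) \<in> theta_algebra"
| mult: "f \<in> theta_algebra \<Longrightarrow> g \<in> theta_algebra \<Longrightarrow> (\<lambda>t. f t * g t) \<in> theta_algebra"

lemma theta_algebra_const: "(\<lambda>_. k) \<in> theta_algebra"
  by (rule theta_algebra.hol) simp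

lemma theta_algebra_power: "f \<in> theta_algebra \<Longrightarrow> (\<lambda>t. f t ^ n) \<in> theta_algebra"
  by (induction n) (auto intro: theta_algebra_const theta_algebra.mult)

lemma theta_algebra_uminus: "f \<in> theta_algebra \<Longrightarrow> (\<lambda>t. - f t) \<in> theta_algebra"
  using theta_algebra.mult[OF theta_algebra_const[of "- 1"], of f] by simp

lemma theta_algebra_wirtinger:
  assumes "f \<in> theta_algebra"
  shows "\<exists>a\<in>theta_algebra. \<exists>P\<in>theta_algebra. \<forall>t\<in>uhp. has_wirtinger f (a t) (P t) t"
  using assms
proof induction
  case (hol f)
  have member: "deriv f \<in> theta_algebra"
    by (intro theta_algebra.hol holomorphic_deriv[OF hol open_uhp])
  show ?case
    by (rule bexI[OF bexI[OF _ theta_algebra_const[of 0]] member])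
       (intro ballI has_wirtinger_hol holomorphic_derivI[OF hol open_uhp])
next
  case (erfc p)
  have members: "(\<lambda>t. - \<i> * half_pi_N * erfc_theta N c (p + 2) t) \<in> theta_algebra"
    "(\<lambda>t. - inv_sqrt_height N t * conj_theta N c (p + 1) t) \<in> theta_algebra"
    by (intro theta_algebra.intros(2-) theta_algebra_const theta_algebra_uminus)+
  show ?case
    by (rule bexI[OF bexI[OF _ members(2)] members(1)]) (rule ballI, rule erfc_theta_wirtinger)
next
  case (conj p)
  have member: "(\<lambda>t. k * conj_theta N c (p + 2) t) \<in> theta_algebra" for k
    by (intro theta_algebra.intros(2-) theta_algebra_const)
  show ?case
    by (rule bexI[OF bexI[OF _ member] member]) (rule ballI, rule conj_theta_wirtinger)
next
  case height
  have member: "(\<lambda>t. - of_nat N / 2 * inv_sqrt_height N t ^ 3) \<in> theta_algebra"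
    by (intro theta_algebra.mult theta_algebra_const theta_algebra_power theta_algebra.height)
  show ?case
    by (rule bexI[OF bexI[OF _ member] theta_algebra_const[of 0]])
       (rule ballI, rule inv_sqrt_height_wirtinger)
next
  case (add f g)
  then obtain a P b Q where "a \<in> theta_algebra" "P \<in> theta_algebra" "b \<in> theta_algebra" "Q \<in> theta_algebra"
    "\<forall>t\<in>uhp. has_wirtinger f (a t) (P t) t" "\<forall>t\<in>uhp. has_wirtinger g (b t) (Q t) t" by blast
  thus ?case
    by (intro bexI[of _ "\<lambda>t. a t + b t"] bexI[of _ "\<lambda>t. P t + Q t"] ballI has_wirtinger_add theta_algebra.add) auto
next
  case (mult f g)
  then obtain a P b Q where "a \<in> theta_algebra" "P \<in> theta_algebra" "b \<in> theta_algebra" "Q \<in> theta_algebra"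
    "\<forall>t\<in>uhp. has_wirtinger f (a t) (P t) t" "\<forall>t\<in>uhp. has_wirtinger g (b t) (Q t) t" by blast
  thus ?case using mult.hyps
    by (intro bexI[of _ "\<lambda>t. a t * g t + f t * b t"] bexI[of _ "\<lambda>t. P t * g t + f t * Q t"] ballI
        has_wirtinger_mult theta_algebra.add theta_algebra.mult) auto
qed

lemma theta_algebra_smooth:
  assumes "f \<in> theta_algebra"
  shows "smooth_uhp f"
proof (rule smooth_uhpI[OF _ assms])
  fix f assume "f \<in> theta_algebra"
  then obtain a P where aP: "a \<in> theta_algebra" "P \<in> theta_algebra"
    "\<forall>t\<in>uhp. has_wirtinger f (a t) (P t) t" using theta_algebra_wirtinger by blast
  moreover have "(\<lambda>t. \<i> * a t + P t) \<in> theta_algebra"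
    using aP by (intro theta_algebra.add theta_algebra.mult theta_algebra_const)
  ultimately show "\<exists>a P. a \<in> theta_algebra \<and> (\<lambda>t. \<i> * a t + P t) \<in> theta_algebra \<and>
      (\<forall>t\<in>uhp. has_wirtinger f (a t) (P t) t)" by blast
qed

definition eichler_three_half :: "complex \<Rightarrow> complex" where
  "eichler_three_half t = erfc_theta N c 1 t + - (of_real (real N / pi) * (inv_sqrt_height N t * conj_theta N c 0 t))"

lemma eichler_three_half_has_sum:
  assumes "t \<in> uhp"
  shows "((\<lambda>n. of_real (c n) * eichler_three_half_term N n t) has_sum eichler_three_half t) UNIV"
proof -
  let ?a = "- of_real (real N / pi) * inv_sqrt_height N t"
  have "((\<lambda>n. of_real (c n) * erfc_theta_term N 1 n t + ?a * (of_real (c n) * conj_theta_term N 0 n t)) has_sum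
      erfc_theta N c 1 t + ?a * conj_theta N c 0 t) UNIV"
    by (intro has_sum_add has_sum_cmult_right erfc_theta_has_sum conj_theta_has_sum assms)
  thus ?thesis
    by (simp add: eichler_three_half_def eichler_three_half_term_def right_diff_distrib mult_ac)
qed

lemma eichler_three_half_bounded: "\<exists>K. \<forall>t. Im t > 1 \<longrightarrow> norm (eichler_three_half t) \<le> K"
proof -
  obtain K where K: "\<And>t. Im t > 1 \<Longrightarrow> norm (erfc_theta N c 1 t) \<le> K" using erfc_theta_bounded by blast
  obtain L where L: "\<And>t. Im t > 1 \<Longrightarrow> norm (conj_theta N c 0 t) \<le> L" using conj_theta_bounded by blast
  obtain H where H: "\<And>t. Im t > 1 \<Longrightarrow> norm (- inv_sqrt_height N t) \<le> H"
    using inv_sqrt_height_bounded[of 1] by auto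
  have "norm (eichler_three_half t) \<le> K + real N / pi * (H * L)" if "Im t > 1" for t
  proof -
    have "H \<ge> 0" using order_trans[OF norm_ge_zero H[OF that]] .
    hence "norm (inv_sqrt_height N t) * norm (conj_theta N c 0 t) \<le> H * L"
      using H[OF that] L[OF that] by (intro mult_mono) auto
    hence "norm (- (of_real (real N / pi) * (inv_sqrt_height N t * conj_theta N c 0 t))) \<le> real N / pi * (H * L)"
      unfolding norm_minus_cancel norm_mult norm_of_real by (simp add: mult_left_mono divide_right_mono)
    thus ?thesis unfolding eichler_three_half_def by (rule norm_triangle_mono[OF K[OF that]])
  qed
  thus ?thesis by blast
qed

lemma eichler_three_half_wirtinger:
  assumes t: "t \<in> uhp"
  shows "has_wirtinger eichler_three_half
    (- \<i> * half_pi_N * erfc_theta N c 3 t + \<i> / 2 * (inv_sqrt_height N t * conj_theta N c 2 t))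
    (of_real (real N ^ 2 / (2 * pi)) * (inv_sqrt_height N t ^ 3 * conj_theta N c 0 t)) t"
proof -
  have "has_wirtinger (\<lambda>t. erfc_theta N c 1 t + - 1 * (of_real (real N / pi) * (inv_sqrt_height N t * conj_theta N c 0 t)))
    (- \<i> * half_pi_N * erfc_theta N c 3 t + \<i> / 2 * (inv_sqrt_height N t * conj_theta N c 2 t))
    (of_real (real N ^ 2 / (2 * pi)) * (inv_sqrt_height N t ^ 3 * conj_theta N c 0 t)) t"
    by (rule has_wirtinger_cong[OF has_wirtinger_add[OF erfc_theta_wirtinger[OF t] has_wirtinger_cmult[OF
         has_wirtinger_cmult[OF has_wirtinger_mult[OF inv_sqrt_height_wirtinger[OF t] conj_theta_wirtinger[OF t]]]]]])
       (use N in \<open>simp_all add: algebra_simps numeral_3_eq_3 numeral_2_eq_2\<close>)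
  thus ?thesis by (simp add: eichler_three_half_def[abs_def])
qed

context
  fixes h :: "complex \<Rightarrow> complex"
  assumes h: "h holomorphic_on uhp"
begin

lemma holomorphic_uhp_wirtinger:
  assumes "t \<in> uhp"
  shows "has_wirtinger h (deriv h t) 0 t" "has_wirtinger (deriv h) (deriv (deriv h) t) 0 t"
  by (intro has_wirtinger_hol holomorphic_derivI[OF _ open_uhp assms] holomorphic_deriv h open_uhp)+

abbreviation (input) height :: "complex \<Rightarrow> complex" where "height \<equiv> inv_sqrt_height N"

abbreviation (input) "\<E> \<equiv> erfc_theta N c"
abbreviation (input) "\<T> \<equiv> conj_theta N c"

lemma erfc_theta_shift_wirtinger:
  assumes t: "t \<in> uhp"
  shows "has_wirtinger (\<lambda>t. h t + \<E> 0 t) (deriv h t + - \<i> * half_pi_N * \<E> 2 t) (- 1 * (height t * \<T> 1 t)) t"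
  by (rule has_wirtinger_cong[OF has_wirtinger_add[OF holomorphic_uhp_wirtinger(1)[OF t] erfc_theta_wirtinger[OF t]]])
     (simp_all add: numeral_2_eq_2)

lemma erfc_theta_maass_half:
  defines "f \<equiv> \<lambda>t. h t + \<E> 0 t"
  shows "smooth_uhp f"
    and "t \<in> uhp \<Longrightarrow> laplacian (1/2) f t = 0"
    and "t \<in> uhp \<Longrightarrow> xi (1/2) f t = - of_real (1 / sqrt (real N)) * cnj (\<T> 1 t)"
proof -
  show "smooth_uhp f" unfolding f_def
    by (intro theta_algebra_smooth theta_algebra.add theta_algebra.hol h theta_algebra.erfc)
  define a where "a = (\<lambda>t. deriv h t + - \<i> * half_pi_N * \<E> 2 t)"
  define P where "P = (\<lambda>t. - 1 * (height t * \<T> 1 t))"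
  have f: "has_wirtinger f (a t) (P t) t" if "t \<in> uhp" for t
    unfolding f_def a_def P_def by (rule erfc_theta_shift_wirtinger[OF that])
  assume t: "t \<in> uhp"
  have "has_wirtinger a (deriv (deriv h) t + - \<i> * half_pi_N * (- \<i> * half_pi_N * \<E> (2 + 2) t))
      (0 + - \<i> * half_pi_N * (- height t * \<T> (2 + 1) t)) t"
    unfolding a_def by (intro has_wirtinger_add has_wirtinger_cmult holomorphic_uhp_wirtinger(2) erfc_theta_wirtinger t)
  hence a: "has_wirtinger a (deriv (deriv h) t + - \<i> * half_pi_N * (- \<i> * half_pi_N * \<E> (2 + 2) t))
      (\<i> * half_pi_N * height t * \<T> 3 t) t"
    by (rule has_wirtinger_cong) (simp_all add: numeral_3_eq_3)
  have "has_wirtinger P (- 1 * (0 * \<T> 1 t + height t * (- \<i> * half_pi_N * \<T> (1 + 2) t)))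
      (- 1 * ((- of_nat N / 2 * height t ^ 3) * \<T> 1 t + height t * (- 2 * half_pi_N * \<T> (1 + 2) t))) t"
    unfolding P_def by (intro has_wirtinger_cmult has_wirtinger_mult inv_sqrt_height_wirtinger conj_theta_wirtinger t)
  hence P: "has_wirtinger P (\<i> * half_pi_N * height t * \<T> 3 t)
      (of_nat N / 2 * height t ^ 3 * \<T> 1 t + 2 * half_pi_N * height t * \<T> 3 t) t"
    by (rule has_wirtinger_cong) (simp_all add: algebra_simps numeral_3_eq_3)
  have "\<i> * (\<i> * b * x * y) + \<i> * (\<i> * b * x * y) + (z + 2 * b * x * y) = z" for b x y z :: complex
    by (simp add: algebra_simps)
  hence "laplacian (1/2) f t = - of_real ((Im t)\<^sup>2) * (of_nat N / 2 * height t ^ 3 * \<T> 1 t) -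
      of_real (1 / 2 * Im t) * P t"
    by (simp only: laplacian_wirtinger[OF f t a P])
  also have "\<dots> = of_real (Im t) / 2 * height t * \<T> 1 t * (1 - of_nat N * of_real (Im t) * height t ^ 2)"
    by (simp add: P_def algebra_simps power2_eq_square power3_eq_cube)
  finally show "laplacian (1/2) f t = 0" by (simp add: inv_sqrt_height_square[OF t])
  have "sqrt (Im t) * (1 / sqrt (real N * Im t)) = 1 / sqrt (real N)"
    using uhpD[OF t] N by (simp add: real_sqrt_mult)
  hence "of_real (sqrt (Im t)) * height t = of_real (1 / sqrt (real N))"
    unfolding inv_sqrt_height_def of_real_mult[symmetric] by simp
  moreover have "cnj (height t) = height t" by (simp add: inv_sqrt_height_def)
  ultimately show "xi (1/2) f t = - of_real (1 / sqrt (real N)) * cnj (\<T> 1 t)"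
    using uhpD[OF t] by (simp add: xi_wirtinger[OF f t] P_def powr_half_sqrt mult.assoc[symmetric])
qed

abbreviation (input) "eichler_const \<equiv> complex_of_real (real N ^ 2 / (2 * pi))"

definition eichler_shift_du :: "complex \<Rightarrow> complex" where
  "eichler_shift_du t = deriv h t + (- \<i> * half_pi_N * \<E> 3 t + \<i> / 2 * (height t * \<T> 2 t))"

definition eichler_shift_dbar :: "complex \<Rightarrow> complex" where
  "eichler_shift_dbar t = eichler_const * (height t ^ 3 * \<T> 0 t)"

lemma eichler_shift_wirtinger:
  assumes "t \<in> uhp"
  shows "has_wirtinger (\<lambda>t. h t + eichler_three_half t) (eichler_shift_du t) (eichler_shift_dbar t) t"
  unfolding eichler_shift_du_def eichler_shift_dbar_def
  using has_wirtinger_add[OF holomorphic_uhp_wirtinger(1)[OF assms] eichler_three_half_wirtinger[OF assms]]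
  by simp

lemma eichler_shift_du_wirtinger:
  assumes t: "t \<in> uhp"
  shows "has_wirtinger eichler_shift_du
    (deriv (deriv h) t + (- \<i> * half_pi_N * (- \<i> * half_pi_N * \<E> (3 + 2) t) +
      \<i> / 2 * (0 * \<T> 2 t + height t * (- \<i> * half_pi_N * \<T> (2 + 2) t))))
    (- \<i> * of_nat N / 4 * height t ^ 3 * \<T> 2 t) t"
proof -
  have "has_wirtinger eichler_shift_du
      (deriv (deriv h) t + (- \<i> * half_pi_N * (- \<i> * half_pi_N * \<E> (3 + 2) t) +
        \<i> / 2 * (0 * \<T> 2 t + height t * (- \<i> * half_pi_N * \<T> (2 + 2) t))))
      (0 + (- \<i> * half_pi_N * (- height t * \<T> (3 + 1) t) +
        \<i> / 2 * ((- of_nat N / 2 * height t ^ 3) * \<T> 2 t + height t * (- 2 * half_pi_N * \<T> (2 + 2) t)))) t"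
    unfolding eichler_shift_du_def[abs_def]
    by (intro has_wirtinger_add has_wirtinger_cmult has_wirtinger_mult
      holomorphic_uhp_wirtinger(2) erfc_theta_wirtinger inv_sqrt_height_wirtinger conj_theta_wirtinger t)
  thus ?thesis by (rule has_wirtinger_cong) (simp_all add: algebra_simps)
qed

lemma eichler_shift_dbar_wirtinger:
  assumes t: "t \<in> uhp"
  shows "has_wirtinger eichler_shift_dbar (- \<i> * (of_nat N / 4) * height t ^ 3 * \<T> 2 t)
    (eichler_const * (- 3 * of_nat N / 2 * height t ^ 5) * \<T> 0 t - 2 * (of_nat N / 4) * height t ^ 3 * \<T> 2 t) t"
proof -
  have const: "eichler_const * half_pi_N = of_nat N / 4" using N by (simp add: power2_eq_square)
  have "has_wirtinger eichler_shift_dbar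
      (eichler_const * (0 * \<T> 0 t + height t ^ 3 * (- \<i> * half_pi_N * \<T> (0 + 2) t)))
      (eichler_const * ((- 3 * of_nat N / 2 * height t ^ 5) * \<T> 0 t + height t ^ 3 * (- 2 * half_pi_N * \<T> (0 + 2) t))) t"
    unfolding eichler_shift_dbar_def[abs_def]
    by (intro has_wirtinger_cmult has_wirtinger_mult inv_sqrt_height_cube_wirtinger conj_theta_wirtinger t)
  moreover have "K * (0 * u + x * (- \<i> * b * y)) = - \<i> * (K * b) * x * y"
    "K * (z * u + x * (- 2 * b * y)) = K * z * u - 2 * (K * b) * x * y" for K b u x y z :: complex
    by (simp_all add: algebra_simps)
  ultimately show ?thesis by (simp only: const add_0)
qed

lemma eichler_shadow_factor:
  assumes t: "t \<in> uhp"
  shows "of_real (Im t powr (3/2)) * (eichler_const * height t ^ 3) = of_real (sqrt (real N) / (2 * pi))"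
proof -
  define x y where "x = sqrt (real N)" and "y = sqrt (Im t)"
  have xy: "x > 0" "y > 0" "real N = x\<^sup>2" "Im t = y\<^sup>2" using uhpD[OF t] N by (simp_all add: x_def y_def)
  have "y\<^sup>2 powr (3/2) = y\<^sup>2 * y"
    using powr_mult_base[of "y\<^sup>2" "1/2"] xy(1,2) by (simp add: powr_half_sqrt)
  hence "Im t powr (3/2) * (real N ^ 2 / (2 * pi) * (1 / sqrt (real N * Im t)) ^ 3) =
      y\<^sup>2 * y * ((x\<^sup>2)\<^sup>2 / (2 * pi) * (1 / (x * y)) ^ 3)"
    using xy(1,2) by (simp add: xy(3,4) real_sqrt_mult)
  also have "\<dots> = x / (2 * pi)"
    using xy(1,2) by (simp add: field_simps eval_nat_numeral)
  also have "x = sqrt (real N)" by (simp add: x_def)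
  finally show ?thesis
    unfolding inv_sqrt_height_def of_real_mult[symmetric] of_real_power[symmetric] by (rule arg_cong)
qed

lemma eichler_three_half_maass:
  defines "f \<equiv> \<lambda>t. h t + eichler_three_half t"
  shows "smooth_uhp f"
    and "t \<in> uhp \<Longrightarrow> laplacian (3/2) f t = 0"
    and "t \<in> uhp \<Longrightarrow> xi (3/2) f t = of_real (sqrt (real N) / (2 * pi)) * cnj (\<T> 0 t)"
proof -
  show "smooth_uhp f" unfolding f_def eichler_three_half_def
    by (intro theta_algebra_smooth theta_algebra.add[OF theta_algebra.hol[OF h]] theta_algebra_uminus
        theta_algebra_const theta_algebra.intros(2-))
  note f = eichler_shift_wirtinger[folded f_def]
  assume t: "t \<in> uhp"
  have "\<i> * (- \<i> * c / 4 * x * y) + \<i> * (- \<i> * (c / 4) * x * y) + (z - 2 * (c / 4) * x * y) = z"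
    for c x y z :: complex
    by (simp add: algebra_simps)
  hence "laplacian (3/2) f t = - of_real ((Im t)\<^sup>2) * (eichler_const * (- 3 * of_nat N / 2 * height t ^ 5) * \<T> 0 t) -
      of_real (3 / 2 * Im t) * eichler_shift_dbar t"
    by (simp only: laplacian_wirtinger[OF f t eichler_shift_du_wirtinger[OF t] eichler_shift_dbar_wirtinger[OF t]])
  moreover have "- of_real (v\<^sup>2) * (K * (- 3 * n / 2 * w ^ 5) * u) - of_real (3 / 2 * v) * (K * (w ^ 3 * u)) =
      - (of_real (3 / 2 * v) * K * w ^ 3 * u * (1 - n * of_real v * w ^ 2))" for v :: real and K n w u :: complex
    by (simp add: field_simps eval_nat_numeral)
  ultimately have "laplacian (3/2) f t =
      - (of_real (3 / 2 * Im t) * eichler_const * height t ^ 3 * \<T> 0 t * (1 - of_nat N * of_real (Im t) * height t ^ 2))"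
    unfolding eichler_shift_dbar_def by (simp only:)
  thus "laplacian (3/2) f t = 0" by (simp add: inv_sqrt_height_square[OF t])
  have "cnj (height t) = height t" by (simp add: inv_sqrt_height_def)
  with eichler_shadow_factor[OF t] show "xi (3/2) f t = of_real (sqrt (real N) / (2 * pi)) * cnj (\<T> 0 t)"
    by (simp only: xi_wirtinger[OF f t] eichler_shift_dbar_def complex_cnj_mult complex_cnj_power
        complex_cnj_complex_of_real mult.assoc[symmetric])
qed

end

end

end

lemma nonhol_term_half:
  assumes "N > 0" "n > 0" "t \<in> uhp"
  shows "nonhol_term N (1/2) (- (int n)\<^sup>2) t = of_real (sqrt pi) * erfc_theta_term N 0 n t"
proof -
  define x where "x = pi * (real n)^2 * Im t / real N"
  have x: "x > 0" using assms by (simp add: x_def uhp_def)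
  have "sqrt x = real n * sqrt (pi * Im t / real N)"
    by (simp add: x_def real_sqrt_mult real_sqrt_divide)
  moreover have "- 4 * pi * (of_int (- (int n)\<^sup>2) / of_nat (4 * N)) * Im t = x"
    using assms by (simp add: x_def)
  ultimately show ?thesis
    using assms inc_Gamma_half[OF x] by (simp add: nonhol_term_def erfc_theta_term_def inverse_theta_q)
qed

lemma nonhol_term_three_half:
  assumes "N > 0" "n > 0" "t \<in> uhp"
  shows "- of_real (real n / (2 * sqrt pi)) * nonhol_term N (3/2) (- (int n)\<^sup>2) t = eichler_three_half_term N n t"
proof -
  define x where "x = pi * (real n)^2 * Im t / real N"
  have x: "x > 0" using assms by (simp add: x_def uhp_def)
  have sqrt_x: "sqrt x = real n * sqrt (pi * Im t / real N)"
    by (simp add: x_def real_sqrt_mult real_sqrt_divide)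
  define R where "R = erfc (sqrt x)"
  define E where "E = inverse (theta_q N (int n) t)"
  have "- 4 * pi * (of_int (- (int n)\<^sup>2) / of_nat (4 * N)) * Im t = x" using assms by (simp add: x_def)
  hence "nonhol_term N (3/2) (- (int n)\<^sup>2) t = of_real (2 / sqrt x * exp (- x) - 2 * sqrt pi * R) * E"
    using assms inc_Gamma_minus_half[OF x] by (simp add: nonhol_term_def E_def R_def inverse_theta_q)
  moreover have "- (real n / (2 * sqrt pi)) * (2 / sqrt x * exp (- x) - 2 * sqrt pi * R) =
      real n * R - real n / (sqrt pi * sqrt x) * exp (- x)"
    using x by (simp add: field_simps)
  moreover have "real n / (sqrt pi * sqrt x) = real N / pi * (1 / sqrt (real N * Im t))"
  proof -
    have "real n / (sqrt pi * sqrt x) = sqrt (real N) / (sqrt pi * sqrt pi * sqrt (Im t))"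
      unfolding sqrt_x using assms(2) by (simp add: real_sqrt_mult real_sqrt_divide)
    also have "\<dots> = (sqrt (real N) * sqrt (real N)) / (pi * (sqrt (real N) * sqrt (Im t)))"
      using assms(1) by (simp del: real_sqrt_mult_self add: field_simps) simp
    finally show ?thesis by (simp add: real_sqrt_mult)
  qed
  moreover have "conj_theta_term N 0 n t = of_real (exp (- x)) * E"
    by (simp add: conj_theta_term_def cnj_theta_q[OF assms(1)] x_def E_def)
  moreover have "erfc_theta_term N 1 n t = of_real (real n * R) * E"
    by (simp add: erfc_theta_term_def R_def sqrt_x E_def)
  ultimately show ?thesis
    by (simp only: eichler_three_half_term_def inv_sqrt_height_def mult.assoc[symmetric] of_real_mult[symmetric]
        of_real_minus[symmetric] of_real_diff[symmetric] left_diff_distrib[symmetric])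
qed

lemma nonhol_term_three_half_0:
  assumes "N > 0" "t \<in> uhp"
  shows "- of_real (sqrt (real N) / pi) * nonhol_term N (3/2) 0 t = eichler_three_half_term N 0 t"
proof -
  have "Im t powr (1 - 3/2) = 1 / sqrt (Im t)"
    using uhpD[OF assms(2)] by (simp add: powr_minus powr_half_sqrt[symmetric] field_simps)
  moreover have "real N / pi * (1 / sqrt (real N * Im t)) = (real N / sqrt (real N)) / pi * (1 / sqrt (Im t))"
    by (simp add: real_sqrt_mult)
  hence "real N / pi * (1 / sqrt (real N * Im t)) = sqrt (real N) / pi * (1 / sqrt (Im t))"
    by (simp only: real_div_sqrt[OF of_nat_0_le_iff])
  from arg_cong[OF this, of complex_of_real]
  have "of_real (sqrt (real N) / pi) * complex_of_real (1 / sqrt (Im t)) = of_real (real N / pi) * inv_sqrt_height N t"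
    unfolding of_real_mult inv_sqrt_height_def by (rule sym)
  ultimately show ?thesis
    by (simp add: nonhol_term_def eichler_three_half_term_def erfc_theta_term_def conj_theta_term_def del: of_real_divide)
qed

lemma infsum_has_field_derivative:
  fixes f :: "'i \<Rightarrow> complex \<Rightarrow> complex"
  assumes r: "r > 0" and hol: "\<And>i w. i \<in> I \<Longrightarrow> w \<in> cball z r \<Longrightarrow> (f i has_field_derivative f' i w) (at w)"
    and M: "M summable_on I" "\<And>i w. i \<in> I \<Longrightarrow> w \<in> cball z r \<Longrightarrow> norm (f i w) \<le> M i"
  obtains g' where "((\<lambda>z. \<Sum>\<^sub>\<infinity>i\<in>I. f i z) has_field_derivative g') (at z)" "((\<lambda>i. f' i z) has_sum g') I"
proof -
  have ul: "uniform_limit (cball z r) (\<lambda>X w. \<Sum>i\<in>X. f i w) (\<lambda>w. \<Sum>\<^sub>\<infinity>i\<in>I. f i w) (finite_subsets_at_top I)"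
    by (rule Weierstrass_m_test_general[OF M(2,1)])
  obtain g' where g': "\<And>w. w \<in> ball z r \<Longrightarrow> ((\<lambda>w. \<Sum>\<^sub>\<infinity>i\<in>I. f i w) has_field_derivative (g' w)) (at w) \<and>
      ((\<lambda>X. \<Sum>i\<in>X. f' i w) \<longlongrightarrow> g' w) (finite_subsets_at_top I)"
  proof (rule has_complex_derivative_uniform_limit[where f="\<lambda>X w. \<Sum>i\<in>X. f i w" and f'="\<lambda>X w. \<Sum>i\<in>X. f' i w"
        and F="finite_subsets_at_top I", OF _ ul _ r])
    have "\<forall>\<^sub>F X in finite_subsets_at_top I. finite X \<and> X \<subseteq> I"
      by (rule eventually_finite_subsets_at_top_weakI) auto
    thus "\<forall>\<^sub>F X in finite_subsets_at_top I. continuous_on (cball z r) (\<lambda>w. \<Sum>i\<in>X. f i w) \<and>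
       (\<forall>w\<in>ball z r. ((\<lambda>w. \<Sum>i\<in>X. f i w) has_field_derivative (\<Sum>i\<in>X. f' i w)) (at w))"
    proof eventually_elim
      case (elim X)
      have "((\<lambda>w. \<Sum>i\<in>X. f i w) has_field_derivative (\<Sum>i\<in>X. f' i w)) (at w)" if "w \<in> cball z r" for w
        by (rule DERIV_sum) (use elim that hol in auto)
      thus ?case by (auto intro!: continuous_at_imp_continuous_on DERIV_isCont)
    qed
  qed auto
  show ?thesis using g'[of z] r by (intro that[of "g' z"]) (auto simp: has_sum_def)
qed

lemma infsum_holomorphic:
  fixes f :: "'i \<Rightarrow> complex \<Rightarrow> complex"
  assumes S: "open S" and hol: "\<And>i. i \<in> I \<Longrightarrow> f i holomorphic_on S"
    and M: "\<And>z. z \<in> S \<Longrightarrow> \<exists>r>0. \<exists>M. cball z r \<subseteq> S \<and> M summable_on I \<and> (\<forall>i\<in>I. \<forall>w\<in>cball z r. norm (f i w) \<le> M i)"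
  shows "(\<lambda>z. \<Sum>\<^sub>\<infinity>i\<in>I. f i z) holomorphic_on S"
  unfolding holomorphic_on_open[OF S]
proof
  fix z assume "z \<in> S"
  from M[OF this] obtain r M where r: "r > 0" "cball z r \<subseteq> S" "M summable_on I"
    "\<forall>i\<in>I. \<forall>w\<in>cball z r. norm (f i w) \<le> M i" by blast
  show "\<exists>f'. ((\<lambda>z. \<Sum>\<^sub>\<infinity>i\<in>I. f i z) has_field_derivative f') (at z)"
    by (rule infsum_has_field_derivative[of r I z f "\<lambda>i. deriv (f i)" M])
       (use r holomorphic_derivI[OF hol S] in blast)+
qed

lemma has_sum_times:
  fixes f :: "'a \<Rightarrow> complex" and g :: "'b \<Rightarrow> complex"
  assumes "(f has_sum a) A" "(g has_sum b) B"
  shows "((\<lambda>(x, y). f x * g y) has_sum (a * b)) (A \<times> B)"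
proof (rule has_sum_SigmaI)
  show "((\<lambda>y. case (x, y) of (x, y) \<Rightarrow> f x * g y) has_sum f x * b) B" if "x \<in> A" for x
    using has_sum_cmult_right[OF assms(2)] by simp
  show "((\<lambda>x. f x * b) has_sum a * b) A" by (rule has_sum_cmult_left[OF assms(1)])
  have "(\<lambda>x. norm (f x)) summable_on A" "(\<lambda>x. norm (g x)) summable_on B"
    using assms has_sum_imp_summable summable_on_iff_abs_summable_on_complex by blast+
  hence "(\<lambda>p. norm (case p of (x, y) \<Rightarrow> f x * g y)) summable_on (A \<times> B)"
    unfolding Infinite_Sum.abs_summable_on_Sigma_iff
    by (auto simp: norm_mult infsum_cmult_right' abs_mult infsum_nonneg intro!: summable_on_cmult_right summable_on_cmult_left)
  thus "(\<lambda>(x, y). f x * g y) summable_on (A \<times> B)" by (simp add: summable_on_iff_abs_summable_on_complex)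
qed

lemma has_sum_group:
  fixes f :: "'x \<Rightarrow> complex" and e :: "'x \<Rightarrow> 'p"
  assumes sum: "(f has_sum s) X" and fin: "\<And>p. finite {x \<in> X. e x = p}"
  shows "((\<lambda>p. \<Sum>x\<in>{x \<in> X. e x = p}. f x) has_sum s) UNIV"
proof (rule has_sum_SigmaD)
  have "bij_betw (\<lambda>x. (e x, x)) X (Sigma UNIV (\<lambda>p. {x \<in> X. e x = p}))" by (rule bij_betwI') auto
  from has_sum_reindex_bij_betw[OF this, of "\<lambda>px. f (snd px)"]
  show "((\<lambda>px. f (snd px)) has_sum s) (Sigma UNIV (\<lambda>p. {x \<in> X. e x = p}))" using sum by simp
  show "((\<lambda>x. f (snd (p, x))) has_sum (\<Sum>x\<in>{x \<in> X. e x = p}. f x)) {x \<in> X. e x = p}" for p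
    by (rule has_sum_finiteI[OF fin]) simp
qed

section \<open>Integral expansions\<close>

definition bimonom :: "complex \<Rightarrow> complex \<Rightarrow> nat \<times> nat \<Rightarrow> complex" where
  "bimonom t z p = ee z ^ fst p * ee (t - z) ^ snd p"

lemma bimonom_eq_ee: "bimonom t z p = ee (of_nat (snd p) * t + (of_nat (fst p) - of_nat (snd p)) * z)"
  unfolding bimonom_def ee_power ee_add[symmetric] by (rule arg_cong[of _ _ ee]) (simp add: algebra_simps)

lemma bimonom_mult: "bimonom t z p * bimonom t z p' = bimonom t z (fst p + fst p', snd p + snd p')"
  by (simp add: bimonom_def power_add mult_ac)

lemma bimonom_power: "bimonom t z p ^ d = bimonom t z (fst p * d, snd p * d)"
  by (simp add: bimonom_def power_mult_distrib power_mult)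

lemma bimonom_prod: "(\<Prod>n\<in>S. bimonom t z (e n)) = bimonom t z (\<Sum>n\<in>S. fst (e n), \<Sum>n\<in>S. snd (e n))"
  by (simp add: bimonom_def prod.distrib power_sum)

lemma bimonom_has_field_derivative:
  "((\<lambda>z. bimonom t z p) has_field_derivative tpi * (of_int (int (fst p) - int (snd p)) * bimonom t w p)) (at w)"
proof -
  define m :: complex where "m = of_nat (fst p) - of_nat (snd p)"
  have "((\<lambda>z. ee (of_nat (snd p) * t) * ee (m * z)) has_field_derivative
      ee (of_nat (snd p) * t) * (tpi * m * ee (m * w))) (at w)"
    by (rule DERIV_cmult[OF ee_has_field_derivative])
  moreover have "bimonom t z p = ee (of_nat (snd p) * t) * ee (m * z)" for z
    by (simp only: bimonom_eq_ee ee_add m_def)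
  moreover have "of_int (int (fst p) - int (snd p)) = m" by (simp add: m_def)
  ultimately show ?thesis by (simp only: mult_ac)
qed

lemma norm_bimonom_le:
  assumes "0 < Im z" "Im z < Im t"
  obtains \<rho> where "0 \<le> \<rho>" "\<rho> < 1" "\<And>p. norm (bimonom t z p) \<le> \<rho> ^ (fst p + snd p)"
proof
  define \<rho> where "\<rho> = max (norm (ee z)) (norm (ee (t - z)))"
  show \<rho>: "0 \<le> \<rho>" "\<rho> < 1" using assms by (auto simp: \<rho>_def norm_ee le_max_iff_disj)
  show "norm (bimonom t z p) \<le> \<rho> ^ (fst p + snd p)" for p
    unfolding bimonom_def norm_mult norm_power power_add using \<rho>(1)
    by (intro mult_mono power_mono) (auto simp: \<rho>_def)
qed

lemma norm_bimonom_le_geometric: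
  assumes "0 < Im z" "Im z < Im t" and e: "\<And>n. Suc n \<le> fst (e n) + snd (e n)"
  obtains \<rho> where "0 \<le> \<rho>" "\<rho> < 1" "\<And>n. norm (bimonom t z (e n)) \<le> \<rho> ^ Suc n"
proof -
  obtain \<rho> where \<rho>: "0 \<le> \<rho>" "\<rho> < 1" "\<And>p. norm (bimonom t z p) \<le> \<rho> ^ (fst p + snd p)"
    using norm_bimonom_le assms(1,2) by blast
  have "norm (bimonom t z (e n)) \<le> \<rho> ^ Suc n" for n
    using \<rho>(3)[of "e n"] power_decreasing[OF e[of n], of \<rho>] \<rho>(1,2) by linarith
  with \<rho> that show ?thesis by blast
qed

definition has_int_expansion :: "(nat \<times> nat \<Rightarrow> int) \<Rightarrow> (complex \<Rightarrow> complex \<Rightarrow> complex) \<Rightarrow> bool" where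
  "has_int_expansion a G \<longleftrightarrow> (\<forall>t z. 0 < Im z \<longrightarrow> Im z < Im t \<longrightarrow>
     ((\<lambda>p. of_int (a p) * bimonom t z p) has_sum G t z) UNIV)"

definition int_expansion :: "(complex \<Rightarrow> complex \<Rightarrow> complex) \<Rightarrow> bool" where
  "int_expansion G \<longleftrightarrow> (\<exists>a. has_int_expansion a G)"

lemma has_int_expansionD:
  "has_int_expansion a G \<Longrightarrow> 0 < Im z \<Longrightarrow> Im z < Im t \<Longrightarrow>
     ((\<lambda>p. of_int (a p) * bimonom t z p) has_sum G t z) UNIV"
  unfolding has_int_expansion_def by blast

lemma int_expansionI:
  fixes c :: "'x \<Rightarrow> int" and e :: "'x \<Rightarrow> nat \<times> nat"
  assumes fin: "\<And>p. finite {x \<in> X. e x = p}"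
    and sum: "\<And>t z. 0 < Im z \<Longrightarrow> Im z < Im t \<Longrightarrow> ((\<lambda>x. of_int (c x) * bimonom t z (e x)) has_sum G t z) X"
  shows "int_expansion G"
  unfolding int_expansion_def has_int_expansion_def
proof (intro exI[of _ "\<lambda>p. \<Sum>x\<in>{x \<in> X. e x = p}. c x"] allI impI)
  fix t z :: complex assume strip: "0 < Im z" "Im z < Im t"
  have "(\<Sum>x\<in>{x \<in> X. e x = p}. of_int (c x) * bimonom t z (e x)) =
      of_int (\<Sum>x\<in>{x \<in> X. e x = p}. c x) * bimonom t z p" for p
    by (simp add: sum_distrib_right)
  with has_sum_group[OF sum[OF strip] fin]
  show "((\<lambda>p. of_int (\<Sum>x\<in>{x \<in> X. e x = p}. c x) * bimonom t z p) has_sum G t z) UNIV" by simp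
qed

lemma int_expansion_cong:
  "int_expansion G \<Longrightarrow> (\<And>t z. 0 < Im z \<Longrightarrow> Im z < Im t \<Longrightarrow> G t z = H t z) \<Longrightarrow> int_expansion H"
  unfolding int_expansion_def has_int_expansion_def by auto

lemma int_expansion_add:
  assumes "int_expansion G" "int_expansion H" shows "int_expansion (\<lambda>t z. G t z + H t z)"
proof -
  obtain a b where "has_int_expansion a G" "has_int_expansion b H"
    using assms by (auto simp: int_expansion_def)
  hence "has_int_expansion (\<lambda>p. a p + b p) (\<lambda>t z. G t z + H t z)"
    unfolding has_int_expansion_def by (auto simp: distrib_right intro: has_sum_add)
  thus ?thesis by (auto simp: int_expansion_def)
qed

lemma int_expansion_const: "int_expansion (\<lambda>t z. of_int k)"
  by (rule int_expansionI[of "{()}" "\<lambda>_. (0,0)" "\<lambda>_. k"]) (auto simp: bimonom_def intro!: has_sum_finiteI)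

lemma int_expansion_mult:
  assumes "int_expansion G" "int_expansion H" shows "int_expansion (\<lambda>t z. G t z * H t z)"
proof -
  obtain a b where ab: "has_int_expansion a G" "has_int_expansion b H"
    using assms by (auto simp: int_expansion_def)
  define e :: "(nat \<times> nat) \<times> (nat \<times> nat) \<Rightarrow> nat \<times> nat" where
    "e = (\<lambda>(p, p'). (fst p + fst p', snd p + snd p'))"
  show ?thesis
  proof (rule int_expansionI[of "UNIV \<times> UNIV" e "\<lambda>(p, p'). a p * b p'"])
    fix p :: "nat \<times> nat"
    have "{x \<in> UNIV \<times> UNIV. e x = p} \<subseteq> ({..fst p} \<times> {..snd p}) \<times> ({..fst p} \<times> {..snd p})"
      by (auto simp: e_def)
    thus "finite {x \<in> UNIV \<times> UNIV. e x = p}" by (rule finite_subset) auto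
  next
    fix t z :: complex assume "0 < Im z" "Im z < Im t"
    from has_sum_times[OF has_int_expansionD[OF ab(1) this] has_int_expansionD[OF ab(2) this]]
    show "((\<lambda>x. of_int (case x of (p, p') \<Rightarrow> a p * b p') * bimonom t z (e x)) has_sum G t z * H t z) (UNIV \<times> UNIV)"
      by (simp add: case_prod_unfold e_def mult_ac flip: bimonom_mult)
  qed
qed

lemma int_expansion_cmult: "int_expansion G \<Longrightarrow> int_expansion (\<lambda>t z. of_int k * G t z)"
  by (rule int_expansion_mult[OF int_expansion_const])

lemma int_expansion_diff: "int_expansion G \<Longrightarrow> int_expansion H \<Longrightarrow> int_expansion (\<lambda>t z. G t z - H t z)"
  using int_expansion_add[of G "\<lambda>t z. of_int (-1) * H t z"] int_expansion_cmult[of H "-1"] by simp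

lemma int_expansion_power: "int_expansion G \<Longrightarrow> int_expansion (\<lambda>t z. G t z ^ n)"
proof (induction n)
  case 0 thus ?case using int_expansion_const[of 1] by simp
next
  case (Suc n) thus ?case using int_expansion_mult[of G "\<lambda>t z. G t z ^ n"] by simp
qed

definition zderiv :: "(complex \<Rightarrow> complex \<Rightarrow> complex) \<Rightarrow> complex \<Rightarrow> complex \<Rightarrow> complex" where
  "zderiv G t z = deriv (G t) z / tpi"

lemma has_int_expansion_majorant:
  assumes a: "has_int_expansion a G" and z: "0 < Im z" "Im z < Im t"
  obtains r M where "r > 0" "M summable_on UNIV" "\<And>w. w \<in> cball z r \<Longrightarrow> 0 < Im w \<and> Im w < Im t"
    "\<And>p w. w \<in> cball z r \<Longrightarrow> norm (of_int (a p) * bimonom t w p) \<le> M p"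
proof -
  define r where "r = min (Im z) (Im t - Im z) / 2"
  have r: "r > 0" "r < Im z" "r < Im t - Im z" using z by (auto simp: r_def min_def)
  have Im_le: "Im z - r \<le> Im w" "Im w \<le> Im z + r" if "w \<in> cball z r" for w
    using that abs_Im_le_cmod[of "z - w"] by (auto simp: dist_norm)
  define s z' where "s = \<i> * of_real (Im t - 2 * r)" and "z' = \<i> * of_real (Im z - r)"
  have "(\<lambda>p. of_int (a p) * bimonom s z' p) summable_on UNIV"
    using has_int_expansionD[OF a, of z' s] r by (intro has_sum_imp_summable) (auto simp: s_def z'_def)
  hence "(\<lambda>p. norm (of_int (a p) * bimonom s z' p)) summable_on UNIV"
    by (simp add: summable_on_iff_abs_summable_on_complex)
  moreover have "norm (of_int (a p) * bimonom t w p) \<le> norm (of_int (a p) * bimonom s z' p)"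
    if "w \<in> cball z r" for p w
  proof -
    have "norm (ee w) \<le> norm (ee z')" "norm (ee (t - w)) \<le> norm (ee (s - z'))"
      using Im_le[OF that] by (auto simp: norm_ee s_def z'_def)
    thus ?thesis unfolding bimonom_def norm_mult norm_power
      by (intro mult_left_mono mult_mono power_mono) auto
  qed
  moreover have "0 < Im w \<and> Im w < Im t" if "w \<in> cball z r" for w using Im_le[OF that] r by auto
  ultimately show ?thesis using that[OF r(1)] by blast
qed

lemma has_int_expansion_zderiv:
  assumes a: "has_int_expansion a G"
  shows "has_int_expansion (\<lambda>p. a p * (int (fst p) - int (snd p))) (zderiv G)"
  unfolding has_int_expansion_def
proof (intro allI impI)
  fix t z :: complex assume "0 < Im z" "Im z < Im t"
  from has_int_expansion_majorant[OF a this] obtain r M where r: "r > 0" and M: "M summable_on UNIV"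
    and strip: "\<And>w. w \<in> cball z r \<Longrightarrow> 0 < Im w \<and> Im w < Im t"
    and term_le: "\<And>p w. w \<in> cball z r \<Longrightarrow> norm (of_int (a p) * bimonom t w p) \<le> M p" by blast
  define D where "D = (\<lambda>p w. tpi * (of_int (a p * (int (fst p) - int (snd p))) * bimonom t w p))"
  have "((\<lambda>z. of_int (a p) * bimonom t z p) has_field_derivative D p w) (at w)" for p w
    using DERIV_cmult[OF bimonom_has_field_derivative, of "of_int (a p)" t p w] by (simp add: D_def mult_ac)
  then obtain g' where g': "((\<lambda>z. \<Sum>\<^sub>\<infinity>p. of_int (a p) * bimonom t z p) has_field_derivative g') (at z)"
    "((\<lambda>p. D p z) has_sum g') UNIV"
    by (rule infsum_has_field_derivative[OF r _ M term_le]) auto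
  have "(G t has_field_derivative g') (at z)"
  proof (rule has_field_derivative_transform_within_open[OF g'(1), of "ball z r"])
    show "(\<Sum>\<^sub>\<infinity>p. of_int (a p) * bimonom t w p) = G t w" if "w \<in> ball z r" for w
      using has_int_expansionD[OF a, of w t] strip[of w] that by (auto intro: infsumI)
  qed (use r in auto)
  hence "zderiv G t z = g' / tpi" by (simp add: zderiv_def DERIV_imp_deriv)
  with has_sum_cmult_right[OF g'(2), of "1 / tpi"]
  show "((\<lambda>p. of_int (a p * (int (fst p) - int (snd p))) * bimonom t z p) has_sum zderiv G t z) UNIV"
    by (simp add: D_def)
qed

lemma int_expansion_zderiv: "int_expansion G \<Longrightarrow> int_expansion (zderiv G)"
  using has_int_expansion_zderiv by (auto simp: int_expansion_def)

lemma int_expansion_half_zderiv_diff: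
  assumes "int_expansion G"
  shows "int_expansion (\<lambda>t z. (zderiv G t z - zderiv (zderiv G) t z) / 2)"
proof -
  from assms obtain a where a: "has_int_expansion a G" by (auto simp: int_expansion_def)
  define m where "m = (\<lambda>p :: nat \<times> nat. int (fst p) - int (snd p))"
  have coeff: "complex_of_int (a p * ((m p - m p * m p) div 2)) =
      (of_int (a p * m p) - of_int (a p * m p * m p)) / 2" for p
  proof -
    have "even (m p - m p * m p)" by simp
    then obtain d where "m p - m p * m p = 2 * d" by (elim evenE)
    moreover have "a p * m p - a p * m p * m p = a p * (m p - m p * m p)" by (simp add: algebra_simps)
    ultimately show ?thesis by (simp only: flip: of_int_diff) simp
  qed
  have "has_int_expansion (\<lambda>p. a p * ((m p - m p * m p) div 2)) (\<lambda>t z. (zderiv G t z - zderiv (zderiv G) t z) / 2)"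
    unfolding has_int_expansion_def coeff
  proof (intro allI impI)
    fix t z :: complex assume z: "0 < Im z" "Im z < Im t"
    note D = has_int_expansion_zderiv[OF a]
    from has_sum_add[OF has_int_expansionD[OF D z] has_sum_uminusI[OF has_int_expansionD[OF has_int_expansion_zderiv[OF D] z]]]
    have "((\<lambda>p. (of_int (a p * m p) - of_int (a p * m p * m p)) * bimonom t z p) has_sum
        zderiv G t z - zderiv (zderiv G) t z) UNIV"
      by (simp add: m_def left_diff_distrib)
    from has_sum_divide_const[OF this, of 2]
    show "((\<lambda>p. (of_int (a p * m p) - of_int (a p * m p * m p)) / 2 * bimonom t z p) has_sum
        (zderiv G t z - zderiv (zderiv G) t z) / 2) UNIV" by simp
  qed
  thus ?thesis by (auto simp: int_expansion_def)
qed

section \<open>Lambert series\<close>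

definition koebe :: "complex \<Rightarrow> complex" where "koebe X = X / (1 - X)^2"

lemma koebe_inverse: "koebe (inverse X) = koebe X"
proof (cases "X = 0 \<or> X = 1")
  case False
  thus ?thesis by (simp add: koebe_def field_simps power2_eq_square)
qed (auto simp: koebe_def)

lemma koebe_of_real: "koebe (of_real t) = of_real (t / (1 - t)^2)"
  by (simp add: koebe_def)

lemma has_sum_koebe:
  assumes "norm X < 1"
  shows "((\<lambda>d. of_nat d * X ^ d) has_sum koebe X) {1..}"
proof -
  have "(\<lambda>n. of_nat (Suc n) * X ^ n) sums (1 / (1 - X)^2)" using geometric_deriv_sums[OF assms] by simp
  hence sums: "(\<lambda>n. X * (of_nat (Suc n) * X ^ n)) sums (X * (1 / (1 - X)^2))" by (rule sums_mult)
  have "(\<lambda>n. of_nat (Suc n) * (norm X) ^ n) sums (1 / (1 - norm X)^2)"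
    using geometric_deriv_sums[of "norm X"] assms by simp
  from sums_summable[OF sums_mult[OF this, of "norm X"]]
  have "summable (\<lambda>n. norm (X * (of_nat (Suc n) * X ^ n)))"
    by (simp add: norm_mult norm_power del: of_nat_Suc)
  from norm_summable_imp_has_sum[OF this sums]
  have "((\<lambda>n. of_nat (Suc n) * X ^ Suc n) has_sum koebe X) UNIV" by (simp add: koebe_def mult_ac)
  thus ?thesis
    by (subst has_sum_reindex_bij_witness[where i="\<lambda>n. Suc n" and j="\<lambda>n. n - 1" and T=UNIV])
       (auto simp: Suc_le_eq power_eq_if)
qed

lemma norm_koebe_le:
  assumes "norm X \<le> \<rho>" "\<rho> < 1"
  shows "norm (koebe X) \<le> norm X / (1 - \<rho>)^2"
proof -
  have "1 - \<rho> \<le> norm (1 - X)" using assms norm_triangle_ineq2[of 1 X] by simp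
  hence "(1 - \<rho>)^2 \<le> norm (1 - X) ^ 2" using assms by (intro power_mono) auto
  moreover have "(1 - \<rho>)^2 > 0" using assms by simp
  ultimately show ?thesis by (simp add: koebe_def norm_divide norm_power frac_le)
qed

lemma koebe_summable:
  assumes X: "\<And>n. norm (X n) \<le> \<rho>" "\<rho> < 1" "(\<lambda>n. norm (X n)) summable_on A"
  shows "(\<lambda>n. koebe (X n)) summable_on A"
proof -
  have "(\<lambda>n. norm (X n) / (1 - \<rho>)^2) summable_on A"
    using summable_on_cmult_left[OF X(3), of "1 / (1 - \<rho>)^2"] by simp
  hence "(\<lambda>n. norm (koebe (X n))) summable_on A"
    by (rule summable_on_comparison_test) (use norm_koebe_le X in auto)
  thus ?thesis by (simp add: summable_on_iff_abs_summable_on_complex)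
qed

lemma has_sum_lambert:
  fixes X :: "'i \<Rightarrow> complex"
  assumes X: "\<And>n. norm (X n) \<le> \<rho>" "\<rho> < 1" "(\<lambda>n. norm (X n)) summable_on A"
  shows "((\<lambda>(n, d). of_nat d * X n ^ d) has_sum (\<Sum>\<^sub>\<infinity>n\<in>A. koebe (X n))) (A \<times> {1..})"
proof (rule has_sum_SigmaI)
  have norm_X: "norm (X n) < 1" for n using X(1)[of n] X(2) by linarith
  show "((\<lambda>d. case (n, d) of (n, d) \<Rightarrow> of_nat d * X n ^ d) has_sum koebe (X n)) {1..}" for n
    using has_sum_koebe[OF norm_X] by simp
  show "((\<lambda>n. koebe (X n)) has_sum (\<Sum>\<^sub>\<infinity>n\<in>A. koebe (X n))) A" using koebe_summable[OF X] by simp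
  have "((\<lambda>d. norm (of_nat d * X n ^ d)) has_sum Re (koebe (of_real (norm (X n))))) {1..}" for n
    using has_sum_Re[OF has_sum_koebe[of "of_real (norm (X n))"]] norm_X
    by (simp add: norm_mult norm_power flip: of_real_power)
  moreover have "(\<lambda>n. koebe (of_real (norm (X n)))) summable_on A"
    by (rule koebe_summable[of _ \<rho>]) (use X in auto)
  hence "(\<lambda>n. Re (koebe (of_real (norm (X n))))) summable_on A" by (rule summable_on_Re)
  ultimately have "(\<lambda>(n, d). norm (of_nat d * X n ^ d)) summable_on (A \<times> {1..})"
    by (intro summable_on_SigmaI[where g="\<lambda>n. Re (koebe (of_real (norm (X n))))"]) (auto simp: koebe_of_real)
  thus "(\<lambda>(n, d). of_nat d * X n ^ d) summable_on (A \<times> {1..})"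
    by (simp add: summable_on_iff_abs_summable_on_complex case_prod_unfold)
qed

lemma summable_geometric_norm: "0 \<le> \<rho> \<Longrightarrow> \<rho> < 1 \<Longrightarrow> (\<lambda>n::nat. C * (\<rho>::real) ^ n) summable_on UNIV"
  by (intro summable_on_cmult_right norm_summable_imp_summable_on) (auto simp: summable_geometric)

lemma int_expansion_lambert:
  fixes e :: "nat \<Rightarrow> nat \<times> nat"
  assumes e: "\<And>n. Suc n \<le> fst (e n) + snd (e n)"
  shows "int_expansion (\<lambda>t z. \<Sum>\<^sub>\<infinity>n. koebe (bimonom t z (e n)))"
proof (rule int_expansionI[of "UNIV \<times> {1..}" "\<lambda>(n, d). (fst (e n) * d, snd (e n) * d)" "\<lambda>(n, d). int d"])
  fix p :: "nat \<times> nat"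
  have "n \<le> fst p + snd p \<and> d \<le> fst p + snd p" if "d \<ge> 1" "(fst (e n) * d, snd (e n) * d) = p" for n d
  proof -
    have "Suc n * d \<le> (fst (e n) + snd (e n)) * d" using e by (intro mult_right_mono) auto
    also have "\<dots> = fst p + snd p" using that by (auto simp: algebra_simps)
    moreover have "n \<le> Suc n * d" "d \<le> Suc n * d" using that(1) by (cases d; simp)+
    ultimately show ?thesis by linarith
  qed
  hence "{x \<in> UNIV \<times> {1..}. (case x of (n, d) \<Rightarrow> (fst (e n) * d, snd (e n) * d)) = p} \<subseteq>
      {..fst p + snd p} \<times> {..fst p + snd p}" by auto
  thus "finite {x \<in> UNIV \<times> {1..}. (case x of (n, d) \<Rightarrow> (fst (e n) * d, snd (e n) * d)) = p}"
    by (rule finite_subset) auto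
next
  fix t z :: complex assume "0 < Im z" "Im z < Im t"
  then obtain \<rho> where \<rho>: "0 \<le> \<rho>" "\<rho> < 1" "\<And>n. norm (bimonom t z (e n)) \<le> \<rho> ^ Suc n"
    using norm_bimonom_le_geometric e by metis
  have "norm (bimonom t z (e n)) \<le> \<rho>" for n
    using \<rho>(3)[of n] power_decreasing[of 1 "Suc n" \<rho>] \<rho>(1,2) by simp
  moreover have "(\<lambda>n. norm (bimonom t z (e n))) summable_on UNIV"
    by (rule summable_on_comparison_test[OF summable_geometric_norm[OF \<rho>(1,2), of \<rho>]]) (use \<rho>(3) in auto)
  ultimately have "((\<lambda>(n, d). of_nat d * bimonom t z (e n) ^ d) has_sum (\<Sum>\<^sub>\<infinity>n. koebe (bimonom t z (e n)))) (UNIV \<times> {1..})"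
    by (rule has_sum_lambert[OF _ \<rho>(2)])
  thus "((\<lambda>x. of_int (case x of (n, d) \<Rightarrow> int d) * bimonom t z (case x of (n, d) \<Rightarrow> (fst (e n) * d, snd (e n) * d))) has_sum
      (\<Sum>\<^sub>\<infinity>n. koebe (bimonom t z (e n)))) (UNIV \<times> {1..})"
    by (simp add: case_prod_unfold bimonom_power)
qed

section \<open>Lattices\<close>

definition lat :: "complex \<Rightarrow> complex set" where
  "lat t = {of_int a * t + of_int b | a b. True}"

lemma latI: "of_int a * t + of_int b \<in> lat t" by (auto simp: lat_def)

lemma lat_add:
  assumes "x \<in> lat t" "y \<in> lat t" shows "x + y \<in> lat t"
proof -
  obtain a b c d where "x = of_int a * t + of_int b" "y = of_int c * t + of_int d"
    using assms by (auto simp: lat_def)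
  hence "x + y = of_int (a + c) * t + of_int (b + d)" by (simp add: algebra_simps)
  thus ?thesis using latI by metis
qed

lemma lat_minus:
  assumes "x \<in> lat t" shows "- x \<in> lat t"
proof -
  obtain a b where "x = of_int a * t + of_int b" using assms by (auto simp: lat_def)
  hence "- x = of_int (- a) * t + of_int (- b)" by (simp add: algebra_simps)
  thus ?thesis using latI by metis
qed

lemma lat_1 [simp]: "1 \<in> lat t" using latI[of 0 t 1] by simp
lemma lat_tau [simp]: "t \<in> lat t" using latI[of 1 t 0] by simp

lemma lat_add_iff: "w \<in> lat t \<Longrightarrow> z + w \<in> lat t \<longleftrightarrow> z \<in> lat t"
  using lat_add[of z t w] lat_add[of "z + w" t "- w"] lat_minus[of w t] by auto

lemma lat_minus_iff [simp]: "- z \<in> lat t \<longleftrightarrow> z \<in> lat t"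
  using lat_minus[of z] lat_minus[of "-z"] by auto

lemma lat_add_1 [simp]: "z + 1 \<in> lat t \<longleftrightarrow> z \<in> lat t" by (rule lat_add_iff) simp
lemma lat_add_tau [simp]: "z + t \<in> lat t \<longleftrightarrow> z \<in> lat t" by (rule lat_add_iff) simp

lemma lat_T: "lat (t + 1) = lat t"
proof -
  have lat_subset: "lat t \<subseteq> lat (t + of_int k)" for t k
  proof
    fix x assume "x \<in> lat t"
    then obtain a b where "x = of_int a * t + of_int b" by (auto simp: lat_def)
    hence "x = of_int a * (t + of_int k) + of_int (b - a * k)" by (simp add: algebra_simps)
    thus "x \<in> lat (t + of_int k)" using latI by metis
  qed
  show ?thesis using lat_subset[of t 1] lat_subset[of "t + 1" "- 1"] by auto
qed

lemma lat_S:
  assumes "t \<in> uhp" shows "z / t \<in> lat (- 1 / t) \<longleftrightarrow> z \<in> lat t"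
proof
  have t: "t \<noteq> 0" using uhp_nonzero[OF assms] .
  show "z / t \<in> lat (- 1 / t)" if z: "z \<in> lat t"
  proof -
    obtain a b where "z = of_int a * t + of_int b" using z by (auto simp: lat_def)
    hence "z / t = of_int (- b) * (- 1 / t) + of_int a" using t by (simp add: field_simps)
    thus ?thesis using latI by metis
  qed
  show "z \<in> lat t" if z: "z / t \<in> lat (- 1 / t)"
  proof -
    obtain a b where "z / t = of_int a * (- 1 / t) + of_int b" using z by (auto simp: lat_def)
    hence "z = of_int b * t + of_int (- a)" using t by (simp add: field_simps)
    thus ?thesis using latI by metis
  qed
qed

lemma lat_small:
  assumes "t \<in> uhp" "z \<in> lat t" "norm z < min 1 (Im t)" shows "z = 0"
proof -
  obtain a b where z: "z = of_int a * t + of_int b" using assms by (auto simp: lat_def)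
  have "\<bar>of_int a * Im t\<bar> < Im t" using abs_Im_le_cmod[of z] assms(3) by (simp add: z)
  hence "\<bar>of_int a\<bar> < (1::real)" using uhpD[OF assms(1)] by (simp add: abs_mult)
  hence "a = 0" by linarith
  moreover from this have "\<bar>of_int b\<bar> < (1::real)" using assms(3) by (simp add: z)
  hence "b = 0" by linarith
  ultimately show ?thesis by (simp add: z)
qed

lemma discrete_imp_sparse_in:
  fixes S :: "'a::metric_space set"
  assumes "0 < \<epsilon>" "\<And>x y. x \<in> S \<Longrightarrow> y \<in> S \<Longrightarrow> dist y x < \<epsilon> \<Longrightarrow> y = x"
  shows "S sparse_in A"
  unfolding sparse_in_def using discrete_imp_not_islimpt[OF assms] by blast

lemma lat_sparse: "t \<in> uhp \<Longrightarrow> lat t sparse_in A"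
proof (rule discrete_imp_sparse_in[of "min 1 (Im t)"])
  assume t: "t \<in> uhp"
  show "0 < min 1 (Im t)" using uhpD[OF t] by simp
  show "y = x" if "x \<in> lat t" "y \<in> lat t" "dist y x < min 1 (Im t)" for x y
    using lat_small[OF t, of "y - x"] lat_add[OF that(2) lat_minus[OF that(1)]] that(3)
    by (simp add: dist_norm)
qed

lemma open_lat: "t \<in> uhp \<Longrightarrow> open (- lat t)"
  using sparse_in_UNIV_imp_closed[OF lat_sparse] by (simp add: open_Compl)

lemma eventually_not_lat: "t \<in> uhp \<Longrightarrow> \<forall>\<^sub>F w in at z. w \<notin> lat t"
  using lat_sparse[of t UNIV] by (simp add: sparse_in_eventually_iff)

lemma lat_eq_iff: "z \<in> lat t \<longleftrightarrow> (\<exists>n::int. ee (z + of_int n * t) = 1)"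
proof
  assume "z \<in> lat t"
  then obtain a b where "z = of_int a * t + of_int b" by (auto simp: lat_def)
  hence "ee (z + of_int (- a) * t) = 1" by simp
  thus "\<exists>n::int. ee (z + of_int n * t) = 1" ..
next
  assume "\<exists>n::int. ee (z + of_int n * t) = 1"
  then obtain n b :: int where "z + of_int n * t = of_int b" by (auto simp: ee_eq_1_iff elim: Ints_cases)
  hence "z = of_int (- n) * t + of_int b" by (simp add: algebra_simps)
  thus "z \<in> lat t" using latI by metis
qed

lemma ee_translate_neq_1: "z \<notin> lat t \<Longrightarrow> ee (z + of_int n * t) \<noteq> 1"
  using lat_eq_iff by blast

lemma lat_induct:
  assumes "w \<in> lat t" "P 0" "\<And>w. w \<in> lat t \<Longrightarrow> P w \<longleftrightarrow> P (w + 1)" "\<And>w. w \<in> lat t \<Longrightarrow> P w \<longleftrightarrow> P (w + t)"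
  shows "P w"
proof -
  obtain a b where w: "w = of_int a * t + of_int b" using assms(1) by (auto simp: lat_def)
  have P_int: "P (of_int b)" for b
  proof (induction b rule: int_induct[of _ 0])
    case (step1 i) thus ?case using assms(3)[of "of_int i"] latI[of 0 t i] by simp
  next
    case (step2 i) thus ?case using assms(3)[of "of_int (i - 1)"] latI[of 0 t "i - 1"] by simp
  qed (use assms(2) in simp)
  have "P (of_int a * t + of_int b)"
  proof (induction a rule: int_induct[of _ 0])
    case (step1 i) thus ?case using assms(4)[OF latI[of i t b]] by (simp add: algebra_simps)
  next
    case (step2 i) thus ?case using assms(4)[OF latI[of "i - 1" t b]] by (simp add: algebra_simps)
  qed (use P_int in simp)
  thus ?thesis by (simp add: w)
qed

lemma lat_reduce:
  assumes t: "t \<in> uhp"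
  obtains w where "w \<in> lat t" "norm (z - w) \<le> norm t + 1"
proof
  define s where "s = Im z / Im t"
  define r where "r = Re z - s * Re t"
  define w where "w = of_int \<lfloor>s\<rfloor> * t + of_int \<lfloor>r\<rfloor>"
  show "w \<in> lat t" unfolding w_def by (rule latI)
  have "z = of_real s * t + of_real r" using uhpD[OF t] by (simp add: complex_eq_iff s_def r_def)
  hence "z - w = of_real (frac s) * t + of_real (frac r)" by (simp add: w_def frac_def algebra_simps)
  also have "norm \<dots> \<le> 1 * norm t + 1"
    unfolding norm_mult norm_of_real
    by (rule norm_triangle_le) (auto intro!: add_mono mult_left_le_one_le simp: norm_mult frac_lt_1 less_imp_le)
  finally show "norm (z - w) \<le> norm t + 1" by simp
qed

lemma isCont_eq_eventually:
  fixes f g :: "complex \<Rightarrow> complex"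
  assumes "isCont f z" "isCont g z" and eq: "\<forall>\<^sub>F w in at z. f w = g w"
  shows "f z = g z"
proof (rule tendsto_unique[OF trivial_limit_at])
  show "(f \<longlongrightarrow> f z) (at z)" using assms by (simp add: isCont_def)
  have "(g \<longlongrightarrow> g z) (at z)" using assms by (simp add: isCont_def)
  thus "(f \<longlongrightarrow> g z) (at z)" by (rule Lim_transform_eventually) (use eq in \<open>simp add: eq_commute\<close>)
qed

lemma entire_isCont: "f holomorphic_on UNIV \<Longrightarrow> isCont f z"
  using holomorphic_on_imp_continuous_on[of f UNIV] by (simp add: continuous_on_eq_continuous_at)

lemma remove_sings_entire:
  fixes \<Lambda> :: "complex set"
  assumes sparse: "\<Lambda> sparse_in UNIV" and hol: "f holomorphic_on (- \<Lambda>)"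
    and lim: "\<And>w. w \<in> \<Lambda> \<Longrightarrow> ((\<lambda>z. (z - w) * f z) \<longlongrightarrow> 0) (at w)"
  shows "remove_sings f holomorphic_on UNIV" "z \<notin> \<Lambda> \<Longrightarrow> remove_sings f z = f z"
proof -
  have "open (- \<Lambda>)" using sparse_in_UNIV_imp_closed[OF sparse] by (simp add: open_Compl)
  hence analytic: "f analytic_on {w}" if "w \<notin> \<Lambda>" for w using hol that by (auto simp: analytic_at)
  show "z \<notin> \<Lambda> \<Longrightarrow> remove_sings f z = f z" by (intro remove_sings_at_analytic analytic)
  have "remove_sings f analytic_on {w}" for w
  proof (cases "w \<in> \<Lambda>")
    case False thus ?thesis by (intro remove_sings_analytic_on analytic)
  next
    case True
    obtain B where B: "open B" "w \<in> B" "\<And>z. z \<in> B \<Longrightarrow> z \<noteq> w \<Longrightarrow> z \<notin> \<Lambda>"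
      using sparse_in_not_in[OF sparse UNIV_I] by metis
    have f: "f holomorphic_on B - {w}" by (rule holomorphic_on_subset[OF hol]) (use B(3) in auto)
    obtain g where g: "g holomorphic_on B" "\<And>z. z \<in> B - {w} \<Longrightarrow> g z = f z"
      using holomorphic_on_extend_lim[OF f] lim[OF True] B by (auto simp: interior_open)
    have "(g \<longlongrightarrow> g w) (at w)"
      using holomorphic_on_imp_continuous_on[OF g(1)] B
      by (simp add: continuous_on_eq_continuous_at isCont_def)
    hence "(f \<longlongrightarrow> g w) (at w)"
      by (rule Lim_transform_within_open[OF _ B(1,2)]) (use g(2) in auto)
    thus ?thesis by (rule remove_sings_analytic_at[OF isolated_singularity_at_holomorphic[OF f B(1,2)]])
  qed
  thus "remove_sings f holomorphic_on UNIV"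
    by (intro analytic_imp_holomorphic) (use analytic_on_analytic_at in blast)
qed

lemma lattice_limit_propagates:
  assumes t: "t \<in> uhp"
    and f1: "\<And>z. z \<notin> lat t \<Longrightarrow> f (z + 1) = f z"
    and ft: "\<And>z. z \<notin> lat t \<Longrightarrow> f (z + t) = m z * f z"
    and m: "\<And>z. isCont m z" "\<And>z. m z \<noteq> 0"
    and lim: "((\<lambda>z. z * f z) \<longlongrightarrow> 0) (at 0)" and w: "w \<in> lat t"
  shows "((\<lambda>z. (z - w) * f z) \<longlongrightarrow> 0) (at w)"
proof (rule lat_induct[OF w])
  show "((\<lambda>z. (z - 0) * f z) \<longlongrightarrow> 0) (at 0)" using lim by simp
  fix w
  note not_lat = eventually_not_lat[OF t, of w]
  have shift: "((\<lambda>z. (z - (w + c)) * f z) \<longlongrightarrow> 0) (at (w + c)) \<longleftrightarrow> ((\<lambda>z. (z - w) * f (z + c)) \<longlongrightarrow> 0) (at w)" for c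
    using filterlim_shift_iff[of "\<lambda>z. (z - (w + c)) * f z" c "nhds 0" "w + c"]
    by (simp add: o_def add.commute[of c])
  show "((\<lambda>z. (z - w) * f z) \<longlongrightarrow> 0) (at w) \<longleftrightarrow> ((\<lambda>z. (z - (w + 1)) * f z) \<longlongrightarrow> 0) (at (w + 1))"
    unfolding shift by (intro tendsto_cong eventually_mono[OF not_lat]) (simp add: f1)
  have "((\<lambda>z. (z - w) * f (z + t)) \<longlongrightarrow> 0) (at w) \<longleftrightarrow> ((\<lambda>z. m z * ((z - w) * f z)) \<longlongrightarrow> 0) (at w)"
    by (intro tendsto_cong eventually_mono[OF not_lat]) (simp add: ft)
  also have "\<dots> \<longleftrightarrow> ((\<lambda>z. (z - w) * f z) \<longlongrightarrow> 0) (at w)"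
  proof
    have m_lim: "(m \<longlongrightarrow> m w) (at w)" using m(1)[of w] by (simp add: isCont_def)
    show "((\<lambda>z. (z - w) * f z) \<longlongrightarrow> 0) (at w)" if "((\<lambda>z. m z * ((z - w) * f z)) \<longlongrightarrow> 0) (at w)"
      using tendsto_divide[OF that m_lim m(2)] m(2) by simp
    show "((\<lambda>z. m z * ((z - w) * f z)) \<longlongrightarrow> 0) (at w)" if "((\<lambda>z. (z - w) * f z) \<longlongrightarrow> 0) (at w)"
      using tendsto_mult[OF m_lim that] by simp
  qed
  finally show "((\<lambda>z. (z - w) * f z) \<longlongrightarrow> 0) (at w) \<longleftrightarrow> ((\<lambda>z. (z - (w + t)) * f z) \<longlongrightarrow> 0) (at (w + t))"
    unfolding shift by simp
qed

lemma lattice_extension: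
  assumes t: "t \<in> uhp" and hol: "f holomorphic_on (- lat t)"
    and f1: "\<And>z. z \<notin> lat t \<Longrightarrow> f (z + 1) = f z"
    and ft: "\<And>z. z \<notin> lat t \<Longrightarrow> f (z + t) = m z * f z"
    and m: "\<And>z. isCont m z" "\<And>z. m z \<noteq> 0"
    and lim: "((\<lambda>z. z * f z) \<longlongrightarrow> 0) (at 0)"
  defines "F \<equiv> remove_sings f"
  shows "F holomorphic_on UNIV" "\<And>z. z \<notin> lat t \<Longrightarrow> F z = f z"
    "\<And>z. F (z + 1) = F z" "\<And>z. F (z + t) = m z * F z"
proof -
  note F = remove_sings_entire[OF lat_sparse[OF t] hol lattice_limit_propagates[OF t f1 ft m lim], folded F_def]
  show "F holomorphic_on UNIV" and F_eq: "\<And>z. z \<notin> lat t \<Longrightarrow> F z = f z" using F by auto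
  note F_cont = entire_isCont[OF F(1)] and not_lat = eventually_not_lat[OF t]
  show "F (z + 1) = F z" for z
    by (rule isCont_eq_eventually[of z "\<lambda>z. F (z + 1)"])
       (auto simp: F_eq f1 intro!: continuous_intros isCont_o2[OF _ F_cont] F_cont eventually_mono[OF not_lat])
  show "F (z + t) = m z * F z" for z
    by (rule isCont_eq_eventually[of z "\<lambda>z. F (z + t)"])
       (auto simp: F_eq ft intro!: continuous_intros isCont_o2[OF _ F_cont] F_cont m eventually_mono[OF not_lat])
qed

lemma entire_lattice_periodic_constant:
  assumes t: "t \<in> uhp" and F: "F holomorphic_on UNIV" "\<And>z. F (z + 1) = F z" "\<And>z. F (z + t) = F z"
  shows "F constant_on UNIV"
proof (rule Liouville_theorem[OF F(1)])
  have periodic: "F (z + w) = F z" if "w \<in> lat t" for w z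
    by (rule lat_induct[OF that]) (use F(2)[of "z + _"] F(3)[of "z + _"] in \<open>auto simp: add.assoc\<close>)
  have "F z \<in> F ` cball 0 (norm t + 1)" for z
  proof -
    obtain w where w: "w \<in> lat t" "norm (z - w) \<le> norm t + 1" by (rule lat_reduce[OF t])
    hence "F z = F (z - w)" using periodic[of w "z - w"] by simp
    with w(2) show ?thesis by auto
  qed
  hence "range F \<subseteq> F ` cball 0 (norm t + 1)" by auto
  moreover have "compact (F ` cball 0 (norm t + 1))"
    by (intro compact_continuous_image holomorphic_on_imp_continuous_on holomorphic_on_subset[OF F(1)]) auto
  ultimately show "bounded (range F)" using bounded_subset compact_imp_bounded by blast
qed

lemma elliptic_Liouville:
  assumes t: "t \<in> uhp" and hol: "f holomorphic_on (- lat t)"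
    and f1: "\<And>z. z \<notin> lat t \<Longrightarrow> f (z + 1) = f z"
    and ft: "\<And>z. z \<notin> lat t \<Longrightarrow> f (z + t) = f z"
    and lim: "(f \<longlongrightarrow> l) (at 0)" and z: "z \<notin> lat t"
  shows "f z = l"
proof -
  have "((\<lambda>z. z * f z) \<longlongrightarrow> 0) (at 0)" using tendsto_mult[OF tendsto_ident_at lim] by simp
  note F = lattice_extension[OF t hol f1, of "\<lambda>_. 1", simplified, OF ft this]
  have "remove_sings f constant_on UNIV"
    by (rule entire_lattice_periodic_constant[OF t]) (use F in auto)
  then obtain k where "\<And>z. remove_sings f z = k" by (auto simp: constant_on_def)
  hence f_eq: "f z = k" if "z \<notin> lat t" for z using F(2) that by metis
  have "(f \<longlongrightarrow> k) (at 0)"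
    by (rule tendsto_eventually, rule eventually_mono[OF eventually_not_lat[OF t]]) (rule f_eq)
  with lim have "l = k" using tendsto_unique[OF trivial_limit_at] by blast
  thus ?thesis using f_eq[OF z] by simp
qed

lemma filterlim_cmult_at_0:
  fixes c :: complex
  assumes "c \<noteq> 0" shows "filterlim (\<lambda>z. c * z) (at 0) (at 0)"
  using assms by (intro filterlim_atI) (auto intro!: tendsto_eq_intros simp: eventually_at_filter)

section \<open>The Weierstrass function\<close>

definition koebe_sum :: "complex \<Rightarrow> complex \<Rightarrow> complex" where
  "koebe_sum t z = (\<Sum>\<^sub>\<infinity>n\<in>(UNIV::int set). koebe (ee (z + of_int n * t)))"

definition divisor_series :: "complex \<Rightarrow> complex" where
  "divisor_series t = (\<Sum>\<^sub>\<infinity>n\<in>(UNIV::nat set). koebe (ee (of_nat (Suc n) * t)))"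

definition wp :: "complex \<Rightarrow> complex \<Rightarrow> complex" where
  "wp t z = koebe_sum t z - 2 * divisor_series t + 1 / 12"

lemma bij_int_nonneg: "bij_betw int UNIV {0..}"
  by (rule bij_betwI[where g=nat]) auto

lemma bij_int_neg: "bij_betw (\<lambda>n. - int n - 1) UNIV {..<0}"
  by (rule bij_betwI[where g="\<lambda>n. nat (- n - 1)"]) auto

lemma int_UNIV_split: "(UNIV :: int set) = {0..} \<union> {..<0}" by auto

lemma summable_int_geometric:
  assumes "0 \<le> \<rho>" "\<rho> < (1::real)"
  shows "(\<lambda>n::int. C * \<rho> ^ nat \<bar>n\<bar>) summable_on UNIV"
  unfolding int_UNIV_split
proof (rule summable_on_Un_disjoint)
  show "(\<lambda>n::int. C * \<rho> ^ nat \<bar>n\<bar>) summable_on {0..}"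
    using summable_geometric_norm[OF assms, of C]
    by (subst summable_on_reindex_bij_betw[OF bij_int_nonneg, symmetric]) simp
  have "nat \<bar>- int n - 1\<bar> = Suc n" for n by simp
  thus "(\<lambda>n::int. C * \<rho> ^ nat \<bar>n\<bar>) summable_on {..<0}"
    using summable_geometric_norm[OF assms, of "C * \<rho>"]
    by (subst summable_on_reindex_bij_betw[OF bij_int_neg, symmetric]) (simp add: mult_ac)
qed auto

lemma norm_ee_uhp: "t \<in> uhp \<Longrightarrow> norm (ee t) < 1" by (simp add: norm_ee uhp_def)

lemma norm_ee_shift: "norm (ee (z + of_nat n * t)) = norm (ee z) * norm (ee t) ^ n"
  by (simp add: ee_add norm_mult ee_power[symmetric] norm_power)

lemma norm_ee_le: "norm z \<le> Y \<Longrightarrow> norm (ee z) \<le> exp (2 * pi * Y)"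
  using abs_Im_le_cmod[of z] mult_left_mono[of "- Im z" Y "2 * pi"] by (simp add: norm_ee)

lemma norm_koebe_translate_le:
  fixes n :: int
  assumes z: "norm z \<le> Y" and small: "exp (2 * pi * Y) * norm (ee t) ^ nat \<bar>n\<bar> \<le> 1 / 2"
  shows "norm (koebe (ee (z + of_int n * t))) \<le> 4 * (exp (2 * pi * Y) * norm (ee t) ^ nat \<bar>n\<bar>)"
proof -
  have koebe_le: "norm (koebe (ee (w + of_nat (nat \<bar>n\<bar>) * t))) \<le> 4 * (exp (2 * pi * Y) * norm (ee t) ^ nat \<bar>n\<bar>)"
    if "norm w \<le> Y" for w
  proof -
    have "norm (ee (w + of_nat (nat \<bar>n\<bar>) * t)) \<le> exp (2 * pi * Y) * norm (ee t) ^ nat \<bar>n\<bar>"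
      unfolding norm_ee_shift by (intro mult_right_mono norm_ee_le that) simp
    with small norm_koebe_le[of "ee (w + of_nat (nat \<bar>n\<bar>) * t)" "1 / 2"] show ?thesis
      by (simp add: power2_eq_square)
  qed
  show ?thesis
  proof (cases "n \<ge> 0")
    case True
    thus ?thesis using koebe_le[OF z] by simp
  next
    case False
    hence "- (z + of_int n * t) = - z + of_nat (nat \<bar>n\<bar>) * t" by (simp add: of_nat_nat)
    moreover have "koebe (ee (z + of_int n * t)) = koebe (ee (- (z + of_int n * t)))"
      by (simp only: ee_minus koebe_inverse)
    ultimately show ?thesis using koebe_le[of "- z"] z by simp
  qed
qed

lemma koebe_term_bounded:
  assumes "compact K" "\<And>z. z \<in> K \<Longrightarrow> ee (z + w) \<noteq> 1"
  obtains B where "B \<ge> 0" "\<And>z. z \<in> K \<Longrightarrow> norm (koebe (ee (z + w))) \<le> B"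
proof -
  have "continuous_on K (\<lambda>z. koebe (ee (z + w)))"
    unfolding koebe_def ee_def using assms(2) by (intro continuous_intros) (auto simp: ee_def)
  hence "bounded ((\<lambda>z. koebe (ee (z + w))) ` K)"
    using assms(1) by (intro compact_imp_bounded compact_continuous_image)
  thus ?thesis using that by (auto simp: bounded_pos intro: less_imp_le)
qed

lemma koebe_sum_majorant:
  fixes I :: "int set"
  assumes t: "t \<in> uhp" and K: "compact K" "\<And>n z. n \<in> I \<Longrightarrow> z \<in> K \<Longrightarrow> ee (z + of_int n * t) \<noteq> 1"
  shows "\<exists>M. M summable_on I \<and> (\<forall>n\<in>I. \<forall>z\<in>K. norm (koebe (ee (z + of_int n * t))) \<le> M n)"
proof -
  obtain Y where Y: "\<And>z. z \<in> K \<Longrightarrow> norm z \<le> Y" using compact_imp_bounded[OF K(1)] by (auto simp: bounded_iff)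
  define \<rho> C where "\<rho> = norm (ee t)" and "C = exp (2 * pi * Y)"
  have \<rho>: "0 \<le> \<rho>" "\<rho> < 1" using norm_ee_uhp[OF t] by (auto simp: \<rho>_def)
  have "(\<lambda>n. C * \<rho> ^ n) \<longlonglongrightarrow> C * 0" using \<rho> by (intro tendsto_intros LIMSEQ_realpow_zero) auto
  hence "\<forall>\<^sub>F n in sequentially. C * \<rho> ^ n < 1 / 2" by (rule order_tendstoD) simp
  then obtain n0 where n0: "\<And>n. n \<ge> n0 \<Longrightarrow> C * \<rho> ^ n < 1 / 2" by (auto simp: eventually_sequentially)
  have "\<forall>n\<in>I. \<exists>B. B \<ge> 0 \<and> (\<forall>z\<in>K. norm (koebe (ee (z + of_int n * t))) \<le> B)"
    using koebe_term_bounded[OF K(1)] K(2) by metis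
  then obtain B where B: "\<And>n. n \<in> I \<Longrightarrow> B n \<ge> 0"
    "\<And>n z. n \<in> I \<Longrightarrow> z \<in> K \<Longrightarrow> norm (koebe (ee (z + of_int n * t))) \<le> B n" by metis
  define M where "M = (\<lambda>n. (if nat \<bar>n\<bar> < n0 then B n else 0) + 4 * C * \<rho> ^ nat \<bar>n\<bar>)"
  have "(\<lambda>n. if nat \<bar>n\<bar> < n0 then B n else 0) summable_on I"
  proof (rule finite_nonzero_values_imp_summable_on)
    have "{n \<in> I. (if nat \<bar>n\<bar> < n0 then B n else 0) \<noteq> 0} \<subseteq> {- int n0..int n0}" by (auto split: if_splits)
    thus "finite {n \<in> I. (if nat \<bar>n\<bar> < n0 then B n else 0) \<noteq> 0}" by (rule finite_subset) auto
  qed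
  hence "M summable_on I" unfolding M_def
    by (intro summable_on_add) (auto intro!: summable_on_subset[OF summable_int_geometric] \<rho>)
  moreover have "norm (koebe (ee (z + of_int n * t))) \<le> M n" if "n \<in> I" "z \<in> K" for n z
  proof (cases "nat \<bar>n\<bar> < n0")
    case True
    have "0 \<le> 4 * C * \<rho> ^ nat \<bar>n\<bar>" using \<rho> by (simp add: C_def)
    thus ?thesis using B(2)[OF that] True by (simp add: M_def)
  next
    case False
    thus ?thesis
      using norm_koebe_translate_le[OF Y[OF that(2)], of t n] n0[of "nat \<bar>n\<bar>"]
      by (simp add: M_def C_def \<rho>_def)
  qed
  ultimately show ?thesis by blast
qed

lemma koebe_sum_term_holomorphic:
  "(\<And>z. z \<in> S \<Longrightarrow> ee (z + of_int n * t) \<noteq> 1) \<Longrightarrow> (\<lambda>z. koebe (ee (z + of_int n * t))) holomorphic_on S"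
  unfolding koebe_def ee_def by (intro holomorphic_intros) auto

lemma koebe_sum_summable:
  assumes "t \<in> uhp" "\<And>n. n \<in> I \<Longrightarrow> ee (z + of_int n * t) \<noteq> 1"
  shows "(\<lambda>n. koebe (ee (z + of_int n * t))) summable_on I"
proof -
  obtain M where "M summable_on I" "\<forall>n\<in>I. norm (koebe (ee (z + of_int n * t))) \<le> M n"
    using koebe_sum_majorant[OF assms(1), of "{z}" I] assms(2) by auto
  thus ?thesis unfolding summable_on_iff_abs_summable_on_complex
    by (elim summable_on_comparison_test) auto
qed

lemma koebe_partial_sum_holomorphic:
  assumes t: "t \<in> uhp" and S: "open S" "\<And>n z. n \<in> I \<Longrightarrow> z \<in> S \<Longrightarrow> ee (z + of_int n * t) \<noteq> 1"
  shows "(\<lambda>z. \<Sum>\<^sub>\<infinity>n\<in>I. koebe (ee (z + of_int n * t))) holomorphic_on S"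
proof (rule infsum_holomorphic[OF S(1)])
  show "(\<lambda>z. koebe (ee (z + of_int n * t))) holomorphic_on S" if "n \<in> I" for n
    using S(2)[OF that] by (rule koebe_sum_term_holomorphic)
  fix z assume "z \<in> S"
  then obtain r where r: "r > 0" "cball z r \<subseteq> S" using S(1) open_contains_cball by metis
  from koebe_sum_majorant[OF t compact_cball, of I z r] S(2) r(2)
  obtain M where "M summable_on I" "\<forall>n\<in>I. \<forall>w\<in>cball z r. norm (koebe (ee (w + of_int n * t))) \<le> M n" by blast
  with r show "\<exists>r>0. \<exists>M. cball z r \<subseteq> S \<and> M summable_on I \<and>
      (\<forall>i\<in>I. \<forall>w\<in>cball z r. norm (koebe (ee (w + of_int i * t))) \<le> M i)" by blast
qed

lemma koebe_sum_holomorphic: "t \<in> uhp \<Longrightarrow> koebe_sum t holomorphic_on (- lat t)"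
  using koebe_partial_sum_holomorphic[OF _ open_lat, of t t UNIV] ee_translate_neq_1
  by (auto simp: koebe_sum_def[abs_def])

lemma wp_holomorphic: "t \<in> uhp \<Longrightarrow> wp t holomorphic_on (- lat t)"
  unfolding wp_def[abs_def] by (intro holomorphic_intros koebe_sum_holomorphic)

lemma koebe_sum_add_1: "koebe_sum t (z + 1) = koebe_sum t z"
proof -
  have "ee (z + 1 + w) = ee (z + w)" for w using ee_add[of "z + w" 1] by (simp add: add_ac)
  thus ?thesis by (simp add: koebe_sum_def)
qed

lemma koebe_sum_add_tau: "koebe_sum t (z + t) = koebe_sum t z"
  unfolding koebe_sum_def
  by (rule infsum_reindex_bij_witness[where i="\<lambda>n. n - 1" and j="\<lambda>n. n + 1"]) (auto simp: algebra_simps)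

lemma koebe_sum_minus: "koebe_sum t (- z) = koebe_sum t z"
  unfolding koebe_sum_def
proof (rule infsum_reindex_bij_witness[where i="\<lambda>n. - n" and j="\<lambda>n. - n"])
  fix n :: int
  have "ee (z + of_int (- n) * t) = inverse (ee (- z + of_int n * t))" by (simp add: ee_minus[symmetric])
  thus "koebe (ee (z + of_int (- n) * t)) = koebe (ee (- z + of_int n * t))" by (simp add: koebe_inverse)
qed auto

lemma ee_T: "ee (z + of_int n * (t + 1)) = ee (z + of_int n * t)"
proof -
  have "z + of_int n * (t + 1) = (z + of_int n * t) + of_int n" by (simp add: algebra_simps)
  thus ?thesis by (simp add: ee_add)
qed

lemma koebe_sum_T: "koebe_sum (t + 1) z = koebe_sum t z" by (simp only: koebe_sum_def ee_T)

lemma divisor_series_T: "divisor_series (t + 1) = divisor_series t"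
  using ee_T[of 0 "int (Suc n)" t for n] by (simp add: divisor_series_def)

lemma koebe_eq_inverse: "X \<noteq> 0 \<Longrightarrow> koebe X = inverse (X + inverse X - 2)"
proof (cases "X = 1")
  case False
  assume "X \<noteq> 0"
  hence "X + inverse X - 2 = (1 - X)\<^sup>2 / X" by (simp add: field_simps power2_eq_square)
  thus ?thesis by (simp add: koebe_def)
qed (simp add: koebe_def)

lemma cosh_quartic_limit:
  "((\<lambda>Z::complex. (exp Z + exp (- Z) - 2 - Z\<^sup>2) / Z ^ 4) \<longlongrightarrow> 1 / 12) (at 0)"
proof -
  have exp_bound: "norm (exp Z - (1 + Z + Z\<^sup>2 / 2 + Z ^ 3 / 6 + Z ^ 4 / 24)) \<le> exp 1 * norm Z ^ 5"
    if "norm Z < 1" for Z :: complex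
  proof -
    have "(\<Sum>k\<le>4. Z ^ k / fact k) = 1 + Z + Z\<^sup>2 / 2 + Z ^ 3 / 6 + Z ^ 4 / 24"
      by (simp add: eval_nat_numeral fact_Suc)
    hence "norm (exp Z - (1 + Z + Z\<^sup>2 / 2 + Z ^ 3 / 6 + Z ^ 4 / 24)) \<le> exp \<bar>Re Z\<bar> * norm Z ^ 5 / fact 4"
      using Taylor_exp[of Z 4] by simp
    also have "\<dots> \<le> exp \<bar>Re Z\<bar> * norm Z ^ 5 / 1" by (intro divide_left_mono) (auto simp: fact_numeral)
    also have "\<dots> \<le> exp 1 * norm Z ^ 5" using abs_Re_le_cmod[of Z] that by (simp add: mult_right_mono)
    finally show ?thesis .
  qed
  have quotient_bound: "norm ((exp Z + exp (- Z) - 2 - Z\<^sup>2) / Z ^ 4 - 1 / 12) \<le> norm Z * (2 * exp 1)"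
    if Z: "norm Z < 1" "Z \<noteq> 0" for Z :: complex
  proof -
    have "(exp Z + exp (- Z) - 2 - Z\<^sup>2) / Z ^ 4 - 1 / 12 =
        ((exp Z - (1 + Z + Z\<^sup>2 / 2 + Z ^ 3 / 6 + Z ^ 4 / 24)) +
         (exp (- Z) - (1 + (- Z) + (- Z)\<^sup>2 / 2 + (- Z) ^ 3 / 6 + (- Z) ^ 4 / 24))) / Z ^ 4"
      using Z(2) by (simp add: field_simps)
    also have "norm \<dots> \<le> (exp 1 * norm Z ^ 5 + exp 1 * norm (- Z) ^ 5) / norm Z ^ 4"
      unfolding norm_divide norm_power
      using Z(1) by (intro divide_right_mono norm_triangle_mono exp_bound) auto
    also have "\<dots> = norm Z * (2 * exp 1)" using Z(2) by (simp add: field_simps eval_nat_numeral)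
    finally show ?thesis .
  qed
  have "\<forall>\<^sub>F Z::complex in at 0. Z \<in> ball 0 1 - {0}" by (intro eventually_at_in_open) auto
  hence "\<forall>\<^sub>F Z::complex in at 0. norm ((exp Z + exp (- Z) - 2 - Z\<^sup>2) / Z ^ 4 - 1 / 12) \<le> norm Z * (2 * exp 1)"
    by eventually_elim (use quotient_bound in auto)
  moreover have "((\<lambda>Z::complex. norm Z * (2 * exp 1)) \<longlongrightarrow> 0) (at 0)" by (auto intro!: tendsto_eq_intros)
  ultimately show ?thesis
    unfolding LIM_zero_iff[of _ "1 / 12 :: complex", symmetric] by (rule Lim_null_comparison)
qed

lemma koebe_limit: "((\<lambda>z. koebe (ee z) - 1 / (tpi * z)\<^sup>2) \<longlongrightarrow> - 1 / 12) (at 0)"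
proof -
  define D Q where "D = (\<lambda>Z::complex. exp Z + exp (- Z) - 2)" and "Q = (\<lambda>Z. (D Z - Z\<^sup>2) / Z ^ 4)"
  have Q: "(Q \<longlongrightarrow> 1 / 12) (at 0)" unfolding Q_def D_def by (rule cosh_quartic_limit)
  have ratio: "((\<lambda>Z. 1 + Z\<^sup>2 * Q Z) \<longlongrightarrow> 1) (at 0)" using Q by (auto intro!: tendsto_eq_intros)
  have D_eq: "D Z = Z\<^sup>2 * (1 + Z\<^sup>2 * Q Z)" if "Z \<noteq> 0" for Z
    using that by (simp add: Q_def field_simps eval_nat_numeral)
  have "\<forall>\<^sub>F Z in at 0. 1 + Z\<^sup>2 * Q Z \<noteq> 0" using ratio by (rule tendsto_imp_eventually_ne) simp
  moreover have "\<forall>\<^sub>F Z::complex in at 0. Z \<noteq> 0" by (simp add: eventually_at_filter)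
  ultimately have "\<forall>\<^sub>F Z in at 0. - Q Z / (1 + Z\<^sup>2 * Q Z) = koebe (exp Z) - 1 / Z\<^sup>2"
  proof eventually_elim
    case (elim Z)
    have "koebe (exp Z) = 1 / D Z" by (simp add: koebe_eq_inverse D_def exp_minus inverse_eq_divide)
    hence "koebe (exp Z) - 1 / Z\<^sup>2 = (1 - (1 + Z\<^sup>2 * Q Z)) / (Z\<^sup>2 * (1 + Z\<^sup>2 * Q Z))"
      unfolding D_eq[OF elim(2)] diff_divide_distrib using elim by simp
    thus ?case using elim by simp
  qed
  moreover have "((\<lambda>Z. - Q Z / (1 + Z\<^sup>2 * Q Z)) \<longlongrightarrow> - (1 / 12) / 1) (at 0)"
    by (intro tendsto_intros Q ratio) simp
  ultimately have "((\<lambda>Z. koebe (exp Z) - 1 / Z\<^sup>2) \<longlongrightarrow> - 1 / 12) (at 0)"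
    using Lim_transform_eventually by fastforce
  from filterlim_compose[OF this filterlim_cmult_at_0[of tpi]] show ?thesis by (simp add: ee_def)
qed

lemma koebe_ee_regular_part:
  obtains G where "G holomorphic_on ball 0 1" "G 0 = - 1 / 12"
    "\<And>z. z \<in> ball 0 1 - {0} \<Longrightarrow> koebe (ee z) = 1 / (tpi * z)\<^sup>2 + G z"
proof -
  define g where "g = (\<lambda>z. koebe (ee z) - 1 / (tpi * z)\<^sup>2)"
  have "ee z \<noteq> 1" if "z \<in> ball 0 1 - {0}" for z
    using that by (auto simp: ee_eq_1_iff elim!: Ints_cases)
  hence "(\<lambda>z. koebe (ee z)) holomorphic_on ball 0 1 - {0}"
    using koebe_sum_term_holomorphic[of "ball 0 1 - {0}" 0 0] by simp
  hence g: "g holomorphic_on ball 0 1 - {0}" unfolding g_def by (intro holomorphic_intros) auto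
  have "((\<lambda>z. (z - 0) * g z) \<longlongrightarrow> 0) (at 0)"
    using tendsto_mult[OF tendsto_ident_at koebe_limit] by (simp add: g_def)
  then obtain G where G: "G holomorphic_on ball 0 1" "\<And>z. z \<in> ball 0 1 - {0} \<Longrightarrow> G z = g z"
    using holomorphic_on_extend_lim[OF g] by auto
  have "(G \<longlongrightarrow> - 1 / 12) (at 0)"
    by (rule Lim_transform_within_open[OF koebe_limit, of "ball 0 1"]) (use G(2) in \<open>auto simp: g_def\<close>)
  moreover have "(G \<longlongrightarrow> G 0) (at 0)"
    using holomorphic_on_imp_continuous_on[OF G(1)] by (simp add: continuous_on_eq_continuous_at isCont_def)
  ultimately have "G 0 = - 1 / 12" using tendsto_unique[OF trivial_limit_at] by blast
  with G show ?thesis by (intro that[of G]) (auto simp: g_def)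
qed

definition koebe_sum_rest :: "complex \<Rightarrow> complex \<Rightarrow> complex" where
  "koebe_sum_rest t z = (\<Sum>\<^sub>\<infinity>n\<in>UNIV - {0}. koebe (ee (z + of_int n * t)))"

lemma ee_translate_neq_1_near_0:
  assumes t: "t \<in> uhp" and z: "z \<in> ball 0 (min 1 (Im t))" and n: "n \<noteq> 0"
  shows "ee (z + of_int n * t) \<noteq> 1"
proof
  assume ee_1: "ee (z + of_int n * t) = 1"
  hence "z \<in> lat t" using lat_eq_iff by blast
  hence "z = 0" using lat_small[OF t] z by simp
  with ee_1 have "of_int n * t \<in> \<int>" by (simp add: ee_eq_1_iff)
  then obtain k where "of_int n * t = of_int k" by (auto elim: Ints_cases)
  hence "Im (of_int n * t) = 0" by simp
  with t n show False by (simp add: uhp_def)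
qed

lemma koebe_sum_split:
  assumes t: "t \<in> uhp" and z: "z \<in> ball 0 (min 1 (Im t))"
  shows "koebe_sum t z = koebe (ee z) + koebe_sum_rest t z"
proof -
  have "(\<lambda>n. koebe (ee (z + of_int n * t))) summable_on (UNIV - {0})"
    by (rule koebe_sum_summable[OF t]) (use ee_translate_neq_1_near_0[OF t z] in auto)
  from infsum_insert[OF this, of 0] show ?thesis
    by (simp add: koebe_sum_def koebe_sum_rest_def insert_UNIV)
qed

lemma koebe_sum_rest_holomorphic:
  assumes t: "t \<in> uhp" shows "koebe_sum_rest t holomorphic_on ball 0 (min 1 (Im t))"
  unfolding koebe_sum_rest_def
  by (rule koebe_partial_sum_holomorphic[OF t]) (use ee_translate_neq_1_near_0[OF t] in auto)

lemma koebe_sum_rest_0: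
  assumes t: "t \<in> uhp" shows "koebe_sum_rest t 0 = 2 * divisor_series t"
proof -
  define f where "f = (\<lambda>n::int. koebe (ee (of_int n * t)))"
  have f_minus: "f (- n) = f n" for n
    using koebe_inverse[of "ee (of_int n * t)"] by (simp add: f_def ee_minus)
  have "ee (of_int n * t) \<noteq> 1" if "n \<noteq> 0" for n
    using ee_translate_neq_1_near_0[OF t _ that, of 0] uhpD[OF t] by simp
  hence summable: "f summable_on I" if "0 \<notin> I" for I
    unfolding f_def by (intro koebe_sum_summable[OF t, of I 0, simplified]) (metis that)
  have pos: "infsum f {0<..} = divisor_series t"
  proof -
    have "bij_betw (\<lambda>n. int n + 1) UNIV {0<..}" by (rule bij_betwI[where g="\<lambda>n. nat (n - 1)"]) auto
    from infsum_reindex_bij_betw[OF this, of f] show ?thesis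
      by (simp add: f_def divisor_series_def add.commute)
  qed
  have "infsum f {..<0} = infsum f {0<..}"
    by (rule infsum_reindex_bij_witness[where i=uminus and j=uminus]) (auto simp: f_minus)
  moreover have nonzero: "UNIV - {0::int} = {0<..} \<union> {..<0}" by auto
  have "infsum f (UNIV - {0}) = infsum f {0<..} + infsum f {..<0}"
    unfolding nonzero by (rule infsum_Un_disjoint[OF summable summable]) auto
  ultimately show ?thesis using pos by (simp add: koebe_sum_rest_def f_def)
qed

lemma wp_expansion:
  assumes t: "t \<in> uhp"
  obtains V where "V holomorphic_on ball 0 (min 1 (Im t))" "V 0 = 0"
    "\<And>z. z \<in> ball 0 (min 1 (Im t)) - {0} \<Longrightarrow> wp t z = 1 / (tpi * z)\<^sup>2 + V z"
proof -
  obtain G where G: "G holomorphic_on ball 0 1" "G 0 = - 1 / 12"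
    "\<And>z. z \<in> ball 0 1 - {0} \<Longrightarrow> koebe (ee z) = 1 / (tpi * z)\<^sup>2 + G z"
    by (rule koebe_ee_regular_part) blast
  show ?thesis
  proof (rule that[of "\<lambda>z. G z + koebe_sum_rest t z - 2 * divisor_series t + 1 / 12"])
    show "(\<lambda>z. G z + koebe_sum_rest t z - 2 * divisor_series t + 1 / 12) holomorphic_on ball 0 (min 1 (Im t))"
      by (intro holomorphic_intros koebe_sum_rest_holomorphic[OF t] holomorphic_on_subset[OF G(1)]) auto
    show "G 0 + koebe_sum_rest t 0 - 2 * divisor_series t + 1 / 12 = 0"
      by (simp add: G(2) koebe_sum_rest_0[OF t])
    show "wp t z = 1 / (tpi * z)\<^sup>2 + (G z + koebe_sum_rest t z - 2 * divisor_series t + 1 / 12)"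
      if "z \<in> ball 0 (min 1 (Im t)) - {0}" for z
      using that koebe_sum_split[OF t, of z] G(3)[of z] by (simp add: wp_def)
  qed
qed

lemma wp_limit:
  assumes t: "t \<in> uhp"
  shows "((\<lambda>z. wp t z - 1 / (tpi * z)\<^sup>2) \<longlongrightarrow> 0) (at 0)"
proof -
  obtain V where V: "V holomorphic_on ball 0 (min 1 (Im t))" "V 0 = 0"
    "\<And>z. z \<in> ball 0 (min 1 (Im t)) - {0} \<Longrightarrow> wp t z = 1 / (tpi * z)\<^sup>2 + V z"
    by (rule wp_expansion[OF t]) blast
  have radius: "min 1 (Im t) > 0" using uhpD[OF t] by simp
  hence "isCont V 0"
    using holomorphic_on_imp_continuous_on[OF V(1)] by (simp add: continuous_on_eq_continuous_at)
  hence "(V \<longlongrightarrow> 0) (at 0)" using V(2) by (simp add: isCont_def)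
  thus ?thesis
    by (rule Lim_transform_within_open[where s="ball 0 (min 1 (Im t))"]) (use radius V(3) in auto)
qed

lemma wp_add_1: "wp t (z + 1) = wp t z" and wp_add_tau: "wp t (z + t) = wp t z"
  and wp_minus: "wp t (- z) = wp t z" and wp_T: "wp (t + 1) z = wp t z"
  by (simp_all add: wp_def koebe_sum_add_1 koebe_sum_add_tau koebe_sum_minus koebe_sum_T divisor_series_T)

lemma wp_S:
  assumes t: "t \<in> uhp" and z: "z \<notin> lat t"
  shows "wp (- 1 / t) (z / t) = t\<^sup>2 * wp t z"
proof -
  have t0: "t \<noteq> 0" using uhp_nonzero[OF t] .
  have t': "- 1 / t \<in> uhp" by (rule minus_inverse_in_uhp[OF t])
  define f where "f = (\<lambda>z. wp (- 1 / t) (z / t) - t\<^sup>2 * wp t z)"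
  have "f z = 0"
  proof (rule elliptic_Liouville[OF t _ _ _ _ z])
    have "(wp (- 1 / t) \<circ> (\<lambda>z. z / t)) holomorphic_on (- lat t)"
      by (rule holomorphic_on_compose_gen[OF _ wp_holomorphic[OF t']])
         (use t0 lat_S[OF t] in \<open>auto intro!: holomorphic_intros\<close>)
    thus "f holomorphic_on (- lat t)"
      unfolding f_def by (intro holomorphic_intros wp_holomorphic[OF t]) (simp add: o_def)
    show "f (z + 1) = f z" for z
      using wp_add_tau[of "- 1 / t" "(z + 1) / t"] by (simp add: f_def wp_add_1 add_divide_distrib)
    show "f (z + t) = f z" for z
      using t0 wp_add_1[of "- 1 / t" "z / t"] by (simp add: f_def wp_add_tau add_divide_distrib)
    have "filterlim (\<lambda>z. z / t) (at 0) (at 0)" using filterlim_cmult_at_0[of "1 / t"] t0 by simp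
    from filterlim_compose[OF wp_limit[OF t'] this]
    have "((\<lambda>z. (wp (- 1 / t) (z / t) - 1 / (tpi * (z / t))\<^sup>2) - t\<^sup>2 * (wp t z - 1 / (tpi * z)\<^sup>2))
        \<longlongrightarrow> 0 - t\<^sup>2 * 0) (at 0)"
      by (intro tendsto_intros wp_limit[OF t])
    moreover have "(wp (- 1 / t) (z / t) - 1 / (tpi * (z / t))\<^sup>2) - t\<^sup>2 * (wp t z - 1 / (tpi * z)\<^sup>2) = f z" for z
      using t0 by (simp add: f_def power_mult_distrib power_divide algebra_simps)
    ultimately show "(f \<longlongrightarrow> 0) (at 0)" by simp
  qed
  thus ?thesis by (simp add: f_def)
qed

section \<open>Integral elliptic functions\<close>

lemma deriv_affine:
  fixes f g :: "complex \<Rightarrow> complex"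
  assumes "open S" "z \<in> S" "f field_differentiable at (a * z + b)" "g field_differentiable at z"
    and eq: "\<And>w. w \<in> S \<Longrightarrow> f (a * w + b) = k * g w"
  shows "a * deriv f (a * z + b) = k * deriv g z"
proof -
  have "(f has_field_derivative deriv f (a * z + b)) (at (a * z + b))"
    using assms(3) by (simp add: field_differentiable_derivI)
  moreover have "((\<lambda>w. a * w + b) has_field_derivative a) (at z)" by (auto intro!: derivative_eq_intros)
  ultimately have "((\<lambda>w. f (a * w + b)) has_field_derivative deriv f (a * z + b) * a) (at z)"
    by (rule DERIV_chain2)
  hence "((\<lambda>w. k * g w) has_field_derivative deriv f (a * z + b) * a) (at z)"
    by (rule has_field_derivative_transform_within_open[OF _ assms(1,2)]) (use eq in auto)
  moreover have "((\<lambda>w. k * g w) has_field_derivative k * deriv g z) (at z)"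
    by (rule DERIV_cmult) (use assms(4) in \<open>simp add: field_differentiable_derivI\<close>)
  ultimately show ?thesis using DERIV_unique by (metis mult.commute)
qed

definition elliptic :: "nat \<Rightarrow> (complex \<Rightarrow> complex \<Rightarrow> complex) \<Rightarrow> bool" where
  "elliptic M G \<longleftrightarrow> (\<forall>t\<in>uhp. G t holomorphic_on (- lat t) \<and> (\<forall>z. z \<notin> lat t \<longrightarrow>
     G t (z + 1) = G t z \<and> G t (z + t) = G t z \<and> G (t + 1) z = G t z \<and>
     G t (- z) = (- 1) ^ M * G t z \<and> G (- 1 / t) (z / t) = t ^ M * G t z))"

lemma ellipticD:
  assumes "elliptic M G" "t \<in> uhp"
  shows "G t holomorphic_on (- lat t)" "z \<notin> lat t \<Longrightarrow> G t (z + 1) = G t z"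
    "z \<notin> lat t \<Longrightarrow> G t (z + t) = G t z" "z \<notin> lat t \<Longrightarrow> G (t + 1) z = G t z"
    "z \<notin> lat t \<Longrightarrow> G t (- z) = (- 1) ^ M * G t z" "z \<notin> lat t \<Longrightarrow> G (- 1 / t) (z / t) = t ^ M * G t z"
  using assms unfolding elliptic_def by blast+

lemma elliptic_differentiable:
  assumes "elliptic M G" "t \<in> uhp" "z \<notin> lat t" shows "G t field_differentiable at z"
  using holomorphic_on_imp_differentiable_at[OF ellipticD(1)[OF assms(1,2)] open_lat[OF assms(2)]] assms(3)
  by simp

lemma elliptic_zderiv:
  assumes G: "elliptic M G" shows "elliptic (Suc M) (zderiv G)"
  unfolding elliptic_def
proof (intro ballI conjI allI impI)
  fix t assume t: "t \<in> uhp"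
  show "zderiv G t holomorphic_on (- lat t)" unfolding zderiv_def[abs_def]
    by (intro holomorphic_intros holomorphic_deriv ellipticD(1)[OF G t] open_lat[OF t]) auto
  fix z assume z: "z \<notin> lat t"
  note S = open_lat[OF t]
  have zS: "z \<in> - lat t" using z by simp
  have translates: "z + 1 \<notin> lat t" "z + t \<notin> lat t" "- z \<notin> lat t" "z \<notin> lat (t + 1)" "z / t \<notin> lat (- 1 / t)"
    using z lat_T lat_S[OF t] by auto
  note D = elliptic_differentiable[OF G]
  have "1 * deriv (G t) (1 * z + 1) = 1 * deriv (G t) z"
    by (rule deriv_affine[OF S zS]) (use translates z ellipticD(2)[OF G t] in \<open>auto intro!: D t\<close>)
  thus "zderiv G t (z + 1) = zderiv G t z" by (simp add: zderiv_def)
  have "1 * deriv (G t) (1 * z + t) = 1 * deriv (G t) z"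
    by (rule deriv_affine[OF S zS]) (use translates z ellipticD(3)[OF G t] in \<open>auto intro!: D t\<close>)
  thus "zderiv G t (z + t) = zderiv G t z" by (simp add: zderiv_def)
  have "1 * deriv (G (t + 1)) (1 * z + 0) = 1 * deriv (G t) z"
    by (rule deriv_affine[OF S zS]) (use translates z ellipticD(4)[OF G t] in \<open>auto intro!: D t add_1_in_uhp\<close>)
  thus "zderiv G (t + 1) z = zderiv G t z" by (simp add: zderiv_def)
  have "(- 1) * deriv (G t) ((- 1) * z + 0) = (- 1) ^ M * deriv (G t) z"
    by (rule deriv_affine[OF S zS]) (use translates z ellipticD(5)[OF G t] in \<open>auto intro!: D t\<close>)
  hence "deriv (G t) (- z) = - ((- 1) ^ M * deriv (G t) z)"
    by (simp add: minus_equation_iff[of "deriv _ _"])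
  thus "zderiv G t (- z) = (- 1) ^ Suc M * zderiv G t z" by (simp add: zderiv_def)
  have "(1 / t) * deriv (G (- 1 / t)) ((1 / t) * z + 0) = t ^ M * deriv (G t) z"
    by (rule deriv_affine[OF S zS]) (use translates z ellipticD(6)[OF G t] in
        \<open>auto intro!: D[simplified] D t minus_inverse_in_uhp[OF t, simplified]\<close>)
  hence "deriv (G (- 1 / t)) (z / t) = t ^ Suc M * deriv (G t) z"
    using uhp_nonzero[OF t] by (simp add: field_simps)
  thus "zderiv G (- 1 / t) (z / t) = t ^ Suc M * zderiv G t z" by (simp add: zderiv_def)
qed

lemma elliptic_mult: "elliptic M G \<Longrightarrow> elliptic M' H \<Longrightarrow> elliptic (M + M') (\<lambda>t z. G t z * H t z)"
  unfolding elliptic_def by (auto simp: power_add intro!: holomorphic_intros)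

lemma elliptic_add: "elliptic M G \<Longrightarrow> elliptic M H \<Longrightarrow> elliptic M (\<lambda>t z. G t z + H t z)"
  unfolding elliptic_def by (auto simp: algebra_simps intro!: holomorphic_intros)

lemma elliptic_cmult: "elliptic M G \<Longrightarrow> elliptic M (\<lambda>t z. k * G t z)"
  unfolding elliptic_def by (auto intro!: holomorphic_intros)

definition int_elliptic :: "nat \<Rightarrow> int \<Rightarrow> (complex \<Rightarrow> complex \<Rightarrow> complex) \<Rightarrow> bool" where
  "int_elliptic M c G \<longleftrightarrow> elliptic M G \<and> int_expansion G \<and>
     (\<forall>t\<in>uhp. ((\<lambda>z. (tpi * z) ^ M * G t z) \<longlongrightarrow> of_int c) (at 0))"

lemma int_ellipticD:
  assumes "int_elliptic M c G"
  shows "elliptic M G" "int_expansion G" "t \<in> uhp \<Longrightarrow> ((\<lambda>z. (tpi * z) ^ M * G t z) \<longlongrightarrow> of_int c) (at 0)"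
  using assms by (auto simp: int_elliptic_def)

lemma int_elliptic_mult:
  assumes G: "int_elliptic M c G" and H: "int_elliptic M' c' H"
  shows "int_elliptic (M + M') (c * c') (\<lambda>t z. G t z * H t z)"
  unfolding int_elliptic_def
proof (intro conjI ballI)
  fix t assume t: "t \<in> uhp"
  have "((tpi * z) ^ M * G t z) * ((tpi * z) ^ M' * H t z) = (tpi * z) ^ (M + M') * (G t z * H t z)" for z
    by (simp only: power_add mult_ac)
  with tendsto_mult[OF int_ellipticD(3)[OF G t] int_ellipticD(3)[OF H t]]
  show "((\<lambda>z. (tpi * z) ^ (M + M') * (G t z * H t z)) \<longlongrightarrow> of_int (c * c')) (at 0)" by (simp only: of_int_mult)
qed (use int_ellipticD[OF G] int_ellipticD[OF H] in \<open>auto intro: elliptic_mult int_expansion_mult\<close>)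

lemma int_elliptic_comb:
  assumes G: "int_elliptic M c G" and H: "int_elliptic M c' H"
  shows "int_elliptic M (k * c + k' * c') (\<lambda>t z. of_int k * G t z + of_int k' * H t z)"
  unfolding int_elliptic_def
proof (intro conjI ballI)
  fix t assume t: "t \<in> uhp"
  have "of_int k * ((tpi * z) ^ M * G t z) + of_int k' * ((tpi * z) ^ M * H t z) =
      (tpi * z) ^ M * (of_int k * G t z + of_int k' * H t z)" for z
    by (simp only: distrib_left mult_ac)
  with tendsto_add[OF tendsto_mult_left[OF int_ellipticD(3)[OF G t], of "of_int k"]
      tendsto_mult_left[OF int_ellipticD(3)[OF H t], of "of_int k'"]]
  show "((\<lambda>z. (tpi * z) ^ M * (of_int k * G t z + of_int k' * H t z)) \<longlongrightarrow> of_int (k * c + k' * c')) (at 0)"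
    by (simp only: of_int_mult of_int_add)
qed (use int_ellipticD[OF G] int_ellipticD[OF H] in
  \<open>auto intro: elliptic_add elliptic_cmult int_expansion_add int_expansion_cmult\<close>)

definition elliptic_lead :: "nat \<Rightarrow> int \<Rightarrow> bool" where "elliptic_lead M c \<longleftrightarrow> (\<exists>G. int_elliptic M c G)"

lemma elliptic_lead_mult: "elliptic_lead M c \<Longrightarrow> elliptic_lead M' c' \<Longrightarrow> elliptic_lead (M + M') (c * c')"
  unfolding elliptic_lead_def using int_elliptic_mult by blast

lemma elliptic_lead_comb: "elliptic_lead M c \<Longrightarrow> elliptic_lead M c' \<Longrightarrow> elliptic_lead M (k * c + k' * c')"
  unfolding elliptic_lead_def using int_elliptic_comb by blast

lemma elliptic_lead_0: "elliptic_lead 0 1"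
proof -
  have "int_expansion (\<lambda>t z. 1)" using int_expansion_const[of 1] by simp
  hence "int_elliptic 0 1 (\<lambda>t z. 1)" unfolding int_elliptic_def elliptic_def by auto
  thus ?thesis by (auto simp: elliptic_lead_def)
qed

lemma elliptic_lead_power: "elliptic_lead M c \<Longrightarrow> elliptic_lead (k * M) (c ^ k)"
  by (induction k) (use elliptic_lead_0 elliptic_lead_mult in auto)

lemma elliptic_lead_cmult: "elliptic_lead M c \<Longrightarrow> elliptic_lead M (k * c)"
  using elliptic_lead_comb[of M c c k 0] by simp

subsection \<open>The generators\<close>

lemma strip_not_lat:
  assumes "0 < Im z" "Im z < Im t" shows "z \<notin> lat t"
proof
  assume "z \<in> lat t"
  then obtain a b where z: "z = of_int a * t + of_int b" by (auto simp: lat_def)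
  have "0 < of_int a * Im t" "of_int a * Im t < 1 * Im t" using assms by (auto simp: z)
  hence "0 < (of_int a :: real)" "(of_int a :: real) < 1" using assms
    by (auto simp: zero_less_mult_iff mult_less_cancel_right)
  thus False by simp
qed

lemma uhp_strip: "0 < Im z \<Longrightarrow> Im z < Im t \<Longrightarrow> t \<in> uhp" by (simp add: uhp_def)

lemma bimonom_translate:
  "bimonom t z (Suc n, n) = ee (z + of_nat n * t)"
  "bimonom t z (n, Suc n) = ee (t - z + of_nat n * t)"
  "bimonom t z (n, n) = ee (of_nat n * t)"
  unfolding bimonom_eq_ee by (rule arg_cong[of _ _ ee]; simp add: algebra_simps)+

lemma int_expansion_koebe_sum: "int_expansion koebe_sum"
proof -
  have "int_expansion (\<lambda>t z. (\<Sum>\<^sub>\<infinity>n. koebe (bimonom t z (Suc n, n))) + (\<Sum>\<^sub>\<infinity>n. koebe (bimonom t z (n, Suc n))))"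
    by (intro int_expansion_add int_expansion_lambert) auto
  thus ?thesis
  proof (rule int_expansion_cong)
    fix t z assume strip: "0 < Im z" "Im z < Im t"
    define f where "f = (\<lambda>n::int. koebe (ee (z + of_int n * t)))"
    have summable: "f summable_on I" for I
      unfolding f_def by (rule koebe_sum_summable[OF uhp_strip ee_translate_neq_1[OF strip_not_lat]]) (rule strip)+
    have "koebe_sum t z = infsum f {0..} + infsum f {..<0}"
      unfolding koebe_sum_def f_def[symmetric] int_UNIV_split
      by (rule infsum_Un_disjoint[OF summable summable]) auto
    moreover have "infsum f {0..} = (\<Sum>\<^sub>\<infinity>n. koebe (bimonom t z (Suc n, n)))"
      using infsum_reindex_bij_betw[OF bij_int_nonneg, of f] by (simp add: f_def bimonom_translate)
    moreover have "infsum f {..<0} = (\<Sum>\<^sub>\<infinity>n. koebe (bimonom t z (n, Suc n)))"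
    proof (subst infsum_reindex_bij_betw[OF bij_int_neg, symmetric], rule infsum_cong)
      fix n :: nat
      have "ee (z + of_int (- int n - 1) * t) = inverse (bimonom t z (n, Suc n))"
        unfolding bimonom_translate ee_minus[symmetric]
        by (rule arg_cong[of _ _ ee]) (simp add: algebra_simps)
      thus "f (- int n - 1) = koebe (bimonom t z (n, Suc n))" by (simp only: f_def koebe_inverse)
    qed
    ultimately show "(\<Sum>\<^sub>\<infinity>n. koebe (bimonom t z (Suc n, n))) + (\<Sum>\<^sub>\<infinity>n. koebe (bimonom t z (n, Suc n))) = koebe_sum t z"
      by simp
  qed
qed

lemma int_expansion_divisor_series: "int_expansion (\<lambda>t z. divisor_series t)"
proof -
  have "int_expansion (\<lambda>t z. \<Sum>\<^sub>\<infinity>n. koebe (bimonom t z (Suc n, Suc n)))"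
    by (rule int_expansion_lambert) simp
  thus ?thesis by (simp only: bimonom_translate(3) divisor_series_def)
qed

lemma elliptic_wp: "elliptic 2 wp"
  unfolding elliptic_def using wp_holomorphic wp_S by (auto simp: wp_add_1 wp_add_tau wp_T wp_minus)

lemma int_expansion_12_wp: "int_expansion (\<lambda>t z. 12 * wp t z)"
proof -
  have "int_expansion (\<lambda>t z. of_int 12 * (koebe_sum t z - of_int 2 * divisor_series t) + of_int 1)"
    by (intro int_expansion_add int_expansion_cmult int_expansion_diff int_expansion_koebe_sum
        int_expansion_divisor_series int_expansion_const)
  thus ?thesis by (simp add: wp_def algebra_simps)
qed

lemma zderiv_wp:
  assumes "t \<in> uhp" "z \<notin> lat t" shows "zderiv wp t z = zderiv koebe_sum t z"
proof -
  have "(koebe_sum t has_field_derivative deriv (koebe_sum t) z) (at z)"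
    by (rule holomorphic_derivI[OF koebe_sum_holomorphic[OF assms(1)] open_lat[OF assms(1)]]) (use assms(2) in simp)
  hence "(wp t has_field_derivative deriv (koebe_sum t) z) (at z)"
    unfolding wp_def[abs_def] by (auto intro!: derivative_eq_intros)
  thus ?thesis by (simp add: zderiv_def DERIV_imp_deriv)
qed

lemma zderiv2_wp:
  assumes "t \<in> uhp" "z \<notin> lat t" shows "zderiv (zderiv wp) t z = zderiv (zderiv koebe_sum) t z"
proof -
  have "\<forall>\<^sub>F w in nhds z. w \<in> - lat t" by (rule eventually_nhds_in_open) (use open_lat assms in auto)
  hence "\<forall>\<^sub>F w in nhds z. zderiv wp t w = zderiv koebe_sum t w"
    by eventually_elim (simp add: zderiv_wp[OF assms(1)])
  hence "deriv (zderiv wp t) z = deriv (zderiv koebe_sum t) z" by (rule deriv_cong_ev) simp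
  thus ?thesis by (simp add: zderiv_def)
qed

lemma inverse_power_has_field_derivative:
  fixes a z :: complex
  assumes "a \<noteq> 0" "z \<noteq> 0"
  shows "((\<lambda>z. c / (a * z) ^ n) has_field_derivative - of_nat n * c * a / (a * z) ^ Suc n) (at z)"
proof -
  have "((\<lambda>z. a * z) has_field_derivative a) (at z)" by (auto intro!: derivative_eq_intros)
  hence "((\<lambda>z. c * inverse (a * z) ^ n) has_field_derivative
      c * (of_nat n * (- (inverse (a * z) * a * inverse (a * z)) * inverse (a * z) ^ (n - Suc 0)))) (at z)"
    by (intro DERIV_cmult DERIV_power DERIV_inverse') (use assms in simp_all)
  moreover have "c * (of_nat n * (- (x * a * x) * x ^ (n - Suc 0))) = - of_nat n * c * a * x ^ Suc n" for x
    by (cases n) (simp_all add: algebra_simps)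
  ultimately show ?thesis by (simp only: divide_inverse power_inverse[symmetric])
qed

definition has_principal_part :: "real \<Rightarrow> nat \<Rightarrow> complex \<Rightarrow> (complex \<Rightarrow> complex) \<Rightarrow> bool" where
  "has_principal_part r n c f \<longleftrightarrow> (\<exists>V. V holomorphic_on ball 0 r \<and> (\<forall>z\<in>ball 0 r - {0}. f z = c / (tpi * z) ^ n + V z))"

lemma has_principal_part_zderiv:
  assumes "has_principal_part r n c (G t)"
  shows "has_principal_part r (Suc n) (- of_nat n * c) (zderiv G t)"
proof -
  obtain V where V: "V holomorphic_on ball 0 r" "\<And>z. z \<in> ball 0 r - {0} \<Longrightarrow> G t z = c / (tpi * z) ^ n + V z"
    using assms by (auto simp: has_principal_part_def)
  have "zderiv G t z = - of_nat n * c / (tpi * z) ^ Suc n + deriv V z / tpi" if z: "z \<in> ball 0 r - {0}" for z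
  proof -
    have "(V has_field_derivative deriv V z) (at z)"
      using V(1) z by (intro holomorphic_derivI[of _ "ball 0 r"]) auto
    moreover have "((\<lambda>z. c / (tpi * z) ^ n) has_field_derivative - of_nat n * c * tpi / (tpi * z) ^ Suc n) (at z)"
      by (rule inverse_power_has_field_derivative) (use z in auto)
    ultimately have "((\<lambda>z. c / (tpi * z) ^ n + V z) has_field_derivative
        - of_nat n * c * tpi / (tpi * z) ^ Suc n + deriv V z) (at z)" by (intro DERIV_add)
    hence "(G t has_field_derivative - of_nat n * c * tpi / (tpi * z) ^ Suc n + deriv V z) (at z)"
      by (rule has_field_derivative_transform_within_open[of _ _ _ "ball 0 r - {0}"]) (use V(2) z in auto)
    hence "zderiv G t z = (- of_nat n * c * tpi / (tpi * z) ^ Suc n + deriv V z) / tpi"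
      by (simp add: zderiv_def DERIV_imp_deriv)
    thus ?thesis by (simp add: add_divide_distrib diff_divide_distrib del: power_Suc)
  qed
  moreover have "(\<lambda>z. deriv V z / tpi) holomorphic_on ball 0 r"
    by (intro holomorphic_intros holomorphic_deriv V(1)) auto
  ultimately show ?thesis unfolding has_principal_part_def by blast
qed

lemma has_principal_part_limit:
  assumes f: "has_principal_part r n c f" and r: "r > 0" and n: "n > 0"
  shows "((\<lambda>z. (tpi * z) ^ n * f z) \<longlongrightarrow> c) (at 0)"
proof -
  obtain V where V: "V holomorphic_on ball 0 r" "\<And>z. z \<in> ball 0 r - {0} \<Longrightarrow> f z = c / (tpi * z) ^ n + V z"
    using f by (auto simp: has_principal_part_def)
  have "isCont V 0"
    using holomorphic_on_imp_continuous_on[OF V(1)] r by (simp add: continuous_on_eq_continuous_at)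
  hence "((\<lambda>z. c + (tpi * z) ^ n * V z) \<longlongrightarrow> c + (tpi * 0) ^ n * V 0) (at 0)"
    by (intro tendsto_intros) (simp add: isCont_def)
  hence "((\<lambda>z. c + (tpi * z) ^ n * V z) \<longlongrightarrow> c) (at 0)" using n by (simp add: power_0_left)
  thus ?thesis
    by (rule Lim_transform_within_open[where s="ball 0 r"]) (use r V(2) in \<open>auto simp: field_simps\<close>)
qed

lemma has_principal_part_wp:
  assumes t: "t \<in> uhp"
  shows "has_principal_part (min 1 (Im t)) 2 1 (wp t)"
    "has_principal_part (min 1 (Im t)) 3 (- 2) (zderiv wp t)"
    "has_principal_part (min 1 (Im t)) 4 6 (zderiv (zderiv wp) t)"
proof -
  show wp: "has_principal_part (min 1 (Im t)) 2 1 (wp t)"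
    unfolding has_principal_part_def by (rule wp_expansion[OF t]) blast
  show zderiv_wp: "has_principal_part (min 1 (Im t)) 3 (- 2) (zderiv wp t)"
    using has_principal_part_zderiv[of _ 2 1 wp t, OF wp] by (simp add: numeral_3_eq_3 numeral_2_eq_2)
  show "has_principal_part (min 1 (Im t)) 4 6 (zderiv (zderiv wp) t)"
    using has_principal_part_zderiv[of _ 3 "- 2" "zderiv wp" t, OF zderiv_wp]
    by (simp add: eval_nat_numeral)
qed

lemma zderiv_wp_limits:
  assumes t: "t \<in> uhp"
  shows "((\<lambda>z. (tpi * z) ^ 2 * wp t z) \<longlongrightarrow> 1) (at 0)"
    "((\<lambda>z. (tpi * z) ^ 3 * zderiv wp t z) \<longlongrightarrow> - 2) (at 0)"
    "((\<lambda>z. (tpi * z) ^ 4 * zderiv (zderiv wp) t z) \<longlongrightarrow> 6) (at 0)"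
  using has_principal_part_wp[OF t, THEN has_principal_part_limit] uhpD[OF t] by auto

lemma int_elliptic_wp: "int_elliptic 2 12 (\<lambda>t z. 12 * wp t z)"
  unfolding int_elliptic_def
proof (intro conjI ballI)
  show "elliptic 2 (\<lambda>t z. 12 * wp t z)" by (rule elliptic_cmult[OF elliptic_wp])
  show "int_expansion (\<lambda>t z. 12 * wp t z)" by (rule int_expansion_12_wp)
  fix t assume "t \<in> uhp"
  from tendsto_mult[OF tendsto_const[of 12] zderiv_wp_limits(1)[OF this]]
  show "((\<lambda>z. (tpi * z) ^ 2 * (12 * wp t z)) \<longlongrightarrow> of_int 12) (at 0)" by (simp add: mult_ac)
qed

lemma int_expansion_zderiv_wp: "int_expansion (zderiv wp)"
  by (rule int_expansion_cong[OF int_expansion_zderiv[OF int_expansion_koebe_sum]])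
     (simp add: zderiv_wp uhp_strip strip_not_lat)

lemma int_elliptic_zderiv_wp: "int_elliptic 3 (- 2) (zderiv wp)"
  unfolding int_elliptic_def
  using elliptic_zderiv[OF elliptic_wp] int_expansion_zderiv_wp zderiv_wp_limits(2)
  by (simp add: numeral_3_eq_3 numeral_2_eq_2)

lemma int_elliptic_zderiv2_wp: "int_elliptic 4 6 (zderiv (zderiv wp))"
  unfolding int_elliptic_def
  using elliptic_zderiv[OF elliptic_zderiv[OF elliptic_wp]] int_expansion_zderiv[OF int_expansion_zderiv_wp]
    zderiv_wp_limits(3)
  by (simp add: eval_nat_numeral)

lemma int_elliptic_divide:
  assumes G: "int_elliptic M (d * c) G" and d: "d \<noteq> 0" and int: "int_expansion (\<lambda>t z. G t z / of_int d)"
  shows "int_elliptic M c (\<lambda>t z. G t z / of_int d)"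
  unfolding int_elliptic_def
proof (intro conjI ballI int)
  show "elliptic M (\<lambda>t z. G t z / of_int d)"
    using elliptic_cmult[OF int_ellipticD(1)[OF G], of "1 / of_int d"] by simp
  show "((\<lambda>z. (tpi * z) ^ M * (G t z / of_int d)) \<longlongrightarrow> of_int c) (at 0)" if "t \<in> uhp" for t
    using tendsto_divide[OF int_ellipticD(3)[OF G that] tendsto_const[of "of_int d"]] d by simp
qed

text \<open>This is \<open>K(3z) / K(z)\<^sup>9\<close> for \<open>K = \<theta>\<^sub>1 / \<eta>\<^sup>3\<close>. It is integral because the coefficients of
  \<open>\<wp>'\<close> and \<open>\<wp>''\<close> are congruent modulo 2.\<close>

definition wp_weight_8 :: "complex \<Rightarrow> complex \<Rightarrow> complex" where
  "wp_weight_8 t z = (12 * wp t z * (zderiv wp t z)\<^sup>2 - (zderiv (zderiv wp) t z)\<^sup>2) / 4"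

lemma int_expansion_wp_weight_8: "int_expansion wp_weight_8"
proof -
  define U H where "U = zderiv koebe_sum" and "H = (\<lambda>t z. (U t z - zderiv U t z) / 2)"
  define P where "P = (\<lambda>t z. koebe_sum t z - of_int 2 * divisor_series t)"
  have "int_expansion (\<lambda>t z. of_int 3 * P t z * (U t z * U t z) + U t z * H t z - H t z * H t z)"
    unfolding P_def U_def H_def
    by (intro int_expansion_add int_expansion_diff int_expansion_mult int_expansion_cmult int_expansion_koebe_sum
        int_expansion_divisor_series int_expansion_zderiv int_expansion_half_zderiv_diff int_expansion_const)
  thus ?thesis
  proof (rule int_expansion_cong)
    fix t z :: complex assume strip: "0 < Im z" "Im z < Im t"
    note off_lattice = uhp_strip[OF strip] strip_not_lat[OF strip]
    have "zderiv wp t z = U t z" by (simp add: U_def zderiv_wp[OF off_lattice])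
    moreover have "zderiv (zderiv wp) t z = U t z - 2 * H t z"
      by (simp add: U_def H_def zderiv2_wp[OF off_lattice] field_simps)
    moreover have "12 * wp t z = 12 * P t z + 1" by (simp add: P_def wp_def algebra_simps)
    ultimately have "wp_weight_8 t z = ((12 * P t z + 1) * (U t z)\<^sup>2 - (U t z - 2 * H t z)\<^sup>2) / 4"
      by (simp only: wp_weight_8_def)
    also have "\<dots> = of_int 3 * P t z * (U t z * U t z) + U t z * H t z - H t z * H t z"
      by (simp add: field_simps power2_eq_square)
    finally show "of_int 3 * P t z * (U t z * U t z) + U t z * H t z - H t z * H t z = wp_weight_8 t z"
      by simp
  qed
qed

lemma int_elliptic_wp_weight_8: "int_elliptic 8 3 wp_weight_8"
proof -
  let ?cubic = "\<lambda>t z. (12 * wp t z) * (zderiv wp t z * zderiv wp t z)"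
  let ?square = "\<lambda>t z. zderiv (zderiv wp) t z * zderiv (zderiv wp) t z"
  let ?G = "\<lambda>t z. of_int 1 * ?cubic t z + of_int (- 1) * ?square t z"
  have "int_elliptic (2 + (3 + 3)) (12 * ((- 2) * (- 2))) ?cubic"
    by (intro int_elliptic_mult int_elliptic_wp int_elliptic_zderiv_wp)
  moreover have "int_elliptic (4 + 4) (6 * 6) ?square" by (intro int_elliptic_mult int_elliptic_zderiv2_wp)
  ultimately have "int_elliptic 8 (1 * 48 + (- 1) * 36) ?G" by (intro int_elliptic_comb) simp_all
  hence "int_elliptic 8 (4 * 3) ?G" by simp
  moreover have quarter: "(\<lambda>t z. ?G t z / of_int 4) = wp_weight_8"
    by (simp add: fun_eq_iff wp_weight_8_def power2_eq_square mult.assoc)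
  ultimately show ?thesis
    using int_elliptic_divide[of 8 4 3 ?G] int_expansion_wp_weight_8 unfolding quarter by simp
qed

lemma elliptic_lead_residue:
  assumes "elliptic_lead m d" "elliptic_lead (M mod m) c"
  shows "elliptic_lead M (c * d ^ (M div m))"
  using elliptic_lead_mult[OF assms(2) elliptic_lead_power[OF assms(1), of "M div m"]] by simp

lemma elliptic_lead_12:
  assumes "even M" shows "elliptic_lead M 12"
proof -
  have "elliptic_lead 3 (- 2)" and lead_4_6: "elliptic_lead 4 6" and lead_8_3: "elliptic_lead 8 3"
    and lead_2: "elliptic_lead 2 12"
    using int_elliptic_wp int_elliptic_zderiv_wp int_elliptic_zderiv2_wp int_elliptic_wp_weight_8
    by (auto simp: elliptic_lead_def)
  hence lead_6_4: "elliptic_lead 6 4" using elliptic_lead_mult[of 3 "- 2" 3 "- 2"] by simp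
  have lead_0: "elliptic_lead 0 12" using elliptic_lead_cmult[OF elliptic_lead_0, of 12] by simp
  have lead_4: "elliptic_lead 4 12" using elliptic_lead_cmult[OF lead_4_6, of 2] by simp
  have lead_6: "elliptic_lead 6 12" using elliptic_lead_cmult[OF lead_6_4, of 3] by simp
  have "M mod 6 \<in> {0, 2, 4}" "M mod 8 \<in> {0, 2, 4, 6}" using assms by (simp, presburger)+
  hence "elliptic_lead (M mod 6) 12" "elliptic_lead (M mod 8) 12" using lead_0 lead_2 lead_4 lead_6 by auto
  hence powers: "elliptic_lead M (12 * 4 ^ (M div 6))" "elliptic_lead M (12 * 3 ^ (M div 8))"
    using elliptic_lead_residue lead_6_4 lead_8_3 by blast+
  have "coprime (4 :: int) 3" using coprime_doff_one_right[of "4 :: int"] by simp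
  hence "coprime (4 ^ (M div 6)) (3 ^ (M div 8) :: int)" by simp
  then obtain u v :: int where "u * 4 ^ (M div 6) + v * 3 ^ (M div 8) = 1"
    using bezout_int[of "4 ^ (M div 6)" "3 ^ (M div 8)"] by (auto simp: coprime_iff_gcd_eq_1)
  hence "u * (12 * 4 ^ (M div 6)) + v * (12 * 3 ^ (M div 8)) = 12" by (simp add: algebra_simps)
  with elliptic_lead_comb[OF powers, of u v] show ?thesis by simp
qed

section \<open>The product \<open>K\<^sup>2\<close>\<close>

lemma sum_Pow_lessThan_prod:
  fixes x :: "nat \<Rightarrow> 'a::comm_ring_1"
  shows "(\<Sum>S\<in>Pow {..<k}. \<Prod>n\<in>S. x n) = (\<Prod>n<k. 1 + x n)"
  using prod_add[of "{..<k}" x "\<lambda>_. 1"] by (simp add: add.commute)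

lemma finite_subsets_nat_bounded:
  assumes "finite F" "F \<subseteq> Collect finite"
  obtains k where "F \<subseteq> Pow {..<k::nat}"
proof -
  have "finite (\<Union>F)" using assms by auto
  then obtain k where "\<Union>F \<subseteq> {..<k}" using finite_nat_iff_bounded by auto
  hence "F \<subseteq> Pow {..<k}" by auto
  thus ?thesis by (rule that)
qed

lemma summable_prod_finite_subsets:
  fixes x :: "nat \<Rightarrow> complex"
  assumes x: "summable (\<lambda>n. norm (x n))"
  shows "(\<lambda>S. \<Prod>n\<in>S. x n) summable_on (Collect finite)"
proof -
  have "(\<lambda>S. norm (\<Prod>n\<in>S. x n)) summable_on (Collect finite)"
  proof (rule nonneg_bdd_above_summable_on)
    show "bdd_above (sum (\<lambda>S. norm (\<Prod>n\<in>S. x n)) ` {F. F \<subseteq> Collect finite \<and> finite F})"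
    proof (rule bdd_aboveI2)
      fix F :: "nat set set" assume F: "F \<in> {F. F \<subseteq> Collect finite \<and> finite F}"
      then obtain k where k: "F \<subseteq> Pow {..<k}" using finite_subsets_nat_bounded[of F] by auto
      have "(\<Sum>S\<in>F. norm (\<Prod>n\<in>S. x n)) \<le> (\<Sum>S\<in>Pow {..<k}. \<Prod>n\<in>S. norm (x n))"
        unfolding prod_norm by (rule sum_mono2) (use k in auto)
      also have "\<dots> = (\<Prod>n<k. 1 + norm (x n))" by (rule sum_Pow_lessThan_prod)
      also have "\<dots> \<le> exp (\<Sum>n<k. norm (x n))" by (rule prod_le_exp_sum) auto
      also have "\<dots> \<le> exp (\<Sum>n. norm (x n))" using sum_le_suminf[OF x, of "{..<k}"] by simp
      finally show "(\<Sum>S\<in>F. norm (\<Prod>n\<in>S. x n)) \<le> exp (\<Sum>n. norm (x n))" .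
    qed
  qed auto
  thus ?thesis by (simp add: summable_on_iff_abs_summable_on_complex)
qed

lemma filterlim_Pow_lessThan:
  "filterlim (\<lambda>k. Pow {..<k::nat}) (finite_subsets_at_top (Collect finite)) sequentially"
  unfolding filterlim_finite_subsets_at_top eventually_sequentially
proof (intro allI impI)
  fix F :: "nat set set" assume F: "finite F \<and> F \<subseteq> Collect finite"
  then obtain k where k: "F \<subseteq> Pow {..<k}" using finite_subsets_nat_bounded by blast
  have "Pow {..<k} \<subseteq> Pow {..<k'}" if "k' \<ge> k" for k' using that by auto
  thus "\<exists>k. \<forall>k'\<ge>k. finite (Pow {..<k'}) \<and> F \<subseteq> Pow {..<k'} \<and> Pow {..<k'} \<subseteq> Collect finite"
    using k by (intro exI[of _ k]) (auto intro: finite_subset[OF _ finite_lessThan])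
qed

lemma has_sum_prod_finite_subsets:
  fixes x :: "nat \<Rightarrow> complex"
  assumes x: "summable (\<lambda>n. norm (x n))"
  shows "((\<lambda>S. \<Prod>n\<in>S. x n) has_sum (\<Prod>n. 1 + x n)) (Collect finite)"
proof -
  obtain s where s: "((\<lambda>S. \<Prod>n\<in>S. x n) has_sum s) (Collect finite)"
    using summable_prod_finite_subsets[OF x] by (auto simp: summable_on_def)
  from filterlim_compose[OF s[unfolded has_sum_def] filterlim_Pow_lessThan]
  have "(\<lambda>k. \<Prod>n<k. 1 + x n) \<longlonglongrightarrow> s" by (simp add: sum_Pow_lessThan_prod)
  hence "(\<lambda>k. \<Prod>n<Suc k. 1 + x n) \<longlonglongrightarrow> s" by (rule LIMSEQ_Suc)
  moreover have "convergent_prod (\<lambda>n. 1 + x n)"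
    by (rule abs_convergent_prod_imp_convergent_prod, rule summable_imp_abs_convergent_prod) (use x in simp)
  hence "(\<lambda>k. \<Prod>n<Suc k. 1 + x n) \<longlonglongrightarrow> (\<Prod>n. 1 + x n)"
    using convergent_prod_LIMSEQ by (simp add: lessThan_Suc_atMost)
  ultimately have "s = (\<Prod>n. 1 + x n)" by (rule LIMSEQ_unique)
  with s show ?thesis by simp
qed

lemma finite_weighted_subsets:
  fixes w :: "nat \<Rightarrow> nat"
  assumes w: "\<And>n. Suc n \<le> w n"
  shows "finite {S. finite S \<and> (\<Sum>n\<in>S. w n) \<le> k}"
proof (rule finite_subset)
  show "{S. finite S \<and> (\<Sum>n\<in>S. w n) \<le> k} \<subseteq> Pow {..<k}"
  proof (intro subsetI PowI)
    fix S n assume S: "S \<in> {S. finite S \<and> (\<Sum>n\<in>S. w n) \<le> k}" "n \<in> S"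
    have "Suc n \<le> w n" by (rule w)
    also have "\<dots> \<le> (\<Sum>n\<in>S. w n)" using S by (intro member_le_sum) auto
    finally show "n \<in> {..<k}" using S(1) by simp
  qed
qed simp

lemma int_expansion_prod:
  fixes e :: "nat \<Rightarrow> nat \<times> nat"
  assumes e: "\<And>n. Suc n \<le> fst (e n) + snd (e n)"
  shows "int_expansion (\<lambda>t z. \<Prod>n. 1 - bimonom t z (e n))"
proof (rule int_expansionI[of "Collect finite" "\<lambda>S. (\<Sum>n\<in>S. fst (e n), \<Sum>n\<in>S. snd (e n))" "\<lambda>S. (- 1) ^ card S"])
  fix p :: "nat \<times> nat"
  have "{S \<in> Collect finite. (\<Sum>n\<in>S. fst (e n), \<Sum>n\<in>S. snd (e n)) = p} \<subseteq>
      {S. finite S \<and> (\<Sum>n\<in>S. fst (e n) + snd (e n)) \<le> fst p + snd p}" by (auto simp: sum.distrib)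
  thus "finite {S \<in> Collect finite. (\<Sum>n\<in>S. fst (e n), \<Sum>n\<in>S. snd (e n)) = p}"
    by (rule finite_subset) (rule finite_weighted_subsets[OF e])
next
  fix t z :: complex assume "0 < Im z" "Im z < Im t"
  then obtain \<rho> where \<rho>: "0 \<le> \<rho>" "\<rho> < 1" "\<And>n. norm (bimonom t z (e n)) \<le> \<rho> ^ Suc n"
    using norm_bimonom_le_geometric e by metis
  have "summable (\<lambda>n. norm (- bimonom t z (e n)))"
    by (rule summable_comparison_test[OF _ summable_mult[OF summable_geometric, of \<rho> \<rho>]]) (use \<rho> in auto)
  moreover have "(\<Prod>n\<in>S. - bimonom t z (e n)) =
      of_int ((- 1) ^ card S) * bimonom t z (\<Sum>n\<in>S. fst (e n), \<Sum>n\<in>S. snd (e n))" for S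
    by (simp add: prod_uminus bimonom_prod)
  ultimately show "((\<lambda>S. of_int ((- 1) ^ card S) * bimonom t z (\<Sum>n\<in>S. fst (e n), \<Sum>n\<in>S. snd (e n))) has_sum
      (\<Prod>n. 1 - bimonom t z (e n))) (Collect finite)"
    using has_sum_prod_finite_subsets[of "\<lambda>n. - bimonom t z (e n)"] by simp
qed

definition qpoch :: "complex \<Rightarrow> complex \<Rightarrow> complex" where
  "qpoch t z = (\<Prod>n. 1 - ee (z + of_nat n * t))"

lemma qpoch_convergent:
  assumes "t \<in> uhp" shows "convergent_prod (\<lambda>n. 1 - ee (z + of_nat n * t))"
proof (rule abs_convergent_prod_imp_convergent_prod, rule summable_imp_abs_convergent_prod)
  show "summable (\<lambda>n. norm (1 - ee (z + of_nat n * t) - 1))"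
    using norm_ee_uhp[OF assms] by (simp add: norm_ee_shift summable_geometric summable_mult)
qed

lemma qpoch_holomorphic:
  assumes t: "t \<in> uhp"
  shows "qpoch t holomorphic_on UNIV"
proof (rule holomorphic_uniform_sequence[OF open_UNIV, where f="\<lambda>N z. \<Prod>n<N. 1 - ee (z + of_nat n * t)"])
  show "(\<lambda>z. \<Prod>n<N. 1 - ee (z + of_nat n * t)) holomorphic_on UNIV" for N
    unfolding ee_def by (intro holomorphic_intros)
  fix z :: complex
  have "uniformly_convergent_on (cball z 1) (\<lambda>N w. \<Prod>n<N. 1 - ee (w + of_nat n * t))"
  proof (rule uniformly_convergent_on_prod')
    show "continuous_on (cball z 1) (\<lambda>w. 1 - ee (w + of_nat n * t))" for n
      unfolding ee_def by (intro continuous_intros)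
    define C where "C = exp (2 * pi * (1 - Im z))"
    have "norm (norm (1 - ee (w + of_nat n * t) - 1)) \<le> C * norm (ee t) ^ n" if "w \<in> cball z 1" for n w
    proof -
      have "\<bar>Im (z - w)\<bar> \<le> 1" using that abs_Im_le_cmod[of "z - w"] by (auto simp: dist_norm)
      hence "2 * pi * (Im z - 1) \<le> 2 * pi * Im w" by (intro mult_left_mono) auto
      hence "norm (ee w) \<le> C" by (simp add: C_def norm_ee algebra_simps)
      thus ?thesis by (simp add: norm_ee_shift mult_right_mono)
    qed
    thus "uniformly_convergent_on (cball z 1) (\<lambda>N x. \<Sum>n<N. norm (1 - ee (x + of_nat n * t) - 1))"
      by (rule Weierstrass_m_test') (use norm_ee_uhp[OF t] in \<open>auto intro!: summable_mult summable_geometric\<close>)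
  qed auto
  hence uniform: "uniform_limit (cball z 1) (\<lambda>N w. \<Prod>n<N. 1 - ee (w + of_nat n * t))
      (\<lambda>w. lim (\<lambda>N. \<Prod>n<N. 1 - ee (w + of_nat n * t))) sequentially"
    by (simp add: uniformly_convergent_uniform_limit_iff)
  have "lim (\<lambda>N. \<Prod>n<N. 1 - ee (w + of_nat n * t)) = qpoch t w" for w
  proof (rule limI)
    have "(\<lambda>N. \<Prod>n<Suc N. 1 - ee (w + of_nat n * t)) \<longlonglongrightarrow> qpoch t w"
      using convergent_prod_LIMSEQ[OF qpoch_convergent[OF t]] by (simp add: lessThan_Suc_atMost qpoch_def)
    thus "(\<lambda>N. \<Prod>n<N. 1 - ee (w + of_nat n * t)) \<longlonglongrightarrow> qpoch t w" by (rule LIMSEQ_imp_Suc)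
  qed
  with uniform show "\<exists>d>0. cball z d \<subseteq> UNIV \<and>
      uniform_limit (cball z d) (\<lambda>N w. \<Prod>n<N. 1 - ee (w + of_nat n * t)) (qpoch t) sequentially"
    by (intro exI[of _ 1]) simp
qed

lemma qpoch_shift:
  assumes t: "t \<in> uhp"
  shows "qpoch t z = (1 - ee z) * qpoch t (z + t)"
proof -
  have "(\<lambda>N. \<Prod>n<Suc (Suc N). 1 - ee (z + of_nat n * t)) \<longlonglongrightarrow> qpoch t z"
    using LIMSEQ_Suc[OF convergent_prod_LIMSEQ[OF qpoch_convergent[OF t]]]
    by (simp add: lessThan_Suc_atMost qpoch_def)
  moreover have "(\<Prod>n<Suc (Suc N). 1 - ee (z + of_nat n * t)) =
      (1 - ee z) * (\<Prod>n<Suc N. 1 - ee (z + t + of_nat n * t))" for N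
    by (subst prod.lessThan_Suc_shift) (simp add: algebra_simps)
  moreover have "(\<lambda>N. (1 - ee z) * (\<Prod>n<Suc N. 1 - ee (z + t + of_nat n * t))) \<longlonglongrightarrow> (1 - ee z) * qpoch t (z + t)"
    using convergent_prod_LIMSEQ[OF qpoch_convergent[OF t], of "z + t"]
    by (intro tendsto_intros) (simp add: lessThan_Suc_atMost qpoch_def)
  ultimately show ?thesis using LIMSEQ_unique by simp
qed

lemma qpoch_eq_0_iff:
  assumes t: "t \<in> uhp"
  shows "qpoch t z = 0 \<longleftrightarrow> (\<exists>n. ee (z + of_nat n * t) = 1)"
proof -
  have "(\<lambda>n. 1 - ee (z + of_nat n * t)) has_prod qpoch t z"
    using qpoch_convergent[OF t] unfolding qpoch_def by (rule convergent_prod_has_prod)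
  from has_prod_eq_0_iff[OF this] show ?thesis by (auto simp: image_iff)
qed

lemma qpoch_add_1: "qpoch t (z + 1) = qpoch t z"
proof -
  have "ee (z + 1 + w) = ee (z + w)" for w using ee_add[of "z + w" 1] by (simp add: add_ac)
  thus ?thesis by (simp add: qpoch_def)
qed

lemma qpoch_T: "qpoch (t + 1) z = qpoch t z"
  unfolding qpoch_def using ee_T[of z "int n" t for n] by simp

lemma qpoch_tau_nonzero:
  assumes t: "t \<in> uhp"
  shows "qpoch t t \<noteq> 0"
proof
  assume "qpoch t t = 0"
  then obtain n where "ee (t + of_nat n * t) = 1" using qpoch_eq_0_iff[OF t] by blast
  hence "norm (ee (t + of_nat n * t)) = 1" by simp
  hence "Im t + of_nat n * Im t = 0" by (simp add: norm_ee)
  moreover have "0 < Im t + of_nat n * Im t" using uhpD[OF t] by (intro add_pos_nonneg) auto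
  ultimately show False by simp
qed

definition jacobi_phi :: "complex \<Rightarrow> complex \<Rightarrow> complex" where
  "jacobi_phi t z = inverse (ee z) * (qpoch t z)\<^sup>2 * (qpoch t (t - z))\<^sup>2 / qpoch t t ^ 4"

lemma jacobi_phi_holomorphic:
  assumes t: "t \<in> uhp"
  shows "jacobi_phi t holomorphic_on UNIV"
proof -
  have "(qpoch t \<circ> (\<lambda>z. t - z)) holomorphic_on UNIV"
    by (rule holomorphic_on_compose_gen[OF _ qpoch_holomorphic[OF t]]) (auto intro!: holomorphic_intros)
  thus ?thesis unfolding jacobi_phi_def[abs_def] using qpoch_tau_nonzero[OF t] qpoch_holomorphic[OF t]
    by (intro holomorphic_intros) (auto simp: o_def ee_def[abs_def] intro!: holomorphic_intros)
qed

lemma jacobi_phi_add_1: "jacobi_phi t (z + 1) = jacobi_phi t z"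
  using qpoch_add_1[of t "t - z - 1"] qpoch_add_1[of t z] by (simp add: jacobi_phi_def ee_add algebra_simps)

lemma jacobi_phi_add_tau:
  assumes t: "t \<in> uhp"
  shows "jacobi_phi t (z + t) = ee (- t - 2 * z) * jacobi_phi t z"
proof -
  have "(qpoch t (t - (z + t)))\<^sup>2 = (1 - inverse (ee z))\<^sup>2 * (qpoch t (t - z))\<^sup>2"
    using qpoch_shift[OF t, of "- z"] by (simp add: ee_minus power_mult_distrib add.commute)
  moreover have "(1 - inverse (ee z))\<^sup>2 = inverse (ee z) ^ 2 * (1 - ee z)\<^sup>2"
    by (simp add: field_simps power2_eq_square)
  moreover have "(qpoch t z)\<^sup>2 = (1 - ee z)\<^sup>2 * (qpoch t (z + t))\<^sup>2"
    using qpoch_shift[OF t, of z] by (simp add: power_mult_distrib)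
  moreover have "ee (- t - 2 * z) = inverse (ee t) * inverse (ee z) ^ 2"
    by (simp add: power2_eq_square flip: ee_minus ee_add)
  ultimately show ?thesis by (simp add: jacobi_phi_def ee_add mult_ac)
qed

lemma jacobi_phi_eq:
  assumes t: "t \<in> uhp"
  shows "jacobi_phi t z = inverse (ee z) * (1 - ee z)\<^sup>2 * ((qpoch t (z + t))\<^sup>2 * (qpoch t (t - z))\<^sup>2) / qpoch t t ^ 4"
  unfolding jacobi_phi_def using qpoch_shift[OF t, of z] by (simp add: power_mult_distrib mult_ac)

lemma jacobi_phi_minus:
  assumes t: "t \<in> uhp"
  shows "jacobi_phi t (- z) = jacobi_phi t z"
proof -
  have "inverse (ee (- z)) * (1 - ee (- z))\<^sup>2 = inverse (ee z) * (1 - ee z)\<^sup>2"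
    by (simp add: ee_minus field_simps power2_eq_square)
  thus ?thesis unfolding jacobi_phi_eq[OF t] by (simp add: mult_ac add.commute)
qed

lemma jacobi_phi_T: "jacobi_phi (t + 1) z = jacobi_phi t z"
proof -
  have "t + 1 - z = (t - z) + 1" by simp
  thus ?thesis by (simp only: jacobi_phi_def qpoch_T qpoch_add_1)
qed

lemma jacobi_phi_nonzero:
  assumes t: "t \<in> uhp" and z: "z \<notin> lat t"
  shows "jacobi_phi t z \<noteq> 0"
proof -
  have "qpoch t w \<noteq> 0" if "w \<notin> lat t" for w
    using qpoch_eq_0_iff[OF t] ee_translate_neq_1[OF that, of "int n" for n] by auto
  moreover have "t - z \<notin> lat t" using z lat_add_tau[of "- z" t] by simp
  ultimately show ?thesis using z qpoch_tau_nonzero[OF t] by (simp add: jacobi_phi_def)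
qed

lemma jacobi_phi_limit:
  assumes t: "t \<in> uhp"
  shows "((\<lambda>z. jacobi_phi t z / (tpi * z)\<^sup>2) \<longlongrightarrow> 1) (at 0)"
proof -
  have "((\<lambda>z. (exp z - 1) / z) \<longlongrightarrow> 1) (at (0::complex))" using lim_exp_minus_1 .
  from filterlim_compose[OF this filterlim_cmult_at_0[of tpi]]
  have "((\<lambda>z. (ee z - 1) / (tpi * z)) \<longlongrightarrow> 1) (at 0)" by (simp add: ee_def)
  moreover have "((\<lambda>z. ee z) \<longlongrightarrow> ee 0) (at 0)"
    unfolding ee_def by (auto intro!: tendsto_eq_intros)
  moreover have "((\<lambda>z. qpoch t (z + t)) \<longlongrightarrow> qpoch t (0 + t)) (at 0)" "((\<lambda>z. qpoch t (t - z)) \<longlongrightarrow> qpoch t (t - 0)) (at 0)"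
    by (rule isCont_tendsto_compose[OF entire_isCont[OF qpoch_holomorphic[OF t]]]; auto intro!: tendsto_eq_intros)+
  ultimately have "((\<lambda>z. inverse (ee z) * ((ee z - 1) / (tpi * z))\<^sup>2 * ((qpoch t (z + t))\<^sup>2 * (qpoch t (t - z))\<^sup>2) / qpoch t t ^ 4)
      \<longlongrightarrow> inverse (ee 0) * 1\<^sup>2 * ((qpoch t (0 + t))\<^sup>2 * (qpoch t (t - 0))\<^sup>2) / qpoch t t ^ 4) (at 0)"
    using qpoch_tau_nonzero[OF t] by (intro tendsto_intros) auto
  moreover have "inverse (ee 0) * 1\<^sup>2 * ((qpoch t (0 + t))\<^sup>2 * (qpoch t (t - 0))\<^sup>2) / qpoch t t ^ 4 = 1"
    using qpoch_tau_nonzero[OF t] by (simp add: power2_eq_square power4_eq_xxxx)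
  moreover have "inverse (ee z) * ((ee z - 1) / (tpi * z))\<^sup>2 * ((qpoch t (z + t))\<^sup>2 * (qpoch t (t - z))\<^sup>2) / qpoch t t ^ 4 =
      jacobi_phi t z / (tpi * z)\<^sup>2" for z
    unfolding jacobi_phi_eq[OF t] power_divide power2_commute[of "ee z" 1] by simp
  ultimately show ?thesis by simp
qed

definition jacobi_phi_inverted :: "complex \<Rightarrow> complex \<Rightarrow> complex" where
  "jacobi_phi_inverted t z = jacobi_phi (- 1 / t) (z / t) * ee (- (z\<^sup>2 / t))"

lemma jacobi_phi_inverted_add_1:
  assumes t: "t \<in> uhp"
  shows "jacobi_phi_inverted t (z + 1) = jacobi_phi_inverted t z"
proof -
  define w where "w = (z + 1) / t"
  have "z / t = w + (- 1 / t)" by (simp add: w_def add_divide_distrib)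
  hence "jacobi_phi (- 1 / t) (z / t) = ee (- (- 1 / t) - 2 * w) * jacobi_phi (- 1 / t) w"
    using jacobi_phi_add_tau[OF minus_inverse_in_uhp[OF t], of w] by simp
  moreover have "ee (- (z\<^sup>2 / t)) * ee (- (- 1 / t) - 2 * w) = ee (- ((z + 1)\<^sup>2 / t))"
    unfolding ee_add[symmetric] w_def
    by (rule arg_cong[of _ _ ee]) (use uhp_nonzero[OF t] in \<open>simp add: field_simps power2_eq_square\<close>)
  ultimately show ?thesis by (simp add: jacobi_phi_inverted_def w_def mult_ac)
qed

lemma jacobi_phi_inverted_add_tau:
  assumes t: "t \<in> uhp"
  shows "jacobi_phi_inverted t (z + t) = ee (- t - 2 * z) * jacobi_phi_inverted t z"
proof -
  have "(z + t) / t = z / t + 1" using uhp_nonzero[OF t] by (simp add: add_divide_distrib)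
  moreover have "ee (- ((z + t)\<^sup>2 / t)) = ee (- (z\<^sup>2 / t)) * ee (- t - 2 * z)"
    unfolding ee_add[symmetric]
    by (rule arg_cong[of _ _ ee]) (use uhp_nonzero[OF t] in \<open>simp add: field_simps power2_eq_square\<close>)
  ultimately show ?thesis by (simp add: jacobi_phi_inverted_def jacobi_phi_add_1)
qed

lemma jacobi_phi_inverted_holomorphic:
  assumes t: "t \<in> uhp"
  shows "jacobi_phi_inverted t holomorphic_on UNIV"
proof -
  have "(jacobi_phi (- 1 / t) \<circ> (\<lambda>z. z / t)) holomorphic_on UNIV"
    by (rule holomorphic_on_compose_gen[OF _ jacobi_phi_holomorphic[OF minus_inverse_in_uhp[OF t]]])
       (use uhp_nonzero[OF t] in \<open>auto intro!: holomorphic_intros\<close>)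
  thus ?thesis
    unfolding jacobi_phi_inverted_def[abs_def] ee_def using uhp_nonzero[OF t]
    by (intro holomorphic_intros) (auto simp: o_def)
qed

lemma jacobi_phi_inverted_limit:
  assumes t: "t \<in> uhp"
  shows "((\<lambda>z. jacobi_phi_inverted t z / jacobi_phi t z) \<longlongrightarrow> 1 / t\<^sup>2) (at 0)"
proof -
  have t0: "t \<noteq> 0" using uhp_nonzero[OF t] .
  have "filterlim (\<lambda>z. z / t) (at 0) (at 0)" using filterlim_cmult_at_0[of "1 / t"] t0 by simp
  from filterlim_compose[OF jacobi_phi_limit[OF minus_inverse_in_uhp[OF t]] this]
  have "((\<lambda>z. jacobi_phi (- 1 / t) (z / t) / (tpi * (z / t))\<^sup>2) \<longlongrightarrow> 1) (at 0)" .
  moreover have "((\<lambda>z. ee (- (z\<^sup>2 / t))) \<longlongrightarrow> 1) (at 0)"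
    unfolding ee_def using t0 by (auto intro!: tendsto_eq_intros)
  ultimately have "((\<lambda>z. (jacobi_phi (- 1 / t) (z / t) / (tpi * (z / t))\<^sup>2) * ee (- (z\<^sup>2 / t)) /
      (jacobi_phi t z / (tpi * z)\<^sup>2) / t\<^sup>2) \<longlongrightarrow> 1 * 1 / 1 / t\<^sup>2) (at 0)"
    using t0 by (intro tendsto_intros jacobi_phi_limit[OF t]) auto
  moreover have "(jacobi_phi (- 1 / t) (z / t) / (tpi * (z / t))\<^sup>2) * ee (- (z\<^sup>2 / t)) / (jacobi_phi t z / (tpi * z)\<^sup>2) / t\<^sup>2 =
      jacobi_phi_inverted t z / jacobi_phi t z" if "z \<noteq> 0" for z
    using that t0 by (simp add: jacobi_phi_inverted_def power_divide power_mult_distrib)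
  ultimately show ?thesis by (subst Lim_cong_within[OF refl refl refl]) (auto simp: power2_eq_square)
qed

lemma jacobi_phi_S:
  assumes t: "t \<in> uhp" and z: "z \<notin> lat t"
  shows "jacobi_phi (- 1 / t) (z / t) = ee (z\<^sup>2 / t) / t\<^sup>2 * jacobi_phi t z"
proof -
  have "jacobi_phi_inverted t z / jacobi_phi t z = 1 / t\<^sup>2"
  proof (rule elliptic_Liouville[OF t _ _ _ jacobi_phi_inverted_limit[OF t] z])
    show "(\<lambda>z. jacobi_phi_inverted t z / jacobi_phi t z) holomorphic_on - lat t"
      by (intro holomorphic_intros holomorphic_on_subset[OF jacobi_phi_inverted_holomorphic[OF t]]
          holomorphic_on_subset[OF jacobi_phi_holomorphic[OF t]]) (use jacobi_phi_nonzero[OF t] in auto)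
  qed (simp_all add: jacobi_phi_inverted_add_1 jacobi_phi_inverted_add_tau jacobi_phi_add_1 jacobi_phi_add_tau t)
  thus ?thesis using jacobi_phi_nonzero[OF t z] uhp_nonzero[OF t]
    by (simp add: jacobi_phi_inverted_def ee_minus field_simps)
qed

subsection \<open>Integrality of the product\<close>

lemma fps_inverse_Ints:
  fixes F :: "complex fps"
  assumes "\<And>n. fps_nth F n \<in> \<int>" "fps_nth F 0 = 1"
  shows "fps_nth (inverse F) n \<in> \<int>"
proof (induction n rule: less_induct)
  case (less n)
  show ?case
  proof (cases "n = 0")
    case True thus ?thesis using assms(2) by simp
  next
    case False
    have "F * inverse F = 1" using assms(2) by (simp add: inverse_mult_eq_1')
    hence "(\<Sum>i=0..n. fps_nth F i * fps_nth (inverse F) (n - i)) = 0"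
      using False by (simp add: fps_eq_iff fps_mult_nth)
    hence "fps_nth (inverse F) n = - (\<Sum>i=1..n. fps_nth F i * fps_nth (inverse F) (n - i))"
      using assms(2) by (simp add: sum.atLeast_Suc_atMost eq_neg_iff_add_eq_0)
    also have "\<dots> \<in> \<int>" using less assms(1) False by (intro Ints_minus Ints_sum Ints_mult) auto
    finally show ?thesis .
  qed
qed

lemma sums_imp_has_fps_expansion:
  fixes a :: "nat \<Rightarrow> complex"
  assumes f: "\<And>q. norm q < 1 \<Longrightarrow> (\<lambda>k. a k * q ^ k) sums f q"
  shows "f has_fps_expansion Abs_fps a"
  unfolding has_fps_expansion_def
proof
  have "summable (\<lambda>k. fps_nth (Abs_fps a) k * of_real (1/2) ^ k)"
    using sums_summable[OF f[of "1/2"]] by simp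
  hence "fps_conv_radius (Abs_fps a) \<ge> norm (of_real (1/2) :: complex)"
    unfolding fps_conv_radius_def by (rule conv_radius_geI)
  also have "norm (of_real (1/2) :: complex) = 1/2" by simp
  finally have "ereal (1/2) \<le> fps_conv_radius (Abs_fps a)" .
  moreover have "(0::ereal) < ereal (1/2)" by simp
  ultimately show "0 < fps_conv_radius (Abs_fps a)" by (rule less_le_trans[rotated])
  have "\<forall>\<^sub>F z in nhds 0. z \<in> ball (0::complex) 1" by (intro eventually_nhds_in_open) auto
  thus "\<forall>\<^sub>F z in nhds 0. eval_fps (Abs_fps a) z = f z"
    by eventually_elim (use f in \<open>auto simp: eval_fps_def sums_iff\<close>)
qed

lemma int_power_series_inverse:
  fixes c :: "nat \<Rightarrow> int" and f :: "complex \<Rightarrow> complex"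
  assumes c0: "c 0 = 1" and f: "\<And>q. norm q < 1 \<Longrightarrow> (\<lambda>k. of_int (c k) * q ^ k) sums f q"
    and nonzero: "\<And>q. norm q < 1 \<Longrightarrow> f q \<noteq> 0"
  obtains b :: "nat \<Rightarrow> int"
    where "\<And>q. norm q < 1 \<Longrightarrow> ((\<lambda>k. of_int (b k) * q ^ k) has_sum inverse (f q)) UNIV"
proof -
  define F :: "complex fps" where "F = Abs_fps (\<lambda>k. of_int (c k))"
  have "f has_fps_expansion F" unfolding F_def by (rule sums_imp_has_fps_expansion) (rule f)
  hence inverse_expansion: "(\<lambda>q. inverse (f q)) has_fps_expansion inverse F"
    by (rule has_fps_expansion_inverse) (simp add: F_def c0)
  have "fps_nth (inverse F) k \<in> \<int>" for k by (rule fps_inverse_Ints) (simp_all add: F_def c0)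
  hence "\<forall>k. \<exists>m::int. fps_nth (inverse F) k = of_int m" by (auto elim: Ints_cases)
  then obtain b :: "nat \<Rightarrow> int" where b: "\<And>k. fps_nth (inverse F) k = of_int (b k)" by metis
  have "f holomorphic_on ball 0 1"
    by (rule power_series_holomorphic[of 0 1 "\<lambda>k. of_int (c k)"]) (use f in auto)
  hence "(\<lambda>q. inverse (f q)) holomorphic_on ball 0 1"
    by (intro holomorphic_on_inverse) (use nonzero in auto)
  from holomorphic_power_series[OF this]
  have sums: "(\<lambda>k. of_int (b k) * q ^ k) sums inverse (f q)" if "norm q < 1" for q
    using that by (simp add: fps_nth_fps_expansion[OF inverse_expansion, symmetric] b)
  show ?thesis
  proof (rule that)
    fix q :: complex assume q: "norm q < 1"
    then obtain r where r: "norm q < r" "r < 1" using dense by blast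
    hence "r \<ge> 0" using norm_ge_zero[of q] by linarith
    hence "summable (\<lambda>k. of_int (b k) * of_real r ^ k :: complex)"
      using sums_summable[OF sums[of "of_real r"]] r by simp
    hence "summable (\<lambda>k. norm (of_int (b k) * q ^ k :: complex))"
      by (rule powser_insidea) (use r \<open>r \<ge> 0\<close> in simp)
    thus "((\<lambda>k. of_int (b k) * q ^ k) has_sum inverse (f q)) UNIV"
      by (rule norm_summable_imp_has_sum[OF _ sums[OF q]])
  qed
qed

definition euler_prod :: "complex \<Rightarrow> complex" where "euler_prod q = (\<Prod>n. 1 - q ^ Suc n)"

lemma qpoch_euler_prod: "qpoch t t = euler_prod (ee t)"
  unfolding qpoch_def euler_prod_def
  by (rule prodinf_cong) (simp add: ee_power ee_add[symmetric] algebra_simps del: power_Suc)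

lemma ee_surj:
  assumes "q \<noteq> 0" "norm q < 1" obtains t where "t \<in> uhp" "ee t = q"
proof
  show ee: "ee (Ln q / tpi) = q" using assms by (simp add: ee_def)
  have "norm (ee (Ln q / tpi)) < 1" using assms unfolding ee by simp
  thus "Ln q / tpi \<in> uhp" unfolding norm_ee by (simp add: uhp_def zero_less_mult_iff del: Im_divide_of_real)
qed

lemma euler_prod_nonzero:
  assumes "norm q < 1" shows "euler_prod q \<noteq> 0"
proof (cases "q = 0")
  case False
  obtain t where "t \<in> uhp" "ee t = q" using ee_surj[OF False assms] by metis
  thus ?thesis using qpoch_tau_nonzero[of t] by (simp add: qpoch_euler_prod)
qed (simp add: euler_prod_def)

lemma euler_prod_int_power_series:
  obtains c :: "nat \<Rightarrow> int" where "c 0 = 1" "\<And>q. norm q < 1 \<Longrightarrow> (\<lambda>k. of_int (c k) * q ^ k) sums euler_prod q"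
proof
  define c :: "nat \<Rightarrow> int" where "c = (\<lambda>k. \<Sum>S\<in>{S \<in> Collect finite. (\<Sum>n\<in>S. Suc n) = k}. (- 1) ^ card S)"
  have "{S::nat set. finite S \<and> (\<Sum>n\<in>S. Suc n) = 0} = {{}}" by auto
  thus "c 0 = 1" by (simp add: c_def)
  fix q :: complex assume q: "norm q < 1"
  have finite_fibre: "finite {S \<in> Collect finite. (\<Sum>n\<in>S. Suc n) = k}" for k
    by (rule finite_subset[OF _ finite_weighted_subsets[of Suc k]]) auto
  have "summable (\<lambda>n. norm (- (q ^ Suc n)))"
    using q by (simp add: norm_mult norm_power summable_mult summable_geometric)
  hence "((\<lambda>S. \<Prod>n\<in>S. - (q ^ Suc n)) has_sum euler_prod q) (Collect finite)"
    using has_sum_prod_finite_subsets[of "\<lambda>n. - (q ^ Suc n)"] by (simp add: euler_prod_def)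
  from has_sum_group[OF this finite_fibre]
  have "((\<lambda>k. \<Sum>S\<in>{S \<in> Collect finite. (\<Sum>n\<in>S. Suc n) = k}. \<Prod>n\<in>S. - (q ^ Suc n)) has_sum euler_prod q) UNIV" .
  moreover have "(\<Sum>S\<in>{S \<in> Collect finite. (\<Sum>n\<in>S. Suc n) = k}. \<Prod>n\<in>S. - (q ^ Suc n)) = of_int (c k) * q ^ k" for k
    unfolding c_def of_int_sum sum_distrib_right
    by (rule sum.cong) (auto simp: prod_uminus power_sum[symmetric] simp del: power_Suc)
  ultimately show "(\<lambda>k. of_int (c k) * q ^ k) sums euler_prod q" by (simp add: has_sum_imp_sums)
qed

lemma int_expansion_inverse_qpoch: "int_expansion (\<lambda>t z. inverse (qpoch t t))"
proof -
  obtain c :: "nat \<Rightarrow> int" where "c 0 = 1" "\<And>q. norm q < 1 \<Longrightarrow> (\<lambda>k. of_int (c k) * q ^ k) sums euler_prod q"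
    by (rule euler_prod_int_power_series) blast
  then obtain b :: "nat \<Rightarrow> int"
    where b: "\<And>q. norm q < 1 \<Longrightarrow> ((\<lambda>k. of_int (b k) * q ^ k) has_sum inverse (euler_prod q)) UNIV"
    using int_power_series_inverse[of c euler_prod] euler_prod_nonzero by metis
  show ?thesis
  proof (rule int_expansionI[of UNIV "\<lambda>k. (k, k)" b])
    show "finite {k \<in> UNIV. (k, k) = p}" for p :: "nat \<times> nat"
      by (rule finite_subset[of _ "{fst p}"]) auto
    fix t z :: complex assume strip: "0 < Im z" "Im z < Im t"
    show "((\<lambda>k. of_int (b k) * bimonom t z (k, k)) has_sum inverse (qpoch t t)) UNIV"
      using b[OF norm_ee_uhp[OF uhp_strip[OF strip]]]
      by (simp add: bimonom_translate ee_power qpoch_euler_prod)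
  qed
qed

lemma int_expansion_jacobi_phi: "int_expansion (\<lambda>t z. ee z * jacobi_phi t z)"
proof -
  have "int_expansion (\<lambda>t z. \<Prod>n. 1 - bimonom t z (Suc n, n))" by (rule int_expansion_prod) simp
  hence qpoch: "int_expansion qpoch" by (simp only: bimonom_translate qpoch_def[abs_def])
  have "int_expansion (\<lambda>t z. \<Prod>n. 1 - bimonom t z (n, Suc n))" by (rule int_expansion_prod) simp
  hence qpoch_reflected: "int_expansion (\<lambda>t z. qpoch t (t - z))"
    by (simp only: bimonom_translate qpoch_def[abs_def])
  have "int_expansion (\<lambda>t z. (qpoch t z)\<^sup>2 * (qpoch t (t - z))\<^sup>2 * inverse (qpoch t t) ^ 4)"
    by (intro int_expansion_mult int_expansion_power qpoch qpoch_reflected int_expansion_inverse_qpoch)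
  moreover have "ee z * jacobi_phi t z = (qpoch t z)\<^sup>2 * (qpoch t (t - z))\<^sup>2 * inverse (qpoch t t) ^ 4" for t z
    by (simp add: jacobi_phi_def divide_inverse power_inverse)
  ultimately show ?thesis by simp
qed

section \<open>The Poincare series\<close>

definition lat_point :: "complex \<Rightarrow> int \<times> int \<Rightarrow> complex" where
  "lat_point t p = of_int (fst p) * t + of_int (snd p)"

definition poincare_form :: "complex \<Rightarrow> complex \<Rightarrow> complex" where
  "poincare_form w z = z\<^sup>2 + 2 * z * cnj w + w * cnj w"

definition poincare_term :: "nat \<Rightarrow> nat \<Rightarrow> complex \<Rightarrow> complex \<Rightarrow> complex \<Rightarrow> complex" where
  "poincare_term N k t w z = exp (- of_real (pi * real N / Im t) * poincare_form w z) / (z + w) ^ k"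

definition poincare :: "nat \<Rightarrow> nat \<Rightarrow> complex \<Rightarrow> complex \<Rightarrow> complex" where
  "poincare N k t z = (\<Sum>\<^sub>\<infinity>p\<in>UNIV. poincare_term N k t (lat_point t p) z)"

lemma lat_point_lat: "lat_point t p \<in> lat t"
  by (simp add: lat_point_def latI)

lemma lat_point_eq_0_iff: "t \<in> uhp \<Longrightarrow> lat_point t p = 0 \<longleftrightarrow> p = (0, 0)"
  by (cases p) (auto simp: lat_point_def complex_eq_iff uhp_def)

lemma norm_lat_point_ge:
  assumes "t \<in> uhp" "p \<noteq> (0, 0)"
  shows "min 1 (Im t) \<le> norm (lat_point t p)"
  using lat_small[OF assms(1) lat_point_lat, of p] lat_point_eq_0_iff[OF assms(1), of p] assms(2) by force

lemma lat_point_coeffs_le: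
  assumes t: "t \<in> uhp"
  shows "\<bar>of_int (fst p)\<bar> + \<bar>of_int (snd p)\<bar> \<le> (1 + (1 + norm t) / Im t) * norm (lat_point t p)"
proof -
  let ?w = "lat_point t p"
  note v = uhpD[OF t]
  have "\<bar>of_int (fst p)\<bar> * Im t \<le> norm ?w"
    using abs_Im_le_cmod[of ?w] v by (simp add: lat_point_def abs_mult)
  hence fst_le: "\<bar>of_int (fst p)\<bar> \<le> norm ?w / Im t" using v by (simp add: field_simps)
  have "norm (of_int (snd p) :: complex) = norm (?w - of_int (fst p) * t)" by (simp add: lat_point_def)
  also have "\<dots> \<le> norm ?w + \<bar>of_int (fst p)\<bar> * norm t"
    by (rule order_trans[OF norm_triangle_ineq4]) (simp add: norm_mult)
  also have "\<dots> \<le> norm ?w + norm ?w / Im t * norm t"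
    using fst_le by (intro add_left_mono mult_right_mono) auto
  finally show ?thesis using fst_le by (simp add: algebra_simps add_divide_distrib)
qed

lemma summable_on_times_nonneg:
  fixes f :: "'a \<Rightarrow> real" and g :: "'b \<Rightarrow> real"
  assumes "f summable_on A" "g summable_on B" "\<And>x. x \<in> A \<Longrightarrow> f x \<ge> 0" "\<And>y. y \<in> B \<Longrightarrow> g y \<ge> 0"
  shows "(\<lambda>p. f (fst p) * g (snd p)) summable_on (A \<times> B)"
proof (rule summable_on_SigmaI[where g="\<lambda>x. f x * infsum g B"])
  show "((\<lambda>y. f (fst (x, y)) * g (snd (x, y))) has_sum f x * infsum g B) B" for x
    using has_sum_cmult_right[of g B "infsum g B" "f x"] assms(2) by simp
  show "(\<lambda>x. f x * infsum g B) summable_on A" by (rule summable_on_cmult_left[OF assms(1)])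
qed (use assms in auto)

lemma gauss_lattice_summable:
  assumes t: "t \<in> uhp" and c: "c > 0"
  shows "(\<lambda>p. exp (- c * (norm (lat_point t p))\<^sup>2)) summable_on UNIV"
proof -
  define C where "C = 1 + (1 + norm t) / Im t"
  have C: "C > 0" using uhpD[OF t] by (auto simp: C_def intro!: add_pos_nonneg divide_nonneg_pos)
  define \<rho> where "\<rho> = exp (- c / C\<^sup>2)"
  have \<rho>: "0 \<le> \<rho>" "\<rho> < 1" using c C by (auto simp: \<rho>_def)
  have term_le: "exp (- c * (norm (lat_point t p))\<^sup>2) \<le> \<rho> ^ nat \<bar>fst p\<bar> * \<rho> ^ nat \<bar>snd p\<bar>" for p
  proof -
    define m where "m = nat \<bar>fst p\<bar> + nat \<bar>snd p\<bar>"
    have "real m \<le> C * norm (lat_point t p)"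
      using lat_point_coeffs_le[OF t, of p] by (simp add: m_def C_def)
    hence "(real m)\<^sup>2 \<le> (C * norm (lat_point t p))\<^sup>2" by (intro power_mono) auto
    moreover have "real m \<le> (real m)\<^sup>2"
      by (simp add: power2_eq_square) (metis le_square of_nat_le_iff of_nat_mult)
    ultimately have "real m \<le> C\<^sup>2 * (norm (lat_point t p))\<^sup>2" unfolding power_mult_distrib by linarith
    hence "real m / C\<^sup>2 \<le> (norm (lat_point t p))\<^sup>2" using C by (simp add: field_simps)
    hence "c * (real m / C\<^sup>2) \<le> c * (norm (lat_point t p))\<^sup>2" using c by (intro mult_left_mono) auto
    hence "exp (- c * (norm (lat_point t p))\<^sup>2) \<le> exp (real m * (- c / C\<^sup>2))" by (simp add: field_simps)
    also have "\<dots> = \<rho> ^ m" unfolding \<rho>_def by (rule exp_of_nat_mult)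
    finally show ?thesis by (simp add: m_def power_add)
  qed
  have "(\<lambda>p. (1 * \<rho> ^ nat \<bar>fst p\<bar>) * (1 * \<rho> ^ nat \<bar>snd p\<bar>)) summable_on (UNIV \<times> UNIV)"
    by (rule summable_on_times_nonneg[OF summable_int_geometric summable_int_geometric]) (use \<rho> in auto)
  hence "(\<lambda>p. \<rho> ^ nat \<bar>fst p\<bar> * \<rho> ^ nat \<bar>snd p\<bar>) summable_on UNIV" by simp
  thus ?thesis by (rule summable_on_comparison_test) (use term_le in auto)
qed

lemma Re_poincare_form_ge:
  assumes z: "norm z \<le> R"
  shows "(norm w)\<^sup>2 / 2 - 3 * R\<^sup>2 \<le> Re (poincare_form w z)"
proof -
  have "- Re (z\<^sup>2) \<le> R\<^sup>2"
    using abs_Re_le_cmod[of "z\<^sup>2"] power_mono[OF z, of 2] by (simp add: norm_power)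
  moreover have "- Re (2 * z * cnj w) \<le> 2 * R\<^sup>2 + (norm w)\<^sup>2 / 2"
  proof -
    have "- Re (2 * z * cnj w) \<le> norm (2 * z * cnj w)" using abs_Re_le_cmod[of "2 * z * cnj w"] by linarith
    also have "\<dots> \<le> 2 * R * norm w" unfolding norm_mult using z by (auto intro: mult_right_mono)
    also have "\<dots> \<le> 2 * R\<^sup>2 + (norm w)\<^sup>2 / 2"
      using sum_squares_bound[of "2 * R" "norm w"] by (simp add: power2_eq_square)
    finally show ?thesis .
  qed
  moreover have "Re (w * cnj w) = (norm w)\<^sup>2" by (simp add: complex_mult_cnj cmod_power2)
  ultimately show ?thesis unfolding poincare_form_def plus_complex.sel by linarith
qed

lemma poincare_majorant:
  assumes t: "t \<in> uhp" and \<epsilon>: "\<epsilon> > 0" and N: "N > 0"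
  shows "\<exists>M. M summable_on I \<and> (\<forall>p\<in>I. \<forall>z. norm z \<le> R \<longrightarrow> \<epsilon> \<le> norm (z + lat_point t p) \<longrightarrow>
    norm (poincare_term N k t (lat_point t p) z) \<le> M p)"
proof (intro exI conjI ballI allI impI)
  let ?\<alpha> = "pi * real N / Im t"
  let ?M = "\<lambda>p. exp (?\<alpha> * (3 * R\<^sup>2)) / \<epsilon> ^ k * exp (- (?\<alpha> / 2) * (norm (lat_point t p))\<^sup>2)"
  have \<alpha>: "?\<alpha> > 0" using uhpD[OF t] N by simp
  hence "(\<lambda>p. exp (- (?\<alpha> / 2) * (norm (lat_point t p))\<^sup>2)) summable_on I"
    by (intro summable_on_subset[OF gauss_lattice_summable[OF t]]) auto
  thus "?M summable_on I" by (rule summable_on_cmult_right)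
  fix p z assume z: "norm z \<le> R" "\<epsilon> \<le> norm (z + lat_point t p)"
  let ?w = "lat_point t p"
  have "?\<alpha> * ((norm ?w)\<^sup>2 / 2 - 3 * R\<^sup>2) \<le> ?\<alpha> * Re (poincare_form ?w z)"
    using \<alpha> by (intro mult_left_mono Re_poincare_form_ge z) auto
  hence "Re (- of_real ?\<alpha> * poincare_form ?w z) \<le> ?\<alpha> * (3 * R\<^sup>2) + - (?\<alpha> / 2) * (norm ?w)\<^sup>2"
    by (simp add: algebra_simps)
  hence "norm (poincare_term N k t ?w z) \<le> exp (?\<alpha> * (3 * R\<^sup>2) + - (?\<alpha> / 2) * (norm ?w)\<^sup>2) / \<epsilon> ^ k"
    unfolding poincare_term_def norm_divide norm_exp_eq_Re norm_power
    using z(2) \<epsilon> by (intro frac_le power_mono) auto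
  thus "norm (poincare_term N k t ?w z) \<le> ?M p" by (simp only: exp_add) simp
qed

lemma lat_point_distance:
  assumes t: "t \<in> uhp" "z \<notin> lat t"
  obtains r where "r > 0" "cball z r \<subseteq> - lat t" "\<And>w p. w \<in> cball z r \<Longrightarrow> r \<le> norm (w + lat_point t p)"
proof -
  obtain e where e: "e > 0" "cball z e \<subseteq> - lat t"
    using open_contains_cball[of "- lat t"] open_lat[OF t(1)] t(2) by auto
  show ?thesis
  proof (rule that[of "e / 2"])
    show "cball z (e / 2) \<subseteq> - lat t" using e by (auto simp: subset_iff)
    fix w p assume "w \<in> cball z (e / 2)"
    hence "norm (z - w) \<le> e / 2" by (simp add: dist_norm)
    moreover have "- lat_point t p \<in> lat t" by (simp add: lat_point_lat)
    hence "- lat_point t p \<notin> cball z e" using e(2) by auto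
    hence "e < norm (z + lat_point t p)" by (simp add: dist_norm)
    moreover have "norm (z + lat_point t p) \<le> norm (z - w) + norm (w + lat_point t p)"
      using norm_triangle_ineq[of "z - w" "w + lat_point t p"] by simp
    ultimately show "e / 2 \<le> norm (w + lat_point t p)" by linarith
  qed (use e in auto)
qed

lemma poincare_holomorphic:
  assumes t: "t \<in> uhp" and N: "N > 0"
  shows "poincare N k t holomorphic_on (- lat t)"
  unfolding poincare_def[abs_def]
proof (rule infsum_holomorphic[OF open_lat[OF t]])
  fix p
  have "z + lat_point t p \<noteq> 0" if "z \<in> - lat t" for z
    using that lat_minus[OF lat_point_lat, of t p] by (auto simp: eq_neg_iff_add_eq_0[symmetric])
  thus "poincare_term N k t (lat_point t p) holomorphic_on (- lat t)"
    unfolding poincare_term_def[abs_def] poincare_form_def by (intro holomorphic_intros) auto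
next
  fix z assume "z \<in> - lat t"
  then obtain r where r: "r > 0" "cball z r \<subseteq> - lat t" "\<And>w p. w \<in> cball z r \<Longrightarrow> r \<le> norm (w + lat_point t p)"
    using lat_point_distance[OF t, of z] by blast
  obtain M where M: "M summable_on UNIV" "\<And>p w. norm w \<le> norm z + r \<Longrightarrow> r \<le> norm (w + lat_point t p) \<Longrightarrow>
      norm (poincare_term N k t (lat_point t p) w) \<le> M p"
    using poincare_majorant[OF t r(1) N, of UNIV "norm z + r" k] by blast
  have "norm w \<le> norm z + r" if "w \<in> cball z r" for w
    using that norm_triangle_ineq2[of w z] by (simp add: dist_norm norm_minus_commute)
  thus "\<exists>r>0. \<exists>M. cball z r \<subseteq> - lat t \<and> M summable_on UNIV \<and>
      (\<forall>p\<in>UNIV. \<forall>w\<in>cball z r. norm (poincare_term N k t (lat_point t p) w) \<le> M p)"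
    using r M by (intro exI[of _ r] conjI exI[of _ M]) auto
qed

lemma poincare_minus_main_term_bounded:
  assumes t: "t \<in> uhp" and N: "N > 0"
  defines "\<delta> \<equiv> min 1 (Im t)"
  shows "\<exists>B. \<forall>z\<in>ball 0 (\<delta> / 2). norm (poincare N k t z - poincare_term N k t 0 z) \<le> B"
proof -
  define I where "I = UNIV - {(0::int, 0::int)}"
  have \<delta>: "\<delta> > 0" using uhpD[OF t] by (simp add: \<delta>_def)
  obtain M where M: "M summable_on I" "\<And>p z. p \<in> I \<Longrightarrow> norm z \<le> \<delta> / 2 \<Longrightarrow> \<delta> / 2 \<le> norm (z + lat_point t p) \<Longrightarrow>
      norm (poincare_term N k t (lat_point t p) z) \<le> M p"
    using poincare_majorant[OF t _ N, of "\<delta> / 2" I "\<delta> / 2" k] \<delta> by auto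
  have "norm (poincare N k t z - poincare_term N k t 0 z) \<le> infsum M I" if z: "z \<in> ball 0 (\<delta> / 2)" for z
  proof -
    have term_le: "norm (poincare_term N k t (lat_point t p) z) \<le> M p" if "p \<in> I" for p
    proof (rule M(2)[OF that])
      have "\<delta> \<le> norm (lat_point t p)"
        unfolding \<delta>_def using that by (intro norm_lat_point_ge[OF t]) (simp add: I_def)
      thus "\<delta> / 2 \<le> norm (z + lat_point t p)"
        using z norm_triangle_ineq2[of "lat_point t p" "- z"] by (simp add: add.commute)
    qed (use z in simp)
    have summable: "(\<lambda>p. norm (poincare_term N k t (lat_point t p) z)) summable_on I"
      by (rule summable_on_comparison_test[OF M(1)]) (use term_le in auto)
    hence "poincare N k t z = poincare_term N k t 0 z + (\<Sum>\<^sub>\<infinity>p\<in>I. poincare_term N k t (lat_point t p) z)"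
      using infsum_insert[of "\<lambda>p. poincare_term N k t (lat_point t p) z" I "(0, 0)"]
      by (simp add: poincare_def I_def insert_absorb lat_point_def summable_on_iff_abs_summable_on_complex)
    hence "norm (poincare N k t z - poincare_term N k t 0 z) \<le> (\<Sum>\<^sub>\<infinity>p\<in>I. norm (poincare_term N k t (lat_point t p) z))"
      using norm_infsum_bound[OF summable] by simp
    also have "\<dots> \<le> infsum M I" by (rule infsum_mono[OF summable M(1) term_le])
    finally show ?thesis .
  qed
  thus ?thesis by blast
qed

lemma poincare_limit:
  assumes t: "t \<in> uhp" and N: "N > 0" and k: "k > 0"
  shows "((\<lambda>z. z ^ k * poincare N k t z) \<longlongrightarrow> 1) (at 0)"
proof -
  define r where "r = min 1 (Im t) / 2"
  have "r > 0" using uhpD[OF t] by (simp add: r_def)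
  hence punctured: "\<forall>\<^sub>F z in at 0. z \<in> ball 0 r - {0}" by (intro eventually_at_in_open) auto
  obtain B where B: "\<And>z. z \<in> ball 0 r \<Longrightarrow> norm (poincare N k t z - poincare_term N k t 0 z) \<le> B"
    using poincare_minus_main_term_bounded[OF t N, of k] unfolding r_def by blast
  have "((\<lambda>z. z ^ k * (poincare N k t z - poincare_term N k t 0 z)) \<longlongrightarrow> 0) (at 0)"
  proof (rule Lim_null_comparison)
    show "\<forall>\<^sub>F z in at 0. norm (z ^ k * (poincare N k t z - poincare_term N k t 0 z)) \<le> norm z ^ k * B"
      using punctured by eventually_elim (use B in \<open>auto simp: norm_mult norm_power intro!: mult_left_mono\<close>)
    show "((\<lambda>z::complex. norm z ^ k * B) \<longlongrightarrow> 0) (at 0)" using k by (auto intro!: tendsto_eq_intros)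
  qed
  moreover have "((\<lambda>z. z ^ k * poincare_term N k t 0 z) \<longlongrightarrow> 1) (at 0)"
  proof (rule Lim_transform_eventually)
    show "((\<lambda>z::complex. exp (- of_real (pi * real N / Im t) * z\<^sup>2)) \<longlongrightarrow> 1) (at 0)"
      using uhpD[OF t] by (auto intro!: tendsto_eq_intros)
    show "\<forall>\<^sub>F z in at 0. exp (- of_real (pi * real N / Im t) * z\<^sup>2) = z ^ k * poincare_term N k t 0 z"
      using punctured by eventually_elim (simp add: poincare_term_def poincare_form_def)
  qed
  ultimately have "((\<lambda>z. z ^ k * (poincare N k t z - poincare_term N k t 0 z) + z ^ k * poincare_term N k t 0 z) \<longlongrightarrow> 0 + 1) (at 0)"
    by (rule tendsto_add)
  thus ?thesis by (simp add: algebra_simps)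
qed

lemma exp_pi_N:
  assumes "v \<noteq> 0"
  shows "exp (- of_real (pi * real N / v) * (2 * \<i> * of_real v * x)) = ee (- (of_nat N * x))"
  unfolding ee_def using assms by (intro arg_cong[of _ _ exp]) (simp add: field_simps)

lemma diff_cnj: "t - cnj t = 2 * \<i> * of_real (Im t)"
  by (simp add: complex_eq_iff)

lemma poincare_term_shift:
  assumes v: "Im t \<noteq> 0" and x: "2 * z * (a - cnj a) + a * (a - cnj a) + (a * cnj w - w * cnj a) = 2 * \<i> * of_real (Im t) * x"
  shows "poincare_term N k t (w - a) (z + a) = ee (- (of_nat N * x)) * poincare_term N k t w z"
proof -
  have "poincare_form (w - a) (z + a) = 2 * \<i> * of_real (Im t) * x + poincare_form w z"
    unfolding x[symmetric] poincare_form_def by (simp add: power2_eq_square algebra_simps)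
  hence "exp (- of_real (pi * real N / Im t) * poincare_form (w - a) (z + a)) =
      ee (- (of_nat N * x)) * exp (- of_real (pi * real N / Im t) * poincare_form w z)"
    by (simp only: distrib_left exp_add exp_pi_N[OF v])
  thus ?thesis by (simp add: poincare_term_def)
qed

lemma poincare_add_1:
  assumes t: "t \<in> uhp"
  shows "poincare N k t (z + 1) = poincare N k t z"
  unfolding poincare_def
proof (rule infsum_reindex_bij_witness[where i="\<lambda>p. (fst p, snd p - 1)" and j="\<lambda>p. (fst p, snd p + 1)"])
  fix p :: "int \<times> int"
  let ?w = "lat_point t (fst p, snd p + 1)"
  have "2 * z * (1 - cnj 1) + 1 * (1 - cnj 1) + (1 * cnj ?w - ?w * cnj 1) = - (of_int (fst p) * (t - cnj t))"
    by (simp add: lat_point_def algebra_simps)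
  hence "poincare_term N k t (?w - 1) (z + 1) = ee (- (of_nat N * - of_int (fst p))) * poincare_term N k t ?w z"
    using uhpD[OF t] by (intro poincare_term_shift) (simp_all add: diff_cnj)
  moreover have "?w - 1 = lat_point t p" by (simp add: lat_point_def)
  moreover have "ee (- (of_nat N * - of_int (fst p))) = 1" using ee_of_int[of "int N * fst p"] by simp
  ultimately show "poincare_term N k t ?w z = poincare_term N k t (lat_point t p) (z + 1)" by simp
qed auto

lemma poincare_add_t:
  assumes t: "t \<in> uhp"
  shows "poincare N k t (z + t) = ee (- (of_nat N * t) - of_nat (2 * N) * z) * poincare N k t z"
  unfolding poincare_def infsum_cmult_right'[symmetric]
proof (rule infsum_reindex_bij_witness[where i="\<lambda>p. (fst p - 1, snd p)" and j="\<lambda>p. (fst p + 1, snd p)"])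
  fix p :: "int \<times> int"
  let ?w = "lat_point t (fst p + 1, snd p)"
  have "2 * z * (t - cnj t) + t * (t - cnj t) + (t * cnj ?w - ?w * cnj t) = (t - cnj t) * (2 * z + t + of_int (snd p))"
    by (simp add: lat_point_def algebra_simps)
  hence "poincare_term N k t (?w - t) (z + t) = ee (- (of_nat N * (2 * z + t + of_int (snd p)))) * poincare_term N k t ?w z"
    using uhpD[OF t] by (intro poincare_term_shift) (simp_all add: diff_cnj)
  moreover have "?w - t = lat_point t p" by (simp add: lat_point_def algebra_simps)
  moreover have "- (of_nat N * (2 * z + t + of_int (snd p))) = (- (of_nat N * t) - of_nat (2 * N) * z) + of_int (- (int N * snd p))"
    by (simp add: algebra_simps)
  hence "ee (- (of_nat N * (2 * z + t + of_int (snd p)))) = ee (- (of_nat N * t) - of_nat (2 * N) * z)"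
    by (simp only: ee_add ee_of_int mult_1_right)
  ultimately show "ee (- (of_nat N * t) - of_nat (2 * N) * z) * poincare_term N k t ?w z =
      poincare_term N k t (lat_point t p) (z + t)" by simp
qed auto

lemma poincare_minus: "poincare N k t (- z) = (- 1) ^ k * poincare N k t z"
  unfolding poincare_def infsum_cmult_right'[symmetric]
proof (rule infsum_reindex_bij_witness[where i="\<lambda>p. (- fst p, - snd p)" and j="\<lambda>p. (- fst p, - snd p)"])
  fix p :: "int \<times> int"
  have minus: "lat_point t (- fst p, - snd p) = - lat_point t p" by (simp add: lat_point_def)
  have "- z + lat_point t p = - (z - lat_point t p)" by simp
  hence "(- z + lat_point t p) ^ k = (- 1) ^ k * (z - lat_point t p) ^ k" by (metis power_minus)
  thus "(- 1) ^ k * poincare_term N k t (lat_point t (- fst p, - snd p)) z = poincare_term N k t (lat_point t p) (- z)"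
    unfolding minus poincare_term_def poincare_form_def by (auto simp: divide_simps minus_one_power_iff)
qed auto

lemma poincare_T: "poincare N k (t + 1) z = poincare N k t z"
  unfolding poincare_def
proof (rule infsum_reindex_bij_witness[where i="\<lambda>p. (fst p, snd p - fst p)" and j="\<lambda>p. (fst p, snd p + fst p)"])
  fix p :: "int \<times> int"
  have "lat_point (t + 1) p = lat_point t (fst p, snd p + fst p)" by (simp add: lat_point_def algebra_simps)
  thus "poincare_term N k t (lat_point t (fst p, snd p + fst p)) z = poincare_term N k (t + 1) (lat_point (t + 1) p) z"
    by (simp add: poincare_term_def)
qed auto

lemma poincare_form_divide:
  assumes "t \<noteq> 0"
  shows "t * cnj t * poincare_form (w / t) (z / t) = poincare_form w z + 2 * \<i> * of_real (Im t) * (- (z\<^sup>2 / t))"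
proof -
  have "t * cnj t * poincare_form (w / t) (z / t) = z\<^sup>2 * cnj t / t + 2 * z * cnj w + w * cnj w"
    using assms by (simp add: poincare_form_def field_simps power2_eq_square)
  also have "z\<^sup>2 * cnj t / t = z\<^sup>2 + (t - cnj t) * (- (z\<^sup>2 / t))" using assms by (simp add: field_simps)
  finally show ?thesis unfolding diff_cnj poincare_form_def by simp
qed

lemma poincare_S:
  assumes t: "t \<in> uhp"
  shows "poincare N k (- 1 / t) (z / t) = t ^ k * ee (of_nat N * z\<^sup>2 / t) * poincare N k t z"
  unfolding poincare_def infsum_cmult_right'[symmetric]
proof (rule infsum_reindex_bij_witness[where i="\<lambda>p. (- snd p, fst p)" and j="\<lambda>p. (snd p, - fst p)"])
  fix p :: "int \<times> int"
  note nonzero = uhp_nonzero[OF t]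
  let ?w = "lat_point t (snd p, - fst p)" and ?K = "complex_of_real (pi * real N / Im t)"
  have lat: "lat_point (- 1 / t) p = ?w / t" using nonzero by (simp add: lat_point_def field_simps)
  have "Im (- 1 / t) = Im t / (norm t)\<^sup>2" by (simp add: Im_divide cmod_power2)
  hence width: "complex_of_real (pi * real N / Im (- 1 / t)) = ?K * (t * cnj t)"
    by (simp add: complex_norm_square[symmetric])
  have "exp (- of_real (pi * real N / Im (- 1 / t)) * poincare_form (?w / t) (z / t)) =
      exp (- ?K * (t * cnj t * poincare_form (?w / t) (z / t)))"
    unfolding width by (simp only: mult_minus_left mult.assoc)
  also have "\<dots> = exp (- ?K * poincare_form ?w z) * ee (- (of_nat N * - (z\<^sup>2 / t)))"
    unfolding poincare_form_divide[OF nonzero] distrib_left exp_add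
    using uhpD[OF t] by (simp only: exp_pi_N)
  finally have gauss: "exp (- of_real (pi * real N / Im (- 1 / t)) * poincare_form (?w / t) (z / t)) =
      exp (- ?K * poincare_form ?w z) * ee (of_nat N * z\<^sup>2 / t)" by simp
  have "(z / t + ?w / t) ^ k = (z + ?w) ^ k / t ^ k" by (simp add: power_divide flip: add_divide_distrib)
  thus "t ^ k * ee (of_nat N * z\<^sup>2 / t) * poincare_term N k t ?w z = poincare_term N k (- 1 / t) (lat_point (- 1 / t) p) (z / t)"
    unfolding lat poincare_term_def gauss using nonzero by simp
qed auto

section \<open>Fourier expansions\<close>

definition period_int :: "(complex \<Rightarrow> complex) \<Rightarrow> complex \<Rightarrow> complex \<Rightarrow> complex" where
  "period_int G z p = integral {0..1} (\<lambda>x. G (z + of_real x * p))"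

lemma period_int_continuous:
  assumes "G holomorphic_on UNIV"
  shows "continuous_on A (\<lambda>x::real. G (z + of_real x * p))"
  by (rule continuous_on_compose2[OF holomorphic_on_imp_continuous_on[OF assms]]) (auto intro!: continuous_intros)

lemma period_int_primitive:
  assumes H: "\<And>z. (H has_field_derivative G z) (at z)" and p: "p \<noteq> 0"
  shows "period_int G z p = (H (z + p) - H z) / p"
proof -
  have "((\<lambda>x. H (z + of_real x * p) / p) has_vector_derivative G (z + of_real x * p)) (at x within {0..1})" for x
  proof -
    have "((\<lambda>w. H (z + w * p) / p) has_field_derivative G (z + of_real x * p)) (at (of_real x))"
      using p by (auto intro!: derivative_eq_intros DERIV_chain2[OF H])
    from has_vector_derivative_real_field[OF this] show ?thesis by (rule has_vector_derivative_at_within)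
  qed
  hence "((\<lambda>x. G (z + of_real x * p)) has_integral (H (z + of_real 1 * p) / p - H (z + of_real 0 * p) / p)) {0..1}"
    by (intro fundamental_theorem_of_calculus) auto
  thus ?thesis unfolding period_int_def by (simp add: integral_unique diff_divide_distrib)
qed

lemma period_int_const:
  assumes G: "G holomorphic_on UNIV" and p: "p \<noteq> 0" and periodic: "\<And>z. G (z + p) = G z"
  shows "period_int G z p = period_int G w p"
proof -
  obtain H where H: "\<And>z. (H has_field_derivative G z) (at z)"
    using holomorphic_convex_primitive'[OF convex_UNIV open_UNIV G] by auto
  have "((\<lambda>z. H (z + p) - H z) has_field_derivative G (z + p) * 1 - G z) (at z)" for z
    by (intro DERIV_diff DERIV_chain2[OF H] H) (auto intro!: derivative_eq_intros)
  hence "\<exists>c. \<forall>z\<in>UNIV. H (z + p) - H z = c"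
    by (intro has_field_derivative_zero_constant) (auto simp: periodic)
  thus ?thesis unfolding period_int_primitive[OF H p] by auto
qed

definition fourier_coeff :: "(complex \<Rightarrow> complex) \<Rightarrow> int \<Rightarrow> complex" where
  "fourier_coeff F n = period_int (\<lambda>z. F z * ee (- (of_int n * z))) 0 1"

lemma fourier_coeff_height:
  assumes F: "F holomorphic_on UNIV" and periodic: "\<And>z. F (z + 1) = F z"
  shows "fourier_coeff F n = period_int (\<lambda>z. F z * ee (- (of_int n * z))) w 1"
  unfolding fourier_coeff_def
proof (rule period_int_const)
  show "(\<lambda>z. F z * ee (- (of_int n * z))) holomorphic_on UNIV"
    by (intro holomorphic_intros F ee_holomorphic)
  fix z :: complex
  have "- (of_int n * (z + 1)) = - (of_int n * z) + of_int (- n)" by (simp add: algebra_simps)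
  thus "F (z + 1) * ee (- (of_int n * (z + 1))) = F z * ee (- (of_int n * z))"
    by (simp only: periodic ee_add ee_of_int mult_1_right)
qed simp

lemma norm_period_int_le:
  assumes "G holomorphic_on UNIV" "\<And>x. x \<in> {0..1} \<Longrightarrow> norm (G (z + of_real x * p)) \<le> B"
  shows "norm (period_int G z p) \<le> B"
  unfolding period_int_def
  using integral_bound[of 0 1 "\<lambda>x. G (z + of_real x * p)" B] period_int_continuous[OF assms(1)] assms(2)
  by simp

lemma period_int_cmult: "period_int (\<lambda>z. c * G z) z p = c * period_int G z p"
  by (simp add: period_int_def)

lemma fourier_coeff_cmult: "fourier_coeff (\<lambda>z. c * F z) n = c * fourier_coeff F n"
  unfolding fourier_coeff_def mult.assoc by (rule period_int_cmult)

lemma fourier_coeff_diff: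
  assumes "F holomorphic_on UNIV" "G holomorphic_on UNIV"
  shows "fourier_coeff (\<lambda>z. F z - G z) n = fourier_coeff F n - fourier_coeff G n"
  unfolding fourier_coeff_def period_int_def left_diff_distrib
  by (intro integral_diff integrable_continuous_interval continuous_on_mult period_int_continuous[OF assms(1)]
      period_int_continuous[OF assms(2)] ee_continuous continuous_intros)

lemma fourier_coeff_exp: "fourier_coeff (\<lambda>z. ee (of_int m * z)) n = (if m = n then 1 else 0)"
proof -
  have "of_int m * z + - (of_int n * z) = of_int (m - n) * z" for z :: complex by (simp add: algebra_simps)
  hence eq: "fourier_coeff (\<lambda>z. ee (of_int m * z)) n = period_int (\<lambda>z. ee (of_int (m - n) * z)) 0 1"
    unfolding fourier_coeff_def by (simp only: ee_add[symmetric])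
  show ?thesis
  proof (cases "m = n")
    case True
    thus ?thesis unfolding eq by (simp add: period_int_def)
  next
    case False
    hence "((\<lambda>z. ee (of_int (m - n) * z) / (tpi * of_int (m - n))) has_field_derivative ee (of_int (m - n) * z)) (at z)" for z
      using DERIV_cdivide[OF ee_has_field_derivative[of "of_int (m - n)" z UNIV], of "tpi * of_int (m - n)"]
      by simp
    from period_int_primitive[OF this, of 1 0] show ?thesis
      unfolding eq using False ee_of_int[of "m - n"] by (simp del: of_int_diff)
  qed
qed

lemma fourier_coeff_ee_times: "fourier_coeff (\<lambda>z. ee z * F z) n = fourier_coeff F (n - 1)"
proof -
  have "ee z * F z * ee (- (of_int n * z)) = F z * ee (- (of_int (n - 1) * z))" for z
  proof -
    have "ee z * ee (- (of_int n * z)) = ee (- (of_int (n - 1) * z))"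
      by (simp add: ee_add[symmetric] algebra_simps)
    thus ?thesis by (metis mult.assoc mult.commute)
  qed
  thus ?thesis by (simp only: fourier_coeff_def)
qed

lemma fourier_coeff_bound:
  assumes F: "F holomorphic_on UNIV" and periodic: "\<And>z. F (z + 1) = F z"
  shows "\<exists>M. \<forall>n. norm (fourier_coeff F n) \<le> M * exp (2 * pi * of_int n * Y)"
proof -
  have "compact ((\<lambda>x. F (\<i> * of_real Y + of_real x * 1)) ` {0..1::real})"
    by (intro compact_continuous_image period_int_continuous[OF F]) auto
  from compact_imp_bounded[OF this] obtain M
    where M: "\<And>x. x \<in> {0..1::real} \<Longrightarrow> norm (F (\<i> * of_real Y + of_real x * 1)) \<le> M"
    unfolding bounded_iff by (meson imageI)
  have "norm (fourier_coeff F n) \<le> M * exp (2 * pi * of_int n * Y)" for n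
    unfolding fourier_coeff_height[OF F periodic, of n "\<i> * of_real Y"]
  proof (rule norm_period_int_le)
    show "(\<lambda>z. F z * ee (- (of_int n * z))) holomorphic_on UNIV"
      by (intro holomorphic_intros F ee_holomorphic)
    fix x :: real assume "x \<in> {0..1}"
    from M[OF this]
    show "norm (F (\<i> * of_real Y + of_real x * 1) * ee (- (of_int n * (\<i> * of_real Y + of_real x * 1)))) \<le> M * exp (2 * pi * of_int n * Y)"
      by (simp add: norm_mult norm_ee mult_right_mono mult.assoc)
  qed
  thus ?thesis by blast
qed

lemma ee_eq_iff: "ee z = ee w \<longleftrightarrow> z - w \<in> \<int>"
  using ee_eq_1_iff[of "z - w"] by (simp add: ee_diff)

lemma eq_0_if_exp_decay:
  fixes x :: complex
  assumes "\<And>n::nat. norm x \<le> M * exp (- 2 * pi * real n)"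
  shows "x = 0"
proof -
  have "(\<lambda>n. M * exp (- 2 * pi * real n)) \<longlonglongrightarrow> 0" by real_asymp
  hence "norm x \<le> 0" by (rule LIMSEQ_le_const) (use assms in auto)
  thus ?thesis by simp
qed

lemma forward_recursion_eq_0:
  fixes a :: "int \<Rightarrow> complex" and z\<^sub>0 :: complex
  assumes recursion: "\<And>n. n > 0 \<Longrightarrow> a (n - 1) = ee z\<^sub>0 * a n"
    and bound: "\<And>n. norm (a n) \<le> M * exp (2 * pi * of_int n * (Im z\<^sub>0 - 1))"
  shows "a 0 = 0"
proof (rule eq_0_if_exp_decay)
  fix n :: nat
  have "a 0 = ee z\<^sub>0 ^ n * a (int n)"
  proof (induction n)
    case (Suc n)
    have "a (int n) = ee z\<^sub>0 * a (int (Suc n))" using recursion[of "int (Suc n)"] by simp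
    with Suc.IH show ?case by simp
  qed simp
  hence "norm (a 0) \<le> norm (ee z\<^sub>0) ^ n * (M * exp (2 * pi * of_int (int n) * (Im z\<^sub>0 - 1)))"
    by (simp only: norm_mult norm_power) (intro mult_left_mono bound, simp)
  also have "\<dots> = M * exp (real n * (- 2 * pi * Im z\<^sub>0) + 2 * pi * real n * (Im z\<^sub>0 - 1))"
    unfolding norm_ee exp_add exp_of_nat_mult by simp
  also have "real n * (- 2 * pi * Im z\<^sub>0) + 2 * pi * real n * (Im z\<^sub>0 - 1) = - 2 * pi * real n"
    by (simp add: algebra_simps)
  finally show "norm (a 0) \<le> M * exp (- 2 * pi * real n)" .
qed

lemma backward_recursion_eq_0:
  fixes a :: "int \<Rightarrow> complex" and z\<^sub>0 :: complex
  assumes recursion: "\<And>n. n < 0 \<Longrightarrow> a (n - 1) = ee z\<^sub>0 * a n"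
    and bound: "\<And>n. norm (a n) \<le> M * exp (2 * pi * of_int n * (Im z\<^sub>0 + 1))"
  shows "a (- 1) = 0"
proof (rule eq_0_if_exp_decay)
  fix n :: nat
  have "a (- 1 - int n) = ee z\<^sub>0 ^ n * a (- 1)"
  proof (induction n)
    case (Suc n)
    have "a (- 1 - int (Suc n)) = ee z\<^sub>0 * a (- 1 - int n)"
      using recursion[of "- 1 - int n"] by (simp add: algebra_simps)
    with Suc.IH show ?case by simp
  qed simp
  hence "norm (a (- 1)) = inverse (norm (ee z\<^sub>0) ^ n) * norm (a (- 1 - int n))"
    by (simp add: norm_mult norm_power)
  also have "\<dots> \<le> inverse (norm (ee z\<^sub>0) ^ n) * (M * exp (2 * pi * of_int (- 1 - int n) * (Im z\<^sub>0 + 1)))"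
    by (intro mult_left_mono bound) auto
  also have "\<dots> = M * exp (- (real n * (- 2 * pi * Im z\<^sub>0)) + 2 * pi * of_int (- 1 - int n) * (Im z\<^sub>0 + 1))"
    unfolding norm_ee exp_add exp_minus exp_of_nat_mult by simp
  also have "- (real n * (- 2 * pi * Im z\<^sub>0)) + 2 * pi * of_int (- 1 - int n) * (Im z\<^sub>0 + 1) =
      - 2 * pi * (Im z\<^sub>0 + 1) + - 2 * pi * real n" by (simp add: algebra_simps)
  finally show "norm (a (- 1)) \<le> M * exp (- 2 * pi * (Im z\<^sub>0 + 1)) * exp (- 2 * pi * real n)"
    by (simp only: exp_add mult.assoc)
qed

text \<open>With \<open>H(z) = (F(z) - F(z\<^sub>0)) / (e(z) - e(z\<^sub>0))\<close>, the coefficients of \<open>H\<close> satisfy a first order recursion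
  whose only solution compatible with their decay is \<open>0\<close>.\<close>

context
  fixes F :: "complex \<Rightarrow> complex" and z\<^sub>0 :: complex
  assumes F: "F holomorphic_on UNIV" and periodic: "\<And>z. F (z + 1) = F z"
begin

abbreviation (input) translates :: "complex set" where "translates \<equiv> {z. z - z\<^sub>0 \<in> \<int>}"

definition exp_quotient :: "complex \<Rightarrow> complex" where
  "exp_quotient = remove_sings (\<lambda>z. (F z - F z\<^sub>0) / (ee z - ee z\<^sub>0))"

lemma periodic_int: "F (z + of_int k) = F z"
proof (induction k rule: int_induct[of _ 0])
  case (step1 i) thus ?case using periodic[of "z + of_int i"] by (simp add: add.assoc)
next
  case (step2 i) thus ?case using periodic[of "z + of_int (i - 1)"] by (simp add: add.assoc)
qed simp

lemma translates_sparse: "translates sparse_in A"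
proof (rule discrete_imp_sparse_in[of 1])
  fix w w' assume "w \<in> translates" "w' \<in> translates" "dist w' w < 1"
  moreover from this have "w' - w \<in> \<int>" using Ints_diff[of "w' - z\<^sub>0" "w - z\<^sub>0"] by simp
  then obtain k :: int where k: "w' - w = of_int k" by (auto elim: Ints_cases)
  ultimately have "\<bar>of_int k\<bar> < (1::real)" by (simp add: dist_norm)
  hence "k = 0" by linarith
  with k show "w' = w" by simp
qed simp

lemma exp_difference_quotient_limit:
  assumes w: "w \<in> translates"
  shows "((\<lambda>z. (z - w) * ((F z - F z\<^sub>0) / (ee z - ee z\<^sub>0))) \<longlongrightarrow> 0) (at w)"
proof -
  obtain k :: int where "w - z\<^sub>0 = of_int k" using w by (auto elim: Ints_cases)
  hence "w = z\<^sub>0 + of_int k" by (simp add: algebra_simps)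
  hence "F w = F z\<^sub>0" using periodic_int by simp
  moreover have "((\<lambda>z. F z - F z\<^sub>0) \<longlongrightarrow> F w - F z\<^sub>0) (at w)"
    using entire_isCont[OF F, of w] by (intro tendsto_intros) (simp add: isCont_def)
  ultimately have "((\<lambda>z. F z - F z\<^sub>0) \<longlongrightarrow> 0) (at w)" by simp
  moreover have "((\<lambda>z. (ee z - ee w) / (z - w)) \<longlongrightarrow> tpi * ee w) (at w)"
    using ee_has_field_derivative[of 1 w UNIV] by (simp add: has_field_derivative_iff)
  ultimately have "((\<lambda>z. (F z - F z\<^sub>0) / ((ee z - ee w) / (z - w))) \<longlongrightarrow> 0 / (tpi * ee w)) (at w)"
    by (rule tendsto_divide) simp
  moreover have "ee w = ee z\<^sub>0" using w by (simp add: ee_eq_iff)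
  ultimately show ?thesis by (simp add: mult.commute)
qed

lemma exp_quotient_holomorphic: "exp_quotient holomorphic_on UNIV"
  and exp_quotient_eq: "z \<notin> translates \<Longrightarrow> exp_quotient z = (F z - F z\<^sub>0) / (ee z - ee z\<^sub>0)"
proof -
  have "F holomorphic_on - translates" by (rule holomorphic_on_subset[OF F]) auto
  hence "(\<lambda>z. (F z - F z\<^sub>0) / (ee z - ee z\<^sub>0)) holomorphic_on - translates"
    by (intro holomorphic_intros ee_holomorphic[of "\<lambda>z. z"]) (auto simp: ee_eq_iff)
  note removable = remove_sings_entire[OF translates_sparse this exp_difference_quotient_limit, folded exp_quotient_def]
  show "exp_quotient holomorphic_on UNIV" by (rule removable(1))
  show "z \<notin> translates \<Longrightarrow> exp_quotient z = (F z - F z\<^sub>0) / (ee z - ee z\<^sub>0)" by (rule removable(2))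
qed

lemma eventually_not_translates: "\<forall>\<^sub>F z in at w. z \<notin> translates"
  using translates_sparse[of UNIV] by (simp add: sparse_in_eventually_iff)

lemma exp_quotient_add_1: "exp_quotient (z + 1) = exp_quotient z"
proof (rule isCont_eq_eventually[of z "\<lambda>z. exp_quotient (z + 1)" exp_quotient])
  note continuous = entire_isCont[OF exp_quotient_holomorphic]
  have "z + 1 \<in> translates \<longleftrightarrow> z \<in> translates" for z
    using Ints_add[of "z - z\<^sub>0" 1] Ints_diff[of "z + 1 - z\<^sub>0" 1] by (auto simp: algebra_simps)
  thus "\<forall>\<^sub>F z in at z. exp_quotient (z + 1) = exp_quotient z"
    using eventually_not_translates[of z]
    by (auto simp: exp_quotient_eq periodic ee_add elim: eventually_mono)
  show "isCont (\<lambda>z. exp_quotient (z + 1)) z" "isCont exp_quotient z"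
    by (auto intro!: isCont_o2[OF _ continuous] continuous_intros continuous)
qed

lemma exp_quotient_relation: "ee z * exp_quotient z - ee z\<^sub>0 * exp_quotient z = F z - F z\<^sub>0"
proof (rule isCont_eq_eventually[of z "\<lambda>z. ee z * exp_quotient z - ee z\<^sub>0 * exp_quotient z" "\<lambda>z. F z - F z\<^sub>0"])
  show "\<forall>\<^sub>F z in at z. ee z * exp_quotient z - ee z\<^sub>0 * exp_quotient z = F z - F z\<^sub>0"
    using eventually_not_translates[of z]
  proof eventually_elim
    case (elim z)
    hence "exp_quotient z * (ee z - ee z\<^sub>0) = F z - F z\<^sub>0" by (simp add: exp_quotient_eq ee_eq_iff)
    thus ?case by (simp add: algebra_simps)
  qed
qed (auto intro!: continuous_intros entire_isCont[OF exp_quotient_holomorphic] entire_isCont[OF F] simp: ee_def)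

lemma fourier_coeff_exp_quotient:
  "fourier_coeff exp_quotient (n - 1) - ee z\<^sub>0 * fourier_coeff exp_quotient n = fourier_coeff F n - (if n = 0 then F z\<^sub>0 else 0)"
proof -
  note holomorphic = exp_quotient_holomorphic
  have "fourier_coeff exp_quotient (n - 1) - ee z\<^sub>0 * fourier_coeff exp_quotient n =
      fourier_coeff (\<lambda>z. ee z * exp_quotient z - ee z\<^sub>0 * exp_quotient z) n"
    unfolding fourier_coeff_ee_times[symmetric] fourier_coeff_cmult[symmetric]
    by (rule fourier_coeff_diff[symmetric]) (intro holomorphic_intros holomorphic ee_holomorphic[of "\<lambda>z. z"])+
  also have "\<dots> = fourier_coeff (\<lambda>z. F z - F z\<^sub>0 * ee (of_int 0 * z)) n"
    unfolding exp_quotient_relation by simp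
  also have "\<dots> = fourier_coeff F n - F z\<^sub>0 * fourier_coeff (\<lambda>z. ee (of_int 0 * z)) n"
    unfolding fourier_coeff_cmult[symmetric]
    by (rule fourier_coeff_diff[OF F]) (intro holomorphic_intros ee_holomorphic)
  finally show ?thesis unfolding fourier_coeff_exp by simp
qed

lemma eq_0_if_fourier_coeff_eq_0:
  assumes zero: "\<And>n. fourier_coeff F n = 0"
  shows "F z\<^sub>0 = 0"
proof -
  define a where "a = fourier_coeff exp_quotient"
  note bound = fourier_coeff_bound[OF exp_quotient_holomorphic exp_quotient_add_1, folded a_def]
  have recursion: "a (n - 1) - ee z\<^sub>0 * a n = (if n = 0 then - F z\<^sub>0 else 0)" for n
    using fourier_coeff_exp_quotient[of n] by (simp add: a_def zero)
  have step: "a (n - 1) = ee z\<^sub>0 * a n" if "n \<noteq> 0" for n using recursion[of n] that by simp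
  obtain M where "\<And>n. norm (a n) \<le> M * exp (2 * pi * of_int n * (Im z\<^sub>0 - 1))" using bound by blast
  hence "a 0 = 0" by (rule forward_recursion_eq_0[rotated]) (simp add: step)
  moreover obtain M where "\<And>n. norm (a n) \<le> M * exp (2 * pi * of_int n * (Im z\<^sub>0 + 1))" using bound by blast
  hence "a (- 1) = 0" by (rule backward_recursion_eq_0[rotated]) (simp add: step)
  ultimately show ?thesis using recursion[of 0] by simp
qed

end

lemma infsum_integral:
  fixes f :: "'i \<Rightarrow> real \<Rightarrow> complex"
  assumes continuous: "\<And>i. continuous_on {a..b} (f i)"
    and M: "M summable_on UNIV" "\<And>i x. x \<in> {a..b} \<Longrightarrow> norm (f i x) \<le> M i"
  shows "((\<lambda>i. integral {a..b} (f i)) has_sum integral {a..b} (\<lambda>x. \<Sum>\<^sub>\<infinity>i\<in>UNIV. f i x)) UNIV"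
proof -
  let ?F = "finite_subsets_at_top (UNIV :: 'i set)"
  have "uniform_limit (cbox a b) (\<lambda>X x. \<Sum>i\<in>X. f i x) (\<lambda>x. \<Sum>\<^sub>\<infinity>i\<in>UNIV. f i x) ?F"
    unfolding cbox_interval by (rule Weierstrass_m_test_general[OF M(2,1)])
  then obtain I J where IJ: "\<And>X. ((\<lambda>x. \<Sum>i\<in>X. f i x) has_integral I X) (cbox a b)"
      "((\<lambda>x. \<Sum>\<^sub>\<infinity>i\<in>UNIV. f i x) has_integral J) (cbox a b)" "(I \<longlongrightarrow> J) ?F"
    by (rule uniform_limit_integral_cbox) (auto intro!: continuous_on_sum continuous simp: cbox_interval)
  have "\<forall>\<^sub>F X in ?F. finite X" by (rule eventually_finite_subsets_at_top_weakI) auto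
  hence "\<forall>\<^sub>F X in ?F. I X = (\<Sum>i\<in>X. integral {a..b} (f i))"
  proof eventually_elim
    case (elim X)
    have "integral {a..b} (\<lambda>x. \<Sum>i\<in>X. f i x) = I X"
      using integral_unique[OF IJ(1)] by (simp add: cbox_interval)
    thus ?case using integral_sum[OF elim, of f "{a..b}"]
      by (simp add: integrable_continuous_interval continuous)
  qed
  from Lim_transform_eventually[OF IJ(3) this] show ?thesis
    using integral_unique[OF IJ(2)] by (simp add: has_sum_def cbox_interval)
qed

lemma has_sum_int_limit:
  assumes "(f has_sum s) (UNIV :: int set)"
  shows "(\<lambda>m. \<Sum>j\<in>{- int m..<int m}. f j) \<longlonglongrightarrow> s"
proof -
  have "filterlim (\<lambda>m. {- int m..<int m}) (finite_subsets_at_top UNIV) sequentially"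
    unfolding filterlim_finite_subsets_at_top
  proof (intro allI impI)
    fix X :: "int set" assume "finite X \<and> X \<subseteq> UNIV"
    then obtain K where K: "\<And>x. x \<in> X \<Longrightarrow> \<bar>x\<bar> \<le> K" using finite_has_maximal[of "abs ` X"]
      by (metis bdd_above_def bdd_above_finite finite_imageI imageI)
    have "\<forall>m\<ge>nat (K + 1). finite {- int m..<int m} \<and> X \<subseteq> {- int m..<int m} \<and> {- int m..<int m} \<subseteq> UNIV"
      using K by force
    thus "\<forall>\<^sub>F m in sequentially. finite {- int m..<int m} \<and> X \<subseteq> {- int m..<int m} \<and> {- int m..<int m} \<subseteq> UNIV"
      unfolding eventually_sequentially by blast
  qed
  from filterlim_compose[OF assms[unfolded has_sum_def] this] show ?thesis .
qed

lemma sum_unit_integrals: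
  fixes g :: "real \<Rightarrow> complex"
  assumes g: "continuous_on UNIV g"
  shows "(\<Sum>j\<in>{- int m..<int m}. integral {0..1} (\<lambda>x. g (x + c + of_int j))) = integral {c - real m..c + real m} g"
proof (induction m)
  case (Suc m)
  have integrable: "g integrable_on {a..b}" for a b
    by (rule integrable_continuous_interval) (rule continuous_on_subset[OF g], simp)
  have shift: "integral {0..1} (\<lambda>x. g (x + t)) = integral {t..t + 1} g" for t
    using integral_shift[of 0 t 1 g] continuous_on_subset[OF g] by (simp add: add.commute o_def)
  have combine: "integral {a..b} g + integral {b..d} g = integral {a..d} g" if "a \<le> b" "b \<le> d" for a b d
    by (rule Henstock_Kurzweil_Integration.integral_combine) (use that integrable in auto)
  have "{- int (Suc m)..<int (Suc m)} = insert (- int (Suc m)) (insert (int m) {- int m..<int m})" by auto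
  hence "(\<Sum>j\<in>{- int (Suc m)..<int (Suc m)}. integral {0..1} (\<lambda>x. g (x + c + of_int j))) =
      integral {0..1} (\<lambda>x. g (x + c + of_int (- int (Suc m)))) +
      (integral {0..1} (\<lambda>x. g (x + c + of_int (int m))) + integral {c - real m..c + real m} g)"
    using Suc.IH by simp
  also have "integral {0..1} (\<lambda>x. g (x + c + of_int (- int (Suc m)))) = integral {c - real (Suc m)..c - real m} g"
    using shift[of "c - real (Suc m)"] by (simp add: algebra_simps)
  also have "integral {0..1} (\<lambda>x. g (x + c + of_int (int m))) = integral {c + real m..c + real (Suc m)} g"
    using shift[of "c + real m"] by (simp add: algebra_simps)
  also have "integral {c - real (Suc m)..c - real m} g +
      (integral {c + real m..c + real (Suc m)} g + integral {c - real m..c + real m} g) = integral {c - real (Suc m)..c + real (Suc m)} g"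
    using combine[of "c - real m" "c + real m" "c + real (Suc m)"]
      combine[of "c - real (Suc m)" "c - real m" "c + real (Suc m)"] by (simp add: add.commute)
  finally show ?case .
qed simp

lemma integral_interval_eq_lborel:
  fixes g :: "real \<Rightarrow> 'b::euclidean_space"
  assumes "integrable lborel g"
  shows "integral {a..b} g = (LINT x|lborel. indicator {a..b} x *\<^sub>R g x)"
  using set_borel_integral_eq_integral(2)[of "{a..b}" g] integrable_mult_indicator[OF _ assms, of "{a..b}"]
  by (simp add: set_lebesgue_integral_def set_integrable_def)

lemma tendsto_integral_UNIV:
  fixes g :: "real \<Rightarrow> 'b::euclidean_space"
  assumes g: "integrable lborel g"
  shows "(\<lambda>m. integral {c - real m..c + real m} g) \<longlonglongrightarrow> (LINT x|lborel. g x)"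
  unfolding integral_interval_eq_lborel[OF g]
proof (rule integral_dominated_convergence[where w="\<lambda>x. norm (g x)"])
  show "AE x in lborel. (\<lambda>m. indicator {c - real m..c + real m} x *\<^sub>R g x) \<longlonglongrightarrow> g x"
  proof (rule AE_I2)
    fix x
    obtain m0 :: nat where m0: "\<bar>x - c\<bar> \<le> real m0" using real_arch_simple by blast
    have "\<forall>\<^sub>F m in sequentially. indicator {c - real m..c + real m} x *\<^sub>R g x = g x"
      using eventually_ge_at_top[of m0]
      by eventually_elim (use m0 in \<open>auto split: split_indicator simp: abs_le_iff\<close>)
    thus "(\<lambda>m. indicator {c - real m..c + real m} x *\<^sub>R g x) \<longlonglongrightarrow> g x" by (rule tendsto_eventually)
  qed
qed (use g in \<open>auto split: split_indicator\<close>)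

lemma norm_integral_tail_le:
  fixes g :: "real \<Rightarrow> 'b::euclidean_space" and h :: "real \<Rightarrow> real"
  assumes g: "integrable lborel g" and h: "integrable lborel h" and le: "\<And>x. norm (g x) \<le> h x"
  shows "norm (integral {a..b} g - (LINT x|lborel. g x)) \<le> (LINT x|lborel. h x) - integral {a..b} h"
proof -
  let ?I = "\<lambda>x. indicator {a..b} x :: real"
  have integrable: "integrable lborel (\<lambda>x. ?I x *\<^sub>R g x)" "integrable lborel (\<lambda>x. ?I x *\<^sub>R h x)"
    by (rule integrable_mult_indicator[OF _ g], simp) (rule integrable_mult_indicator[OF _ h], simp)
  have "norm (integral {a..b} g - (LINT x|lborel. g x)) = norm (LINT x|lborel. ?I x *\<^sub>R g x - g x)"
    unfolding integral_interval_eq_lborel[OF g] Bochner_Integration.integral_diff[OF integrable(1) g] ..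
  also have "\<dots> \<le> (LINT x|lborel. h x - ?I x *\<^sub>R h x)"
  proof (rule Bochner_Integration.integral_norm_bound_integral)
    show "integrable lborel (\<lambda>x. ?I x *\<^sub>R g x - g x)" "integrable lborel (\<lambda>x. h x - ?I x *\<^sub>R h x)"
      by (intro Bochner_Integration.integrable_diff g h integrable)+
    show "norm (?I x *\<^sub>R g x - g x) \<le> h x - ?I x *\<^sub>R h x" for x
      using le[of x] by (simp split: split_indicator)
  qed
  also have "\<dots> = (LINT x|lborel. h x) - integral {a..b} h"
    unfolding integral_interval_eq_lborel[OF h]
    by (rule Bochner_Integration.integral_diff[OF h integrable(2)])
  finally show ?thesis .
qed

lemma has_sum_unfold:
  fixes g :: "real \<Rightarrow> complex"
  assumes "continuous_on UNIV g" "integrable lborel g"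
    "((\<lambda>j. integral {0..1} (\<lambda>x. g (x + c + of_int j))) has_sum s) (UNIV :: int set)"
  shows "s = (LINT x|lborel. g x)"
  using has_sum_int_limit[OF assms(3)] tendsto_integral_UNIV[OF assms(2), of c]
  unfolding sum_unit_integrals[OF assms(1)] by (rule LIMSEQ_unique)

subsection \<open>Gaussian integrals\<close>

lemma gaussian_real:
  assumes a: "a > 0"
  shows "integrable lborel (\<lambda>x::real. exp (- a * x\<^sup>2))" "(LINT x|lborel. exp (- a * x\<^sup>2)) = sqrt (pi / a)"
proof -
  have square: "exp (- (0 + sqrt a * x)\<^sup>2) = exp (- a * x\<^sup>2)" for x
    using a by (simp add: power_mult_distrib)
  show "integrable lborel (\<lambda>x::real. exp (- a * x\<^sup>2))"
    using lborel_integrable_real_affine[of "\<lambda>x::real. exp (- x\<^sup>2)" "sqrt a" 0] integrable_gauss a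
      unfolding square by auto
  have "sqrt pi = sqrt a * (LINT x|lborel. exp (- a * x\<^sup>2))"
    using lborel_integral_real_affine[of "sqrt a" "\<lambda>x::real. exp (- x\<^sup>2)" 0] integral_gauss a
      unfolding square by simp
  thus "(LINT x|lborel. exp (- a * x\<^sup>2)) = sqrt (pi / a)"
    using a by (simp add: real_sqrt_divide field_simps)
qed

lemma norm_exp_gauss: "norm (exp (- a * of_real (x\<^sup>2))) = exp (- Re a * x\<^sup>2)" for x :: real
  by (simp add: norm_exp_eq_Re)

lemma integrable_gauss_complex:
  assumes "Re a > 0"
  shows "integrable lborel (\<lambda>x::real. exp (- a * of_real (x\<^sup>2)))"
proof (rule Bochner_Integration.integrable_bound[OF gaussian_real(1)[OF assms]])
  show "(\<lambda>x::real. exp (- a * of_real (x\<^sup>2))) \<in> borel_measurable lborel" by measurable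
qed (simp add: norm_exp_gauss)

definition gauss_integral :: "complex \<Rightarrow> complex" where
  "gauss_integral a = (LINT x|lborel. exp (- a * of_real ((x::real)\<^sup>2)))"

definition gauss_truncated :: "nat \<Rightarrow> complex \<Rightarrow> complex" where
  "gauss_truncated n a = integral {- real n..real n} (\<lambda>x. exp (- a * of_real (x\<^sup>2)))"

lemma gauss_truncated_holomorphic: "gauss_truncated n holomorphic_on UNIV"
proof -
  have "(\<lambda>a. integral (cbox (- real n) (real n)) (\<lambda>x. exp (- a * of_real ((x::real)\<^sup>2)))) holomorphic_on UNIV"
  proof (rule leibniz_rule_holomorphic[where fx="\<lambda>a x. - of_real (x\<^sup>2) * exp (- a * of_real (x\<^sup>2))"])
    show "((\<lambda>a. exp (- a * of_real (x\<^sup>2))) has_field_derivative - of_real (x\<^sup>2) * exp (- a * of_real (x\<^sup>2))) (at a within UNIV)"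
      for a :: complex and x :: real by (auto intro!: derivative_eq_intros)
    show "continuous_on (UNIV \<times> cbox (- real n) (real n)) (\<lambda>(a, x). - of_real (x\<^sup>2) * exp (- a * of_real (x\<^sup>2)) :: complex)"
      unfolding case_prod_unfold by (intro continuous_intros)
    show "(\<lambda>x. exp (- a * of_real (x\<^sup>2))) integrable_on cbox (- real n) (real n)" for a :: complex
      by (intro integrable_continuous continuous_intros)
  qed auto
  thus ?thesis by (simp add: gauss_truncated_def[abs_def])
qed

lemma gauss_truncated_uniform_limit:
  assumes d: "d > 0" and A: "\<And>a. a \<in> A \<Longrightarrow> d \<le> Re a"
  shows "uniform_limit A gauss_truncated gauss_integral sequentially"
proof (rule uniform_limitI)
  define tail where "tail = (\<lambda>n::nat. (LINT x|lborel. exp (- d * x\<^sup>2)) - integral {0 - real n..0 + real n} (\<lambda>x. exp (- d * x\<^sup>2)))"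
  have "tail \<longlonglongrightarrow> (LINT x|lborel. exp (- d * x\<^sup>2)) - (LINT x|lborel. exp (- d * x\<^sup>2))"
    unfolding tail_def by (intro tendsto_intros tendsto_integral_UNIV gaussian_real(1)[OF d])
  hence tail: "tail \<longlonglongrightarrow> 0" by simp
  fix e :: real assume "e > 0"
  with tail have "\<forall>\<^sub>F n in sequentially. tail n < e" by (rule order_tendstoD)
  thus "\<forall>\<^sub>F n in sequentially. \<forall>a\<in>A. dist (gauss_truncated n a) (gauss_integral a) < e"
  proof eventually_elim
    case (elim n)
    have "norm (gauss_truncated n a - gauss_integral a) \<le> tail n" if a: "a \<in> A" for a
    proof -
      have "norm (exp (- a * of_real (x\<^sup>2))) \<le> exp (- d * x\<^sup>2)" for x :: real
        unfolding norm_exp_gauss using mult_right_mono[OF A[OF a], of "x\<^sup>2"] by simp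
      from norm_integral_tail_le[OF integrable_gauss_complex gaussian_real(1)[OF d] this, of "- real n" "real n"]
      show ?thesis using A[OF a] d by (simp add: gauss_truncated_def gauss_integral_def tail_def)
    qed
    with elim show ?case unfolding dist_norm by (meson le_less_trans)
  qed
qed

lemma gauss_integral_holomorphic: "gauss_integral holomorphic_on {a. Re a > 0}"
proof (rule holomorphic_uniform_sequence)
  show "open {a. Re a > 0}" by (rule open_halfspace_Re_gt)
  show "gauss_truncated n holomorphic_on {a. Re a > 0}" for n
    by (rule holomorphic_on_subset[OF gauss_truncated_holomorphic]) simp
  fix a assume "a \<in> {a. Re a > 0}"
  hence pos: "Re a / 2 > 0" by simp
  have "Re a / 2 \<le> Re b" if "b \<in> cball a (Re a / 2)" for b
    using that abs_Re_le_cmod[of "a - b"] by (auto simp: dist_norm)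
  moreover from this have "cball a (Re a / 2) \<subseteq> {a. Re a > 0}" using pos by fastforce
  ultimately show "\<exists>d>0. cball a d \<subseteq> {a. Re a > 0} \<and> uniform_limit (cball a d) gauss_truncated gauss_integral sequentially"
    using pos gauss_truncated_uniform_limit by blast
qed

lemma gaussian_complex:
  assumes a: "Re a > 0"
  shows "(LINT x|lborel. exp (- a * of_real ((x::real)\<^sup>2))) = csqrt (of_real pi / a)"
proof -
  have csqrt_holomorphic: "(\<lambda>a. csqrt (of_real pi / a)) holomorphic_on {a. Re a > 0}"
  proof (rule holomorphic_on_csqrt')
    fix a assume "a \<in> {a. Re a > 0}"
    hence "Re (of_real pi / a) > 0" by (simp add: Re_divide divide_pos_pos sum_power2_gt_zero_iff)
    thus "of_real pi / a \<notin> \<real>\<^sub>\<le>\<^sub>0" by (auto simp: complex_nonpos_Reals_iff)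
  qed (auto intro!: holomorphic_intros)
  have "gauss_integral a - csqrt (of_real pi / a) = 0"
  proof (rule analytic_continuation[of "\<lambda>a. gauss_integral a - csqrt (of_real pi / a)" "{a. Re a > 0}" "{x. Im x = 0 \<and> Re x > 0}" 1])
    show "(\<lambda>a. gauss_integral a - csqrt (of_real pi / a)) holomorphic_on {a. Re a > 0}"
      by (intro holomorphic_intros gauss_integral_holomorphic csqrt_holomorphic)
    show "open {a. Re a > 0}" "connected {a. Re a > 0}"
      by (auto simp: open_halfspace_Re_gt convex_halfspace_Re_gt convex_connected)
    show "1 islimpt {x. Im x = 0 \<and> Re x > 0}"
      unfolding islimpt_approachable
    proof (intro allI impI)
      fix e :: real assume "e > 0"
      thus "\<exists>x'\<in>{x. Im x = 0 \<and> Re x > 0}. x' \<noteq> 1 \<and> dist x' (1::complex) < e"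
        by (intro bexI[of _ "of_real (1 + e / 2)"]) (auto simp: dist_norm complex_eq_iff cmod_def)
    qed
    fix x :: complex assume "x \<in> {x. Im x = 0 \<and> Re x > 0}"
    then obtain t where t: "x = of_real t" "t > 0" by (auto simp: complex_eq_iff intro!: that[of "Re x"])
    have "gauss_integral x = (LINT y|lborel. complex_of_real (exp (- t * y\<^sup>2)))"
      unfolding gauss_integral_def t(1)
      by (intro Bochner_Integration.integral_cong refl) (simp flip: exp_of_real)
    also have "\<dots> = of_real (sqrt (pi / t))" using gaussian_real(2)[OF t(2)] by simp
    also have "\<dots> = csqrt (of_real pi / x)" using t by (simp flip: of_real_divide of_real_sqrt)
    finally show "gauss_integral x - csqrt (of_real pi / x) = 0" by simp
  qed (use a in auto)
  thus ?thesis by (simp add: gauss_integral_def)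
qed

section \<open>Theta decomposition\<close>

definition theta_comp :: "nat \<Rightarrow> complex \<Rightarrow> (complex \<Rightarrow> complex) \<Rightarrow> int \<Rightarrow> complex" where
  "theta_comp N t F n = inverse (theta_q N n t) * fourier_coeff F n"

lemma fourier_coeff_eq_theta_comp: "fourier_coeff F n = theta_q N n t * theta_comp N t F n"
  by (simp add: theta_comp_def)

lemma theta_q_add_period:
  "N > 0 \<Longrightarrow> theta_q N (n + 2 * int N) t = ee ((of_nat N + of_int n) * t) * theta_q N n t"
  unfolding theta_q_def ee_add[symmetric]
  by (rule arg_cong[of _ _ ee]) (simp add: field_simps power2_eq_square)

lemma linear_minus_square_le:
  fixes n :: int and b c :: real
  assumes "b > 0"
  shows "c * \<bar>of_int n\<bar> - b * (of_int n)\<^sup>2 \<le> c\<^sup>2 / (2 * b) - b / 2 * \<bar>of_int n\<bar>"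
proof -
  let ?m = "\<bar>real_of_int n\<bar>"
  have "0 \<le> (b * ?m - c)\<^sup>2 / (2 * b)" using assms by simp
  also have "\<dots> = b / 2 * ?m\<^sup>2 + c\<^sup>2 / (2 * b) - c * ?m"
    using assms by (simp add: field_simps power2_eq_square)
  finally have "c * ?m - b * ?m\<^sup>2 \<le> c\<^sup>2 / (2 * b) - b / 2 * ?m\<^sup>2" by simp
  moreover have "?m \<le> ?m\<^sup>2"
    using mult_left_mono[of 1 ?m ?m] by (cases "n = 0") (auto simp: power2_eq_square simp flip: of_int_abs)
  hence "b / 2 * ?m \<le> b / 2 * ?m\<^sup>2" using assms by (intro mult_left_mono) auto
  ultimately show ?thesis unfolding power2_abs by linarith
qed

lemma bij_betw_divmod:
  assumes "m > 0"
  shows "bij_betw (\<lambda>(\<mu>, j). int \<mu> + int m * j) ({..<m} \<times> UNIV) UNIV"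
  by (rule bij_betwI[where g="\<lambda>n. (nat (n mod int m), n div int m)"])
     (use assms in \<open>auto simp: nat_less_iff div_mult_self2 mod_mult_self2\<close>)

lemma has_sum_unfold_family:
  fixes g :: "'a \<Rightarrow> real \<Rightarrow> complex" and E :: "'a \<Rightarrow> complex"
  assumes sum: "((\<lambda>(a, n::int). E a * integral {0..1} (\<lambda>x. g a (x + s a + of_int n))) has_sum S) (A \<times> UNIV)"
    and g: "\<And>a. a \<in> A \<Longrightarrow> continuous_on UNIV (g a)" "\<And>a. a \<in> A \<Longrightarrow> integrable lborel (g a)"
  shows "((\<lambda>a. E a * (LINT x|lborel. g a x)) has_sum S) A"
proof (rule has_sum_SigmaD[OF sum])
  fix a assume a: "a \<in> A"
  let ?I = "\<lambda>n. integral {0..1} (\<lambda>x. g a (x + s a + of_int n))"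
  have "((\<lambda>n. E a * ?I n) has_sum E a * (LINT x|lborel. g a x)) UNIV"
  proof (cases "E a = 0")
    case False
    have "(\<lambda>n. E a * ?I n) summable_on UNIV"
      using summable_on_SigmaD1[OF has_sum_imp_summable[OF sum] a] by simp
    hence "?I summable_on UNIV" by (simp add: summable_on_cmult_right'[OF False])
    then obtain I where I: "(?I has_sum I) UNIV" by (auto simp: summable_on_def)
    from has_sum_unfold[OF g[OF a] this] have "I = (LINT x|lborel. g a x)" .
    with I show ?thesis by (auto intro: has_sum_cmult_right)
  qed simp
  thus "((\<lambda>n. case (a, n) of (a, n) \<Rightarrow> E a * integral {0..1} (\<lambda>x. g a (x + s a + of_int n))) has_sum
    E a * (LINT x|lborel. g a x)) UNIV" by simp
qed

definition fourier_series :: "(int \<Rightarrow> complex) \<Rightarrow> complex \<Rightarrow> complex" where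
  "fourier_series a z = (\<Sum>\<^sub>\<infinity>n. a n * ee (of_int n * z))"

lemma fourier_series_add_1: "fourier_series a (z + 1) = fourier_series a z"
proof -
  have "ee (of_int n * (z + 1)) = ee (of_int n * z)" for n by (simp add: distrib_left ee_add)
  thus ?thesis by (simp add: fourier_series_def)
qed

context
  fixes a :: "int \<Rightarrow> complex"
  assumes majorant: "\<And>R. \<exists>M. M summable_on UNIV \<and> (\<forall>n z. norm z \<le> R \<longrightarrow> norm (a n * ee (of_int n * z)) \<le> M n)"
begin

lemma fourier_series_holomorphic: "fourier_series a holomorphic_on UNIV"
  unfolding fourier_series_def[abs_def]
proof (rule infsum_holomorphic[OF open_UNIV])
  show "(\<lambda>z. a n * ee (of_int n * z)) holomorphic_on UNIV" for n
    by (intro holomorphic_intros ee_holomorphic)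
  fix z :: complex
  obtain M where M: "M summable_on UNIV" "\<And>n w. norm w \<le> norm z + 1 \<Longrightarrow> norm (a n * ee (of_int n * w)) \<le> M n"
    using majorant[of "norm z + 1"] by blast
  have "norm w \<le> norm z + 1" if "w \<in> cball z 1" for w
    using that norm_triangle_ineq2[of w z] by (simp add: dist_norm norm_minus_commute)
  with M show "\<exists>r>0. \<exists>M. cball z r \<subseteq> UNIV \<and> M summable_on UNIV \<and>
      (\<forall>n\<in>UNIV. \<forall>w\<in>cball z r. norm (a n * ee (of_int n * w)) \<le> M n)"
    by (intro exI[of _ 1] conjI exI[of _ M]) auto
qed

lemma fourier_coeff_fourier_series: "fourier_coeff (fourier_series a) m = a m"
proof -
  obtain M where M: "M summable_on UNIV" "\<And>n w. norm w \<le> 1 \<Longrightarrow> norm (a n * ee (of_int n * w)) \<le> M n"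
    using majorant[of 1] by blast
  let ?f = "\<lambda>n x. a n * ee (of_int n * of_real x) * ee (- (of_int m * of_real x))"
  have "((\<lambda>n. integral {0..1} (?f n)) has_sum integral {0..1} (\<lambda>x. \<Sum>\<^sub>\<infinity>n\<in>UNIV. ?f n x)) UNIV"
  proof (rule infsum_integral[OF _ M(1)])
    show "continuous_on {0..1} (?f n)" for n by (intro continuous_intros ee_continuous)
    fix n :: int and x :: real assume "x \<in> {0..1}"
    thus "norm (?f n x) \<le> M n" using M(2)[of "of_real x" n] by (simp add: norm_mult norm_ee)
  qed
  moreover have "integral {0..1} (\<lambda>x. \<Sum>\<^sub>\<infinity>n\<in>UNIV. ?f n x) = fourier_coeff (fourier_series a) m"
    unfolding fourier_coeff_def period_int_def fourier_series_def by (simp add: infsum_cmult_left')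
  moreover have "integral {0..1} (?f n) = (if n = m then a m else 0)" for n
    using fourier_coeff_exp[of n m] by (simp add: fourier_coeff_def period_int_def mult.assoc)
  moreover have "((\<lambda>n. if n = m then a m else 0) has_sum a m) UNIV"
    by (rule has_sum_finite_neutralI[of "{m}"]) auto
  ultimately show ?thesis by (simp add: has_sum_unique)
qed

end

context
  fixes N :: nat and t :: complex and F :: "complex \<Rightarrow> complex"
  assumes N: "N > 0" and t: "t \<in> uhp" and F: "F holomorphic_on UNIV" and F_add_1: "\<And>z. F (z + 1) = F z"
    and F_add_t: "\<And>z. F (z + t) = ee (- (of_nat N * t) - of_nat (2 * N) * z) * F z"
begin

lemma fourier_coeff_add_period:
  "fourier_coeff F (n + 2 * int N) = ee ((of_nat N + of_int n) * t) * fourier_coeff F n"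
proof -
  have "ee (- (of_nat N * t) - of_nat (2 * N) * z) * ee (- (of_int n * (z + t))) =
      ee (- ((of_nat N + of_int n) * t)) * ee (- (of_int (n + 2 * int N) * z))" for z
    unfolding ee_add[symmetric] by (rule arg_cong[of _ _ ee]) (simp add: algebra_simps)
  hence integrand: "F (t + z) * ee (- (of_int n * (t + z))) =
      ee (- ((of_nat N + of_int n) * t)) * (F (0 + z) * ee (- (of_int (n + 2 * int N) * (0 + z))))" for z
    unfolding add.commute[of t] F_add_t by (simp add: mult_ac)
  have "fourier_coeff F n = period_int (\<lambda>z. F z * ee (- (of_int n * z))) t 1"
    by (rule fourier_coeff_height[OF F F_add_1])
  also have "\<dots> = ee (- ((of_nat N + of_int n) * t)) * fourier_coeff F (n + 2 * int N)"
    unfolding fourier_coeff_def period_int_def integrand by (rule integral_mult_right)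
  finally show ?thesis by (simp add: ee_minus)
qed

lemma theta_comp_add_period: "theta_comp N t F (n + 2 * int N) = theta_comp N t F n"
  by (simp add: theta_comp_def theta_q_add_period[OF N] fourier_coeff_add_period ee_nonzero)

lemma theta_comp_add_periods: "theta_comp N t F (n + 2 * int N * j) = theta_comp N t F n"
proof (induction j rule: int_induct[of _ 0])
  case (step1 i)
  thus ?case using theta_comp_add_period[of "n + 2 * int N * i"] by (simp add: algebra_simps)
next
  case (step2 i)
  thus ?case using theta_comp_add_period[of "n + 2 * int N * (i - 1)"] by (simp add: algebra_simps)
qed simp

lemma theta_comp_bounded: "\<exists>C\<ge>0. \<forall>n. norm (theta_comp N t F n) \<le> C"
proof (intro exI conjI allI)
  let ?A = "(\<lambda>n. norm (theta_comp N t F n)) ` {0..<2 * int N}"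
  show bound: "norm (theta_comp N t F n) \<le> Max ?A" for n
  proof -
    have "n mod (2 * int N) \<in> {0..<2 * int N}" using N by simp
    hence "norm (theta_comp N t F (n mod (2 * int N))) \<le> Max ?A" by (intro Max_ge) auto
    thus ?thesis using theta_comp_add_periods[of "n mod (2 * int N)" "n div (2 * int N)"] by simp
  qed
  show "Max ?A \<ge> 0" using order_trans[OF norm_ge_zero bound[of 0]] .
qed

lemma fourier_coeff_majorant:
  "\<exists>M. M summable_on UNIV \<and> (\<forall>n z. norm z \<le> R \<longrightarrow> norm (fourier_coeff F n * ee (of_int n * z)) \<le> M n)"
proof -
  obtain C where C: "C \<ge> 0" "\<And>n. norm (theta_comp N t F n) \<le> C" using theta_comp_bounded by blast
  define b where "b = pi / (2 * real N) * Im t"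
  have b: "b > 0" using uhpD[OF t] N by (simp add: b_def)
  have "(\<lambda>n. C * exp ((2 * pi * R)\<^sup>2 / (2 * b)) * exp (- b / 2) ^ nat \<bar>n\<bar>) summable_on UNIV"
    by (rule summable_int_geometric) (use b in auto)
  moreover have "norm (fourier_coeff F n * ee (of_int n * z)) \<le>
      C * exp ((2 * pi * R)\<^sup>2 / (2 * b)) * exp (- b / 2) ^ nat \<bar>n\<bar>" if z: "norm z \<le> R" for n z
  proof -
    have "\<bar>of_int n * Im z\<bar> \<le> \<bar>of_int n\<bar> * R"
      unfolding abs_mult using abs_Im_le_cmod[of z] z by (intro mult_left_mono) auto
    hence "2 * pi * - (of_int n * Im z) \<le> 2 * pi * (\<bar>of_int n\<bar> * R)"
      by (intro mult_left_mono) (linarith, simp)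
    hence "- (b * (of_int n)\<^sup>2) + - (2 * pi * (of_int n * Im z)) \<le>
        (2 * pi * R)\<^sup>2 / (2 * b) + real (nat \<bar>n\<bar>) * (- b / 2)"
      using linear_minus_square_le[OF b, of "2 * pi * R" n] by (simp add: algebra_simps)
    hence "exp (- (b * (of_int n)\<^sup>2)) * exp (- (2 * pi * (of_int n * Im z))) \<le>
        exp ((2 * pi * R)\<^sup>2 / (2 * b)) * exp (- b / 2) ^ nat \<bar>n\<bar>"
      unfolding exp_add[symmetric] exp_of_nat_mult[symmetric] by simp
    hence "norm (theta_comp N t F n) * (exp (- (b * (of_int n)\<^sup>2)) * exp (- (2 * pi * (of_int n * Im z)))) \<le>
        C * (exp ((2 * pi * R)\<^sup>2 / (2 * b)) * exp (- b / 2) ^ nat \<bar>n\<bar>)"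
      by (rule mult_mono[OF C(2) _ C(1)]) simp
    thus ?thesis
      unfolding fourier_coeff_eq_theta_comp[of F n N t] norm_mult norm_theta_q norm_ee
      by (simp add: b_def mult_ac)
  qed
  ultimately show ?thesis by blast
qed

lemma fourier_expansion: "F z = fourier_series (fourier_coeff F) z"
proof -
  note hol = fourier_series_holomorphic[OF fourier_coeff_majorant]
  have "F z - fourier_series (fourier_coeff F) z = 0"
  proof (rule eq_0_if_fourier_coeff_eq_0[of "\<lambda>z. F z - fourier_series (fourier_coeff F) z"])
    show "fourier_coeff (\<lambda>z. F z - fourier_series (fourier_coeff F) z) n = 0" for n
      by (simp add: fourier_coeff_diff[OF F hol] fourier_coeff_fourier_series[OF fourier_coeff_majorant])
  qed (simp_all add: F_add_1 fourier_series_add_1 holomorphic_on_diff[OF F hol])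
  thus ?thesis by simp
qed

lemma gauss_times_fourier_term:
  "ee (of_nat N * t * of_real (x\<^sup>2)) * (fourier_coeff F n * ee (of_int n * (of_nat l / of_nat (2 * N) + of_real x * t))) =
    ee (of_int n * of_nat l / of_nat (2 * N)) * theta_comp N t F n *
    ee (of_nat N * t * of_real ((x + of_int n / of_nat (2 * N))\<^sup>2))"
proof -
  have "ee (of_nat N * t * of_real (x\<^sup>2)) * (theta_q N n t * ee (of_int n * (of_nat l / of_nat (2 * N) + of_real x * t))) =
      ee (of_int n * of_nat l / of_nat (2 * N)) * ee (of_nat N * t * of_real ((x + of_int n / of_nat (2 * N))\<^sup>2))"
    unfolding ee_add[symmetric] theta_q_def
    using N by (intro arg_cong[of _ _ ee]) (simp add: field_simps power2_eq_square)
  thus ?thesis unfolding fourier_coeff_eq_theta_comp[of F n N t] by (simp add: mult_ac)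
qed

lemma gauss_times_fourier_term_class:
  fixes \<mu> :: nat and j :: int
  defines "n \<equiv> int \<mu> + int (2 * N) * j"
  shows "ee (of_nat N * t * of_real (x\<^sup>2)) * (fourier_coeff F n * ee (of_int n * (of_nat l / of_nat (2 * N) + of_real x * t))) =
    ee (of_nat (l * \<mu>) / of_nat (2 * N)) * theta_comp N t F (int \<mu>) *
    ee (of_nat N * t * of_real ((x + real \<mu> / real (2 * N) + of_int j)\<^sup>2))"
proof -
  have "of_int n * of_nat l / of_nat (2 * N) = of_nat (l * \<mu>) / of_nat (2 * N) + (of_int (j * int l) :: complex)"
    using N by (simp add: n_def field_simps)
  hence "ee (of_int n * of_nat l / of_nat (2 * N)) = ee (of_nat (l * \<mu>) / of_nat (2 * N))"
    by (simp only: ee_add ee_of_int mult_1_right)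
  moreover have "x + of_int n / of_nat (2 * N) = x + real \<mu> / real (2 * N) + of_int j"
    using N by (simp add: n_def field_simps)
  moreover have "theta_comp N t F n = theta_comp N t F (int \<mu>)"
    using theta_comp_add_periods by (simp add: n_def)
  ultimately show ?thesis by (simp only: gauss_times_fourier_term)
qed

lemma gauss_times_fourier_has_sum:
  fixes w :: complex
  defines "f \<equiv> \<lambda>n x. ee (of_nat N * t * of_real (x\<^sup>2)) * (fourier_coeff F n * ee (of_int n * (w + of_real x * t)))"
  shows "((\<lambda>n. integral {0..1} (f n)) has_sum
    integral {0..1} (\<lambda>x. ee (of_nat N * t * of_real (x\<^sup>2)) * F (w + of_real x * t))) UNIV"
proof -
  obtain M where M: "M summable_on UNIV"
      "\<And>n z. norm z \<le> norm w + norm t \<Longrightarrow> norm (fourier_coeff F n * ee (of_int n * z)) \<le> M n"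
    using fourier_coeff_majorant[of "norm w + norm t"] by blast
  have "((\<lambda>n. integral {0..1} (f n)) has_sum integral {0..1} (\<lambda>x. \<Sum>\<^sub>\<infinity>n\<in>UNIV. f n x)) UNIV"
  proof (rule infsum_integral[OF _ M(1)])
    show "continuous_on {0..1} (f n)" for n unfolding f_def by (intro continuous_intros ee_continuous)
    fix n :: int and x :: real assume x: "x \<in> {0..1}"
    have "norm (ee (of_nat N * t * of_real (x\<^sup>2))) \<le> 1" using uhpD[OF t] by (simp add: norm_ee)
    moreover have "norm (of_real x * t) \<le> 1 * norm t"
      unfolding norm_mult using x by (intro mult_right_mono) auto
    hence "norm (w + of_real x * t) \<le> norm w + norm t" by (intro norm_triangle_mono) simp_all
    ultimately have "norm (f n x) \<le> 1 * M n"
      unfolding f_def norm_mult[of "ee (of_nat N * t * of_real (x\<^sup>2))"] by (rule mult_mono[OF _ M(2)]) auto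
    thus "norm (f n x) \<le> M n" by simp
  qed
  moreover have "(\<Sum>\<^sub>\<infinity>n\<in>UNIV. f n x) = ee (of_nat N * t * of_real (x\<^sup>2)) * F (w + of_real x * t)" for x
    unfolding f_def infsum_cmult_right' fourier_expansion[of "w + of_real x * t"] fourier_series_def ..
  ultimately show ?thesis by simp
qed

lemma theta_inversion_integral:
  fixes l :: nat
  shows "integral {0..1} (\<lambda>x. ee (of_nat N * t * of_real (x\<^sup>2)) * F (of_nat l / of_nat (2 * N) + of_real x * t)) =
    csqrt (of_real pi / (- 2 * of_real pi * \<i> * of_nat N * t)) *
      (\<Sum>\<mu><2*N. ee (of_nat (l * \<mu>) / of_nat (2 * N)) * theta_comp N t F (int \<mu>))" (is "?lhs = ?G * _")
proof -
  define g where "g = (\<lambda>x::real. ee (of_nat N * t * of_real (x\<^sup>2)))"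
  define r where "r = (\<lambda>\<mu>::nat. ee (of_nat (l * \<mu>) / of_nat (2 * N)) * theta_comp N t F (int \<mu>))"
  have g_exp: "g = (\<lambda>x. exp (- (- 2 * of_real pi * \<i> * of_nat N * t) * of_real (x\<^sup>2)))"
    by (simp add: g_def ee_def mult_ac)
  have width: "Re (- 2 * of_real pi * \<i> * of_nat N * t) > 0" using uhpD[OF t] N by simp
  let ?f = "\<lambda>n. integral {0..1} (\<lambda>x. g x *
    (fourier_coeff F n * ee (of_int n * (of_nat l / of_nat (2 * N) + of_real x * t))))"
  have "bij_betw (\<lambda>(\<mu>, j). int \<mu> + int (2 * N) * j) ({..<2 * N} \<times> UNIV) UNIV"
    by (rule bij_betw_divmod) (use N in simp)
  from has_sum_reindex_bij_betw[OF this, of ?f ?lhs]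
  have "((\<lambda>(\<mu>, j). ?f (int \<mu> + int (2 * N) * j)) has_sum ?lhs) ({..<2 * N} \<times> UNIV)"
    using gauss_times_fourier_has_sum[of "of_nat l / of_nat (2 * N)"]
      unfolding g_def case_prod_unfold by blast
  moreover have "?f (int \<mu> + int (2 * N) * j) =
      r \<mu> * integral {0..1} (\<lambda>x. g (x + real \<mu> / real (2 * N) + of_int j))" for \<mu> j
    unfolding g_def gauss_times_fourier_term_class r_def by (simp only: integral_mult_right)
  ultimately have "((\<lambda>(\<mu>, j). r \<mu> * integral {0..1} (\<lambda>x. g (x + real \<mu> / real (2 * N) + of_int j))) has_sum ?lhs)
      ({..<2 * N} \<times> UNIV)" by simp
  hence "((\<lambda>\<mu>. r \<mu> * (LINT x|lborel. g x)) has_sum ?lhs) {..<2 * N}"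
  proof (rule has_sum_unfold_family)
    show "continuous_on UNIV g" unfolding g_def by (intro continuous_intros ee_continuous)
    show "integrable lborel g" unfolding g_exp by (rule integrable_gauss_complex[OF width])
  qed
  moreover have "(LINT x|lborel. g x) = ?G" unfolding g_exp by (rule gaussian_complex[OF width])
  ultimately have "?lhs = (\<Sum>\<mu><2*N. r \<mu> * ?G)" by (simp add: has_sum_finite_iff)
  thus ?thesis by (simp add: r_def sum_distrib_left mult.commute)
qed

end

lemma csqrt_gauss_width:
  assumes t: "t \<in> uhp" and N: "N > 0"
  shows "csqrt (of_real pi / (- 2 * of_real pi * \<i> * of_nat N * t)) * csqrt t = ee (1 / 8) / of_real (sqrt (real (2 * N)))"
proof -
  have nonzero: "t \<noteq> 0" by (rule uhp_nonzero[OF t])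
  have not_neg: "t \<notin> \<real>\<^sub>\<le>\<^sub>0" using uhpD[OF t] by (auto simp: complex_nonpos_Reals_iff)
  have Arg_t: "0 < Arg t" "Arg t < pi"
    using Im_Ln_pos_lt[OF nonzero] uhpD[OF t] by (simp_all add: Arg_eq_Im_Ln[OF nonzero])
  let ?c = "1 / real (2 * N)"
  have "of_real pi / (- 2 * of_real pi * \<i> * of_nat N * t) = of_real ?c * (\<i> * inverse t)"
    using N nonzero by (simp add: field_simps)
  also have "csqrt \<dots> = csqrt (of_real ?c) * csqrt (\<i> * inverse t)"
    by (rule csqrt_mult, subst Arg_of_real) (simp add: mpi_less_Arg Arg_le_pi)
  also have "csqrt (\<i> * inverse t) = csqrt \<i> * csqrt (inverse t)"
    using Arg_t uhpD[OF t] by (intro csqrt_mult) (auto simp: Arg_inverse Arg_eq_Im_Ln complex_is_Real_iff)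
  also have "csqrt (inverse t) = inverse (csqrt t)" by (rule csqrt_inverse[OF not_neg])
  also have "csqrt \<i> = exp (Ln \<i> / 2)" by (rule csqrt_exp_Ln) simp
  also have "\<dots> = ee (1 / 8)" by (simp add: ee_def mult_ac)
  also have "csqrt (of_real ?c) = of_real (1 / sqrt (real (2 * N)))"
    by (subst of_real_sqrt[symmetric]) (simp_all add: real_sqrt_divide)
  finally show ?thesis using nonzero by simp
qed

section \<open>Mordell integrals\<close>

lemma gauss_fourier_transform:
  assumes a: "\<alpha> > 0"
  shows "(LINT s|lborel. of_real (exp (- \<alpha> * s\<^sup>2)) * iexp (u * s)) =
    complex_of_real (sqrt (pi / \<alpha>) * exp (- u\<^sup>2 / (4 * \<alpha>)))" (is "?J = _")
proof -
  define c where "c = sqrt (2 * \<alpha>)"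
  have c: "c > 0" "c\<^sup>2 = 2 * \<alpha>" using a by (auto simp: c_def)
  have "complex_of_real (exp (- (u / c)\<^sup>2 / 2)) = (LINT x|std_normal_distribution. iexp (u / c * x))"
    using fun_cong[OF char_std_normal_distribution, of "u / c"] unfolding char_def by simp
  also have "\<dots> = (LINT x|lborel. std_normal_density x *\<^sub>R iexp (u / c * x))"
    by (rule integral_density) auto
  also have "\<dots> = \<bar>c\<bar> *\<^sub>R (LINT s|lborel. std_normal_density (0 + c * s) *\<^sub>R iexp (u / c * (0 + c * s)))"
    by (rule lborel_integral_real_affine) (use c in auto)
  also have "(\<lambda>s. std_normal_density (0 + c * s) *\<^sub>R iexp (u / c * (0 + c * s))) =
      (\<lambda>s. of_real (1 / sqrt (2 * pi)) * (of_real (exp (- \<alpha> * s\<^sup>2)) * iexp (u * s)))"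
    using c by (simp add: fun_eq_iff std_normal_density_def power_mult_distrib scaleR_conv_of_real)
  also have "\<bar>c\<bar> *\<^sub>R (LINT s|lborel. of_real (1 / sqrt (2 * pi)) * (of_real (exp (- \<alpha> * s\<^sup>2)) * iexp (u * s))) =
      of_real (c / sqrt (2 * pi)) * ?J"
    unfolding integral_mult_right_zero using c(1) by (simp add: scaleR_conv_of_real)
  finally have "of_real (sqrt (2 * pi) / c) * complex_of_real (exp (- (u / c)\<^sup>2 / 2)) = ?J"
    using c(1) by (simp add: field_simps)
  moreover have "sqrt (2 * pi) / c = sqrt (pi / \<alpha>)"
    using a by (simp add: c_def real_sqrt_mult real_sqrt_divide)
  moreover have "- (u / c)\<^sup>2 / 2 = - u\<^sup>2 / (4 * \<alpha>)" by (simp add: power_divide c(2))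
  ultimately show ?thesis by simp
qed

abbreviation horizontal :: "real \<Rightarrow> real \<Rightarrow> complex" where
  "horizontal Y s \<equiv> of_real s + \<i> * of_real Y"

definition gauss_wave :: "real \<Rightarrow> real \<Rightarrow> real \<Rightarrow> real \<Rightarrow> complex" where
  "gauss_wave \<alpha> r Y s = exp (- of_real \<alpha> * (horizontal Y s)\<^sup>2) * ee (of_real r * horizontal Y s)"

definition mordell :: "real \<Rightarrow> nat \<Rightarrow> real \<Rightarrow> real \<Rightarrow> complex" where
  "mordell \<alpha> k r Y = (LINT s|lborel. gauss_wave \<alpha> r Y s / horizontal Y s ^ k)"

lemma horizontal_nonzero: "Y \<noteq> 0 \<Longrightarrow> horizontal Y s \<noteq> 0"
  by (simp add: complex_eq_iff)

lemma gauss_wave_eq: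
  "gauss_wave \<alpha> r Y s = of_real (exp (\<alpha> * Y\<^sup>2 - 2 * pi * (r * Y))) *
     (of_real (exp (- \<alpha> * s\<^sup>2)) * iexp ((2 * pi * r - 2 * \<alpha> * Y) * s))"
proof -
  have "- of_real \<alpha> * (horizontal Y s)\<^sup>2 + tpi * (of_real r * horizontal Y s) =
      of_real (\<alpha> * Y\<^sup>2 - 2 * pi * (r * Y)) + (of_real (- \<alpha> * s\<^sup>2) + \<i> * of_real ((2 * pi * r - 2 * \<alpha> * Y) * s))"
    by (simp add: complex_eq_iff power2_eq_square algebra_simps)
  thus ?thesis unfolding gauss_wave_def ee_def exp_add[symmetric] exp_of_real[symmetric] by (rule arg_cong)
qed

lemma norm_gauss_wave: "norm (gauss_wave \<alpha> r Y s) = exp (\<alpha> * Y\<^sup>2 - 2 * pi * (r * Y)) * exp (- \<alpha> * s\<^sup>2)"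
  by (simp add: gauss_wave_eq norm_mult)

lemma gauss_wave_measurable [measurable]: "gauss_wave \<alpha> r Y \<in> borel_measurable borel"
  unfolding gauss_wave_def[abs_def] ee_def by measurable

lemma gauss_wave_continuous: "continuous_on A (gauss_wave \<alpha> r Y)"
  unfolding gauss_wave_def[abs_def] by (intro continuous_intros ee_continuous)

lemma norm_gauss_wave_divide_le:
  assumes "Y \<noteq> 0 \<or> k = 0"
  shows "norm (gauss_wave \<alpha> r Y s / horizontal Y s ^ k) \<le>
    exp (\<alpha> * Y\<^sup>2 - 2 * pi * (r * Y)) / \<bar>Y\<bar> ^ k * exp (- \<alpha> * s\<^sup>2)"
proof -
  have "\<bar>Y\<bar> \<le> norm (horizontal Y s)" using abs_Im_le_cmod[of "horizontal Y s"] by simp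
  hence "\<bar>Y\<bar> ^ k \<le> norm (horizontal Y s) ^ k" by (rule power_mono) simp
  moreover have "\<bar>Y\<bar> ^ k > 0" using assms by auto
  ultimately have "norm (gauss_wave \<alpha> r Y s) / norm (horizontal Y s) ^ k \<le> norm (gauss_wave \<alpha> r Y s) / \<bar>Y\<bar> ^ k"
    by (intro divide_left_mono mult_pos_pos norm_ge_zero) linarith+
  thus ?thesis unfolding norm_divide norm_power norm_gauss_wave by simp
qed

lemma mordell_integrable:
  assumes a: "\<alpha> > 0" and Y: "Y \<noteq> 0 \<or> k = 0"
  shows "integrable lborel (\<lambda>s. gauss_wave \<alpha> r Y s / horizontal Y s ^ k)"
proof (rule Bochner_Integration.integrable_bound)
  show "integrable lborel (\<lambda>s. exp (\<alpha> * Y\<^sup>2 - 2 * pi * (r * Y)) / \<bar>Y\<bar> ^ k * exp (- \<alpha> * s\<^sup>2))"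
    by (rule integrable_mult_right) (rule gaussian_real(1)[OF a])
qed (use norm_gauss_wave_divide_le[OF Y] in auto)

lemma gauss_wave_integrable: "\<alpha> > 0 \<Longrightarrow> integrable lborel (gauss_wave \<alpha> r Y)"
  using mordell_integrable[of \<alpha> Y 0 r] by simp

lemma gauss_wave_integral:
  assumes a: "\<alpha> > 0"
  shows "(LINT s|lborel. gauss_wave \<alpha> r Y s) = of_real (sqrt (pi / \<alpha>) * exp (- pi\<^sup>2 * r\<^sup>2 / \<alpha>))"
proof -
  have "(LINT s|lborel. gauss_wave \<alpha> r Y s) =
      of_real (exp (\<alpha> * Y\<^sup>2 - 2 * pi * (r * Y)) * (sqrt (pi / \<alpha>) * exp (- (2 * pi * r - 2 * \<alpha> * Y)\<^sup>2 / (4 * \<alpha>))))"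
    unfolding gauss_wave_eq integral_mult_right_zero gauss_fourier_transform[OF a] by simp
  also have "exp (\<alpha> * Y\<^sup>2 - 2 * pi * (r * Y)) * (sqrt (pi / \<alpha>) * exp (- (2 * pi * r - 2 * \<alpha> * Y)\<^sup>2 / (4 * \<alpha>))) =
      sqrt (pi / \<alpha>) * exp (\<alpha> * Y\<^sup>2 - 2 * pi * (r * Y) + - (2 * pi * r - 2 * \<alpha> * Y)\<^sup>2 / (4 * \<alpha>))"
    by (simp only: exp_add mult_ac)
  also have "\<alpha> * Y\<^sup>2 - 2 * pi * (r * Y) + - (2 * pi * r - 2 * \<alpha> * Y)\<^sup>2 / (4 * \<alpha>) = - pi\<^sup>2 * r\<^sup>2 / \<alpha>"
    using a by (simp add: field_simps power2_eq_square)
  finally show ?thesis .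
qed

lemma integral_ee_half_line:
  assumes w: "Im w > 0"
  shows "(LINT s|lborel. indicator {0<..} s *\<^sub>R ee (of_real s * w)) = - 1 / (tpi * w)"
proof -
  let ?f = "\<lambda>s::real. indicator {0<..} s *\<^sub>R ee (of_real s * w)"
  have nonzero: "tpi * w \<noteq> 0" using w by auto
  have norm: "norm (ee (of_real s * w)) = exp (- (s * (2 * pi * Im w)))" for s :: real
    by (simp add: norm_ee mult_ac)
  have "integrable lborel ?f"
  proof (rule Bochner_Integration.integrable_bound)
    show "integrable lborel (\<lambda>s. indicator {0<..} s *\<^sub>R exp (- (s * (2 * pi * Im w))))"
      using integrable_I0i_exp_mscale[of "2 * pi * Im w"] w by (simp add: set_integrable_def)
    show "?f \<in> borel_measurable lborel" unfolding ee_def by measurable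
  qed (auto simp: norm)
  from tendsto_integral_UNIV[OF this, of 0]
  have "(\<lambda>m. integral {0 - real m..0 + real m} ?f) \<longlonglongrightarrow> (LINT s|lborel. ?f s)" .
  moreover have "integral {0 - real m..0 + real m} ?f = (ee (of_real (real m) * w) - 1) / (tpi * w)" for m
  proof -
    have "((\<lambda>s. ee (of_real s * w) / (tpi * w)) has_vector_derivative ee (of_real s * w)) (at s within {0..real m})" for s :: real
      using has_vector_derivative_real_field[OF DERIV_cdivide[OF ee_has_field_derivative[of w "of_real s" UNIV], of "tpi * w"]]
        nonzero by (auto simp: mult.commute[of w] intro: has_vector_derivative_at_within)
    hence "((\<lambda>s. ee (of_real s * w)) has_integral (ee (of_real (real m) * w) - 1) / (tpi * w)) {0..real m}"
      using fundamental_theorem_of_calculus[of 0 "real m" "\<lambda>s. ee (of_real s * w) / (tpi * w)"]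
      by (simp add: diff_divide_distrib)
    hence "((\<lambda>s. if s \<in> {0..real m} then ee (of_real s * w) else 0) has_integral
        (ee (of_real (real m) * w) - 1) / (tpi * w)) {0 - real m..0 + real m}"
      by (subst has_integral_restrict) auto
    hence "(?f has_integral (ee (of_real (real m) * w) - 1) / (tpi * w)) {0 - real m..0 + real m}"
      by (rule has_integral_spike_finite[of "{0}", rotated 2]) auto
    thus ?thesis by (rule integral_unique)
  qed
  moreover have "(\<lambda>m. ee (of_real (real m) * w)) \<longlonglongrightarrow> 0"
  proof (rule Lim_null_comparison)
    have "(\<lambda>m. exp (- (real m * u))) \<longlonglongrightarrow> 0" if "u > 0" for u using that by real_asymp
    thus "(\<lambda>m. exp (- (real m * (2 * pi * Im w)))) \<longlonglongrightarrow> 0" using w by simp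
  qed (simp only: norm order_refl eventually_True)
  hence "(\<lambda>m. (ee (of_real (real m) * w) - 1) / (tpi * w)) \<longlonglongrightarrow> (0 - 1) / (tpi * w)"
    by (intro tendsto_intros nonzero)
  ultimately show ?thesis by (simp add: LIMSEQ_unique)
qed

lemma integral_gauss_half_line:
  assumes a: "\<alpha> > 0"
  shows "(LINT s|lborel. indicator {0<..} s *\<^sub>R (sqrt (pi / \<alpha>) * exp (- pi\<^sup>2 * (r + s)\<^sup>2 / \<alpha>))) =
    erfc (r * pi / sqrt \<alpha>) / 2"
proof -
  define c where "c = pi / sqrt \<alpha>"
  have c: "c > 0" "c\<^sup>2 = pi\<^sup>2 / \<alpha>" "sqrt (pi / \<alpha>) = c / sqrt pi"
    using a by (simp_all add: c_def power_divide real_sqrt_divide field_simps)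
  let ?J = "LINT s|lborel. indicator {0<..} s *\<^sub>R exp (- pi\<^sup>2 * (r + s)\<^sup>2 / \<alpha>)"
  have "erfc (r * c) = 2 / sqrt pi * (LINT s|lborel. indicator {0..} s *\<^sub>R exp (- (r * c + s)\<^sup>2))"
    by (rule erfc_shift)
  also have "(LINT s|lborel. indicator {0..} s *\<^sub>R exp (- (r * c + s)\<^sup>2)) =
      \<bar>c\<bar> *\<^sub>R (LINT s|lborel. indicator {0..} (0 + c * s) *\<^sub>R exp (- (r * c + (0 + c * s))\<^sup>2))"
    by (rule lborel_integral_real_affine) (use c in auto)
  also have "(LINT s|lborel. indicator {0..} (0 + c * s) *\<^sub>R exp (- (r * c + (0 + c * s))\<^sup>2)) = ?J"
  proof (rule integral_cong_AE)
    show "AE s in lborel. indicator {0..} (0 + c * s) *\<^sub>R exp (- (r * c + (0 + c * s))\<^sup>2) =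
        indicator {0<..} s *\<^sub>R exp (- pi\<^sup>2 * (r + s)\<^sup>2 / \<alpha>)"
      using AE_lborel_singleton[of 0]
    proof eventually_elim
      case (elim s)
      have "(r * c + (0 + c * s))\<^sup>2 = c\<^sup>2 * (r + s)\<^sup>2" by (simp add: power2_eq_square algebra_simps)
      hence "- (r * c + (0 + c * s))\<^sup>2 = - pi\<^sup>2 * (r + s)\<^sup>2 / \<alpha>" unfolding c(2) by simp
      thus ?case using elim c(1) by (auto split: split_indicator simp: zero_le_mult_iff)
    qed
  qed auto
  finally have "erfc (r * c) / 2 = sqrt (pi / \<alpha>) * ?J" using c(1) by (simp add: c(3))
  also have "\<dots> = (LINT s|lborel. sqrt (pi / \<alpha>) * (indicator {0<..} s *\<^sub>R exp (- pi\<^sup>2 * (r + s)\<^sup>2 / \<alpha>)))"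
    by (rule integral_mult_right_zero[symmetric])
  finally show ?thesis by (simp add: c_def mult.left_commute)
qed

text \<open>Write \<open>1 / w\<close> as an integral of \<open>ee (s * w)\<close> over \<open>s > 0\<close> and exchange the two integrals.\<close>

lemma mordell_1:
  assumes a: "\<alpha> > 0" and Y: "Y > 0"
  shows "mordell \<alpha> 1 r Y = - (of_real pi * \<i>) * of_real (erfc (r * pi / sqrt \<alpha>))"
proof -
  define f where "f = (\<lambda>s u. indicator {0<..} s *\<^sub>R gauss_wave \<alpha> (r + s) Y u)"
  have norm_f: "norm (f s u) = indicator {0<..} s *
      (exp (\<alpha> * Y\<^sup>2 - 2 * pi * (r * Y)) * exp (- (s * (2 * pi * Y)))) * exp (- \<alpha> * u\<^sup>2)" for s u
    unfolding f_def norm_scaleR norm_gauss_wave by (simp add: algebra_simps flip: exp_add)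
  have integrable_f: "integrable (lborel \<Otimes>\<^sub>M lborel) (case_prod f)"
  proof (rule lborel_pair.Fubini_integrable)
    show "case_prod f \<in> borel_measurable (lborel \<Otimes>\<^sub>M lborel)"
      unfolding f_def gauss_wave_def ee_def by measurable
    have "(LINT u|lborel. norm (case_prod f (s, u))) =
        sqrt (pi / \<alpha>) * exp (\<alpha> * Y\<^sup>2 - 2 * pi * (r * Y)) * (indicator {0<..} s *\<^sub>R exp (- (s * (2 * pi * Y))))" for s
      unfolding prod.case norm_f integral_mult_right_zero gaussian_real(2)[OF a] by simp
    moreover have "integrable lborel (\<lambda>s. indicator {0<..} s *\<^sub>R exp (- (s * (2 * pi * Y))))"
      using integrable_I0i_exp_mscale[of "2 * pi * Y"] Y by (simp add: set_integrable_def)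
    ultimately show "integrable lborel (\<lambda>s. LINT u|lborel. norm (case_prod f (s, u)))"
      by (simp only: integrable_mult_right)
    show "AE s in lborel. integrable lborel (\<lambda>u. case_prod f (s, u))"
      unfolding f_def prod.case by (intro AE_I2 integrable_scaleR_right gauss_wave_integrable a)
  qed
  have inner: "(LINT s|lborel. f s u) = - 1 / tpi * (gauss_wave \<alpha> r Y u / horizontal Y u ^ 1)" for u
  proof -
    have "f s u = gauss_wave \<alpha> r Y u * (indicator {0<..} s *\<^sub>R ee (of_real s * horizontal Y u))" for s
      unfolding f_def gauss_wave_def of_real_add distrib_right[of "of_real r"] ee_add by simp
    hence "(LINT s|lborel. f s u) = gauss_wave \<alpha> r Y u * (- 1 / (tpi * horizontal Y u))"
      using integral_ee_half_line[of "horizontal Y u"] Y by (simp only: integral_mult_right_zero) simp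
    thus ?thesis by simp
  qed
  have "- 1 / tpi * mordell \<alpha> 1 r Y = (LINT u|lborel. LINT s|lborel. f s u)"
    unfolding inner mordell_def by (rule integral_mult_right_zero[symmetric])
  also have "\<dots> = (LINT s|lborel. LINT u|lborel. f s u)"
    by (rule lborel_pair.Fubini_integral[OF integrable_f])
  also have "\<dots> = (LINT s|lborel. complex_of_real (indicator {0<..} s *\<^sub>R (sqrt (pi / \<alpha>) * exp (- pi\<^sup>2 * (r + s)\<^sup>2 / \<alpha>))))"
    unfolding f_def integral_scaleR_right gauss_wave_integral[OF a] by (simp add: scaleR_conv_of_real)
  also have "\<dots> = of_real (erfc (r * pi / sqrt \<alpha>) / 2)"
    unfolding integral_complex_of_real integral_gauss_half_line[OF a] ..
  finally have "- tpi * (- 1 / tpi * mordell \<alpha> 1 r Y) = - tpi * of_real (erfc (r * pi / sqrt \<alpha>) / 2)"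
    by (rule arg_cong)
  thus ?thesis by simp
qed

lemma mordell_uminus: "mordell \<alpha> k r (- Y) = (- 1) ^ k * mordell \<alpha> k (- r) Y"
proof -
  have "gauss_wave \<alpha> r (- Y) (0 + - 1 * s) / horizontal (- Y) (0 + - 1 * s) ^ k =
      (- 1) ^ k * (gauss_wave \<alpha> (- r) Y s / horizontal Y s ^ k)" for s
  proof -
    have minus: "horizontal (- Y) (0 + - 1 * s) = - horizontal Y s" by simp
    have "gauss_wave \<alpha> r (- Y) (0 + - 1 * s) = gauss_wave \<alpha> (- r) Y s"
      unfolding gauss_wave_def minus
      by (simp only: power2_minus mult_minus_right mult_minus_left of_real_minus)
    thus ?thesis unfolding minus power_minus[of "horizontal Y s"] by (simp add: minus_one_power_iff)
  qed
  thus ?thesis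
    using lborel_integral_real_affine[of "- 1" "\<lambda>s. gauss_wave \<alpha> r (- Y) s / horizontal (- Y) s ^ k" 0]
    unfolding mordell_def by (simp only: integral_mult_right_zero) simp
qed

lemma gauss_wave_divide_has_vector_derivative:
  assumes Y: "Y \<noteq> 0"
  shows "((\<lambda>s. gauss_wave \<alpha> r Y s / horizontal Y s ^ 1) has_vector_derivative
    - 2 * of_real \<alpha> * gauss_wave \<alpha> r Y s + tpi * of_real r * (gauss_wave \<alpha> r Y s / horizontal Y s ^ 1) -
      gauss_wave \<alpha> r Y s / horizontal Y s ^ 2) (at s)"
proof -
  define G where "G = (\<lambda>z. exp (- of_real \<alpha> * (z + \<i> * of_real Y)\<^sup>2) * ee (of_real r * (z + \<i> * of_real Y)))"
  have G: "G (of_real s) = gauss_wave \<alpha> r Y s" for s by (simp add: G_def gauss_wave_def)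
  have "(G has_field_derivative (- 2 * of_real \<alpha> * horizontal Y s + tpi * of_real r) * G (of_real s)) (at (of_real s))"
    unfolding G_def ee_def by (auto intro!: derivative_eq_intros simp: algebra_simps)
  from DERIV_divide[OF this DERIV_add[OF DERIV_ident DERIV_const] horizontal_nonzero[OF Y]]
  have "((\<lambda>z. G z / (z + \<i> * of_real Y)) has_field_derivative
      - 2 * of_real \<alpha> * gauss_wave \<alpha> r Y s + tpi * of_real r * (gauss_wave \<alpha> r Y s / horizontal Y s ^ 1) -
        gauss_wave \<alpha> r Y s / horizontal Y s ^ 2) (at (of_real s))"
    by (rule DERIV_cong)
       (use horizontal_nonzero[OF Y, of s] in \<open>simp add: G divide_simps, simp add: algebra_simps power2_eq_square\<close>)
  from has_vector_derivative_real_field[OF this] show ?thesis by (simp add: G)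
qed

lemma mordell_2:
  assumes a: "\<alpha> > 0" and Y: "Y \<noteq> 0"
  shows "mordell \<alpha> 2 r Y =
    - 2 * of_real \<alpha> * of_real (sqrt (pi / \<alpha>) * exp (- pi\<^sup>2 * r\<^sup>2 / \<alpha>)) + tpi * of_real r * mordell \<alpha> 1 r Y"
proof -
  define F where "F = (\<lambda>s. gauss_wave \<alpha> r Y s / horizontal Y s ^ 1)"
  define F' where "F' = (\<lambda>s. - 2 * of_real \<alpha> * gauss_wave \<alpha> r Y s + tpi * of_real r * F s -
    gauss_wave \<alpha> r Y s / horizontal Y s ^ 2)"
  have integrable: "integrable lborel (gauss_wave \<alpha> r Y)" "integrable lborel F"
      "integrable lborel (\<lambda>s. gauss_wave \<alpha> r Y s / horizontal Y s ^ 2)"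
    unfolding F_def using gauss_wave_integrable[OF a] mordell_integrable[OF a] Y by blast+
  hence "integrable lborel F'" unfolding F'_def
    by (intro Bochner_Integration.integrable_diff Bochner_Integration.integrable_add integrable_mult_right)
  from tendsto_integral_UNIV[OF this, of 0]
  have "(\<lambda>m. integral {0 - real m..0 + real m} F') \<longlonglongrightarrow> (LINT s|lborel. F' s)" .
  moreover have "integral {0 - real m..0 + real m} F' = F (real m) - F (- 1 * real m)" for m
    using fundamental_theorem_of_calculus[of "- real m" "real m" F F']
      gauss_wave_divide_has_vector_derivative[OF Y, of \<alpha> r] unfolding F_def F'_def
    by (simp add: has_vector_derivative_at_within integral_unique)
  moreover have "(\<lambda>m. F (\<sigma> * real m)) \<longlonglongrightarrow> 0" if "\<sigma>\<^sup>2 = 1" for \<sigma>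
  proof (rule Lim_null_comparison)
    let ?C = "exp (\<alpha> * Y\<^sup>2 - 2 * pi * (r * Y)) / \<bar>Y\<bar> ^ 1"
    show "(\<lambda>m. ?C * exp (- \<alpha> * (real m)\<^sup>2)) \<longlonglongrightarrow> 0" using a by real_asymp
    show "\<forall>\<^sub>F m in sequentially. norm (F (\<sigma> * real m)) \<le> ?C * exp (- \<alpha> * (real m)\<^sup>2)"
      using norm_gauss_wave_divide_le[of Y 1 \<alpha> r "\<sigma> * real m" for m] Y that
      by (simp add: F_def power_mult_distrib)
  qed
  from tendsto_diff[OF this[of 1] this[of "- 1"]]
  have "(\<lambda>m. F (real m) - F (- 1 * real m)) \<longlonglongrightarrow> 0" by simp
  ultimately have "(LINT s|lborel. F' s) = 0" by (simp add: LIMSEQ_unique)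
  moreover have "(LINT s|lborel. F' s) = - 2 * of_real \<alpha> * (LINT s|lborel. gauss_wave \<alpha> r Y s) +
      tpi * of_real r * (LINT s|lborel. F s) - mordell \<alpha> 2 r Y"
    unfolding F'_def mordell_def
    by (simp only: Bochner_Integration.integral_diff Bochner_Integration.integral_add
        Bochner_Integration.integrable_add integrable_mult_right integrable integral_mult_right_zero)
  ultimately show ?thesis
    unfolding gauss_wave_integral[OF a] F_def mordell_def[symmetric] by (simp add: algebra_simps)
qed

lemma poincare_term_gauss_wave:
  fixes l :: int and y :: real
  assumes t: "t \<in> uhp" and N: "N > 0"
  defines "z \<equiv> \<lambda>x. \<i> * complex_of_real y + of_real x * 1" and "r \<equiv> \<lambda>a. 2 * int N * a - l"
  shows "poincare_term N k t (lat_point t (a, b)) (z x) * ee (- (of_int l * z x)) =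
    theta_q N l t * inverse (theta_q N (r a) t) *
    (gauss_wave (pi * real N / Im t) (of_int (r a)) (y + of_int a * Im t) (x + of_int a * Re t + of_int b) /
      horizontal (y + of_int a * Im t) (x + of_int a * Re t + of_int b) ^ k)"
proof -
  define \<omega> where "\<omega> = lat_point t (a, b)"
  define \<alpha> where "\<alpha> = pi * real N / Im t"
  have v: "Im t \<noteq> 0" using uhpD[OF t] by simp
  have shift: "horizontal (y + of_int a * Im t) (x + of_int a * Re t + of_int b) = z x + \<omega>"
    by (simp add: z_def \<omega>_def lat_point_def complex_eq_iff)
  have "cnj \<omega> = \<omega> - 2 * \<i> * of_real (Im t) * of_int a"
    by (simp add: \<omega>_def lat_point_def complex_eq_iff)
  hence "(z x)\<^sup>2 + 2 * z x * cnj \<omega> + \<omega> * cnj \<omega> = (z x + \<omega>)\<^sup>2 + 2 * \<i> * of_real (Im t) * (- (of_int a * (2 * z x + \<omega>)))"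
    by (simp only:) (simp add: power2_eq_square algebra_simps)
  hence "exp (- of_real \<alpha> * ((z x)\<^sup>2 + 2 * z x * cnj \<omega> + \<omega> * cnj \<omega>)) = exp (- of_real \<alpha> * (z x + \<omega>)\<^sup>2) *
      exp (- of_real \<alpha> * (2 * \<i> * of_real (Im t) * (- (of_int a * (2 * z x + \<omega>)))))"
    by (simp only: distrib_left exp_add)
  also have "exp (- of_real \<alpha> * (2 * \<i> * of_real (Im t) * (- (of_int a * (2 * z x + \<omega>))))) =
      ee (of_nat N * (of_int a * (2 * z x + \<omega>)))"
    unfolding \<alpha>_def exp_pi_N[OF v] by simp
  finally have gauss: "exp (- of_real \<alpha> * ((z x)\<^sup>2 + 2 * z x * cnj \<omega> + \<omega> * cnj \<omega>)) =
      exp (- of_real \<alpha> * (z x + \<omega>)\<^sup>2) * ee (of_nat N * (of_int a * (2 * z x + \<omega>)))" .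
  have "of_nat N * (of_int a * (2 * z x + \<omega>)) + - (of_int l * z x) =
     of_int (l\<^sup>2) / of_nat (4 * N) * t + - (of_int ((r a)\<^sup>2) / of_nat (4 * N) * t) +
       of_real (of_int (r a)) * (z x + \<omega>) + of_int (l * b - int N * a * b)"
    using N by (simp add: r_def \<omega>_def lat_point_def field_simps power2_eq_square)
  hence "ee (of_nat N * (of_int a * (2 * z x + \<omega>))) * ee (- (of_int l * z x)) =
     theta_q N l t * inverse (theta_q N (r a) t) * ee (of_real (of_int (r a)) * (z x + \<omega>))"
    unfolding inverse_theta_q unfolding theta_q_def
    by (simp only: ee_add[symmetric]) (simp only: ee_add ee_of_int mult_1_right)
  thus ?thesis
    unfolding \<omega>_def[symmetric] \<alpha>_def[symmetric] gauss_wave_def shift poincare_term_def poincare_form_def gauss by (simp add: mult_ac)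
qed

lemma strip_height_le:
  fixes y v :: real and a :: int
  assumes "0 < y" "y < v"
  shows "min y (v - y) \<le> \<bar>y + of_int a * v\<bar>"
proof (cases "a \<ge> 0")
  case True
  hence "of_int a * v \<ge> 0" using assms by simp
  thus ?thesis using assms by simp
next
  case False
  hence "of_int (a + 1) * v \<le> 0" using assms by (intro mult_nonpos_nonneg) auto
  thus ?thesis using assms by (simp add: algebra_simps)
qed

context
  fixes N k :: nat and t :: complex and l :: int and y :: real
  assumes t: "t \<in> uhp" and N: "N > 0" and y: "0 < y" "y < Im t"
begin

lemma poincare_term_integrals_has_sum:
  defines "z \<equiv> \<lambda>x::real. \<i> * of_real y + of_real x * 1"
  shows "((\<lambda>p. integral {0..1} (\<lambda>x. poincare_term N k t (lat_point t p) (z x) * ee (- (of_int l * z x)))) has_sum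
    period_int (\<lambda>z. poincare N k t z * ee (- (of_int l * z))) (\<i> * of_real y) 1) UNIV"
proof -
  let ?\<epsilon> = "min y (Im t - y)"
  have \<epsilon>: "?\<epsilon> > 0" using y by simp
  have dist_lat: "?\<epsilon> \<le> norm (z x + lat_point t p)" for x p
    using strip_height_le[OF y, of "fst p"] abs_Im_le_cmod[of "z x + lat_point t p"]
    by (simp add: z_def lat_point_def)
  obtain M where M: "M summable_on UNIV" "\<And>p x. norm (z x) \<le> 1 + y \<Longrightarrow> norm (poincare_term N k t (lat_point t p) (z x)) \<le> M p"
    using poincare_majorant[OF t \<epsilon> N, of UNIV "1 + y" k] dist_lat by blast
  define f where "f = (\<lambda>p x. poincare_term N k t (lat_point t p) (z x) * ee (- (of_int l * z x)))"
  have "((\<lambda>p. integral {0..1} (f p)) has_sum integral {0..1} (\<lambda>x. \<Sum>\<^sub>\<infinity>p\<in>UNIV. f p x)) UNIV"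
  proof (rule infsum_integral)
    show "(\<lambda>p. M p * exp (2 * pi * of_int l * y)) summable_on UNIV"
      by (rule summable_on_cmult_left[OF M(1)])
    fix p
    have "z x + lat_point t p \<noteq> 0" for x using dist_lat[of x p] \<epsilon> by auto
    moreover have "continuous_on {0..1} z" unfolding z_def by (intro continuous_intros)
    ultimately show "continuous_on {0..1} (f p)"
      unfolding f_def poincare_term_def poincare_form_def by (intro continuous_intros ee_continuous) auto
    fix x :: real assume "x \<in> {0..1}"
    hence "norm (z x) \<le> y + 1" unfolding z_def using y by (intro norm_triangle_mono) (auto simp: norm_mult)
    hence "norm (poincare_term N k t (lat_point t p) (z x)) * exp (2 * pi * of_int l * y) \<le> M p * exp (2 * pi * of_int l * y)"
      by (intro mult_right_mono M) auto
    moreover have "norm (ee (- (of_int l * z x))) = exp (2 * pi * of_int l * y)"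
      by (simp add: norm_ee z_def mult.assoc)
    ultimately show "norm (f p x) \<le> M p * exp (2 * pi * of_int l * y)" by (simp add: f_def norm_mult)
  qed
  thus ?thesis unfolding period_int_def f_def infsum_cmult_left' poincare_def z_def .
qed

lemma poincare_coefficient:
  "((\<lambda>a. inverse (theta_q N (2 * int N * a - l) t) *
      mordell (pi * real N / Im t) k (of_int (2 * int N * a - l)) (y + of_int a * Im t)) has_sum
    inverse (theta_q N l t) * period_int (\<lambda>z. poincare N k t z * ee (- (of_int l * z))) (\<i> * of_real y) 1) UNIV"
proof -
  define r where "r = (\<lambda>a::int. 2 * int N * a - l)"
  define Y where "Y = (\<lambda>a::int. y + of_int a * Im t)"
  define g where "g = (\<lambda>a s. gauss_wave (pi * real N / Im t) (of_int (r a)) (Y a) s / horizontal (Y a) s ^ k)"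
  have Y: "Y a \<noteq> 0" for a using strip_height_le[OF y, of a] y by (auto simp: Y_def)
  let ?S = "period_int (\<lambda>z. poincare N k t z * ee (- (of_int l * z))) (\<i> * of_real y) 1"
  have "integral {0..1} (\<lambda>x. poincare_term N k t (lat_point t p) (\<i> * of_real y + of_real x * 1) *
      ee (- (of_int l * (\<i> * of_real y + of_real x * 1)))) =
      (case p of (a, b) \<Rightarrow> theta_q N l t * inverse (theta_q N (r a) t) *
        integral {0..1} (\<lambda>x. g a (x + of_int a * Re t + of_int b)))" for p
    by (cases p) (simp only: poincare_term_gauss_wave[OF t N] g_def r_def Y_def integral_mult_right prod.case)
  with poincare_term_integrals_has_sum
  have "((\<lambda>(a, b). theta_q N l t * inverse (theta_q N (r a) t) *
      integral {0..1} (\<lambda>x. g a (x + of_int a * Re t + of_int b))) has_sum ?S) (UNIV \<times> UNIV)"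
    by (simp only: UNIV_Times_UNIV)
  hence "((\<lambda>a. theta_q N l t * inverse (theta_q N (r a) t) * (LINT s|lborel. g a s)) has_sum ?S) UNIV"
  proof (rule has_sum_unfold_family)
    fix a
    show "continuous_on UNIV (g a)" unfolding g_def using horizontal_nonzero[OF Y]
      by (intro continuous_intros gauss_wave_continuous) auto
    show "integrable lborel (g a)" unfolding g_def using uhpD[OF t] N Y by (intro mordell_integrable) auto
  qed
  from has_sum_cmult_right[OF this, of "inverse (theta_q N l t)"] show ?thesis
    by (simp add: mult.assoc[symmetric] g_def r_def Y_def mordell_def)
qed

end

section \<open>The completed Jacobi form\<close>

definition mero_jacobi :: "nat \<Rightarrow> (complex \<Rightarrow> complex \<Rightarrow> complex) \<Rightarrow> complex \<Rightarrow> complex \<Rightarrow> complex" where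
  "mero_jacobi N G t z = jacobi_phi t z ^ N * G t z"

definition completed_jacobi :: "nat \<Rightarrow> nat \<Rightarrow> int \<Rightarrow> (complex \<Rightarrow> complex \<Rightarrow> complex) \<Rightarrow> complex \<Rightarrow> complex \<Rightarrow> complex" where
  "completed_jacobi N k c G t z = mero_jacobi N G t z - of_int c / tpi ^ k * poincare N k t z"

definition entire_jacobi :: "nat \<Rightarrow> nat \<Rightarrow> int \<Rightarrow> (complex \<Rightarrow> complex \<Rightarrow> complex) \<Rightarrow> complex \<Rightarrow> complex \<Rightarrow> complex" where
  "entire_jacobi N k c G t = remove_sings (completed_jacobi N k c G t)"

definition theta_vec :: "nat \<Rightarrow> nat \<Rightarrow> int \<Rightarrow> (complex \<Rightarrow> complex \<Rightarrow> complex) \<Rightarrow> nat \<Rightarrow> complex \<Rightarrow> complex" where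
  "theta_vec N k c G l t = theta_comp N t (entire_jacobi N k c G t) (int l)"

lemma odd_removable_tendsto_0:
  assumes \<delta>: "\<delta> > 0" and hol: "h holomorphic_on ball 0 \<delta> - {0}"
    and odd: "\<And>z. z \<in> ball 0 \<delta> - {0} \<Longrightarrow> h (- z) = - h z" and lim: "((\<lambda>z. z * h z) \<longlongrightarrow> 0) (at 0)"
  shows "(h \<longlongrightarrow> 0) (at (0 :: complex))"
proof -
  have "((\<lambda>z. (z - 0) * h z) \<longlongrightarrow> 0) (at 0)" using lim by simp
  hence "\<exists>g. g holomorphic_on ball 0 \<delta> \<and> (\<forall>z\<in>ball 0 \<delta> - {0}. g z = h z)"
    by (subst holomorphic_on_extend_lim) (use hol \<delta> in auto)
  then obtain g where g: "g holomorphic_on ball 0 \<delta>" "\<And>z. z \<in> ball 0 \<delta> - {0} \<Longrightarrow> g z = h z" by blast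
  have punctured: "\<forall>\<^sub>F z in at 0. z \<in> ball 0 \<delta> - {0}" using \<delta> by (intro eventually_at_in_open) auto
  have "isCont g 0"
    using holomorphic_on_imp_continuous_on[OF g(1)] \<delta> by (simp add: continuous_on_eq_continuous_at)
  hence "(g \<longlongrightarrow> g 0) (at 0)" by (simp add: isCont_def)
  hence lim_h: "(h \<longlongrightarrow> g 0) (at 0)"
    by (rule Lim_transform_eventually) (use punctured in eventually_elim, simp add: g(2))
  have "filterlim (\<lambda>z::complex. - z) (at 0) (at 0)"
    unfolding filterlim_at by (auto intro!: tendsto_eq_intros simp: eventually_at_filter)
  from filterlim_compose[OF lim_h this] have "((\<lambda>z. - h z) \<longlongrightarrow> g 0) (at 0)"
    by (rule Lim_transform_eventually) (use punctured in eventually_elim, simp add: odd)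
  moreover have "((\<lambda>z. - h z) \<longlongrightarrow> - g 0) (at 0)" by (rule tendsto_minus[OF lim_h])
  ultimately have "g 0 = - g 0" by (rule tendsto_unique[OF trivial_limit_at])
  with lim_h show ?thesis by simp
qed

lemma theta_q_add_1: "theta_q N n (t + 1) = ee (of_int (n\<^sup>2) / of_nat (4 * N)) * theta_q N n t"
  unfolding theta_q_def distrib_left ee_add by (simp add: mult.commute)

lemma csqrt_power_gauss_width:
  assumes "t \<in> uhp" "N > 0" "k > 0"
  shows "t ^ k * csqrt (of_real pi / (- 2 * of_real pi * \<i> * of_nat N * t)) =
    csqrt t ^ (2 * k - 1) * (ee (1 / 8) / of_real (sqrt (real (2 * N))))"
proof -
  have "t ^ k = (csqrt t)\<^sup>2 ^ k" by simp
  also have "\<dots> = csqrt t ^ Suc (2 * k - 1)"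
    unfolding power_mult[symmetric] using assms(3) by (intro arg_cong2[of _ _ _ _ power]) auto
  finally show ?thesis
    unfolding csqrt_gauss_width[OF assms(1,2), symmetric] by (simp only: power_Suc2 mult_ac)
qed

context
  fixes N k :: nat and c :: int and G :: "complex \<Rightarrow> complex \<Rightarrow> complex"
  assumes N: "N > 0" and k: "k = 1 \<or> k = 2" and G: "int_elliptic (2 * N + k) c G"
begin

abbreviation (input) completed :: "complex \<Rightarrow> complex \<Rightarrow> complex" where "completed \<equiv> completed_jacobi N k c G"
abbreviation (input) entire :: "complex \<Rightarrow> complex \<Rightarrow> complex" where "entire \<equiv> entire_jacobi N k c G"

lemma elliptic_G: "elliptic (2 * N + k) G" using G by (simp add: int_elliptic_def)

lemma mero_jacobi_holomorphic: "t \<in> uhp \<Longrightarrow> mero_jacobi N G t holomorphic_on (- lat t)"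
  unfolding mero_jacobi_def[abs_def]
  by (intro holomorphic_intros ellipticD(1)[OF elliptic_G] holomorphic_on_subset[OF jacobi_phi_holomorphic]) auto

lemma completed_jacobi_holomorphic: "t \<in> uhp \<Longrightarrow> completed t holomorphic_on (- lat t)"
  unfolding completed_jacobi_def[abs_def]
  by (intro holomorphic_intros mero_jacobi_holomorphic poincare_holomorphic N)

lemma completed_jacobi_add_1: "t \<in> uhp \<Longrightarrow> z \<notin> lat t \<Longrightarrow> completed t (z + 1) = completed t z"
  by (simp add: completed_jacobi_def mero_jacobi_def jacobi_phi_add_1 poincare_add_1 ellipticD(2)[OF elliptic_G])

lemma completed_jacobi_add_t:
  assumes "t \<in> uhp" "z \<notin> lat t"
  shows "completed t (z + t) = ee (- (of_nat N * t) - of_nat (2 * N) * z) * completed t z"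
proof -
  have "ee (- t - 2 * z) ^ N = ee (- (of_nat N * t) - of_nat (2 * N) * z)"
    unfolding ee_power by (simp add: algebra_simps)
  thus ?thesis using assms
    by (simp add: completed_jacobi_def mero_jacobi_def jacobi_phi_add_tau poincare_add_t ellipticD(3)[OF elliptic_G]
        power_mult_distrib right_diff_distrib mult_ac)
qed

lemma completed_jacobi_T: "t \<in> uhp \<Longrightarrow> z \<notin> lat t \<Longrightarrow> completed (t + 1) z = completed t z"
  by (simp add: completed_jacobi_def mero_jacobi_def jacobi_phi_T poincare_T ellipticD(4)[OF elliptic_G])

lemma completed_jacobi_minus: "t \<in> uhp \<Longrightarrow> z \<notin> lat t \<Longrightarrow> completed t (- z) = (- 1) ^ k * completed t z"
  by (simp add: completed_jacobi_def mero_jacobi_def jacobi_phi_minus poincare_minus ellipticD(5)[OF elliptic_G]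
      power_add right_diff_distrib mult_ac)

lemma completed_jacobi_S:
  assumes t: "t \<in> uhp" and z: "z \<notin> lat t"
  shows "completed (- 1 / t) (z / t) = t ^ k * ee (of_nat N * z\<^sup>2 / t) * completed t z"
proof -
  have "(ee (z\<^sup>2 / t) / t\<^sup>2) ^ N * t ^ (2 * N + k) = t ^ k * ee (of_nat N * z\<^sup>2 / t)"
    using uhp_nonzero[OF t] by (simp add: power_divide ee_power power_add power_mult)
  hence "mero_jacobi N G (- 1 / t) (z / t) = t ^ k * ee (of_nat N * z\<^sup>2 / t) * mero_jacobi N G t z"
    unfolding mero_jacobi_def jacobi_phi_S[OF t z] ellipticD(6)[OF elliptic_G t z] power_mult_distrib
    by (metis mult.assoc mult.commute)
  thus ?thesis unfolding completed_jacobi_def poincare_S[OF t] by (simp add: right_diff_distrib mult_ac)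
qed

lemma mero_jacobi_limit:
  assumes t: "t \<in> uhp"
  shows "((\<lambda>z. z ^ k * mero_jacobi N G t z) \<longlongrightarrow> of_int c / tpi ^ k) (at 0)"
proof -
  define C where "C = tpi"
  have C: "C \<noteq> 0" by (simp add: C_def)
  have "((\<lambda>z. (jacobi_phi t z / (C * z)\<^sup>2) ^ N * ((C * z) ^ (2 * N + k) * G t z) / C ^ k) \<longlongrightarrow>
      1 ^ N * of_int c / C ^ k) (at 0)"
    using jacobi_phi_limit[OF t] G t C
      unfolding C_def[symmetric] int_elliptic_def by (intro tendsto_intros) auto
  moreover have "\<forall>\<^sub>F z::complex in at 0. z \<noteq> 0" by (simp add: eventually_at_filter)
  hence "\<forall>\<^sub>F z in at 0. (jacobi_phi t z / (C * z)\<^sup>2) ^ N * ((C * z) ^ (2 * N + k) * G t z) / C ^ k =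
      z ^ k * mero_jacobi N G t z"
  proof eventually_elim
    case (elim z)
    hence "(jacobi_phi t z / (C * z)\<^sup>2) ^ N * (C * z) ^ (2 * N + k) = jacobi_phi t z ^ N * (C * z) ^ k"
      using C by (simp add: power_divide power_add power_mult)
    thus ?case using C by (simp add: mero_jacobi_def mult.assoc[symmetric] power_mult_distrib)
  qed
  ultimately show ?thesis unfolding C_def[symmetric] by (simp add: Lim_transform_eventually)
qed

lemma completed_jacobi_limit_power:
  assumes t: "t \<in> uhp"
  shows "((\<lambda>z. z ^ k * completed t z) \<longlongrightarrow> 0) (at 0)"
proof -
  have "((\<lambda>z. z ^ k * mero_jacobi N G t z - of_int c / tpi ^ k * (z ^ k * poincare N k t z)) \<longlongrightarrow>
      of_int c / tpi ^ k - of_int c / tpi ^ k * 1) (at 0)"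
    using k by (intro tendsto_intros mero_jacobi_limit[OF t] poincare_limit[OF t N]) auto
  thus ?thesis by (simp add: completed_jacobi_def right_diff_distrib mult_ac)
qed

lemma completed_jacobi_limit:
  assumes t: "t \<in> uhp"
  shows "((\<lambda>z. z * completed t z) \<longlongrightarrow> 0) (at 0)"
proof (cases "k = 1")
  case True
  thus ?thesis using completed_jacobi_limit_power[OF t] by simp
next
  case False
  hence k2: "k = 2" using k by simp
  have not_lat: "z \<notin> lat t" if "z \<in> ball 0 (min 1 (Im t)) - {0}" for z
    using lat_small[OF t, of z] that by auto
  show ?thesis
  proof (rule odd_removable_tendsto_0)
    show "min 1 (Im t) > 0" using uhpD[OF t] by simp
    show "(\<lambda>z. z * completed t z) holomorphic_on ball 0 (min 1 (Im t)) - {0}"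
      by (intro holomorphic_intros holomorphic_on_subset[OF completed_jacobi_holomorphic[OF t]]) (use not_lat in auto)
    show "- z * completed t (- z) = - (z * completed t z)" if "z \<in> ball 0 (min 1 (Im t)) - {0}" for z
      using completed_jacobi_minus[OF t not_lat[OF that]] by (simp add: k2)
    show "((\<lambda>z. z * (z * completed t z)) \<longlongrightarrow> 0) (at 0)"
      using completed_jacobi_limit_power[OF t] by (simp add: k2 power2_eq_square mult.assoc)
  qed
qed

lemma
  assumes t: "t \<in> uhp"
  shows entire_jacobi_holomorphic: "entire t holomorphic_on UNIV"
    and entire_jacobi_eq: "z \<notin> lat t \<Longrightarrow> entire t z = completed t z"
    and entire_jacobi_add_1: "entire t (z + 1) = entire t z"
    and entire_jacobi_add_t: "entire t (z + t) = ee (- (of_nat N * t) - of_nat (2 * N) * z) * entire t z"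
proof -
  have "isCont (\<lambda>z. ee (- (of_nat N * t) - of_nat (2 * N) * z)) z" for z
    unfolding ee_def by (intro continuous_intros)
  note extension = lattice_extension[OF t completed_jacobi_holomorphic[OF t] completed_jacobi_add_1[OF t]
      completed_jacobi_add_t[OF t] this ee_nonzero completed_jacobi_limit[OF t], folded entire_jacobi_def]
  show "entire t holomorphic_on UNIV" by (rule extension(1))
  show "z \<notin> lat t \<Longrightarrow> entire t z = completed t z" by (rule extension(2))
  show "entire t (z + 1) = entire t z" by (rule extension(3))
  show "entire t (z + t) = ee (- (of_nat N * t) - of_nat (2 * N) * z) * entire t z" by (rule extension(4))
qed

lemma entire_jacobi_T:
  assumes t: "t \<in> uhp"
  shows "entire (t + 1) = entire t"
proof (rule ext)
  fix z
  show "entire (t + 1) z = entire t z"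
  proof (rule isCont_eq_eventually[where f="entire (t + 1)" and g="entire t"])
    show "isCont (entire (t + 1)) z" "isCont (entire t) z"
      by (intro entire_isCont entire_jacobi_holomorphic add_1_in_uhp t)+
    show "\<forall>\<^sub>F w in at z. entire (t + 1) w = entire t w"
      using eventually_not_lat[OF t, of z]
      by eventually_elim (simp add: entire_jacobi_eq t add_1_in_uhp lat_T completed_jacobi_T)
  qed
qed

lemma entire_jacobi_S:
  assumes t: "t \<in> uhp"
  shows "entire (- 1 / t) (z / t) = t ^ k * ee (of_nat N * z\<^sup>2 / t) * entire t z"
proof (rule isCont_eq_eventually[where f="\<lambda>z. entire (- 1 / t) (z / t)" and g="\<lambda>z. t ^ k * ee (of_nat N * z\<^sup>2 / t) * entire t z"])
  note t' = minus_inverse_in_uhp[OF t]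
  show "isCont (\<lambda>z. entire (- 1 / t) (z / t)) z"
    by (rule isCont_o2[OF _ entire_isCont[OF entire_jacobi_holomorphic[OF t']]])
       (use uhp_nonzero[OF t] in \<open>auto intro!: continuous_intros\<close>)
  show "isCont (\<lambda>z. t ^ k * ee (of_nat N * z\<^sup>2 / t) * entire t z) z"
    unfolding ee_def using uhp_nonzero[OF t]
    by (intro continuous_intros entire_isCont[OF entire_jacobi_holomorphic[OF t]]) auto
  show "\<forall>\<^sub>F w in at z. entire (- 1 / t) (w / t) = t ^ k * ee (of_nat N * w\<^sup>2 / t) * entire t w"
    using eventually_not_lat[OF t, of z]
  proof eventually_elim
    case (elim w)
    hence "w / t \<notin> lat (- 1 / t)" using lat_S[OF t] by simp
    thus ?case using entire_jacobi_eq[OF t elim] entire_jacobi_eq[OF t'] completed_jacobi_S[OF t elim]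
      by simp
  qed
qed

lemma theta_vec_T:
  assumes t: "t \<in> uhp"
  shows "theta_vec N k c G l (t + 1) = ee (- (of_nat (l\<^sup>2) / of_nat (4 * N))) * theta_vec N k c G l t"
  by (simp add: theta_vec_def theta_comp_def entire_jacobi_T[OF t] theta_q_add_1 ee_minus)

context
  fixes t :: complex and l :: nat
  assumes t: "t \<in> uhp"
begin

definition gauss_entire :: "complex \<Rightarrow> complex" where
  "gauss_entire z = ee (of_nat N * (z - of_nat l / of_nat (2 * N))\<^sup>2 / t) * entire t z"

lemma gauss_entire_holomorphic: "gauss_entire holomorphic_on UNIV"
  unfolding gauss_entire_def[abs_def]
  by (intro holomorphic_intros ee_holomorphic entire_jacobi_holomorphic t) (use uhp_nonzero[OF t] in auto)

lemma gauss_entire_add_t: "gauss_entire (z + t) = gauss_entire z"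
proof -
  let ?p = "of_nat l / of_nat (2 * N) :: complex"
  have "of_nat N * (z + t - ?p)\<^sup>2 / t + (- (of_nat N * t) - of_nat (2 * N) * z) = of_nat N * (z - ?p)\<^sup>2 / t + of_int (- int l)"
    using uhp_nonzero[OF t] N by (simp add: field_simps power2_eq_square)
  hence "ee (of_nat N * (z + t - ?p)\<^sup>2 / t) * ee (- (of_nat N * t) - of_nat (2 * N) * z) = ee (of_nat N * (z - ?p)\<^sup>2 / t)"
    by (simp only: ee_add[symmetric]) (simp only: ee_add ee_of_int mult_1_right)
  thus ?thesis unfolding gauss_entire_def entire_jacobi_add_t[OF t] by (metis mult.assoc)
qed

lemma theta_vec_S_integral: "theta_vec N k c G l (- 1 / t) = t ^ k * period_int gauss_entire 0 t"
proof -
  note nonzero = uhp_nonzero[OF t]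
  have "inverse (theta_q N (int l) (- 1 / t)) *
      (entire (- 1 / t) (0 + of_real x * 1) * ee (- (of_int (int l) * (0 + of_real x * 1)))) =
      t ^ k * gauss_entire (0 + of_real x * t)" for x :: real
  proof -
    define z where "z = of_real x * t"
    have x: "of_real x = z / t" using nonzero by (simp add: z_def)
    have "- (of_int ((int l)\<^sup>2) / of_nat (4 * N) * (- 1 / t)) + of_nat N * z\<^sup>2 / t + - (of_int (int l) * (z / t)) =
        of_nat N * (z - of_nat l / of_nat (2 * N))\<^sup>2 / t"
      using nonzero N by (simp add: field_simps power2_eq_square)
    hence gauss: "inverse (theta_q N (int l) (- 1 / t)) * ee (of_nat N * z\<^sup>2 / t) * ee (- (of_int (int l) * (z / t))) =
        ee (of_nat N * (z - of_nat l / of_nat (2 * N))\<^sup>2 / t)"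
      unfolding inverse_theta_q by (simp only: ee_add[symmetric])
    have "A * (t ^ k * B * f * C) = t ^ k * (A * B * C * f)" for A B C f :: complex by simp
    thus ?thesis
      unfolding gauss_entire_def add_0 mult_1_right z_def[symmetric] unfolding x entire_jacobi_S[OF t]
      by (simp only: gauss)
  qed
  thus ?thesis
    unfolding theta_vec_def theta_comp_def fourier_coeff_def period_int_def integral_mult_right[symmetric]
    by (simp only:)
qed

lemma theta_vec_S:
  "theta_vec N k c G l (- 1 / t) = csqrt t ^ (2 * k - 1) *
     (\<Sum>\<mu><2*N. ee (1 / 8) / of_real (sqrt (real (2 * N))) * ee (of_nat (l * \<mu>) / of_nat (2 * N)) * theta_vec N k c G \<mu> t)"
proof -
  let ?p = "of_nat l / of_nat (2 * N) :: complex"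
  have "period_int gauss_entire 0 t = period_int gauss_entire ?p t"
    by (rule period_int_const[OF gauss_entire_holomorphic uhp_nonzero[OF t] gauss_entire_add_t])
  also have "\<dots> = integral {0..1} (\<lambda>x. ee (of_nat N * t * of_real (x\<^sup>2)) * entire t (?p + of_real x * t))"
    unfolding period_int_def gauss_entire_def
    using uhp_nonzero[OF t] by (simp add: power2_eq_square mult_ac)
  also have "\<dots> = csqrt (of_real pi / (- 2 * of_real pi * \<i> * of_nat N * t)) *
      (\<Sum>\<mu><2*N. ee (of_nat (l * \<mu>) / of_nat (2 * N)) * theta_vec N k c G \<mu> t)"
    unfolding theta_vec_def
    by (rule theta_inversion_integral[OF N t entire_jacobi_holomorphic[OF t] entire_jacobi_add_1[OF t] entire_jacobi_add_t[OF t]])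
  finally have eq: "theta_vec N k c G l (- 1 / t) = t ^ k * csqrt (of_real pi / (- 2 * of_real pi * \<i> * of_nat N * t)) *
      (\<Sum>\<mu><2*N. ee (of_nat (l * \<mu>) / of_nat (2 * N)) * theta_vec N k c G \<mu> t)"
    unfolding theta_vec_S_integral by (simp only: mult.assoc)
  have "k > 0" using k by auto
  thus ?thesis unfolding eq csqrt_power_gauss_width[OF t N \<open>k > 0\<close>] sum_distrib_left
    by (simp only: mult.assoc)
qed

end

lemma theta_vec_modular:
  assumes f: "\<And>l t. l < 2 * N \<Longrightarrow> t \<in> uhp \<Longrightarrow> f l t = s * theta_vec N k c G l t"
  shows "modular N (real k - 1 / 2) (conj_weil_rep N) f"
proof (rule modularI[OF N])
  fix t l assume t: "t \<in> uhp" and l: "l < 2 * N"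
  show "f l (t + 1) = ee (- (of_nat (l\<^sup>2) / of_nat (4 * N))) * f l t"
    unfolding f[OF l add_1_in_uhp[OF t]] f[OF l t] theta_vec_T[OF t] by (rule mult.left_commute)
  have "\<lfloor>2 * (real k - 1 / 2)\<rfloor> = int (2 * k - 1)" using k by auto
  moreover have "(\<Sum>\<mu><2*N. ee (1 / 8) / of_real (sqrt (real (2 * N))) * ee (of_nat (l * \<mu>) / of_nat (2 * N)) * f \<mu> t) =
     s * (\<Sum>\<mu><2*N. ee (1 / 8) / of_real (sqrt (real (2 * N))) * ee (of_nat (l * \<mu>) / of_nat (2 * N)) * theta_vec N k c G \<mu> t)"
    unfolding sum_distrib_left by (intro sum.cong refl) (simp add: f[OF _ t])
  ultimately show "f l (- 1 / t) = csqrt t powi \<lfloor>2 * (real k - 1 / 2)\<rfloor> *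
     (\<Sum>\<mu><2*N. ee (1 / 8) / of_real (sqrt (real (2 * N))) * ee (of_nat (l * \<mu>) / of_nat (2 * N)) * f \<mu> t)"
    unfolding f[OF l minus_inverse_in_uhp[OF t]] theta_vec_S[OF t]
    by (simp only: power_int_of_nat mult.left_commute)
qed

end

section \<open>Theta coefficients at half height\<close>

text \<open>At height \<open>Im t / 2\<close> the path of integration stays between the poles on \<open>\<real>\<close> and those on \<open>t + \<real>\<close>.\<close>

definition mid_coeff :: "(complex \<Rightarrow> complex) \<Rightarrow> nat \<Rightarrow> complex \<Rightarrow> complex" where
  "mid_coeff F l t = period_int (\<lambda>z. F z * ee (- (of_int (int l) * z))) (\<i> * of_real (Im t / 2)) 1"

definition mid_theta_comp :: "nat \<Rightarrow> (complex \<Rightarrow> complex) \<Rightarrow> nat \<Rightarrow> complex \<Rightarrow> complex" where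
  "mid_theta_comp N F l t = inverse (theta_q N (int l) t) * mid_coeff F l t"

abbreviation residue_class :: "nat \<Rightarrow> nat \<Rightarrow> int set" where
  "residue_class N l \<equiv> {n. [n = int l] (mod int (2 * N))}"

definition theta_coeff :: "nat \<Rightarrow> real \<Rightarrow> real \<Rightarrow> nat \<Rightarrow> nat \<Rightarrow> real" where
  "theta_coeff N s0 \<sigma> l m = (if m = 0 then (if l = 0 then s0 else 0) else
     (if - int m \<in> residue_class N l then 1 else 0) + (if int m \<in> residue_class N l then \<sigma> else 0))"

lemma theta_coeff_bound: "\<bar>theta_coeff N s0 \<sigma> l m\<bar> \<le> \<bar>s0\<bar> + 1 + \<bar>\<sigma>\<bar>"
  by (auto simp: theta_coeff_def)

lemma zero_in_residue_class: "l < 2 * N \<Longrightarrow> 0 \<in> residue_class N l \<longleftrightarrow> l = 0"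
  by (simp add: cong_def flip: zmod_int del: of_nat_mult)

lemma residue_class_le_imp_eq:
  assumes "n \<in> residue_class N l" "l < 2 * N" "0 \<le> n" "n \<le> int l"
  shows "n = int l"
  using assms by (simp add: cong_def del: of_nat_mult)

lemma has_sum_theta_coeff:
  fixes F :: "int \<Rightarrow> complex" and u :: "nat \<Rightarrow> complex"
  assumes l: "l < 2 * N" and sum: "(F has_sum S) (residue_class N l)"
    and pos: "\<And>m. m > 0 \<Longrightarrow> int m \<in> residue_class N l \<Longrightarrow> F (int m) = of_real \<sigma> * u m + (if m = l then X else 0)"
    and neg: "\<And>m. m > 0 \<Longrightarrow> - int m \<in> residue_class N l \<Longrightarrow> F (- int m) = u m"
    and zero: "l = 0 \<Longrightarrow> F 0 = of_real s0 * u 0 + X"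
  shows "((\<lambda>m. of_real (theta_coeff N s0 \<sigma> l m) * u m) has_sum S - X) UNIV"
proof -
  let ?C = "residue_class N l"
  define F' where "F' = (\<lambda>n. F n + (if n = int l then - X else 0))"
  have "((\<lambda>n. if n = int l then - X else 0) has_sum - X) ?C"
    by (rule has_sum_finite_neutralI[of "{int l}"]) auto
  from has_sum_add[OF sum this] have F'_sum: "(F' has_sum S - X) ?C" by (simp add: F'_def)
  have fibre_subset: "{n \<in> ?C. nat \<bar>n\<bar> = m} \<subseteq> {int m, - int m}" for m by auto
  have "(\<Sum>n\<in>{n \<in> ?C. nat \<bar>n\<bar> = m}. F' n) = of_real (theta_coeff N s0 \<sigma> l m) * u m" for m
  proof (cases "m = 0")
    case True
    hence "{n \<in> ?C. nat \<bar>n\<bar> = m} = (if l = 0 then {0} else {})" using zero_in_residue_class[OF l] by auto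
    thus ?thesis using zero True by (simp add: theta_coeff_def F'_def)
  next
    case False
    have "(\<Sum>n\<in>{n \<in> ?C. nat \<bar>n\<bar> = m}. F' n) = (\<Sum>n\<in>{int m, - int m}. if n \<in> ?C then F' n else 0)"
      by (rule sum.mono_neutral_cong_left) auto
    also have "\<dots> = (if int m \<in> ?C then F' (int m) else 0) + (if - int m \<in> ?C then F' (- int m) else 0)"
      using False by simp
    also have "\<dots> = of_real (theta_coeff N s0 \<sigma> l m) * u m"
      using False pos[of m] neg[of m] by (auto simp: theta_coeff_def F'_def distrib_right)
    finally show ?thesis .
  qed
  with has_sum_group[OF F'_sum finite_subset[OF fibre_subset]] show ?thesis by simp
qed

definition class_height :: "nat \<Rightarrow> nat \<Rightarrow> complex \<Rightarrow> int \<Rightarrow> real" where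
  "class_height N l t n = Im t / 2 + of_int ((int l - n) div (2 * int N)) * Im t"

context
  fixes N l :: nat and t :: complex
  assumes t: "t \<in> uhp" and N: "N > 0" and l: "l < 2 * N"
begin

lemma class_height_pos: "n \<le> int l \<Longrightarrow> class_height N l t n > 0"
  using uhpD[OF t] N unfolding class_height_def
  by (intro add_pos_nonneg) (auto simp: pos_imp_zdiv_nonneg_iff)

lemma class_height_neg:
  assumes "n > int l"
  shows "class_height N l t n < 0"
proof -
  have "(int l - n) div (2 * int N) < 0" using assms N by (intro div_neg_pos_less0) auto
  hence "real_of_int ((int l - n) div (2 * int N)) \<le> - 1" by linarith
  hence "of_int ((int l - n) div (2 * int N)) * Im t \<le> - 1 * Im t"
    using uhpD[OF t] by (intro mult_right_mono) auto
  thus ?thesis using uhpD[OF t] unfolding class_height_def by linarith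
qed

lemma mid_theta_comp_poincare_has_sum:
  "((\<lambda>n. inverse (theta_q N n t) * mordell (pi * real N / Im t) k (- of_int n) (class_height N l t n)) has_sum
    mid_theta_comp N (poincare N k t) l t) (residue_class N l)"
proof -
  let ?F = "\<lambda>n. inverse (theta_q N n t) * mordell (pi * real N / Im t) k (- of_int n) (class_height N l t n)"
  have bij: "bij_betw (\<lambda>a. int l - 2 * int N * a) UNIV (residue_class N l)"
    by (rule bij_betwI[where g="\<lambda>n. (int l - n) div (2 * int N)"])
       (use N in \<open>auto simp: cong_iff_dvd_diff dvd_diff_commute\<close>)
  have "?F (int l - 2 * int N * a) = inverse (theta_q N (2 * int N * a - int l) t) *
      mordell (pi * real N / Im t) k (of_int (2 * int N * a - int l)) (Im t / 2 + of_int a * Im t)" for a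
  proof -
    have "class_height N l t (int l - 2 * int N * a) = Im t / 2 + of_int a * Im t"
      using N by (simp add: class_height_def)
    moreover have "theta_q N (int l - 2 * int N * a) t = theta_q N (2 * int N * a - int l) t"
      using theta_q_minus[of N "2 * int N * a - int l" t] by simp
    moreover have "- real_of_int (int l - 2 * int N * a) = of_int (2 * int N * a - int l)" by simp
    ultimately show ?thesis by (simp only:)
  qed
  hence "((\<lambda>a. ?F (int l - 2 * int N * a)) has_sum mid_theta_comp N (poincare N k t) l t) UNIV"
    using poincare_coefficient[OF t N, of "Im t / 2" "int l" k] uhpD[OF t]
    unfolding mid_theta_comp_def mid_coeff_def by (simp only:)
  thus ?thesis using has_sum_reindex_bij_betw[OF bij, of ?F] by blast
qed

abbreviation class_mordell :: "nat \<Rightarrow> int \<Rightarrow> complex" where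
  "class_mordell k n \<equiv> mordell (pi * real N / Im t) k (- of_int n) (class_height N l t n)"

abbreviation erfc_scale :: real where "erfc_scale \<equiv> sqrt (pi * Im t / real N)"

lemma width_pos: "pi * real N / Im t > 0" using uhpD[OF t] N by simp

lemma class_mordell_1:
  shows "n \<le> int l \<Longrightarrow> class_mordell 1 n = - (of_real pi * \<i>) * of_real (erfc (- of_int n * erfc_scale))"
    and "n > int l \<Longrightarrow> class_mordell 1 n = of_real pi * \<i> * of_real (erfc (of_int n * erfc_scale))"
proof -
  have "pi / sqrt (pi * real N / Im t) = (sqrt pi * sqrt pi) / (sqrt pi * sqrt (real N) / sqrt (Im t))"
    by (simp add: real_sqrt_mult real_sqrt_divide)
  also have "\<dots> = erfc_scale"
    using uhpD[OF t] N by (simp del: real_sqrt_mult_self add: real_sqrt_mult real_sqrt_divide)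
  finally have scale: "x * pi / sqrt (pi * real N / Im t) = x * erfc_scale" for x
    by (simp flip: times_divide_eq_right)
  show "class_mordell 1 n = - (of_real pi * \<i>) * of_real (erfc (- of_int n * erfc_scale))" if "n \<le> int l"
    unfolding mordell_1[OF width_pos class_height_pos[OF that]] scale ..
  show "class_mordell 1 n = of_real pi * \<i> * of_real (erfc (of_int n * erfc_scale))" if "n > int l"
    using mordell_1[OF width_pos, of "- class_height N l t n" "of_int n"] class_height_neg[OF that]
      mordell_uminus[of _ 1 "- of_int n" "- class_height N l t n"] unfolding scale by simp
qed

lemma class_mordell_2:
  "inverse (theta_q N n t) * class_mordell 2 n =
    - (2 * of_real (pi\<^sup>2)) * (of_real (real N / pi) * (inv_sqrt_height N t * cnj (theta_q N n t))) +
    tpi * - of_int n * (inverse (theta_q N n t) * class_mordell 1 n)"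
proof -
  let ?\<alpha> = "pi * real N / Im t"
  have v: "Im t > 0" by (rule uhpD[OF t])
  have nonzero: "class_height N l t n \<noteq> 0"
    using class_height_pos[of n] class_height_neg[of n] by (cases "n \<le> int l") auto
  have "sqrt (pi / ?\<alpha>) = Im t / sqrt (real N * Im t)"
    using N v by (simp add: real_sqrt_mult real_sqrt_divide real_div_sqrt field_simps)
  hence scale: "- 2 * ?\<alpha> * sqrt (pi / ?\<alpha>) = - (2 * pi\<^sup>2 * (real N / pi * (1 / sqrt (real N * Im t))))"
    using v by (simp add: power2_eq_square)
  have gauss: "- pi\<^sup>2 * (- of_int n)\<^sup>2 / ?\<alpha> = - (pi * (of_int n)\<^sup>2 * Im t / real N)"
    using N v by (simp add: field_simps power2_eq_square)
  have "- 2 * of_real ?\<alpha> * of_real (sqrt (pi / ?\<alpha>) * exp (- pi\<^sup>2 * (- of_int n)\<^sup>2 / ?\<alpha>)) =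
      of_real (- 2 * ?\<alpha> * sqrt (pi / ?\<alpha>)) * complex_of_real (exp (- (pi * (of_int n)\<^sup>2 * Im t / real N)))"
    unfolding gauss by simp
  also have "\<dots> = - (2 * of_real (pi\<^sup>2)) * (of_real (real N / pi) * (inv_sqrt_height N t *
      of_real (exp (- (pi * (of_int n)\<^sup>2 * Im t / real N)))))"
    unfolding scale inv_sqrt_height_def by simp
  finally show ?thesis
    unfolding mordell_2[OF width_pos nonzero] cnj_theta_q[OF N]
    by (simp only: distrib_left mult_ac of_real_minus of_real_of_int_eq)
qed

lemma mid_theta_comp_poincare_1:
  "mid_theta_comp N (poincare N 1 t) l t = - (of_real pi * \<i>) *
    ((if l = 0 then 1 else 2) * inverse (theta_q N (int l) t) + erfc_theta N (theta_coeff N 0 (- 1) l) 0 t)"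
proof -
  let ?X = "- (of_real pi * \<i>) * ((if l = 0 then 1 else 2) * inverse (theta_q N (int l) t))"
  let ?u = "\<lambda>m. - (of_real pi * \<i>) * erfc_theta_term N 0 m t"
  have "((\<lambda>m. of_real (theta_coeff N 0 (- 1) l m) * ?u m) has_sum mid_theta_comp N (poincare N 1 t) l t - ?X) UNIV"
  proof (rule has_sum_theta_coeff[OF l mid_theta_comp_poincare_has_sum])
    fix m :: nat assume m: "m > 0" "int m \<in> residue_class N l"
    show "inverse (theta_q N (int m) t) * class_mordell 1 (int m) = of_real (- 1) * ?u m + (if m = l then ?X else 0)"
    proof (cases "int m \<le> int l")
      case True
      hence "m = l" using residue_class_le_imp_eq[OF m(2) l] by simp
      thus ?thesis unfolding class_mordell_1(1)[OF True] using m(1)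
        by (simp add: erfc_theta_term_def erfc_minus algebra_simps)
    next
      case False
      with class_mordell_1(2)[of "int m"] show ?thesis by (simp add: erfc_theta_term_def mult_ac)
    qed
  next
    fix m :: nat
    show "inverse (theta_q N (- int m) t) * class_mordell 1 (- int m) = ?u m"
      using class_mordell_1(1)[of "- int m"] by (simp add: erfc_theta_term_def mult_ac)
  next
    assume "l = 0"
    thus "inverse (theta_q N 0 t) * class_mordell 1 0 = of_real 0 * ?u 0 + ?X"
      using class_mordell_1(1)[of 0] by (simp add: erfc_0)
  qed
  moreover have "((\<lambda>m. - (of_real pi * \<i>) * (of_real (theta_coeff N 0 (- 1) l m) * erfc_theta_term N 0 m t)) has_sum
      - (of_real pi * \<i>) * erfc_theta N (theta_coeff N 0 (- 1) l) 0 t) UNIV"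
    by (rule has_sum_cmult_right[OF erfc_theta_has_sum[OF N theta_coeff_bound t]])
  ultimately have "mid_theta_comp N (poincare N 1 t) l t - ?X = - (of_real pi * \<i>) * erfc_theta N (theta_coeff N 0 (- 1) l) 0 t"
    by (simp only: mult.left_commute has_sum_unique)
  thus ?thesis by (simp add: algebra_simps)
qed

lemma mid_theta_comp_poincare_2:
  "mid_theta_comp N (poincare N 2 t) l t = 2 * of_real (pi\<^sup>2) *
    (- 2 * of_nat l * inverse (theta_q N (int l) t) + eichler_three_half N (theta_coeff N 1 1 l) t)"
proof -
  let ?X = "2 * of_real (pi\<^sup>2) * (- 2 * of_nat l * inverse (theta_q N (int l) t))"
  let ?u = "\<lambda>m. 2 * of_real (pi\<^sup>2) * eichler_three_half_term N m t"
  note eichler_term = eichler_three_half_term_def erfc_theta_term_def conj_theta_term_def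
  let ?g = "\<lambda>n. - (2 * of_real (pi\<^sup>2)) * (of_real (real N / pi) * (inv_sqrt_height N t * cnj (theta_q N n t))) +
    tpi * - of_int n * (inverse (theta_q N n t) * class_mordell 1 n)"
  have "((\<lambda>m. of_real (theta_coeff N 1 1 l m) * ?u m) has_sum mid_theta_comp N (poincare N 2 t) l t - ?X) UNIV"
  proof (rule has_sum_theta_coeff[OF l mid_theta_comp_poincare_has_sum], unfold class_mordell_2)
    fix m :: nat assume m: "m > 0" "int m \<in> residue_class N l"
    show "?g (int m) = of_real 1 * ?u m + (if m = l then ?X else 0)"
    proof (cases "int m \<le> int l")
      case True
      hence "m = l" using residue_class_le_imp_eq[OF m(2) l] by simp
      thus ?thesis unfolding class_mordell_1(1)[OF True]
        by (simp add: eichler_term erfc_minus power2_eq_square algebra_simps)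
    next
      case False
      with class_mordell_1(2)[of "int m"] show ?thesis
        by (simp add: eichler_term power2_eq_square algebra_simps)
    qed
  next
    show "?g (- int m) = ?u m" for m
      using class_mordell_1(1)[of "- int m"] by (simp add: eichler_term power2_eq_square algebra_simps)
    from this[of 0] show "?g 0 = of_real 1 * ?u 0 + ?X" if "l = 0" using that by simp
  qed
  moreover have "((\<lambda>m. 2 * of_real (pi\<^sup>2) * (of_real (theta_coeff N 1 1 l m) * eichler_three_half_term N m t)) has_sum
      2 * of_real (pi\<^sup>2) * eichler_three_half N (theta_coeff N 1 1 l) t) UNIV"
    by (rule has_sum_cmult_right[OF eichler_three_half_has_sum[OF N theta_coeff_bound t]])
  ultimately have "mid_theta_comp N (poincare N 2 t) l t - ?X = 2 * of_real (pi\<^sup>2) * eichler_three_half N (theta_coeff N 1 1 l) t"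
    by (simp only: mult.left_commute has_sum_unique)
  thus ?thesis by (simp add: algebra_simps)
qed

end

lemma period_int_bimonom:
  "period_int (\<lambda>z. bimonom t z p * ee (- (of_nat M * z))) w 1 = (if fst p = snd p + M then ee (of_nat (snd p) * t) else 0)"
proof -
  define m where "m = int (fst p) - int (snd p)"
  have "bimonom t z p * ee (- (of_nat M * z)) =
      ee (of_nat (snd p) * t) * (ee (of_int m * z) * ee (- (of_int (int M) * z)))" for z
    by (simp add: bimonom_eq_ee ee_add m_def)
  hence "period_int (\<lambda>z. bimonom t z p * ee (- (of_nat M * z))) w 1 =
      ee (of_nat (snd p) * t) * period_int (\<lambda>z. ee (of_int m * z) * ee (- (of_int (int M) * z))) w 1"
    by (simp only: period_int_cmult)
  also have "period_int (\<lambda>z. ee (of_int m * z) * ee (- (of_int (int M) * z))) w 1 =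
      fourier_coeff (\<lambda>z. ee (of_int m * z)) (int M)"
    by (rule fourier_coeff_height[symmetric])
       (auto intro!: holomorphic_intros ee_holomorphic simp: distrib_left ee_add)
  finally show ?thesis unfolding fourier_coeff_exp m_def by auto
qed

lemma has_int_expansion_period_int:
  assumes H: "has_int_expansion a H" and y: "0 < y" "y < Im t"
  shows "((\<lambda>j. of_int (a (j + M, j)) * ee (of_nat j * t)) has_sum
    period_int (\<lambda>z. H t z * ee (- (of_nat M * z))) (\<i> * of_real y) 1) UNIV"
proof -
  define z where "z = (\<lambda>x::real. \<i> * of_real y + of_real x * 1)"
  define f where "f = (\<lambda>p x. of_int (a p) * (bimonom t (z x) p * ee (- (of_nat M * z x))))"
  have f_sum: "((\<lambda>p. f p x) has_sum H t (z x) * ee (- (of_nat M * z x))) UNIV" for x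
    unfolding f_def mult.assoc[symmetric]
    by (rule has_sum_cmult_left, rule has_int_expansionD[OF H]) (use y in \<open>simp_all add: z_def\<close>)
  have norm_periodic: "norm (ee (z x)) = norm (ee (z 0))" "norm (ee (t - z x)) = norm (ee (t - z 0))"
      "norm (ee (- (of_nat M * z x))) = norm (ee (- (of_nat M * z 0)))" for x
    by (simp_all add: norm_ee z_def)
  have "((\<lambda>p. integral {0..1} (f p)) has_sum integral {0..1} (\<lambda>x. \<Sum>\<^sub>\<infinity>p\<in>UNIV. f p x)) UNIV"
  proof (rule infsum_integral)
    show "(\<lambda>p. norm (f p 0)) summable_on UNIV"
      using has_sum_imp_summable[OF f_sum[of 0]] by (simp add: summable_on_iff_abs_summable_on_complex)
    show "norm (f p x) \<le> norm (f p 0)" for p x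
      unfolding f_def bimonom_def norm_mult norm_power norm_periodic[of x] by simp
    show "continuous_on {0..1} (f p)" for p
      unfolding f_def bimonom_def z_def by (intro continuous_intros ee_continuous)
  qed
  moreover have "integral {0..1} (f p) = (if fst p = snd p + M then of_int (a p) * ee (of_nat (snd p) * t) else 0)" for p
    using period_int_bimonom[of t p M "\<i> * of_real y"] by (simp add: f_def z_def period_int_def)
  ultimately have "((\<lambda>p. if fst p = snd p + M then of_int (a p) * ee (of_nat (snd p) * t) else 0) has_sum
      period_int (\<lambda>z. H t z * ee (- (of_nat M * z))) (\<i> * of_real y) 1) UNIV"
    unfolding infsumI[OF f_sum] period_int_def z_def by simp
  hence "((\<lambda>p. if fst p = snd p + M then of_int (a p) * ee (of_nat (snd p) * t) else 0) has_sum
      period_int (\<lambda>z. H t z * ee (- (of_nat M * z))) (\<i> * of_real y) 1) (range (\<lambda>j. (j + M, j)))"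
    by (subst has_sum_cong_neutral[where T=UNIV]) (auto simp: image_iff)
  thus ?thesis by (subst (asm) has_sum_reindex) (auto simp: inj_on_def o_def)
qed

context
  fixes N k :: nat and c :: int and G :: "complex \<Rightarrow> complex \<Rightarrow> complex"
  assumes N: "N > 0" and k: "k = 1 \<or> k = 2" and G: "int_elliptic (2 * N + k) c G"
begin

lemma mero_jacobi_coefficients:
  "\<exists>A :: nat \<Rightarrow> nat \<Rightarrow> int. \<forall>l. \<forall>t\<in>uhp.
     ((\<lambda>j. of_int (A l j) * ee (of_nat j * t)) has_sum mid_coeff (mero_jacobi N G t) l t) UNIV"
proof -
  have "int_expansion (\<lambda>t z. (ee z * jacobi_phi t z) ^ N * G t z)"
    using G by (intro int_expansion_mult int_expansion_power int_expansion_jacobi_phi) (simp add: int_elliptic_def)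
  then obtain a where a: "has_int_expansion a (\<lambda>t z. (ee z * jacobi_phi t z) ^ N * G t z)"
    by (auto simp: int_expansion_def)
  have "(ee z * jacobi_phi t z) ^ N * G t z * ee (- (of_nat (N + l) * z)) =
      mero_jacobi N G t z * ee (- (of_int (int l) * z))" for l t z
  proof -
    have "ee z ^ N * ee (- (of_nat (N + l) * z)) = ee (- (of_int (int l) * z))"
      unfolding ee_power ee_add[symmetric] by (simp add: algebra_simps)
    thus ?thesis unfolding mero_jacobi_def power_mult_distrib by (metis mult.assoc mult.commute)
  qed
  hence "((\<lambda>j. of_int (a (j + (N + l), j)) * ee (of_nat j * t)) has_sum mid_coeff (mero_jacobi N G t) l t) UNIV"
    if "t \<in> uhp" for l t
    using has_int_expansion_period_int[OF a, of "Im t / 2" t "N + l"] uhpD[OF that]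
    by (simp add: mid_coeff_def)
  thus ?thesis by (intro exI[of _ "\<lambda>l j. a (j + (N + l), j)"]) blast
qed

lemma theta_vec_decomposition:
  assumes t: "t \<in> uhp"
  shows "theta_vec N k c G l t =
    mid_theta_comp N (mero_jacobi N G t) l t - of_int c / tpi ^ k * mid_theta_comp N (poincare N k t) l t"
proof -
  define z where "z = (\<lambda>x::real. \<i> * of_real (Im t / 2) + of_real x * 1)"
  define e where "e = (\<lambda>x. ee (- (of_int (int l) * z x)))"
  have z_not_lat: "z x \<notin> lat t" for x by (rule strip_not_lat) (use uhpD[OF t] in \<open>auto simp: z_def\<close>)
  have z_continuous: "continuous_on {0..1} z" unfolding z_def by (intro continuous_intros)
  have e_continuous: "continuous_on {0..1} e"
    unfolding e_def by (intro ee_continuous continuous_intros z_continuous)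
  have continuous: "continuous_on {0..1} (\<lambda>x. F (z x))" if "F holomorphic_on (- lat t)" for F
    by (rule continuous_on_compose2[OF holomorphic_on_imp_continuous_on[OF that] z_continuous]) (use z_not_lat in auto)
  have "fourier_coeff (entire_jacobi N k c G t) (int l) = integral {0..1} (\<lambda>x. entire_jacobi N k c G t (z x) * e x)"
    unfolding fourier_coeff_height[OF entire_jacobi_holomorphic[OF N k G t] entire_jacobi_add_1[OF N k G t],
        of "int l" "\<i> * of_real (Im t / 2)"] period_int_def z_def e_def ..
  also have "\<dots> = integral {0..1} (\<lambda>x. mero_jacobi N G t (z x) * e x - of_int c / tpi ^ k * (poincare N k t (z x) * e x))"
    by (simp only: entire_jacobi_eq[OF N k G t z_not_lat] completed_jacobi_def left_diff_distrib mult.assoc)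
  also have "\<dots> = integral {0..1} (\<lambda>x. mero_jacobi N G t (z x) * e x) -
      integral {0..1} (\<lambda>x. of_int c / tpi ^ k * (poincare N k t (z x) * e x))"
    by (intro integral_diff integrable_continuous_interval continuous_on_mult continuous_on_const e_continuous
        continuous mero_jacobi_holomorphic[OF N k G t] poincare_holomorphic[OF t N])
  also have "\<dots> = mid_coeff (mero_jacobi N G t) l t - of_int c / tpi ^ k * mid_coeff (poincare N k t) l t"
    unfolding mid_coeff_def period_int_def z_def e_def integral_mult_right ..
  finally show ?thesis
    unfolding theta_vec_def theta_comp_def mid_theta_comp_def by (simp add: right_diff_distrib mult_ac)
qed

end

section \<open>Mock modular forms from Jacobi forms\<close>

definition extend_coeff :: "(nat \<Rightarrow> int) \<Rightarrow> (nat \<Rightarrow> complex) \<Rightarrow> int \<Rightarrow> complex" where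
  "extend_coeff g b n = (if n \<in> range g then b (inv_into UNIV g n) else 0)"

lemma extend_coeff_apply: "inj g \<Longrightarrow> extend_coeff g b (g j) = b j"
  by (simp add: extend_coeff_def)

lemma extend_coeff_eq_0: "(\<And>j. n \<noteq> g j) \<Longrightarrow> extend_coeff g b n = 0"
  by (auto simp: extend_coeff_def)

lemma extend_coeff_has_sum:
  assumes g: "inj g" and sum: "((\<lambda>j. b j * f (g j)) has_sum s) UNIV"
  shows "((\<lambda>n. extend_coeff g b n * f n) has_sum s) UNIV"
proof -
  have "((\<lambda>n. extend_coeff g b n * f n) has_sum s) (range g)"
    using sum by (subst has_sum_reindex[OF g]) (simp add: o_def extend_coeff_apply[OF g])
  thus ?thesis by (subst has_sum_cong_neutral[where T="range g"]) (auto simp: extend_coeff_def)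
qed

lemma nonhol_expansion_squares:
  assumes "\<And>l t. l < 2 * N \<Longrightarrow> t \<in> uhp \<Longrightarrow> ((\<lambda>m. b l m * nonhol_term N k (- (int m)\<^sup>2) t) has_sum F l t) UNIV"
  shows "\<exists>b. nonhol_expansion N k F b"
proof -
  have inj: "inj (\<lambda>m::nat. - (int m)\<^sup>2)" by (auto simp: inj_on_def)
  have "extend_coeff (\<lambda>m. - (int m)\<^sup>2) (b l) n = 0" if "n > 0" for l n
  proof (rule extend_coeff_eq_0)
    show "n \<noteq> - (int j)\<^sup>2" for j using that zero_le_power2[of "int j"] by linarith
  qed
  hence "nonhol_expansion N k F (\<lambda>l. extend_coeff (\<lambda>m. - (int m)\<^sup>2) (b l))"
    using extend_coeff_has_sum[OF inj assms] unfolding nonhol_expansion_def by blast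
  thus ?thesis by blast
qed

lemma
  fixes b :: "nat \<Rightarrow> complex"
  assumes sum: "\<And>t. t \<in> uhp \<Longrightarrow> ((\<lambda>j. b j * ee (of_nat j * t)) has_sum F t) UNIV"
  shows power_series_q_holomorphic: "F holomorphic_on uhp"
    and power_series_q_bounded: "\<exists>K. \<forall>t. Im t \<ge> 1 \<longrightarrow> norm (F t) \<le> K"
proof -
  define M where "M = (\<lambda>y j. norm (b j * ee (of_nat j * (\<i> * of_real y))))"
  have M: "M y summable_on UNIV" if "y > 0" for y
    using has_sum_imp_summable[OF sum[of "\<i> * of_real y"]] that
    by (simp add: M_def uhp_def summable_on_iff_abs_summable_on_complex)
  have term_le: "norm (b j * ee (of_nat j * t)) \<le> M y j" if "Im t \<ge> y" for j t y
    unfolding M_def norm_mult norm_ee using that by (intro mult_left_mono) (auto intro!: mult_left_mono)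
  have "(\<lambda>t. \<Sum>\<^sub>\<infinity>j. b j * ee (of_nat j * t)) holomorphic_on uhp"
  proof (rule infsum_holomorphic[OF open_uhp])
    show "(\<lambda>t. b j * ee (of_nat j * t)) holomorphic_on uhp" for j
      by (intro holomorphic_intros ee_holomorphic)
    fix t assume t: "t \<in> uhp"
    have Im_ge: "Im w \<ge> Im t / 2" if "w \<in> cball t (Im t / 2)" for w
      using that abs_Im_le_cmod[of "t - w"] by (simp add: dist_norm)
    have "cball t (Im t / 2) \<subseteq> uhp" using Im_ge uhpD[OF t] by (force simp: uhp_def)
    thus "\<exists>r>0. \<exists>M. cball t r \<subseteq> uhp \<and> M summable_on UNIV \<and>
        (\<forall>j\<in>UNIV. \<forall>w\<in>cball t r. norm (b j * ee (of_nat j * w)) \<le> M j)"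
      using uhpD[OF t] M[of "Im t / 2"] term_le[OF Im_ge]
      by (intro exI[of _ "Im t / 2"] conjI exI[of _ "M (Im t / 2)"]) auto
  qed
  thus "F holomorphic_on uhp" by (rule holomorphic_transform) (rule infsumI[OF sum])
  have "norm (F t) \<le> infsum (M 1) UNIV" if "Im t \<ge> 1" for t
  proof -
    have t: "t \<in> uhp" using that by (simp add: uhp_def)
    have summable: "(\<lambda>j. norm (b j * ee (of_nat j * t))) summable_on UNIV"
      using has_sum_imp_summable[OF sum[OF t]] by (simp add: summable_on_iff_abs_summable_on_complex)
    have "norm (F t) \<le> (\<Sum>\<^sub>\<infinity>j. norm (b j * ee (of_nat j * t)))"
      using norm_infsum_bound[OF summable] infsumI[OF sum[OF t]] by simp
    also have "\<dots> \<le> infsum (M 1) UNIV" by (rule infsum_mono[OF summable M]) (use term_le that in auto)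
    finally show ?thesis .
  qed
  thus "\<exists>K. \<forall>t. Im t \<ge> 1 \<longrightarrow> norm (F t) \<le> K" by blast
qed

context
  fixes N :: nat and b :: "nat \<Rightarrow> nat \<Rightarrow> complex" and F :: "nat \<Rightarrow> complex \<Rightarrow> complex"
  assumes N: "N > 0"
    and sum: "\<And>l t. t \<in> uhp \<Longrightarrow> ((\<lambda>j. b l j * ee (of_nat j * t)) has_sum F l t) UNIV"
begin

lemma theta_shift_holomorphic: "(\<lambda>t. inverse (theta_q N (int l) t) * F l t) holomorphic_on uhp"
  by (intro holomorphic_intros theta_q_holomorphic power_series_q_holomorphic[OF sum]) auto

lemma theta_shift_growth:
  assumes S: "\<exists>K. \<forall>t. Im t > 1 \<longrightarrow> norm (S t) \<le> K"
  shows "linear_exp_growth (\<lambda>t. inverse (theta_q N (int l) t) * F l t + S t)"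
proof -
  obtain K where K: "\<And>t. Im t \<ge> 1 \<Longrightarrow> norm (F l t) \<le> K" using power_series_q_bounded[OF sum, of l] by blast
  obtain L where L: "\<And>t. Im t > 1 \<Longrightarrow> norm (S t) \<le> L" using S by blast
  define C where "C = pi / (2 * real N) * (real l)\<^sup>2"
  have "norm (inverse (theta_q N (int l) t) * F l t + S t) \<le> (K + L) * exp (C * Im t)" if t: "Im t > 1" for t
  proof -
    have "1 \<le> exp (C * Im t)" using t by (simp add: C_def)
    hence "norm (S t) \<le> L * exp (C * Im t)"
      using mult_mono[of 1 "exp (C * Im t)" L L] L[OF t] order_trans[OF norm_ge_zero L[OF t]]
      by (simp add: mult.commute)
    moreover have "norm (inverse (theta_q N (int l) t) * F l t) \<le> K * exp (C * Im t)"
      using K[of t] t by (simp add: norm_mult norm_inverse norm_theta_q C_def mult_ac flip: exp_minus)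
    ultimately show ?thesis using norm_triangle_mono by (fastforce simp: distrib_right)
  qed
  hence "\<forall>\<^sub>F t in filtercomap Im at_top. norm (norm (inverse (theta_q N (int l) t) * F l t + S t)) \<le> (K + L) * norm (exp (C * Im t))"
    unfolding eventually_filtercomap_at_top_dense by (intro exI[of _ 1]) auto
  thus ?thesis unfolding linear_exp_growth_def by (intro exI[of _ C] bigoI)
qed

lemma theta_shift_q_expansion:
  "q_expansion N (\<lambda>l t. of_nat D * (inverse (theta_q N (int l) t) * F l t))
     (\<lambda>l. extend_coeff (\<lambda>j. int (4 * N * j) - (int l)\<^sup>2) (\<lambda>j. of_nat D * b l j))"
  unfolding q_expansion_def
proof (intro conjI exI[of _ "- int ((2 * N)\<^sup>2)"] allI impI ballI)
  show "extend_coeff (\<lambda>j. int (4 * N * j) - (int l)\<^sup>2) (\<lambda>j. of_nat D * b l j) n = 0"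
    if "l < 2 * N" "n < - int ((2 * N)\<^sup>2)" for l n
  proof (rule extend_coeff_eq_0)
    have "(int l)\<^sup>2 \<le> int ((2 * N)\<^sup>2)" using that(1) power_mono[of l "2 * N" 2] by (simp flip: of_nat_power)
    thus "n \<noteq> int (4 * N * j) - (int l)\<^sup>2" for j using that(2) by linarith
  qed
next
  fix l t assume t: "t \<in> uhp"
  show "((\<lambda>n. extend_coeff (\<lambda>j. int (4 * N * j) - (int l)\<^sup>2) (\<lambda>j. of_nat D * b l j) n * ee (of_int n / of_nat (4 * N) * t))
      has_sum of_nat D * (inverse (theta_q N (int l) t) * F l t)) UNIV"
  proof (rule extend_coeff_has_sum)
    show "inj (\<lambda>j. int (4 * N * j) - (int l)\<^sup>2)" using N by (auto simp: inj_on_def)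
    have "ee (of_int (int (4 * N * j) - (int l)\<^sup>2) / of_nat (4 * N) * t) = inverse (theta_q N (int l) t) * ee (of_nat j * t)" for j
      unfolding inverse_theta_q ee_add[symmetric]
      using N by (intro arg_cong[of _ _ ee]) (simp add: field_simps)
    thus "((\<lambda>j. of_nat D * b l j * ee (of_int (int (4 * N * j) - (int l)\<^sup>2) / of_nat (4 * N) * t)) has_sum
        of_nat D * (inverse (theta_q N (int l) t) * F l t)) UNIV"
      using has_sum_cmult_right[OF sum[OF t, of l], of "of_nat D * inverse (theta_q N (int l) t)"]
      by (simp add: mult_ac)
  qed
qed

lemma theta_shift_integral:
  assumes "\<And>l j. of_nat D * b l j \<in> \<int>"
  shows "integral_coefficients N (\<lambda>l t. of_nat D * (inverse (theta_q N (int l) t) * F l t))"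
  unfolding integral_coefficients_def
  using theta_shift_q_expansion assms by (intro exI conjI) (auto simp: extend_coeff_def)

end

lemma has_sum_affine_coeff:
  fixes a :: "nat \<Rightarrow> complex"
  assumes sum: "((\<lambda>j. a j * e j) has_sum s) UNIV" and e: "e 0 = 1"
  shows "((\<lambda>j. (r * a j + (if j = 0 then x else 0)) * e j) has_sum r * s + x) UNIV"
proof -
  have "((\<lambda>j. if j = 0 then x else 0) has_sum x) (UNIV :: nat set)"
    by (rule has_sum_finite_neutralI[of "{0}"]) auto
  from has_sum_add[OF has_sum_cmult_right[OF sum, of r] this]
  have "((\<lambda>j. r * (a j * e j) + (if j = 0 then x else 0)) has_sum r * s + x) UNIV" .
  moreover have "r * (a j * e j) + (if j = 0 then x else 0) = (r * a j + (if j = 0 then x else 0)) * e j" for j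
    by (simp add: e distrib_right)
  ultimately show ?thesis by (simp only:)
qed

lemma theta_vec_eq_shifted:
  assumes N: "N > 0" and k: "k = 1 \<or> k = 2" and G: "int_elliptic (2 * N + k) c G" and t: "t \<in> uhp"
    and c: "c \<noteq> 0"
    and poincare: "- 2 / tpi ^ k * mid_theta_comp N (poincare N k t) l t = x * inverse (theta_q N (int l) t) + s"
  shows "2 / of_int c * theta_vec N k c G l t =
    inverse (theta_q N (int l) t) * (2 / of_int c * mid_coeff (mero_jacobi N G t) l t + x) + s"
proof -
  let ?P = "mid_theta_comp N (poincare N k t) l t"
  have "2 / of_int c * mid_theta_comp N (mero_jacobi N G t) l t =
      inverse (theta_q N (int l) t) * (2 / of_int c * mid_coeff (mero_jacobi N G t) l t)"
    by (simp add: mid_theta_comp_def)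
  moreover have "2 / of_int c * (of_int c / tpi ^ k * ?P) = - (- 2 / tpi ^ k * ?P)" using c by simp
  ultimately show ?thesis
    unfolding theta_vec_decomposition[OF N k G t] right_diff_distrib poincare
    by (simp only:) (simp add: distrib_left mult.commute)
qed

text \<open>The hypothesis on \<open>x\<close> and \<open>S\<close> splits the theta components of the Poincare series into a
  holomorphic monomial, which is absorbed by the mock modular form, and the non-holomorphic part.\<close>

lemma mock_modular_form_exists:
  fixes S g :: "nat \<Rightarrow> complex \<Rightarrow> complex" and x :: "nat \<Rightarrow> int"
  assumes N: "N > 0" and k: "k = 1 \<or> k = 2" and G: "int_elliptic (2 * N + k) c G"
    and c: "c \<noteq> 0" "c dvd 2 * int D"
    and poincare: "\<And>l t. l < 2 * N \<Longrightarrow> t \<in> uhp \<Longrightarrow>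
        - 2 / tpi ^ k * mid_theta_comp N (poincare N k t) l t = of_int (x l) * inverse (theta_q N (int l) t) + S l t"
    and smooth: "\<And>l h. h holomorphic_on uhp \<Longrightarrow> smooth_uhp (\<lambda>t. h t + S l t)"
    and laplace: "\<And>l h t. h holomorphic_on uhp \<Longrightarrow> t \<in> uhp \<Longrightarrow> laplacian (real k - 1 / 2) (\<lambda>t. h t + S l t) t = 0"
    and xi: "\<And>l h t. h holomorphic_on uhp \<Longrightarrow> t \<in> uhp \<Longrightarrow> l < 2 * N \<Longrightarrow> xi (real k - 1 / 2) (\<lambda>t. h t + S l t) t = g l t"
    and bounded: "\<And>l. \<exists>K. \<forall>t. Im t > 1 \<longrightarrow> norm (S l t) \<le> K"
    and nonhol: "\<exists>b. nonhol_expansion N (real k - 1 / 2) S b"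
  shows "\<exists>\<Theta>. mock_modular_form N (real k - 1 / 2) (conj_weil_rep N) g \<Theta> \<and>
    integral_coefficients N (\<lambda>l t. of_nat D * \<Theta> l t)"
proof -
  let ?J = "\<lambda>l t. mid_coeff (mero_jacobi N G t) l t"
  obtain A :: "nat \<Rightarrow> nat \<Rightarrow> int"
    where A: "\<And>l t. t \<in> uhp \<Longrightarrow> ((\<lambda>j. of_int (A l j) * ee (of_nat j * t)) has_sum ?J l t) UNIV"
    using mero_jacobi_coefficients[OF N k G] by blast
  define b where "b = (\<lambda>l j. 2 / of_int c * of_int (A l j) + (if j = 0 then of_int (x l) else 0) :: complex)"
  define F where "F = (\<lambda>l t. 2 / of_int c * ?J l t + of_int (x l))"
  define h where "h = (\<lambda>l t. inverse (theta_q N (int l) t) * F l t)"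
  have F_sum: "((\<lambda>j. b l j * ee (of_nat j * t)) has_sum F l t) UNIV" if "t \<in> uhp" for l t
    unfolding b_def F_def by (rule has_sum_affine_coeff[OF A[OF that]]) simp
  have maass: "h l t + S l t = 2 / of_int c * theta_vec N k c G l t" if "l < 2 * N" "t \<in> uhp" for l t
    using theta_vec_eq_shifted[OF N k G that(2) c(1) poincare[OF that]] by (simp add: h_def F_def)
  have h_holomorphic: "h l holomorphic_on uhp" for l
    unfolding h_def by (rule theta_shift_holomorphic[OF N F_sum])
  have growth: "linear_exp_growth (\<lambda>t. h l t + S l t)" for l
    unfolding h_def by (rule theta_shift_growth[OF N F_sum bounded])
  have "modular N (real k - 1 / 2) (conj_weil_rep N) (\<lambda>l t. h l t + S l t)"
    by (rule theta_vec_modular[OF N k G]) (rule maass)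
  hence "harmonic_maass_form N (real k - 1 / 2) (conj_weil_rep N) (\<lambda>l t. h l t + S l t)"
    unfolding harmonic_maass_form_def
    using smooth[OF h_holomorphic] laplace[OF h_holomorphic] growth by simp
  moreover have "q_expansion N h (\<lambda>l. extend_coeff (\<lambda>j. int (4 * N * j) - (int l)\<^sup>2) (\<lambda>j. of_nat 1 * b l j))"
    using theta_shift_q_expansion[OF N F_sum, of 1] by (simp add: h_def)
  ultimately have "mock_modular_form N (real k - 1 / 2) (conj_weil_rep N) g h"
    unfolding mock_modular_form_def is_holomorphic_part_def
    using nonhol xi[OF h_holomorphic] by (intro exI[of _ "\<lambda>l t. h l t + S l t"]) auto
  moreover have "of_nat D * b l j \<in> \<int>" for l j
  proof -
    from c(2) obtain d where "2 * int D = c * d" by (auto elim: dvdE)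
    hence "complex_of_int (2 * int D) = of_int (c * d)" by (rule arg_cong)
    hence "of_nat D * (2 / of_int c) = (of_int d :: complex)" using c(1) by (simp add: field_simps)
    hence "of_nat D * b l j = of_int (d * A l j + (if j = 0 then int D * x l else 0))"
      unfolding b_def distrib_left mult.assoc[symmetric] by simp
    thus ?thesis by simp
  qed
  from theta_shift_integral[OF N F_sum this] have "integral_coefficients N (\<lambda>l t. of_nat D * h l t)"
    unfolding h_def .
  ultimately show ?thesis by blast
qed

section \<open>The two shadows\<close>

lemma summable_on_int_abs:
  fixes f :: "nat \<Rightarrow> real"
  assumes "summable f" "\<And>n. f n \<ge> 0"
  shows "(\<lambda>n::int. f (nat \<bar>n\<bar>)) summable_on UNIV"
proof -
  have nonneg: "(\<lambda>n::int. f (nat \<bar>n\<bar>)) summable_on {0..}"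
    using summable_on_reindex_bij_betw[OF bij_int_nonneg, of "\<lambda>n. f (nat \<bar>n\<bar>)"]
      summable_nonneg_imp_summable_on[OF assms] by simp
  have "summable (\<lambda>n. f (Suc n))" using assms(1) by (simp add: summable_Suc_iff)
  hence "(\<lambda>n. f (Suc n)) summable_on UNIV" by (rule summable_nonneg_imp_summable_on) (use assms in auto)
  moreover have "nat \<bar>- int n - 1\<bar> = Suc n" for n by simp
  ultimately have "(\<lambda>n::int. f (nat \<bar>n\<bar>)) summable_on {..<0}"
    using summable_on_reindex_bij_betw[OF bij_int_neg, of "\<lambda>n. f (nat \<bar>n\<bar>)"] by (simp only:)
  from summable_on_union[OF nonneg this] show ?thesis by (simp add: int_UNIV_split)
qed

context
  fixes N :: nat
  assumes N: "N > 0"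
begin

lemma unary_theta_has_sum:
  assumes t: "t \<in> uhp"
  shows "((\<lambda>n. of_int n ^ \<nu> * theta_q N n t) has_sum unary_theta N \<nu> l t) (residue_class N l)"
proof -
  have "summable (\<lambda>m. norm (conj_theta_term N \<nu> m t))"
    by (rule uhp_majorized_summable[OF uhp_majorized_conj_theta_term[OF N] t])
  hence "(\<lambda>n::int. norm (conj_theta_term N \<nu> (nat \<bar>n\<bar>) t)) summable_on UNIV"
    by (rule summable_on_int_abs) simp
  moreover have "norm (conj_theta_term N \<nu> (nat \<bar>n\<bar>) t) = norm (of_int n ^ \<nu> * theta_q N n t)" for n
    by (simp add: conj_theta_term_def norm_mult norm_power norm_theta_q)
  ultimately have "(\<lambda>n. of_int n ^ \<nu> * theta_q N n t) summable_on UNIV"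
    by (simp add: summable_on_iff_abs_summable_on_complex)
  hence "(\<lambda>n. of_int n ^ \<nu> * theta_q N n t) summable_on residue_class N l"
    by (rule summable_on_subset) auto
  thus ?thesis unfolding unary_theta_def theta_q_def by (rule has_sum_infsum)
qed

lemma unary_theta_eq_cnj_conj_theta:
  assumes t: "t \<in> uhp" and l: "l < 2 * N" and s0: "\<nu> = 0 \<longrightarrow> s0 = 1"
  shows "unary_theta N \<nu> l t = (- 1) ^ \<nu> * cnj (conj_theta N (theta_coeff N s0 ((- 1) ^ \<nu>) l) \<nu> t)"
proof -
  let ?c = "theta_coeff N s0 ((- 1) ^ \<nu>) l"
  have "((\<lambda>m. of_real (?c m) * ((- of_nat m) ^ \<nu> * theta_q N (int m) t)) has_sum unary_theta N \<nu> l t - 0) UNIV"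
  proof (rule has_sum_theta_coeff[OF l unary_theta_has_sum[OF t]])
    fix m :: nat
    have "(- 1) ^ \<nu> * (- of_nat m) ^ \<nu> = (of_nat m ^ \<nu> :: complex)" by (simp flip: power_mult_distrib)
    thus "of_int (int m) ^ \<nu> * theta_q N (int m) t =
        of_real ((- 1) ^ \<nu>) * ((- of_nat m) ^ \<nu> * theta_q N (int m) t) + (if m = l then 0 else 0)"
      by (simp add: mult.assoc[symmetric])
    show "of_int (- int m) ^ \<nu> * theta_q N (- int m) t = (- of_nat m) ^ \<nu> * theta_q N (int m) t" by simp
    show "of_int 0 ^ \<nu> * theta_q N 0 t = of_real s0 * ((- of_nat 0) ^ \<nu> * theta_q N (int 0) t) + 0"
      using s0 by (cases "\<nu> = 0") auto
  qed
  moreover have "((\<lambda>m. (- 1) ^ \<nu> * cnj (of_real (?c m) * conj_theta_term N \<nu> m t)) has_sum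
      (- 1) ^ \<nu> * cnj (conj_theta N ?c \<nu> t)) UNIV"
    by (intro has_sum_cmult_right has_sum_cnj_iff[THEN iffD2] conj_theta_has_sum[OF N theta_coeff_bound t])
  moreover have "(- 1) ^ \<nu> * cnj (of_real (?c m) * conj_theta_term N \<nu> m t) =
      of_real (?c m) * ((- of_nat m) ^ \<nu> * theta_q N (int m) t)" for m
    by (simp add: conj_theta_term_def power_minus[of "of_nat m"])
  ultimately show ?thesis by (simp only: diff_zero has_sum_unique)
qed

lemma nonhol_expansion_half:
  "\<exists>b. nonhol_expansion N (1/2) (\<lambda>l. erfc_theta N (theta_coeff N 0 (- 1) l) 0) b"
proof (rule nonhol_expansion_squares)
  fix l t assume t: "t \<in> uhp"
  let ?c = "theta_coeff N 0 (- 1) l"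
  have "of_real (?c m) * erfc_theta_term N 0 m t = of_real (?c m / sqrt pi) * nonhol_term N (1/2) (- (int m)\<^sup>2) t" for m
    using nonhol_term_half[OF N _ t, of m] by (cases "m = 0") (auto simp: theta_coeff_def)
  thus "((\<lambda>m. of_real (?c m / sqrt pi) * nonhol_term N (1/2) (- (int m)\<^sup>2) t) has_sum erfc_theta N ?c 0 t) UNIV"
    using erfc_theta_has_sum[where c="?c", OF N theta_coeff_bound t, of 0] by (simp only:)
qed

lemma nonhol_expansion_three_half:
  "\<exists>b. nonhol_expansion N (3/2) (\<lambda>l. eichler_three_half N (theta_coeff N 1 1 l)) b"
proof (rule nonhol_expansion_squares)
  fix l t assume t: "t \<in> uhp"
  let ?c = "theta_coeff N 1 1 l"
  let ?b = "\<lambda>m. of_real (?c m) * - of_real (if m = 0 then sqrt (real N) / pi else real m / (2 * sqrt pi)) :: complex"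
  have "of_real (?c m) * eichler_three_half_term N m t = ?b m * nonhol_term N (3/2) (- (int m)\<^sup>2) t" for m
  proof (cases "m = 0")
    case True
    show ?thesis unfolding True nonhol_term_three_half_0[OF N t, symmetric] by simp
  next
    case False
    hence "m > 0" by simp
    show ?thesis unfolding nonhol_term_three_half[OF N \<open>m > 0\<close> t, symmetric] using False by simp
  qed
  thus "((\<lambda>m. ?b m * nonhol_term N (3/2) (- (int m)\<^sup>2) t) has_sum eichler_three_half N ?c t) UNIV"
    using eichler_three_half_has_sum[where c="?c", OF N theta_coeff_bound t] by (simp only:)
qed

lemma mock_theta_half:
  "\<exists>\<Theta>. mock_modular_form N (1/2) (conj_weil_rep N) (\<lambda>h \<tau>. of_real (1 / sqrt (real N)) * unary_theta N 1 h \<tau>) \<Theta> \<and>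
     integral_coefficients N (\<lambda>h \<tau>. of_nat (24 * gcd N 4) * \<Theta> h \<tau>)"
proof -
  have "elliptic_lead (3 + (2 * N - 2)) (- 2 * 12)"
    by (rule elliptic_lead_mult) (use int_elliptic_zderiv_wp elliptic_lead_12 in \<open>auto simp: elliptic_lead_def\<close>)
  moreover have "3 + (2 * N - 2) = 2 * N + 1" using N by simp
  ultimately obtain G where G: "int_elliptic (2 * N + 1) (- 24) G" by (auto simp: elliptic_lead_def)
  let ?E = "\<lambda>l. erfc_theta N (theta_coeff N 0 (- 1) l) 0"
  note maass = erfc_theta_maass_half[OF N theta_coeff_bound]
  have "\<exists>\<Theta>. mock_modular_form N (real 1 - 1 / 2) (conj_weil_rep N)
      (\<lambda>h \<tau>. of_real (1 / sqrt (real N)) * unary_theta N 1 h \<tau>) \<Theta> \<and>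
      integral_coefficients N (\<lambda>h \<tau>. of_nat (24 * gcd N 4) * \<Theta> h \<tau>)"
  proof (rule mock_modular_form_exists[OF N _ G, where x="\<lambda>l. if l = 0 then 1 else 2" and S="?E"])
    show "- 2 / tpi ^ 1 * mid_theta_comp N (poincare N 1 t) l t =
        of_int (if l = 0 then 1 else 2) * inverse (theta_q N (int l) t) + ?E l t" if "l < 2 * N" "t \<in> uhp" for l t
      unfolding mid_theta_comp_poincare_1[OF that(2) N that(1)] by simp
    show "xi (real 1 - 1 / 2) (\<lambda>t. h t + ?E l t) t = of_real (1 / sqrt (real N)) * unary_theta N 1 l t"
      if "h holomorphic_on uhp" "t \<in> uhp" "l < 2 * N" for h l t
      using maass(3)[OF that(1,2)] unary_theta_eq_cnj_conj_theta[OF that(2,3), of 1 0] by simp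
  qed (use nonhol_expansion_half maass(1,2) erfc_theta_bounded[OF N theta_coeff_bound] in simp_all)
  thus ?thesis by simp
qed

lemma mock_theta_three_half:
  "\<exists>\<Theta>. mock_modular_form N (3/2) (conj_weil_rep N) (\<lambda>h \<tau>. of_real (sqrt (real N) / (2 * pi)) * unary_theta N 0 h \<tau>) \<Theta> \<and>
     integral_coefficients N (\<lambda>h \<tau>. of_nat (144 * gcd N 4) * \<Theta> h \<tau>)"
proof -
  obtain G where G: "int_elliptic (2 * N + 2) 12 G"
    using elliptic_lead_12[of "2 * N + 2"] by (auto simp: elliptic_lead_def)
  let ?E = "\<lambda>l. eichler_three_half N (theta_coeff N 1 1 l)"
  note maass = eichler_three_half_maass[OF N theta_coeff_bound]
  have "\<exists>\<Theta>. mock_modular_form N (real 2 - 1 / 2) (conj_weil_rep N)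
      (\<lambda>h \<tau>. of_real (sqrt (real N) / (2 * pi)) * unary_theta N 0 h \<tau>) \<Theta> \<and>
      integral_coefficients N (\<lambda>h \<tau>. of_nat (144 * gcd N 4) * \<Theta> h \<tau>)"
  proof (rule mock_modular_form_exists[OF N _ G, where x="\<lambda>l. - 2 * int l" and S="?E"])
    have "- 2 / tpi ^ 2 * (2 * of_real (pi\<^sup>2) * X) = X" for X :: complex
      by (simp add: power_mult_distrib)
    thus "- 2 / tpi ^ 2 * mid_theta_comp N (poincare N 2 t) l t =
        of_int (- 2 * int l) * inverse (theta_q N (int l) t) + ?E l t" if "l < 2 * N" "t \<in> uhp" for l t
      unfolding mid_theta_comp_poincare_2[OF that(2) N that(1)] by simp
    show "xi (real 2 - 1 / 2) (\<lambda>t. h t + ?E l t) t = of_real (sqrt (real N) / (2 * pi)) * unary_theta N 0 l t"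
      if "h holomorphic_on uhp" "t \<in> uhp" "l < 2 * N" for h l t
      using maass(3)[OF that(1,2)] unary_theta_eq_cnj_conj_theta[OF that(2,3), of 0 1] by simp
  qed (use nonhol_expansion_three_half maass(1,2) eichler_three_half_bounded[OF N theta_coeff_bound] in simp_all)
  thus ?thesis by simp
qed

end

theorem theorem1p1:
  fixes N :: nat
  assumes "N > 0"
  shows
    "(\<exists>\<Theta>. mock_modular_form N (1/2) (conj_weil_rep N)
            (\<lambda>h \<tau>. of_real (1 / sqrt (real N)) * unary_theta N 1 h \<tau>) \<Theta> \<and>
          integral_coefficients N (\<lambda>h \<tau>. of_nat (24 * gcd N 4) * \<Theta> h \<tau>)) \<and>
     (\<exists>\<Theta>. mock_modular_form N (3/2) (conj_weil_rep N)
            (\<lambda>h \<tau>. of_real (sqrt (real N) / (2 * pi)) * unary_theta N 0 h \<tau>) \<Theta> \<and>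
          integral_coefficients N (\<lambda>h \<tau>. of_nat (144 * gcd N 4) * \<Theta> h \<tau>))"
  using mock_theta_half[OF assms] mock_theta_three_half[OF assms] by (rule conjI)

end
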